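(* The operator-norm closure of $\{T_f:f\in L^\infty(\mathbb{D},dv)\}$ coincides with the Toeplitz algebra $\mathcal{T}(\mathbb{D})$, and $\mathcal{T}(\mathbb{D})$ also coincides with $\mathcal{D}$.
   Context: Fix an integer $n\ge 1$. $D$ is the open unit disc in $\mathbb{C}$ and $\mathbb{D}=\{z=(z_1,\dots,z_n)\in\mathbb{C}^n:|z_i|<1,\ i=1,\dots,n\}$ is the polydisk. $dv$ is normalized Lebesgue measure on $\mathbb{D}$. The Bergman space $L^2_a(\mathbb{D})$ is the closed subspace of analytic functions in $L^2(\mathbb{D},dv)$, and $P:L^2(\mathbb{D},dv)\to L^2_a(\mathbb{D})$ is the orthogonal projection. Its normalized reproducing kernels are $k_z(w)=\prod_{i=1}^n\frac{1-|z_i|^2}{(1-w_i\overline{z_i})^2}$, $z,w\in\mathbb{D}$. For vectors $f,g$, $f\otimes g$ is the operator $h\mapsto\langle h,g\rangle f$. For $f\in L^\infty(\mathbb{D},dv)$ the Toeplitz operator on $L^2_a(\mathbb{D})$ is $T_fh=P(fh)$. The Toeplitz algebra $\mathcal{T}(\mathbb{D})$ is the $C^*$-algebra generated by $\{T_f:f\in L^\infty(\mathbb{D},dv)\}$. For $u,v\in D$ let $\varphi_u(v)=(u-v)/(1-v\overline{u})$ and $\beta(u,v)=\frac12\log\frac{1+|\varphi_u(v)|}{1-|\varphi_u(v)|}$. On $\mathbb{D}$ use the metric $d(z,w)=\sum_{i=1}^n\beta(z_i,w_i)$ and write $D(z,a)=\{w\in\mathbb{D}:d(z,w)<a\}$.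 A set $\Gamma\subset\mathbb{D}$ is separated if there is $a>0$ with $D(u,a)\cap D(v,a)=\emptyset$ for all $u\ne v$ in $\Gamma$. $\mathcal{D}_0$ is the collection of operators $\sum_{z\in\Gamma}c_zk_z\otimes k_{\gamma(z)}$ on $L^2_a(\mathbb{D})$, where $\Gamma$ is any separated set in $\mathbb{D}$, $\{c_z:z\in\Gamma\}$ is any bounded set of complex coefficients, and $\gamma:\Gamma\to\mathbb{D}$ is any map for which there is $0\le C<\infty$ with $d(z,\gamma(z))\le C$ for every $z\in\Gamma$ (sums over $\Gamma$ are understood in the strong operator topology). $\mathcal{D}$ is the operator-norm closure of the linear span of $\mathcal{D}_0$. *)

theory Defs
  imports "HOL-Analysis.Analysis"
begin

section \<open>The polydisc and its normalized Lebesgue measure\<close>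

definition polydisc :: "(complex ^ 'n) set" where
  "polydisc = {z. \<forall>i. cmod (z $ i) < 1}"

definition dv :: "(complex ^ 'n) measure" where
  "dv = uniform_measure lebesgue polydisc"

lemma open_polydisc: "open (polydisc :: (complex ^ 'n) set)"
proof -
  have "(polydisc :: (complex ^ 'n) set) = (\<Inter>i. {z. cmod (z $ i) < 1})"
    by (auto simp: polydisc_def)
  moreover have "open {z :: complex ^ 'n. cmod (z $ i) < 1}" for i
    by (intro open_Collect_less continuous_intros)
  ultimately show ?thesis
    by (metis (no_types, lifting) finite open_INT)
qed

lemma zero_in_polydisc: "0 \<in> polydisc"
  by (simp add: polydisc_def)

lemma bounded_polydisc: "bounded (polydisc :: (complex ^ 'n) set)"
proof (rule boundedI)
  fix z :: "complex ^ 'n"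
  assume z: "z \<in> polydisc"
  have "norm z \<le> (\<Sum>i\<in>UNIV. norm (z $ i))"
    unfolding norm_vec_def by (rule L2_set_le_sum) simp
  also have "\<dots> \<le> (\<Sum>i\<in>(UNIV :: 'n set). 1)"
    using z by (intro sum_mono) (auto simp: polydisc_def less_imp_le)
  finally show "norm z \<le> (\<Sum>i\<in>(UNIV :: 'n set). 1)" .
qed

lemma sets_polydisc: "polydisc \<in> sets lebesgue"
  by (simp add: open_polydisc borel_open)

lemma emeasure_polydisc:
  "emeasure lebesgue (polydisc :: (complex ^ 'n) set) \<noteq> 0"
  "emeasure lebesgue (polydisc :: (complex ^ 'n) set) < \<infinity>"
proof -
  have "\<not> negligible (polydisc :: (complex ^ 'n) set)"
    using open_not_negligible[OF open_polydisc] zero_in_polydisc by blast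
  then show "emeasure lebesgue (polydisc :: (complex ^ 'n) set) \<noteq> 0"
    using sets_polydisc by (auto simp: negligible_iff_null_sets null_sets_def)
  show "emeasure lebesgue (polydisc :: (complex ^ 'n) set) < \<infinity>"
    using emeasure_bounded_finite[OF bounded_polydisc]
    by (simp add: open_polydisc borel_open)
qed

lemma sets_dv [measurable_cong]: "sets dv = sets lebesgue"
  by (simp add: dv_def)

lemma space_dv [simp]: "space dv = UNIV"
  by (simp add: dv_def uniform_measure_def)

lemma emeasure_dv_UNIV: "emeasure (dv :: (complex ^ 'n) measure) UNIV = 1"
proof -
  have "emeasure (dv :: (complex ^ 'n) measure) UNIV = emeasure lebesgue (polydisc :: (complex ^ 'n) set) /
      emeasure lebesgue (polydisc :: (complex ^ 'n) set)"
    unfolding dv_def by (subst emeasure_uniform_measure) (use sets_polydisc in auto)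
  then show ?thesis
    using emeasure_polydisc[where 'n = 'n] by (simp add: ennreal_divide_self)
qed

lemma finite_measure_dv: "finite_measure dv"
  by (rule finite_measureI) (simp add: emeasure_dv_UNIV)

lemma AE_dv: "(AE z in dv. Q z) \<longleftrightarrow> (AE z in lebesgue. z \<in> polydisc \<longrightarrow> Q z)"
  unfolding dv_def by (rule AE_uniform_measure) (use emeasure_polydisc in auto)


section \<open>Function spaces\<close>

text \<open>Functions on the polydisc are represented by functions on the whole of
  \<open>complex ^ 'n\<close>; the measure \<open>dv\<close> does not see their values off the polydisc.\<close>

definition L2 :: "(complex ^ 'n \<Rightarrow> complex) set" where
  "L2 = {f \<in> borel_measurable dv. integrable dv (\<lambda>z. (cmod (f z))\<^sup>2)}"

definition Linfty :: "(complex ^ 'n \<Rightarrow> complex) set" where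
  "Linfty = {f \<in> borel_measurable dv. \<exists>C. AE z in dv. cmod (f z) \<le> C}"

text \<open>Analyticity in several variables: Frechet differentiability with a complex-linear
  derivative.\<close>

definition analytic_vec :: "(complex ^ 'n \<Rightarrow> complex) \<Rightarrow> (complex ^ 'n) set \<Rightarrow> bool" where
  "analytic_vec f S \<longleftrightarrow>
     (\<forall>z\<in>S. \<exists>f'. (f has_derivative f') (at z) \<and> (\<forall>c v. f' (c *s v) = c * f' v))"

lemma analytic_vec_continuous_on: "analytic_vec f S \<Longrightarrow> continuous_on S f"
  unfolding analytic_vec_def
  by (meson continuous_at_imp_continuous_on has_derivative_continuous)

lemma analytic_vec_const: "analytic_vec (\<lambda>_. c) S"
  unfolding analytic_vec_def by (auto intro!: exI[of _ "\<lambda>_. 0"])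

lemma analytic_vec_add:
  assumes "analytic_vec f S" "analytic_vec g S"
  shows "analytic_vec (\<lambda>z. f z + g z) S"
  unfolding analytic_vec_def
proof
  fix z assume "z \<in> S"
  then obtain f' g' where "(f has_derivative f') (at z)" "\<forall>c v. f' (c *s v) = c * f' v"
      "(g has_derivative g') (at z)" "\<forall>c v. g' (c *s v) = c * g' v"
    using assms unfolding analytic_vec_def by meson
  then show "\<exists>h'. ((\<lambda>z. f z + g z) has_derivative h') (at z) \<and> (\<forall>c v. h' (c *s v) = c * h' v)"
    by (intro exI[of _ "\<lambda>v. f' v + g' v"]) (auto intro: has_derivative_add simp: algebra_simps)
qed

lemma analytic_vec_mult:
  assumes "analytic_vec f S" "analytic_vec g S"
  shows "analytic_vec (\<lambda>z. f z * g z) S"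
  unfolding analytic_vec_def
proof
  fix z assume "z \<in> S"
  then obtain f' g' where "(f has_derivative f') (at z)" "\<forall>c v. f' (c *s v) = c * f' v"
      "(g has_derivative g') (at z)" "\<forall>c v. g' (c *s v) = c * g' v"
    using assms unfolding analytic_vec_def by meson
  then show "\<exists>h'. ((\<lambda>z. f z * g z) has_derivative h') (at z) \<and> (\<forall>c v. h' (c *s v) = c * h' v)"
    by (intro exI[of _ "\<lambda>v. f z * g' v + f' v * g z"])
       (auto intro: has_derivative_mult simp: algebra_simps)
qed

lemma analytic_vec_prod:
  assumes "\<And>i. i \<in> I \<Longrightarrow> analytic_vec (f i) S"
  shows "analytic_vec (\<lambda>z. \<Prod>i\<in>I. f i z) S"
  using assms
proof (induction I rule: infinite_finite_induct)
  case (insert i I)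
  then show ?case
    by (simp add: analytic_vec_mult)
qed (simp_all add: analytic_vec_const)

lemma analytic_vec_component:
  assumes "\<And>z. z \<in> S \<Longrightarrow> g field_differentiable (at (z $ i))"
  shows "analytic_vec (\<lambda>z. g (z $ i)) S"
  unfolding analytic_vec_def
proof
  fix z assume "z \<in> S"
  then obtain d where "(g has_derivative (\<lambda>x. d * x)) (at (z $ i))"
    using assms unfolding field_differentiable_def has_field_derivative_def by blast
  moreover have "((\<lambda>z. z $ i) has_derivative (\<lambda>v. v $ i)) (at z)"
    by (rule bounded_linear_imp_has_derivative[OF bounded_linear_vec_nth])
  ultimately have "((\<lambda>z. g (z $ i)) has_derivative (\<lambda>v. d * v $ i)) (at z)"
    using has_derivative_compose[of "\<lambda>z. z $ i" "\<lambda>v. v $ i" z UNIV g "\<lambda>x. d * x"] by simp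
  then show "\<exists>f'. ((\<lambda>z. g (z $ i)) has_derivative f') (at z) \<and> (\<forall>c v. f' (c *s v) = c * f' v)"
    by (intro exI[of _ "\<lambda>v. d * v $ i"]) (auto simp: vector_scalar_mult_def)
qed

lemma analytic_vec_transform:
  assumes "analytic_vec f S" "open S" "\<And>z. z \<in> S \<Longrightarrow> f z = g z"
  shows "analytic_vec g S"
  unfolding analytic_vec_def
proof
  fix z assume z: "z \<in> S"
  then obtain f' where f': "(f has_derivative f') (at z)" "\<forall>c v. f' (c *s v) = c * f' v"
    using assms(1) unfolding analytic_vec_def by blast
  have "(g has_derivative f') (at z)"
    by (rule has_derivative_transform_within_open[OF f'(1) assms(2) z assms(3)])
  then show "\<exists>g'. (g has_derivative g') (at z) \<and> (\<forall>c v. g' (c *s v) = c * g' v)"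
    using f'(2) by blast
qed

lemma borel_measurable_dvI:
  assumes "continuous_on polydisc f" "\<And>z. z \<notin> polydisc \<Longrightarrow> f z = (0::complex)"
  shows "f \<in> borel_measurable dv"
proof -
  have "(\<lambda>z. indicator polydisc z *\<^sub>R f z) \<in> borel_measurable borel"
    by (rule borel_measurable_continuous_on_indicator) (simp_all add: open_polydisc borel_open assms)
  moreover have "(\<lambda>z. indicator polydisc z *\<^sub>R f z) = f"
    using assms(2) by (auto simp: indicator_def)
  ultimately have "f \<in> borel_measurable borel" by simp
  then have "f \<in> borel_measurable lebesgue"
    by (intro measurable_completion) (simp add: measurable_lborel1)
  then show ?thesis
    unfolding measurable_cong_sets[OF sets_dv refl] .
qed

lemma L2_add:
  assumes "f \<in> L2" "g \<in> L2"
  shows "(\<lambda>z. f z + g z) \<in> L2"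
proof -
  have [measurable]: "f \<in> borel_measurable dv" "g \<in> borel_measurable dv"
    using assms by (auto simp: L2_def)
  have bnd: "(cmod (f z + g z))\<^sup>2 \<le> 2 * (cmod (f z))\<^sup>2 + 2 * (cmod (g z))\<^sup>2" for z
  proof -
    have "(cmod (f z + g z))\<^sup>2 \<le> (cmod (f z) + cmod (g z))\<^sup>2"
      by (intro power_mono norm_triangle_ineq) auto
    also have "\<dots> \<le> 2 * (cmod (f z))\<^sup>2 + 2 * (cmod (g z))\<^sup>2"
      using sum_squares_bound[of "cmod (f z)" "cmod (g z)"] by (simp add: power2_sum)
    finally show ?thesis .
  qed
  have "integrable dv (\<lambda>z. 2 * (cmod (f z))\<^sup>2 + 2 * (cmod (g z))\<^sup>2)"
    using assms by (auto simp: L2_def)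
  then have "integrable dv (\<lambda>z. (cmod (f z + g z))\<^sup>2)"
    by (rule Bochner_Integration.integrable_bound) (use bnd in auto)
  then show ?thesis
    by (simp add: L2_def)
qed

lemma L2_cmult:
  assumes "f \<in> L2"
  shows "(\<lambda>z. c * f z) \<in> L2"
proof -
  have [measurable]: "f \<in> borel_measurable dv"
    using assms by (simp add: L2_def)
  have "integrable dv (\<lambda>z. (cmod c)\<^sup>2 * (cmod (f z))\<^sup>2)"
    using assms by (simp add: L2_def)
  then show ?thesis
    by (simp add: L2_def norm_mult power_mult_distrib)
qed

lemma L2_integrable_cnj:
  assumes "f \<in> L2" "g \<in> L2"
  shows "integrable dv (\<lambda>z. f z * cnj (g z))"
proof -
  have [measurable]: "f \<in> borel_measurable dv" "g \<in> borel_measurable dv"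
    using assms by (auto simp: L2_def)
  have [measurable]: "(\<lambda>z. cnj (g z)) \<in> borel_measurable dv"
    by (rule borel_measurable_continuous_on[OF _ \<open>g \<in> borel_measurable dv\<close>])
       (intro continuous_intros)
  have bnd: "cmod (f z * cnj (g z)) \<le> (cmod (f z))\<^sup>2 + (cmod (g z))\<^sup>2" for z
    using sum_squares_bound[of "cmod (f z)" "cmod (g z)"]
      mult_nonneg_nonneg[OF norm_ge_zero[of "f z"] norm_ge_zero[of "g z"]]
    unfolding norm_mult complex_mod_cnj by linarith
  have "integrable dv (\<lambda>z. (cmod (f z))\<^sup>2 + (cmod (g z))\<^sup>2)"
    using assms by (auto simp: L2_def)
  then show ?thesis
    by (rule Bochner_Integration.integrable_bound) (use bnd in auto)
qed


section \<open>The Bergman space\<close>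

text \<open>Each class in the Bergman space has a unique representative that is analytic on the polydisc
  and zero outside.\<close>

typedef ('n::finite) bergman =
  "{f :: complex ^ 'n \<Rightarrow> complex. f \<in> L2 \<and> analytic_vec f polydisc \<and> (\<forall>z. z \<notin> polydisc \<longrightarrow> f z = 0)}"
  morphisms eval Bergman
  by (rule exI[of _ "\<lambda>_. 0"]) (simp add: L2_def analytic_vec_const)

setup_lifting type_definition_bergman

lemma eval_L2: "eval f \<in> L2"
  and eval_analytic: "analytic_vec (eval f) polydisc"
  and eval_outside: "z \<notin> polydisc \<Longrightarrow> eval f z = 0"
  using eval[of f] by auto

lift_definition scale_vec :: "complex \<Rightarrow> 'n::finite bergman \<Rightarrow> 'n bergman" is "\<lambda>c f z. c * f z"
  by (auto intro: L2_cmult analytic_vec_mult analytic_vec_const)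

definition cinner :: "'n::finite bergman \<Rightarrow> 'n bergman \<Rightarrow> complex" where
  "cinner f g = (\<integral>z. eval f z * cnj (eval g z) \<partial>dv)"

instantiation bergman :: (finite) real_inner
begin

lift_definition zero_bergman :: "'a bergman" is "\<lambda>_. 0"
  by (simp add: L2_def analytic_vec_const)

lift_definition plus_bergman :: "'a bergman \<Rightarrow> 'a bergman \<Rightarrow> 'a bergman" is "\<lambda>f g z. f z + g z"
  by (auto intro: L2_add analytic_vec_add)

definition scaleR_bergman :: "real \<Rightarrow> 'a bergman \<Rightarrow> 'a bergman" where
  "scaleR_bergman r f = scale_vec (complex_of_real r) f"

definition uminus_bergman :: "'a bergman \<Rightarrow> 'a bergman" where
  "uminus_bergman f = scale_vec (- 1) f"

definition minus_bergman :: "'a bergman \<Rightarrow> 'a bergman \<Rightarrow> 'a bergman" where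
  "minus_bergman f g = f + - g"

definition inner_bergman :: "'a bergman \<Rightarrow> 'a bergman \<Rightarrow> real" where
  "inner_bergman f g = Re (cinner f g)"

definition norm_bergman :: "'a bergman \<Rightarrow> real" where
  "norm_bergman f = sqrt (inner f f)"

definition sgn_bergman :: "'a bergman \<Rightarrow> 'a bergman" where
  "sgn_bergman f = inverse (norm f) *\<^sub>R f"

definition dist_bergman :: "'a bergman \<Rightarrow> 'a bergman \<Rightarrow> real" where
  "dist_bergman f g = norm (f - g)"

definition uniformity_bergman :: "('a bergman \<times> 'a bergman) filter" where
  "uniformity_bergman = (INF e\<in>{0<..}. principal {(f, g). dist f g < e})"

definition open_bergman :: "'a bergman set \<Rightarrow> bool" where
  "open_bergman U \<longleftrightarrow> (\<forall>f\<in>U. eventually (\<lambda>(f', g). f' = f \<longrightarrow> g \<in> U) uniformity)"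

lemma eval_scaleR: "eval (r *\<^sub>R f) z = complex_of_real r * eval (f :: 'a bergman) z"
  by (simp add: scaleR_bergman_def scale_vec.rep_eq)

lemma eval_uminus: "eval (- f) z = - eval (f :: 'a bergman) z"
  by (simp add: uminus_bergman_def scale_vec.rep_eq)

lemma eval_minus: "eval (f - g) z = eval f z - eval (g :: 'a bergman) z"
  by (simp add: minus_bergman_def plus_bergman.rep_eq eval_uminus)

lemma cinner_self: "cinner f f = complex_of_real (\<integral>z. (cmod (eval f z))\<^sup>2 \<partial>dv)"
  unfolding cinner_def by (simp add: complex_norm_square[symmetric] del: of_real_power)

lemma cinner_self_eq_0: "Re (cinner f f) = 0 \<longleftrightarrow> f = (0 :: 'a bergman)"
proof
  assume "Re (cinner f f) = 0"
  then have "(\<integral>z. (cmod (eval f z))\<^sup>2 \<partial>dv) = 0"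
    by (simp add: cinner_self)
  moreover have "integrable dv (\<lambda>z. (cmod (eval f z))\<^sup>2)"
    using eval_L2[of f] by (simp add: L2_def)
  ultimately have "AE z in dv. (cmod (eval f z))\<^sup>2 = 0"
    by (subst (asm) integral_nonneg_eq_0_iff_AE) auto
  then have "AE z in lebesgue. z \<in> polydisc \<longrightarrow> eval f z = 0"
    by (simp add: AE_dv)
  moreover have op: "open {z \<in> polydisc. eval f z \<noteq> 0}"
  proof -
    have "open (polydisc \<inter> eval f -` (- {0}))"
      by (rule continuous_open_preimage)
         (auto intro: analytic_vec_continuous_on eval_analytic open_polydisc)
    also have "polydisc \<inter> eval f -` (- {0}) = {z \<in> polydisc. eval f z \<noteq> 0}" by auto
    finally show ?thesis .
  qed
  ultimately have "{z \<in> polydisc. eval f z \<noteq> 0} \<in> null_sets lebesgue"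
    by (subst (asm) AE_iff_null) (auto simp: borel_open)
  then have "negligible {z \<in> polydisc. eval f z \<noteq> 0}"
    by (simp add: negligible_iff_null_sets)
  then have "{z \<in> polydisc. eval f z \<noteq> 0} = {}"
    using open_not_negligible[OF op] by blast
  then have "eval f z = 0" for z
    using eval_outside[of z f] by blast
  then show "f = 0"
    by (simp add: eval_inject[symmetric] zero_bergman.rep_eq fun_eq_iff)
qed (simp add: cinner_def zero_bergman.rep_eq)

instance
proof
  fix f g h :: "'a bergman" and a b :: real and U :: "'a bergman set"
  note ext_simps = eval_inject[symmetric] fun_eq_iff plus_bergman.rep_eq zero_bergman.rep_eq
    eval_scaleR eval_uminus eval_minus
  note int = L2_integrable_cnj[OF eval_L2 eval_L2]
  show "f + g + h = f + (g + h)" "f + g = g + f" "0 + f = f" "- f + f = 0" "f - g = f + - g"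
    "a *\<^sub>R (f + g) = a *\<^sub>R f + a *\<^sub>R g" "(a + b) *\<^sub>R f = a *\<^sub>R f + b *\<^sub>R f"
    "a *\<^sub>R b *\<^sub>R f = (a * b) *\<^sub>R f" "1 *\<^sub>R f = f"
    by (simp_all add: ext_simps algebra_simps)
  show "dist f g = norm (f - g)" by (rule dist_bergman_def)
  show "sgn f = inverse (norm f) *\<^sub>R f" by (rule sgn_bergman_def)
  show "uniformity = (INF e\<in>{0<..}. principal {(x, y :: 'a bergman). dist x y < e})"
    by (rule uniformity_bergman_def)
  show "open U \<longleftrightarrow> (\<forall>x\<in>U. \<forall>\<^sub>F (x', y) in uniformity. x' = x \<longrightarrow> y \<in> U)"
    by (rule open_bergman_def)
  show "norm f = sqrt (inner f f)" by (rule norm_bergman_def)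
  have "cnj (cinner g f) = (\<integral>z. cnj (eval g z * cnj (eval f z)) \<partial>dv)"
    unfolding cinner_def by (rule Bochner_Integration.integral_cnj[symmetric])
  also have "(\<lambda>z. cnj (eval g z * cnj (eval f z))) = (\<lambda>z. eval f z * cnj (eval g z))"
    by (rule ext) (simp only: complex_cnj_mult complex_cnj_cnj mult.commute)
  finally have "cnj (cinner g f) = cinner f g"
    unfolding cinner_def .
  then have "Re (cinner f g) = Re (cinner g f)"
    by (metis cnj.simps(1))
  then show "inner f g = inner g f"
    by (simp add: inner_bergman_def)
  show "inner (f + g) h = inner f h + inner g h"
    by (simp add: inner_bergman_def cinner_def plus_bergman.rep_eq distrib_right int)
  show "inner (a *\<^sub>R f) g = a * inner f g"
    by (simp add: inner_bergman_def cinner_def eval_scaleR mult.assoc)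
  show "0 \<le> inner f f"
    by (simp add: inner_bergman_def cinner_self)
  show "inner f f = 0 \<longleftrightarrow> f = 0"
    by (simp add: inner_bergman_def cinner_self_eq_0)
qed

end

lemma cinner_add_left: "cinner (f + g) h = cinner f h + cinner g h"
  by (simp add: cinner_def plus_bergman.rep_eq distrib_right L2_integrable_cnj eval_L2)

lemma cinner_scale_left: "cinner (scale_vec c f) g = c * cinner f g"
  by (simp add: cinner_def scale_vec.rep_eq mult.assoc)

lemma scale_vec_add_right: "scale_vec c (f + g) = scale_vec c f + scale_vec c g"
  by (simp add: eval_inject[symmetric] fun_eq_iff scale_vec.rep_eq plus_bergman.rep_eq algebra_simps)

lemma scale_vec_add_left: "scale_vec (c + d) f = scale_vec c f + scale_vec d f"
  by (simp add: eval_inject[symmetric] fun_eq_iff scale_vec.rep_eq plus_bergman.rep_eq algebra_simps)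

lemma scale_vec_mult: "scale_vec c (scale_vec d f) = scale_vec (c * d) f"
  by (simp add: eval_inject[symmetric] fun_eq_iff scale_vec.rep_eq)

lemma scale_vec_of_real: "scale_vec (complex_of_real r) f = r *\<^sub>R f"
  by (simp add: scaleR_bergman_def)

lemma scale_vec_1: "scale_vec 1 f = f"
  using scale_vec_of_real[of 1 f] by simp

lemma norm_bergman_eq: "norm f = sqrt (\<integral>z. (cmod (eval f z))\<^sup>2 \<partial>dv)"
  by (simp add: norm_bergman_def inner_bergman_def cinner_self)

lemma norm_scale_vec: "norm (scale_vec c f) = cmod c * norm f"
  by (simp add: norm_bergman_eq scale_vec.rep_eq norm_mult power_mult_distrib real_sqrt_mult)

lemma bounded_linear_scale_vec: "bounded_linear (scale_vec c)"
proof (rule bounded_linear_intro[where K = "cmod c"])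
  show "scale_vec c (r *\<^sub>R f) = r *\<^sub>R scale_vec c f" for r f
    by (simp add: scale_vec_of_real[symmetric] scale_vec_mult mult.commute)
qed (simp_all add: scale_vec_add_right norm_scale_vec mult.commute)

lemma cmod_cinner_le: "cmod (cinner f g) \<le> norm f * norm g"
proof (cases "cinner f g = 0")
  case False
  define u where "u = cnj (cinner f g) / cmod (cinner f g)"
  have "cmod u = 1"
    using False by (simp add: u_def norm_divide)
  have "cinner (scale_vec u f) g = (cinner f g * cnj (cinner f g)) / cmod (cinner f g)"
    by (simp add: cinner_scale_left u_def mult.commute)
  also have "\<dots> = complex_of_real (cmod (cinner f g))"
    using False by (simp add: complex_norm_square[symmetric] power2_eq_square)
  finally have "cinner (scale_vec u f) g = complex_of_real (cmod (cinner f g))" .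
  then have "cmod (cinner f g) = inner (scale_vec u f) g"
    by (simp add: inner_bergman_def)
  also have "\<dots> \<le> norm (scale_vec u f) * norm g"
    by (rule norm_cauchy_schwarz)
  finally show ?thesis
    by (simp add: norm_scale_vec \<open>cmod u = 1\<close>)
qed simp


section \<open>Bounded operators on the Bergman space\<close>

text \<open>The library's \<open>blinfun\<close> only demands real linearity, hence the separate predicate for
  complex linearity.\<close>

type_synonym 'n op = "'n bergman \<Rightarrow>\<^sub>L 'n bergman"

definition clinear_op :: "'n::finite op \<Rightarrow> bool" where
  "clinear_op A \<longleftrightarrow> (\<forall>c f. A (scale_vec c f) = scale_vec c (A f))"

definition scale_op :: "complex \<Rightarrow> 'n::finite op \<Rightarrow> 'n op" where
  "scale_op c A = Blinfun (\<lambda>f. scale_vec c (A f))"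

lemma scale_op_apply [simp]: "scale_op c A f = scale_vec c (A f)"
  unfolding scale_op_def
  by (simp add: bounded_linear_Blinfun_apply bounded_linear_compose[OF bounded_linear_scale_vec]
      blinfun.bounded_linear_right)

lemma vector_space_scale_op: "vector_space (scale_op :: complex \<Rightarrow> 'n::finite op \<Rightarrow> 'n op)"
  by standard
     (auto intro!: blinfun_eqI simp: plus_blinfun.rep_eq scale_vec_add_right
       scale_vec_add_left scale_vec_mult scale_vec_1)

definition adjoint_op :: "'n::finite op \<Rightarrow> 'n op" where
  "adjoint_op A = (THE B :: 'n op. \<forall>f g. cinner (A f) g = cinner f (B g))"

definition cstar_subalgebra :: "'n::finite op set \<Rightarrow> bool" where
  "cstar_subalgebra M \<longleftrightarrow>
     (\<forall>A\<in>M. clinear_op A) \<and>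
     0 \<in> M \<and> (\<forall>A\<in>M. \<forall>B\<in>M. A + B \<in> M) \<and> (\<forall>c. \<forall>A\<in>M. scale_op c A \<in> M) \<and>
     (\<forall>A\<in>M. \<forall>B\<in>M. A o\<^sub>L B \<in> M) \<and> (\<forall>A\<in>M. adjoint_op A \<in> M) \<and> closed M"

definition cstar_generated :: "'n::finite op set \<Rightarrow> 'n op set" where
  "cstar_generated S = \<Inter> {M. cstar_subalgebra M \<and> S \<subseteq> M}"

definition rank_one :: "'n::finite bergman \<Rightarrow> 'n bergman \<Rightarrow> 'n op" where
  "rank_one f g = Blinfun (\<lambda>h. scale_vec (cinner h g) f)"

lemma rank_one_apply [simp]: "rank_one f g h = scale_vec (cinner h g) f"
proof -
  have "bounded_linear (\<lambda>h. scale_vec (cinner h g) f)"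
  proof (rule bounded_linear_intro[where K = "norm g * norm f"])
    show "scale_vec (cinner (r *\<^sub>R h) g) f = r *\<^sub>R scale_vec (cinner h g) f" for r h
      by (simp add: scale_vec_of_real[symmetric] cinner_scale_left scale_vec_mult)
    show "norm (scale_vec (cinner h g) f) \<le> norm h * (norm g * norm f)" for h
      using mult_right_mono[OF cmod_cinner_le[of h g], of "norm f"]
      by (simp add: norm_scale_vec mult.assoc)
  qed (simp add: cinner_add_left scale_vec_add_left)
  then show ?thesis
    by (simp add: rank_one_def bounded_linear_Blinfun_apply)
qed


section \<open>Toeplitz operators\<close>

text \<open>The projection of \<open>f\<close> is the unique element \<open>h\<close> with \<open>f - h\<close> orthogonal to the Bergman
  space.\<close>

definition bergman_proj :: "(complex ^ 'n \<Rightarrow> complex) \<Rightarrow> 'n bergman" where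
  "bergman_proj f = (THE h. \<forall>g. (\<integral>z. (f z - eval h z) * cnj (eval g z) \<partial>dv) = 0)"

definition toeplitz :: "(complex ^ 'n \<Rightarrow> complex) \<Rightarrow> 'n::finite op" where
  "toeplitz f = Blinfun (\<lambda>h. bergman_proj (\<lambda>z. f z * eval h z))"

definition toeplitz_algebra :: "'n::finite op set" where
  "toeplitz_algebra = cstar_generated {toeplitz f | f. f \<in> Linfty}"


section \<open>The metric, separated sets, and the class of localized operators\<close>

definition mobius :: "complex \<Rightarrow> complex \<Rightarrow> complex" where
  "mobius u v = (u - v) / (1 - v * cnj u)"

definition bergman_beta :: "complex \<Rightarrow> complex \<Rightarrow> real" where
  "bergman_beta u v = 1/2 * ln ((1 + cmod (mobius u v)) / (1 - cmod (mobius u v)))"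

definition poly_dist :: "complex ^ 'n \<Rightarrow> complex ^ 'n \<Rightarrow> real" where
  "poly_dist z w = (\<Sum>i\<in>UNIV. bergman_beta (z $ i) (w $ i))"

definition poly_ball :: "complex ^ 'n \<Rightarrow> real \<Rightarrow> (complex ^ 'n) set" where
  "poly_ball z a = {w \<in> polydisc. poly_dist z w < a}"

definition separated_set :: "(complex ^ 'n) set \<Rightarrow> bool" where
  "separated_set \<Gamma> \<longleftrightarrow> \<Gamma> \<subseteq> polydisc \<and>
     (\<exists>a>0. \<forall>u\<in>\<Gamma>. \<forall>v\<in>\<Gamma>. u \<noteq> v \<longrightarrow> poly_ball u a \<inter> poly_ball v a = {})"

lemma one_minus_mult_cnj_bound:
  assumes "cmod z < 1" "cmod w < 1"
  shows "1 - cmod z \<le> cmod (1 - w * cnj z)"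
proof -
  have "cmod (w * cnj z) \<le> cmod z"
    using assms mult_right_mono[of "cmod w" 1 "cmod z"] by (simp add: norm_mult)
  then show ?thesis
    using norm_triangle_ineq2[of 1 "w * cnj z"] by simp
qed

lemma normalized_kernel_mem:
  fixes z :: "complex ^ 'n"
  defines "K \<equiv> \<lambda>w. if z \<in> polydisc \<and> w \<in> polydisc
      then \<Prod>i\<in>UNIV. complex_of_real (1 - (cmod (z $ i))\<^sup>2) / (1 - w $ i * cnj (z $ i))\<^sup>2
      else 0"
  shows "K \<in> {f. f \<in> L2 \<and> analytic_vec f polydisc \<and> (\<forall>z. z \<notin> polydisc \<longrightarrow> f z = 0)}"
proof -
  define k where "k w = (\<Prod>i\<in>UNIV. complex_of_real (1 - (cmod (z $ i))\<^sup>2) /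
      (1 - w $ i * cnj (z $ i))\<^sup>2)" for w :: "complex ^ 'n"
  have K: "K w = (if z \<in> polydisc \<and> w \<in> polydisc then k w else 0)" for w
    by (simp only: K_def k_def)
  show ?thesis
  proof (cases "z \<in> polydisc")
    case False
    then have "K = (\<lambda>_. 0)" by (simp add: K fun_eq_iff)
    then show ?thesis by (simp add: L2_def analytic_vec_const)
  next
    case True
    then have z: "cmod (z $ i) < 1" for i by (simp add: polydisc_def)
    have nz: "1 - w $ i * cnj (z $ i) \<noteq> 0" if "w \<in> polydisc" for w i
      using one_minus_mult_cnj_bound[OF z, of "w $ i" i] that z[of i] by (auto simp: polydisc_def)
    have "analytic_vec k polydisc"
      unfolding k_def
    proof (rule analytic_vec_prod)
      fix i :: 'n
      have "(\<lambda>x. complex_of_real (1 - (cmod (z $ i))\<^sup>2) / (1 - x * cnj (z $ i))\<^sup>2)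
          field_differentiable (at (w $ i))" if "w \<in> polydisc" for w
        by (intro derivative_intros) (use nz[OF that] in auto)
      then show "analytic_vec (\<lambda>w. complex_of_real (1 - (cmod (z $ i))\<^sup>2) /
          (1 - w $ i * cnj (z $ i))\<^sup>2) polydisc"
        by (rule analytic_vec_component)
    qed
    then have an: "analytic_vec K polydisc"
      by (rule analytic_vec_transform[OF _ open_polydisc]) (simp add: K True)
    have meas [measurable]: "K \<in> borel_measurable dv"
      by (rule borel_measurable_dvI[OF analytic_vec_continuous_on[OF an]]) (simp add: K)
    define B where "B = (\<Prod>i\<in>UNIV. 1 / (1 - cmod (z $ i))\<^sup>2)"
    have "B \<ge> 0" unfolding B_def by (intro prod_nonneg) auto
    have "cmod (k w) \<le> B" if w: "w \<in> polydisc" for w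
      unfolding k_def B_def prod_norm[symmetric]
    proof (rule prod_mono, intro conjI)
      fix i :: 'n
      have "(1 - cmod (z $ i))\<^sup>2 \<le> (cmod (1 - w $ i * cnj (z $ i)))\<^sup>2"
        using one_minus_mult_cnj_bound[OF z, of "w $ i" i] w z[of i]
        by (intro power_mono) (auto simp: polydisc_def)
      moreover have "\<bar>1 - (cmod (z $ i))\<^sup>2\<bar> \<le> 1"
        using z[of i] power_le_one[of "cmod (z $ i)" 2] by (simp add: abs_if)
      moreover have "0 < (1 - cmod (z $ i))\<^sup>2" using z[of i] by simp
      ultimately have "\<bar>1 - (cmod (z $ i))\<^sup>2\<bar> / (cmod (1 - w $ i * cnj (z $ i)))\<^sup>2
          \<le> 1 / (1 - cmod (z $ i))\<^sup>2"
        by (intro frac_le) auto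
      then show "cmod (complex_of_real (1 - (cmod (z $ i))\<^sup>2) / (1 - w $ i * cnj (z $ i))\<^sup>2)
          \<le> 1 / (1 - cmod (z $ i))\<^sup>2"
        by (simp only: norm_divide norm_of_real norm_power)
    qed simp
    then have "cmod (K w) \<le> B" for w
      using \<open>B \<ge> 0\<close> by (simp add: K)
    then have "(cmod (K w))\<^sup>2 \<le> B\<^sup>2" for w
      by (intro power_mono) auto
    then have "integrable dv (\<lambda>w. (cmod (K w))\<^sup>2)"
      by (intro finite_measure.integrable_const_bound[OF finite_measure_dv, of _ "B\<^sup>2"]) auto
    then show ?thesis
      using an meas by (simp add: L2_def K)
  qed
qed

text \<open>The normalized reproducing kernel; for \<open>z\<close> outside the polydisc it is set to zero.\<close>

definition normalized_kernel :: "complex ^ 'n \<Rightarrow> 'n bergman" where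
  "normalized_kernel z = Bergman (\<lambda>w. if z \<in> polydisc \<and> w \<in> polydisc
      then \<Prod>i\<in>UNIV. complex_of_real (1 - (cmod (z $ i))\<^sup>2) / (1 - w $ i * cnj (z $ i))\<^sup>2
      else 0)"

lemma eval_normalized_kernel:
  "eval (normalized_kernel z) w = (if z \<in> polydisc \<and> w \<in> polydisc
      then \<Prod>i\<in>UNIV. complex_of_real (1 - (cmod (z $ i))\<^sup>2) / (1 - w $ i * cnj (z $ i))\<^sup>2
      else 0)"
  unfolding normalized_kernel_def
  by (subst Bergman_inverse[OF normalized_kernel_mem]) (rule refl)

text \<open>The sum over \<open>\<Gamma>\<close> converges in the strong operator topology, i.e. after application to each
  vector, as an unconditional sum (a limit along the finite subsets of \<open>\<Gamma>\<close>).\<close>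

definition sot_has_sum :: "('a \<Rightarrow> 'n::finite op) \<Rightarrow> 'n op \<Rightarrow> 'a set \<Rightarrow> bool" where
  "sot_has_sum T A \<Gamma> \<longleftrightarrow> (\<forall>h. ((\<lambda>z. T z h) has_sum A h) \<Gamma>)"

definition D0 :: "'n::finite op set" where
  "D0 = {A. \<exists>\<Gamma> c \<gamma>. separated_set \<Gamma> \<and> bounded (c ` \<Gamma>) \<and> \<gamma> ` \<Gamma> \<subseteq> polydisc \<and>
      (\<exists>C\<ge>0. \<forall>z\<in>\<Gamma>. poly_dist z (\<gamma> z) \<le> C) \<and>
      sot_has_sum
        (\<lambda>z. scale_op (c z) (rank_one (normalized_kernel z) (normalized_kernel (\<gamma> z)))) A \<Gamma>}"

definition D_closure :: "'n::finite op set" where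
  "D_closure = closure (module.span scale_op D0)"

end

theory Submission
  imports Defs "HOL-Complex_Analysis.Cauchy_Integral_Formula"
begin

text \<open>
  Let \<open>U\<^sub>z h = (h \<circ> \<phi>\<^sub>z) k\<^sub>z\<close> for the coordinatewise Moebius involution \<open>\<phi>\<^sub>z\<close>. An operator is a
  norm limit of Toeplitz operators iff its sesquilinear form is a limit of forms
  \<open>\<integral> f h conj(g) dv\<close>, uniformly on the unit balls. For a uniformly locally finite measure \<open>M\<close>
  (counting measure on a separated set, or the invariant measure \<open>\<lambda>\<close>), averaging a bump around
  \<open>w\<close> shows that \<open>\<integral> c(z) (U\<^sub>z h)(w) conj((U\<^sub>z g)(w)) dM\<close> is such a limit. Filtering the power series
  along a complex line by roots of unity turns these diagonal forms into the off-diagonal ones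
  \<open>\<integral> c(z) (U\<^sub>z h)(b) conj((U\<^sub>z g)(0)) dM\<close>, and finite nets allow \<open>b\<close> to depend on \<open>z\<close> within a
  compact set, or to be integrated there.

  Counting measure then gives that every localized sum is a limit of Toeplitz operators. The form
  of \<open>T\<^sub>f T\<^sub>g\<close> is an integral over \<open>\<lambda>\<close> of functionals of \<open>U\<^sub>z h\<close> that are localized up to a tail
  controlled by the Schur test, so the closure of the Toeplitz operators is an algebra. Finally
  \<open>T\<^sub>f = \<integral> f(z) k\<^sub>z \<otimes> k\<^sub>z d\<lambda>\<close> is approximated by Riemann sums over fine separated nets.
\<close>

text \<open>The obstacle is that the invariant measure is infinite while \<open>mobU z\<close> is
  isometric for z in the polydisc: an error in the integrand measured by
  \<open>norm (mobU z h)\<close> cannot be integrated over z. Hence values, derivatives and Taylor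
  coefficients are all estimated by the local norm \<open>locnorm t\<close> with t < 1. The square
  of \<open>locnorm t (mobU z h)\<close> is the mass of |h|^2 on a hyperbolic ball around z; these
  balls overlap boundedly with respect to \<open>M\<close>, so Fubini and Cauchy-Schwarz turn a
  local error e into a form of norm O(e) (\<open>sesq_bound\<close>). What is left to approximate
  are functionals on a compact part of the polydisc that is the same for all z.

  The starting point is exact rather than approximate: a symbol supported in \<open>pd r\<close>,
  moved by all \<open>mob z\<close> and superposed, is again a bounded symbol. The passage off the
  diagonal is possible because h enters analytically and g antianalytically, so that rotating the
  evaluation point separates the terms of the two power series.\<close>

section \<open>Lebesgue measure on coordinate spaces and its change under holomorphic maps\<close>

lemma Basis_vec_image: "(Basis :: ('a::euclidean_space ^ 'n) set) = (\<lambda>(i, b). axis i b) ` (UNIV \<times> Basis)"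
  by (auto simp: Basis_vec_def)

lemma prod_Basis_vec:
  "(\<Prod>b\<in>(Basis :: ('a::euclidean_space ^ 'n) set). f b) = (\<Prod>i\<in>UNIV. \<Prod>b\<in>Basis. f (axis i b))"
proof -
  have "inj_on (\<lambda>(i, b). axis i b :: 'a ^ 'n) (UNIV \<times> Basis)"
    by (auto simp: inj_on_def axis_eq_axis)
  then show ?thesis
    unfolding Basis_vec_image
    by (subst prod.reindex) (auto simp: prod.cartesian_product case_prod_beta')
qed

lemma mem_box_vec: "x \<in> box a b \<longleftrightarrow> (\<forall>i. x $ i \<in> box (a $ i) (b $ i))"
  for x :: "'a::euclidean_space ^ 'n"
  by (auto simp: mem_box Basis_vec_def inner_axis)

lemma measurable_vec_lambda [measurable (raw)]:
  fixes f :: "'b \<Rightarrow> 'n::finite \<Rightarrow> 'a::euclidean_space"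
  assumes "\<And>i. (\<lambda>x. f x i) \<in> borel_measurable M"
  shows "(\<lambda>x. \<chi> i. f x i) \<in> borel_measurable M"
proof (subst borel_measurable_euclidean_space, intro ballI)
  fix b :: "'a ^ 'n" assume "b \<in> Basis"
  then obtain i c where "b = axis i c" "c \<in> Basis" by (auto simp: Basis_vec_def)
  then show "(\<lambda>x. (\<chi> i. f x i) \<bullet> b) \<in> borel_measurable M"
    using assms[of i] by (simp add: inner_axis)
qed

lemma measurable_vec_nth [measurable]: "(\<lambda>x :: 'a::euclidean_space ^ 'n. x $ i) \<in> borel_measurable borel"
  by (intro borel_measurable_continuous_onI continuous_intros)

text \<open>Boxes determine Lebesgue measure, and a box in \<open>'a ^ 'n\<close> is the product of
  its coordinate boxes. This gives access to Tonelli over the coordinates.\<close>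

lemma lborel_vec_eq:
  "(lborel :: ('a::euclidean_space ^ 'n) measure) = distr (PiM UNIV (\<lambda>_. lborel)) borel vec_lambda"
proof (rule lborel_eqI)
  interpret product_sigma_finite "\<lambda>_ :: 'n. lborel :: 'a measure" ..
  fix l u :: "'a ^ 'n" assume le': "\<And>b. b \<in> Basis \<Longrightarrow> l \<bullet> b \<le> u \<bullet> b"
  have le: "l $ i \<bullet> b \<le> u $ i \<bullet> b" if "b \<in> Basis" for i b
    using le'[of "axis i b"] that by (auto simp: inner_axis Basis_vec_def)
  have m: "vec_lambda \<in> PiM UNIV (\<lambda>_ :: 'n. lborel :: 'a measure) \<rightarrow>\<^sub>M borel"
    using measurable_vec_lambda[of "\<lambda>f i. f i" "PiM UNIV (\<lambda>_ :: 'n. lborel :: 'a measure)"]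
    by (simp add: measurable_component_singleton)
  have "vec_lambda -` box l u \<inter> space (PiM UNIV (\<lambda>_ :: 'n. lborel :: 'a measure)) =
     PiE UNIV (\<lambda>i. box (l $ i) (u $ i))"
    by (auto simp: mem_box_vec space_PiM PiE_def Pi_iff)
  then have "emeasure (distr (PiM UNIV (\<lambda>_. lborel)) borel vec_lambda) (box l u)
      = (\<Prod>i\<in>UNIV. emeasure lborel (box (l $ i) (u $ i)))"
    by (simp add: emeasure_distr[OF m] emeasure_PiM)
  also have "\<dots> = (\<Prod>i\<in>UNIV. ennreal (\<Prod>b\<in>Basis. (u $ i - l $ i) \<bullet> b))"
    using le by (intro prod.cong refl emeasure_lborel_box) auto
  also have "\<dots> = ennreal (\<Prod>i\<in>UNIV. \<Prod>b\<in>Basis. (u $ i - l $ i) \<bullet> b)"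
    using le by (intro prod_ennreal prod_nonneg) (auto simp: inner_diff_left)
  also have "(\<Prod>i\<in>UNIV. \<Prod>b\<in>Basis. (u $ i - l $ i) \<bullet> b) = (\<Prod>b\<in>Basis. (u - l) \<bullet> b)"
    by (simp add: prod_Basis_vec inner_axis)
  finally show "emeasure (distr (PiM UNIV (\<lambda>_. lborel)) borel vec_lambda) (box l u)
      = (\<Prod>b\<in>Basis. (u - l) \<bullet> b)" .
qed simp

lemma nn_integral_lborel_vec_prod:
  fixes f :: "'n::finite \<Rightarrow> 'a::euclidean_space \<Rightarrow> ennreal"
  assumes [measurable]: "\<And>i. f i \<in> borel_measurable borel"
  shows "(\<integral>\<^sup>+z. (\<Prod>i\<in>UNIV. f i (z $ i)) \<partial>lborel) = (\<Prod>i\<in>UNIV. \<integral>\<^sup>+x. f i x \<partial>lborel)"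
proof -
  interpret product_sigma_finite "\<lambda>_ :: 'n. lborel :: 'a measure" ..
  have m: "vec_lambda \<in> PiM UNIV (\<lambda>_ :: 'n. lborel :: 'a measure) \<rightarrow>\<^sub>M borel"
    using measurable_vec_lambda[of "\<lambda>f i. f i" "PiM UNIV (\<lambda>_ :: 'n. lborel :: 'a measure)"]
    by (simp add: measurable_component_singleton)
  show ?thesis
    unfolding lborel_vec_eq
    by (subst nn_integral_distr[OF m]) (auto simp: product_nn_integral_prod)
qed

text \<open>Boxes are stable under intersection, generate the Borel sets, and countably many of them
  exhaust the space.\<close>

lemma measure_eqI_box:
  fixes M N :: "'a::euclidean_space measure"
  assumes s: "sets M = sets borel" "sets N = sets borel"
    and fin: "emeasure M UNIV \<noteq> \<infinity>"
    and eq: "\<And>a b. emeasure M (box a b) = emeasure N (box a b)"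
  shows "M = N"
proof (rule measure_eqI_generator_eq)
  let ?E = "range (\<lambda>(a, b). box a b::'a set)"
  show "Int_stable ?E"
    by (auto simp: Int_stable_def box_Int_box)
  show "?E \<subseteq> Pow UNIV" "sets M = sigma_sets UNIV ?E" "sets N = sigma_sets UNIV ?E"
    by (simp_all add: borel_eq_box s)
  let ?A = "\<lambda>n::nat. box (- (real n *\<^sub>R One)) (real n *\<^sub>R One) :: 'a set"
  show "range ?A \<subseteq> ?E" "(\<Union>i. ?A i) = UNIV"
    unfolding UN_box_eq_UNIV by auto
  have "space M = UNIV" using sets_eq_imp_space_eq[OF s(1)] by simp
  then show "emeasure M (?A i) \<noteq> \<infinity>" for i
    using fin emeasure_mono[of "?A i" UNIV M] sets.top[of M] by (auto simp: top_unique)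
  show "emeasure M X = emeasure N X" if "X \<in> ?E" for X
    using that eq by auto
qed

text \<open>Carries the plane over to \<open>real ^ 2\<close>, where the change of variables is
  expressed by the determinant of a matrix.\<close>

lemma lborel_complex_eq:
  "(lborel :: complex measure) = distr (lborel :: (real ^ 2) measure) borel (\<lambda>x. Complex (x $ 1) (x $ 2))"
proof (rule lborel_eqI)
  fix l u :: complex assume le: "\<And>b. b \<in> Basis \<Longrightarrow> l \<bullet> b \<le> u \<bullet> b"
  have m: "(\<lambda>x :: real ^ 2. Complex (x $ 1) (x $ 2)) \<in> borel_measurable borel"
    unfolding complex_eq_iff Complex_eq by measurable
  have U2: "(UNIV :: 2 set) = {1, 2}" using exhaust_2 by auto
  have eq: "(\<lambda>x :: real ^ 2. Complex (x $ 1) (x $ 2)) -` box l u = box (vector [Re l, Im l]) (vector [Re u, Im u])"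
    by (auto simp: mem_box_cart forall_2 vector_2 mem_box Basis_complex_def inner_complex_def)
  have "emeasure (distr (lborel :: (real ^ 2) measure) borel (\<lambda>x. Complex (x $ 1) (x $ 2))) (box l u)
     = emeasure lborel (box (vector [Re l, Im l] :: real ^ 2) (vector [Re u, Im u]))"
    using m by (subst emeasure_distr) (auto simp: eq)
  also have "\<dots> = (\<Prod>b\<in>Basis. (vector [Re u, Im u] - vector [Re l, Im l] :: real ^ 2) \<bullet> b)"
    using le by (intro emeasure_lborel_box)
      (use le[of 1] le[of "\<i>"] in \<open>auto simp: Basis_vec_def inner_axis Basis_complex_def inner_complex_def U2 vector_2\<close>)
  also have "(\<Prod>b\<in>Basis. (vector [Re u, Im u] - vector [Re l, Im l] :: real ^ 2) \<bullet> b)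
      = (\<Prod>b\<in>Basis. (u - l) \<bullet> b)"
    by (simp add: prod_Basis_vec inner_axis U2 vector_2 Basis_complex_def inner_complex_def complex_eq_iff)
  finally show "emeasure (distr (lborel :: (real ^ 2) measure) borel (\<lambda>x. Complex (x $ 1) (x $ 2))) (box l u)
     = (\<Prod>b\<in>Basis. (u - l) \<bullet> b)" .
qed simp

text \<open>By the Cauchy-Riemann equations the real Jacobian of a holomorphic map is the squared
  modulus of its derivative. The map is conjugated by the identification \<open>P\<close> of
  \<open>real ^ 2\<close> with the plane, whose inverse is \<open>Q\<close>.\<close>

lemma emeasure_holomorphic_image:
  fixes g g' :: "complex \<Rightarrow> complex"
  assumes S: "open S" and gS: "open (g ` S)" "emeasure lborel (g ` S) < \<infinity>"
    and der: "\<And>z. z \<in> S \<Longrightarrow> (g has_field_derivative g' z) (at z)"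
    and g': "g' \<in> borel_measurable borel"
    and inj: "inj_on g S"
  shows "(\<integral>\<^sup>+z. indicator S z * ennreal ((cmod (g' z))\<^sup>2) \<partial>lborel) = emeasure lborel (g ` S)"
proof -
  define P where "P = (\<lambda>x :: real ^ 2. Complex (x $ 1) (x $ 2))"
  define Q where "Q = (\<lambda>z. vector [Re z, Im z] :: real ^ 2)"
  have PQ [simp]: "P (Q z) = z" "Q (P x) = x" for z x
    by (auto simp: P_def Q_def vec_eq_iff forall_2 vector_2)
  have linP: "linear P"
    by (auto simp: linear_iff P_def complex_eq_iff)
  have linQ: "linear Q"
    by (auto simp: linear_iff Q_def vec_eq_iff forall_2 vector_2)
  have bP: "bounded_linear P" and bQ: "bounded_linear Q"
    using linP linQ linear_conv_bounded_linear by auto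
  have mP [measurable]: "P \<in> borel_measurable borel"
    by (intro borel_measurable_continuous_onI linear_continuous_on bP)
  have lb: "(lborel :: complex measure) = distr lborel borel P"
    unfolding P_def by (rule lborel_complex_eq)
  define S2 where "S2 = P -` S"
  define G where "G = Q \<circ> g \<circ> P"
  define G' where "G' x = (\<lambda>h. Q (g' (P x) * P h))" for x
  have contP: "continuous_on UNIV P" by (intro linear_continuous_on bP)
  have S2: "open S2" unfolding S2_def using open_vimage[OF S contP] by simp
  have im: "G ` S2 = P -` (g ` S)"
  proof safe
    fix x z assume "P x = g z" "z \<in> S"
    then have "x = G (Q z)" "Q z \<in> S2"
      by (auto simp: G_def S2_def) (metis PQ(2))
    then show "x \<in> G ` S2" by blast
  qed (auto simp: G_def S2_def)
  have oim: "open (G ` S2)" unfolding im using open_vimage[OF gS(1) contP] by simp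
  have em: "emeasure lborel (G ` S2) = emeasure lborel (g ` S)"
    unfolding im lb using gS by (subst emeasure_distr) (auto simp: borel_open)
  \<comment> \<open>Multiplication by a + ib has the matrix with rows (a, -b) and (b, a), of
    determinant a^2 + b^2.\<close>
  have det: "\<bar>det (matrix (G' x))\<bar> = (cmod (g' (P x)))\<^sup>2" for x
  proof -
    have "det (matrix (G' x)) = (Re (g' (P x)))\<^sup>2 + (Im (g' (P x)))\<^sup>2"
      by (simp add: det_2 matrix_def G'_def Q_def P_def axis_def vector_2 power2_eq_square)
    then show ?thesis by (simp add: cmod_power2)
  qed
  have dG: "(G has_derivative G' x) (at x within S2)" if "x \<in> S2" for x
  proof -
    have "(g has_derivative (*) (g' (P x))) (at (P x))"
      using der that by (simp add: S2_def has_field_derivative_def)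
    then have "((\<lambda>x. g (P x)) has_derivative (\<lambda>h. g' (P x) * P h)) (at x)"
      using has_derivative_compose[OF bounded_linear_imp_has_derivative[OF bP], of g _ x UNIV] by simp
    then have "((\<lambda>x. Q (g (P x))) has_derivative (\<lambda>h. Q (g' (P x) * P h))) (at x)"
      using bounded_linear.has_derivative[OF bQ] by blast
    then show ?thesis
      unfolding G_def G'_def comp_def by (rule has_derivative_at_withinI)
  qed
  have injG: "inj_on G S2"
    using inj unfolding inj_on_def G_def S2_def comp_def by (metis PQ vimage_eq)
  have "G ` S2 \<in> lmeasurable"
    using oim gS(2) em by (auto intro!: fmeasurableI simp: borel_open)
  then have "((\<lambda>x. \<bar>det (matrix (G' x))\<bar>) has_integral measure lebesgue (G ` S2)) S2"
    using has_measure_differentiable_image[of S2 G G' "measure lebesgue (G ` S2)"] S2 dG injG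
    by (auto simp: borel_open)
  then have "((\<lambda>x. indicator S2 x * (cmod (g' (P x)))\<^sup>2) has_integral measure lebesgue (G ` S2)) UNIV"
    unfolding det
    by (subst (asm) has_integral_restrict_UNIV[symmetric])
      (simp add: indicator_def of_bool_def if_distribR if_distrib[of "\<lambda>t. t * _"] cong: if_cong)
  then have "(\<integral>\<^sup>+x. ennreal (indicator S2 x * (cmod (g' (P x)))\<^sup>2) \<partial>lborel) = ennreal (measure lebesgue (G ` S2))"
    using g' S2 by (intro nn_integral_has_integral_lborel) (auto simp: borel_open)
  also have "\<dots> = emeasure lborel (G ` S2)"
  proof -
    have "G ` S2 \<in> sets lborel" "emeasure lborel (G ` S2) \<noteq> \<infinity>"
      using oim em gS(2) by (auto simp: borel_open)
    then show ?thesis by (simp add: emeasure_eq_ennreal_measure measure_completion)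
  qed
  also have "(\<integral>\<^sup>+x. ennreal (indicator S2 x * (cmod (g' (P x)))\<^sup>2) \<partial>lborel) =
     (\<integral>\<^sup>+x. indicator S (P x) * ennreal ((cmod (g' (P x)))\<^sup>2) \<partial>lborel)"
    by (intro nn_integral_cong) (auto simp: indicator_def S2_def)
  also have "\<dots> = (\<integral>\<^sup>+z. indicator S z * ennreal ((cmod (g' z))\<^sup>2) \<partial>lborel)"
    unfolding lb using S g' by (subst nn_integral_distr) (auto simp: borel_open)
  finally show ?thesis using em by simp
qed

section \<open>Borel versions of the normalized measures\<close>

text \<open>Borel sets make the Tonelli theorem available; \<open>dv\<close> itself lives on the Lebesgue sets.\<close>

definition dvb :: "(complex ^ 'n) measure" where
  "dvb = distr dv borel (\<lambda>z. z)"

definition dv1 :: "complex measure" where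
  "dv1 = uniform_measure lborel (ball 0 1)"

lemma id_measurable_dv: "(\<lambda>z. z) \<in> dv \<rightarrow>\<^sub>M borel"
  by (rule measurableI) (auto simp: sets_dv intro: sets_completionI_sets)

lemma sets_dvb [simp, measurable_cong]: "sets dvb = sets borel"
  and space_dvb [simp]: "space dvb = UNIV"
  by (simp_all add: dvb_def)

lemma sets_dv1 [simp, measurable_cong]: "sets dv1 = sets borel"
  and space_dv1 [simp]: "space dv1 = UNIV"
  by (simp_all add: dv1_def)

lemma borel_imp_measurable_dv: "f \<in> borel_measurable borel \<Longrightarrow> f \<in> borel_measurable dv"
  by (rule measurable_compose[OF id_measurable_dv])

lemma integral_dv_eq:
  fixes f :: "complex ^ 'n \<Rightarrow> 'a::{banach, second_countable_topology}"
  assumes "f \<in> borel_measurable borel"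
  shows "integral\<^sup>L dv f = integral\<^sup>L dvb f" and "integrable dv f \<longleftrightarrow> integrable dvb f"
  unfolding dvb_def
  by (rule integral_distr[OF id_measurable_dv assms, symmetric])
    (rule integrable_distr_eq[OF id_measurable_dv assms, symmetric])

lemma open_polydisc_borel [measurable]: "(polydisc :: (complex ^ 'n) set) \<in> sets borel"
  by (simp add: open_polydisc borel_open)

lemma dvb_uniform: "(dvb :: (complex ^ 'n) measure) = uniform_measure lborel polydisc"
proof (rule measure_eqI)
  fix A :: "(complex ^ 'n) set" assume "A \<in> sets dvb"
  then have A [measurable]: "A \<in> sets borel" by simp
  have L: "emeasure lebesgue S = emeasure lborel S" if "S \<in> sets borel" for S :: "(complex ^ 'n) set"
    using that by (simp add: emeasure_completion)
  have "emeasure dvb A = emeasure dv A"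
    unfolding dvb_def using A by (subst emeasure_distr[OF id_measurable_dv]) auto
  also have "\<dots> = emeasure lebesgue (polydisc \<inter> A) / emeasure lebesgue (polydisc :: (complex ^ 'n) set)"
    unfolding dv_def by (rule emeasure_uniform_measure) (auto simp: sets_polydisc)
  also have "\<dots> = emeasure (uniform_measure lborel polydisc) A"
    by (simp add: emeasure_uniform_measure L)
  finally show "emeasure dvb A = emeasure (uniform_measure lborel polydisc) A" .
qed simp

lemma emeasure_lborel_polydisc:
  "emeasure lborel (polydisc :: (complex ^ 'n) set) \<noteq> 0"
  "emeasure lborel (polydisc :: (complex ^ 'n) set) < \<infinity>"
  using emeasure_polydisc[where 'n='n] by (simp_all add: emeasure_completion)

lemma emeasure_dvb_UNIV: "emeasure (dvb :: (complex ^ 'n) measure) UNIV = 1"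
  unfolding dvb_def using emeasure_dv_UNIV by (subst emeasure_distr[OF id_measurable_dv]) auto

interpretation dvb: finite_measure "dvb :: (complex ^ 'n) measure"
  by (rule finite_measureI) (simp add: emeasure_dvb_UNIV)

lemma emeasure_lborel_disc:
  "emeasure lborel (ball 0 1 :: complex set) \<noteq> 0" "emeasure lborel (ball 0 1 :: complex set) < \<infinity>"
proof -
  have "\<not> negligible (ball 0 1 :: complex set)" by (rule open_not_negligible) auto
  then show "emeasure lborel (ball 0 1 :: complex set) \<noteq> 0"
    by (auto simp: negligible_iff_null_sets null_sets_def emeasure_completion)
  show "emeasure lborel (ball 0 1 :: complex set) < \<infinity>"
    by (rule emeasure_bounded_finite) auto
qed

lemma emeasure_dv1_UNIV: "emeasure dv1 UNIV = 1"
  unfolding dv1_def using emeasure_lborel_disc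
  by (subst emeasure_uniform_measure) (auto simp: ennreal_divide_self less_top[symmetric])

interpretation dv1: finite_measure dv1
  by (rule finite_measureI) (simp add: emeasure_dv1_UNIV)

lemma indicator_polydisc: "indicator polydisc z = (\<Prod>i\<in>UNIV. indicator (ball 0 1) (z $ i) :: ennreal)"
proof (cases "z \<in> polydisc")
  case False
  then obtain i where "\<not> cmod (z $ i) < 1" by (auto simp: polydisc_def)
  then have "(\<Prod>i\<in>UNIV. indicator (ball 0 1) (z $ i) :: ennreal) = 0"
    by (intro prod_zero) (auto intro!: exI[of _ i])
  then show ?thesis using False by simp
qed (auto simp: polydisc_def)

text \<open>The indicator of the polydisc is a product over the coordinates and its volume is a
  power of the area of the disc, so the normalizations match and \<open>dvb\<close> behaves as a
  product of copies of \<open>dv1\<close>.\<close>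

lemma nn_integral_dvb_prod:
  fixes f :: "'n::finite \<Rightarrow> complex \<Rightarrow> ennreal"
  assumes [measurable]: "\<And>i. f i \<in> borel_measurable borel"
  shows "(\<integral>\<^sup>+z. (\<Prod>i\<in>UNIV. f i (z $ i)) \<partial>dvb) = (\<Prod>i\<in>UNIV. \<integral>\<^sup>+x. f i x \<partial>dv1)"
proof -
  define V where "V = measure lborel (ball 0 1 :: complex set)"
  have V: "emeasure lborel (ball 0 1 :: complex set) = ennreal V"
    using emeasure_lborel_disc(2) by (simp add: V_def emeasure_eq_ennreal_measure)
  have V0: "V > 0"
    using V emeasure_lborel_disc(1) by (metis V_def ennreal_0 measure_nonneg order_le_less)
  have "emeasure lborel (polydisc :: (complex ^ 'n) set) = (\<integral>\<^sup>+z. indicator (polydisc :: (complex ^ 'n) set) z \<partial>lborel)"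
    by (subst nn_integral_indicator) auto
  also have "\<dots> = (\<Prod>i\<in>(UNIV :: 'n set). ennreal V)"
    unfolding indicator_polydisc
    by (subst nn_integral_lborel_vec_prod) (auto simp: V intro!: borel_measurable_indicator)
  finally have Vp: "emeasure lborel (polydisc :: (complex ^ 'n) set) = (\<Prod>i\<in>(UNIV :: 'n set). ennreal V)" .
  have inv: "inverse (\<Prod>i\<in>(UNIV :: 'n set). ennreal V) = (\<Prod>i\<in>(UNIV :: 'n set). inverse (ennreal V))"
    using V0 by (simp add: ennreal_power inverse_ennreal power_inverse)
  have "(\<integral>\<^sup>+z. (\<Prod>i\<in>UNIV. f i (z $ i)) \<partial>dvb)
     = (\<integral>\<^sup>+z. (\<Prod>i\<in>UNIV. f i (z $ i) * indicator (ball 0 1) (z $ i)) \<partial>lborel)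
        / (\<Prod>i\<in>(UNIV :: 'n set). ennreal V)"
    unfolding dvb_uniform
    by (subst nn_integral_uniform_measure) (auto simp: Vp indicator_polydisc prod.distrib)
  also have "\<dots> = (\<Prod>i\<in>UNIV. \<integral>\<^sup>+x. f i x * indicator (ball 0 1) x \<partial>lborel) /
        (\<Prod>i\<in>(UNIV :: 'n set). ennreal V)"
    by (subst nn_integral_lborel_vec_prod) (auto intro!: borel_measurable_times_ennreal borel_measurable_indicator)
  also have "\<dots> = (\<Prod>i\<in>UNIV. (\<integral>\<^sup>+x. f i x * indicator (ball 0 1) x \<partial>lborel) / ennreal V)"
    unfolding divide_ennreal_def inv prod.distrib ..
  also have "\<dots> = (\<Prod>i\<in>UNIV. \<integral>\<^sup>+x. f i x \<partial>dv1)"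
    unfolding dv1_def by (intro prod.cong refl, subst nn_integral_uniform_measure) (auto simp: V)
  finally show ?thesis .
qed

text \<open>It suffices to compare the two measures on boxes: the part of the disc that
  \<open>g\<close> sends into a box is open, and its image is the box cut with the disc.\<close>

lemma nn_integral_dv1_transform:
  fixes g g' :: "complex \<Rightarrow> complex" and f :: "complex \<Rightarrow> ennreal"
  assumes g: "g ` ball 0 1 = ball 0 1" and inj: "inj_on g (ball 0 1)"
    and der: "\<And>z. z \<in> ball 0 1 \<Longrightarrow> (g has_field_derivative g' z) (at z)"
    and [measurable]: "g' \<in> borel_measurable borel" "g \<in> borel_measurable borel"
      "f \<in> borel_measurable borel"
  shows "(\<integral>\<^sup>+u. f (g u) * ennreal ((cmod (g' u))\<^sup>2) \<partial>dv1) = (\<integral>\<^sup>+u. f u \<partial>dv1)"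
proof -
  have "dv1 = distr (density dv1 (\<lambda>u. ennreal ((cmod (g' u))\<^sup>2))) borel g"
  proof (rule measure_eqI_box)
    fix a b :: complex
    define S where "S = {u \<in> ball 0 1. g u \<in> box a b}"
    have "continuous_on (ball 0 1) g"
      using der by (meson DERIV_continuous_on has_field_derivative_at_within)
    then have S: "open S"
      using continuous_on_open_vimage[of "ball 0 1" g] open_box[of a b]
      by (auto simp: S_def Int_def vimage_def conj_commute)
    have im: "g ` S = ball 0 1 \<inter> box a b"
    proof -
      have "g ` S = g ` ball 0 1 \<inter> box a b" unfolding S_def by blast
      then show ?thesis by (simp only: g)
    qed
    have fin: "emeasure lborel (g ` S) < \<infinity>"
      unfolding im by (rule emeasure_bounded_finite, rule bounded_subset[of "ball 0 1"]) auto
    have *: "(\<integral>\<^sup>+z. indicator S z * ennreal ((cmod (g' z))\<^sup>2) \<partial>lborel) = emeasure lborel (ball 0 1 \<inter> box a b)"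
      unfolding im[symmetric]
    proof (rule emeasure_holomorphic_image[OF S _ fin])
      show "open (g ` S)" unfolding im by auto
      show "inj_on g S" by (rule inj_on_subset[OF inj]) (auto simp: S_def)
    qed (auto simp: S_def intro: der)
    have "emeasure (distr (density dv1 (\<lambda>u. ennreal ((cmod (g' u))\<^sup>2))) borel g) (box a b) =
        (\<integral>\<^sup>+u. indicator (box a b) u \<partial>distr (density dv1 (\<lambda>u. ennreal ((cmod (g' u))\<^sup>2))) borel g)"
      by (subst nn_integral_indicator) auto
    also have "\<dots> = (\<integral>\<^sup>+u. ennreal ((cmod (g' u))\<^sup>2) * indicator (box a b) (g u) \<partial>dv1)"
      by (simp add: nn_integral_distr nn_integral_density del: nn_integral_indicator)
    also have "\<dots> = (\<integral>\<^sup>+z. indicator S z * ennreal ((cmod (g' z))\<^sup>2) \<partial>lborel) / emeasure lborel (ball 0 1 :: complex set)"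
      unfolding dv1_def
      by (subst nn_integral_uniform_measure)
        (auto simp: S_def indicator_def intro!: arg_cong2[where f = "(/)"] nn_integral_cong)
    also have "\<dots> = emeasure dv1 (box a b)"
      unfolding * dv1_def by (subst emeasure_uniform_measure) auto
    finally show "emeasure dv1 (box a b) =
       emeasure (distr (density dv1 (\<lambda>u. ennreal ((cmod (g' u))\<^sup>2))) borel g) (box a b)" ..
  qed (auto simp: emeasure_dv1_UNIV)
  then have "(\<integral>\<^sup>+u. f u \<partial>dv1) = (\<integral>\<^sup>+u. f u \<partial>(distr (density dv1 (\<lambda>u. ennreal ((cmod (g' u))\<^sup>2))) borel g))"
    by metis
  also have "\<dots> = (\<integral>\<^sup>+u. f (g u) * ennreal ((cmod (g' u))\<^sup>2) \<partial>dv1)"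
    by (simp add: nn_integral_distr nn_integral_density mult.commute)
  finally show ?thesis ..
qed

lemma indicator_box_vec: "indicator (box a b) z = (\<Prod>i\<in>UNIV. indicator (box (a $ i) (b $ i)) (z $ i) :: ennreal)"
  for z :: "'a::euclidean_space ^ 'n"
proof (cases "z \<in> box a b")
  case False
  then obtain i where "z $ i \<notin> box (a $ i) (b $ i)" by (auto simp: mem_box_vec)
  then have "(\<Prod>i\<in>UNIV. indicator (box (a $ i) (b $ i)) (z $ i) :: ennreal) = 0"
    by (intro prod_zero) (auto intro!: exI[of _ i])
  then show ?thesis using False by simp
qed (auto simp: mem_box_vec)

text \<open>Testing on boxes reduces the claim to one coordinate at a time. Keeping the densities
  \<open>d\<close> abstract lets the same lemma serve Moebius maps, with density the squared
  derivative, and rotations, with density 1.\<close>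

lemma dvb_transform:
  fixes g :: "'n::finite \<Rightarrow> complex \<Rightarrow> complex" and d :: "'n \<Rightarrow> complex \<Rightarrow> ennreal"
  assumes [measurable]: "\<And>i. g i \<in> borel_measurable borel" "\<And>i. d i \<in> borel_measurable borel"
    and inv: "\<And>i f. f \<in> borel_measurable borel \<Longrightarrow> (\<integral>\<^sup>+u. f (g i u) * d i u \<partial>dv1) = (\<integral>\<^sup>+u. f u \<partial>dv1)"
  shows "distr (density dvb (\<lambda>u. \<Prod>i\<in>UNIV. d i (u $ i))) borel (\<lambda>u. \<chi> i. g i (u $ i)) = dvb"
proof -
  define G where "G = (\<lambda>u. \<chi> i. g i (u $ i))"
  have [measurable]: "G \<in> borel_measurable borel"
    unfolding G_def by measurable
  have "dvb = distr (density dvb (\<lambda>u. \<Prod>i\<in>UNIV. d i (u $ i))) borel G"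
  proof (rule measure_eqI_box)
    fix a b :: "complex ^ 'n"
    have "emeasure (distr (density dvb (\<lambda>u. \<Prod>i\<in>UNIV. d i (u $ i))) borel G) (box a b) =
        (\<integral>\<^sup>+u. indicator (box a b) u \<partial>distr (density dvb (\<lambda>u. \<Prod>i\<in>UNIV. d i (u $ i))) borel G)"
      by (subst nn_integral_indicator) auto
    also have "\<dots> = (\<integral>\<^sup>+u. (\<Prod>i\<in>UNIV. d i (u $ i)) * indicator (box a b) (G u) \<partial>dvb)"
      by (simp add: nn_integral_distr nn_integral_density del: nn_integral_indicator)
    also have "\<dots> = (\<integral>\<^sup>+u. (\<Prod>i\<in>UNIV. indicator (box (a $ i) (b $ i)) (g i (u $ i)) * d i (u $ i)) \<partial>dvb)"
      by (simp add: indicator_box_vec G_def prod.distrib mult.commute)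
    also have "\<dots> = (\<Prod>i\<in>UNIV. \<integral>\<^sup>+u. indicator (box (a $ i) (b $ i)) (g i u) * d i u \<partial>dv1)"
      by (subst nn_integral_dvb_prod) auto
    also have "\<dots> = (\<Prod>i\<in>UNIV. \<integral>\<^sup>+u. indicator (box (a $ i) (b $ i)) u \<partial>dv1)"
      by (intro prod.cong refl inv) auto
    also have "\<dots> = (\<integral>\<^sup>+u. (\<Prod>i\<in>UNIV. indicator (box (a $ i) (b $ i)) (u $ i)) \<partial>dvb)"
      by (subst nn_integral_dvb_prod) auto
    also have "\<dots> = emeasure dvb (box a b)"
      by (simp add: indicator_box_vec[symmetric])
    finally show "emeasure dvb (box a b) =
       emeasure (distr (density dvb (\<lambda>u. \<Prod>i\<in>UNIV. d i (u $ i))) borel G) (box a b)" ..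
  qed (auto simp: emeasure_dvb_UNIV)
  then show ?thesis unfolding G_def ..
qed

section \<open>Moebius involutions and the pseudohyperbolic distance of the disc\<close>

lemma den_nz: "cmod z < 1 \<Longrightarrow> cmod u < 1 \<Longrightarrow> 1 - u * cnj z \<noteq> 0"
  using one_minus_mult_cnj_bound[of z u] by auto

lemma cmod_one_minus_commute: "cmod (1 - u * cnj z) = cmod (1 - z * cnj u)"
proof -
  have "1 - z * cnj u = cnj (1 - u * cnj z)" by (simp add: mult.commute)
  then show ?thesis by (simp only: complex_mod_cnj)
qed

lemma one_minus_cmod_mobius:
  assumes "cmod z < 1" "cmod u < 1"
  shows "1 - (cmod (mobius z u))\<^sup>2 = (1 - (cmod z)\<^sup>2) * (1 - (cmod u)\<^sup>2) / (cmod (1 - u * cnj z))\<^sup>2"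
proof -
  have nz: "(cmod (1 - u * cnj z))\<^sup>2 \<noteq> 0" using den_nz[OF assms] by simp
  have "(cmod (1 - u * cnj z))\<^sup>2 - (cmod (z - u))\<^sup>2 = (1 - (cmod z)\<^sup>2) * (1 - (cmod u)\<^sup>2)"
    by (simp add: cmod_power2) algebra
  then show ?thesis
    using nz by (simp add: mobius_def norm_divide power_divide field_simps)
qed

lemma cmod_mobius_lt_1:
  assumes "cmod z < 1" "cmod u < 1"
  shows "cmod (mobius z u) < 1"
proof -
  have "0 < (1 - (cmod z)\<^sup>2) * (1 - (cmod u)\<^sup>2) / (cmod (1 - u * cnj z))\<^sup>2"
    using assms den_nz[OF assms] by (auto intro!: divide_pos_pos mult_pos_pos simp: power_less_one_iff abs_square_less_1)
  then have "(cmod (mobius z u))\<^sup>2 < 1" using one_minus_cmod_mobius[OF assms] by simp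
  then show ?thesis by (simp add: abs_square_less_1)
qed

lemma cmod_mobius_commute: "cmod (mobius z u) = cmod (mobius u z)"
  by (simp add: mobius_def norm_divide cmod_one_minus_commute[of u z] norm_minus_commute)

lemma one_minus_mobius_cnj:
  assumes "cmod z < 1" "cmod u < 1"
  shows "1 - mobius z u * cnj z = complex_of_real (1 - (cmod z)\<^sup>2) / (1 - u * cnj z)"
  using den_nz[OF assms]
  by (simp add: mobius_def field_simps complex_norm_square[unfolded of_real_power])

lemma one_minus_cmod_nz: "cmod z < 1 \<Longrightarrow> complex_of_real (1 - (cmod z)\<^sup>2) \<noteq> 0"
  by (metis abs_norm_cancel abs_square_less_1 diff_gt_0_iff_gt less_irrefl of_real_eq_0_iff)

lemma mobius_mobius:
  assumes "cmod z < 1" "cmod u < 1"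
  shows "mobius z (mobius z u) = u"
proof -
  have n: "1 - u * cnj z \<noteq> 0" using den_nz[OF assms] .
  have "z - mobius z u = u * complex_of_real (1 - (cmod z)\<^sup>2) / (1 - u * cnj z)"
    using n by (simp add: mobius_def field_simps complex_norm_square[unfolded of_real_power])
  then show ?thesis
    unfolding mobius_def[of z "mobius z u"] one_minus_mobius_cnj[OF assms]
    using n one_minus_cmod_nz[OF assms(1)] by simp
qed

lemma mobius_self [simp]: "mobius z z = 0" and mobius_0 [simp]: "mobius z 0 = z"
  by (simp_all add: mobius_def)

lemma DERIV_mobius:
  assumes "cmod z < 1" "cmod u < 1"
  shows "(mobius z has_field_derivative - complex_of_real (1 - (cmod z)\<^sup>2) / (1 - u * cnj z)\<^sup>2) (at u)"
proof -
  have "((\<lambda>u. (z - u) / (1 - u * cnj z)) has_field_derivative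
      ((- 1) * (1 - u * cnj z) - (z - u) * (- cnj z)) / ((1 - u * cnj z) * (1 - u * cnj z))) (at u)"
    by (rule DERIV_divide) (use den_nz[OF assms] in \<open>auto intro!: derivative_eq_intros\<close>)
  moreover have "(- 1) * (1 - u * cnj z) - (z - u) * (- cnj z) = - complex_of_real (1 - (cmod z)\<^sup>2)"
    by (simp add: complex_norm_square[unfolded of_real_power] algebra_simps)
  ultimately show ?thesis
    unfolding mobius_def[abs_def] power2_eq_square[of "1 - u * cnj z"] by metis
qed

text \<open>Invariance of the pseudohyperbolic distance: the involution multiplies numerator and
  denominator by \<open>q / (a * b)\<close> and \<open>q / (b * cnj a)\<close>, which have equal
  modulus.\<close>

lemma cmod_mobius_comp:
  assumes "cmod x < 1" "cmod y < 1" "cmod z < 1"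
  shows "cmod (mobius (mobius y x) (mobius y z)) = cmod (mobius x z)"
proof -
  define a where "a = 1 - x * cnj y"
  define b where "b = 1 - z * cnj y"
  define q where "q = complex_of_real (1 - (cmod y)\<^sup>2)"
  have nz: "a \<noteq> 0" "b \<noteq> 0" "cnj a \<noteq> 0" "q \<noteq> 0" "1 - z * cnj x \<noteq> 0"
    using den_nz[of y x] den_nz[of y z] den_nz[of x z] one_minus_cmod_nz[of y] assms
    unfolding a_def b_def q_def by (auto simp del: complex_cnj_diff)
  have qy: "q = 1 - y * cnj y" by (simp add: q_def complex_norm_square[unfolded of_real_power])
  have num: "mobius y x - mobius y z = (z - x) * q / (a * b)"
    using nz unfolding mobius_def a_def[symmetric] b_def[symmetric]
    by (simp add: field_simps) (simp add: a_def b_def qy algebra_simps)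
  have den: "1 - mobius y z * cnj (mobius y x) = (1 - z * cnj x) * q / (b * cnj a)"
    using nz unfolding mobius_def complex_cnj_divide a_def[symmetric] b_def[symmetric]
    by (simp add: field_simps) (simp add: a_def b_def qy algebra_simps)
  have "cmod (mobius (mobius y x) (mobius y z)) = cmod ((z - x) * q / (a * b)) / cmod ((1 - z * cnj x) * q / (b * cnj a))"
    unfolding mobius_def[of "mobius y x"] num den norm_divide ..
  also have "\<dots> = cmod (z - x) / cmod (1 - z * cnj x)"
    using nz by (simp add: norm_divide norm_mult del: complex_cnj_diff)
  finally show ?thesis by (simp add: mobius_def norm_divide norm_minus_commute)
qed

lemma one_minus_cmod_mobius_ge:
  assumes "cmod x < 1" "cmod y < 1"
  shows "(1 - (cmod x)\<^sup>2) * (1 - (cmod y)\<^sup>2) / 4 \<le> 1 - (cmod (mobius x y))\<^sup>2"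
proof -
  have "cmod (1 - y * cnj x) \<le> 1 + cmod y * cmod x"
    using norm_triangle_ineq4[of 1 "y * cnj x"] by (simp add: norm_mult)
  also have "\<dots> \<le> 2" using assms mult_mono[of "cmod y" 1 "cmod x" 1] by simp
  finally have "(cmod (1 - y * cnj x))\<^sup>2 \<le> 2\<^sup>2" by (intro power_mono) auto
  moreover have "0 < (cmod (1 - y * cnj x))\<^sup>2" using den_nz[OF assms] by simp
  moreover have "0 \<le> (1 - (cmod x)\<^sup>2) * (1 - (cmod y)\<^sup>2)"
    using assms by (auto intro!: mult_nonneg_nonneg simp: power_le_one)
  ultimately show ?thesis
    unfolding one_minus_cmod_mobius[OF assms] by (intro divide_left_mono) auto
qed

text \<open>By invariance \<open>y\<close> is moved to the origin, where the denominator is at most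
  2. The bound is crude for small radii, but it keeps the distance of \<open>x\<close> and
  \<open>z\<close> away from 1 in terms of \<open>r\<close> and \<open>s\<close> alone.\<close>

lemma mobius_triangle_ge:
  assumes "cmod x < 1" "cmod y < 1" "cmod z < 1"
    and "cmod (mobius x y) \<le> r" "cmod (mobius y z) \<le> s" "r < 1" "s < 1"
  shows "(1 - r\<^sup>2) * (1 - s\<^sup>2) / 4 \<le> 1 - (cmod (mobius x z))\<^sup>2"
proof -
  have r: "(cmod (mobius y x))\<^sup>2 \<le> r\<^sup>2" "(cmod (mobius y z))\<^sup>2 \<le> s\<^sup>2"
    using assms by (auto intro!: power_mono simp: cmod_mobius_commute[of x y])
  have "0 \<le> r" "0 \<le> s" using assms norm_ge_zero order_trans by blast+
  then have "r\<^sup>2 \<le> 1" "s\<^sup>2 \<le> 1" using assms by (auto simp: power_le_one)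
  then have "(1 - r\<^sup>2) * (1 - s\<^sup>2) / 4 \<le> (1 - (cmod (mobius y x))\<^sup>2) * (1 - (cmod (mobius y z))\<^sup>2) / 4"
    using r by (intro divide_right_mono mult_mono) auto
  also have "\<dots> \<le> 1 - (cmod (mobius (mobius y x) (mobius y z)))\<^sup>2"
    using assms by (intro one_minus_cmod_mobius_ge cmod_mobius_lt_1) auto
  finally show ?thesis using assms by (simp add: cmod_mobius_comp)
qed

text \<open>The sharp form of the triangle inequality, with \<open>y\<close> again moved to the
  origin. Unlike \<open>mobius_triangle_ge\<close> it yields a small radius from small radii, which
  the construction of fine nets relies on.\<close>

lemma mobius_triangle_le:
  assumes "cmod x < 1" "cmod y < 1" "cmod z < 1"
    and "cmod (mobius x y) \<le> r" "cmod (mobius y z) \<le> s" "r < 1" "s < 1"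
  shows "cmod (mobius x z) \<le> (r + s) / (1 - r * s)"
proof -
  define p q where "p = mobius y x" and "q = mobius y z"
  have pq: "cmod p \<le> r" "cmod q \<le> s" using assms by (auto simp: p_def q_def cmod_mobius_commute[of x y])
  have 0: "0 \<le> r" "0 \<le> s" using assms norm_ge_zero order_trans by blast+
  then have "r * s < 1" using assms mult_strict_mono[of r 1 s 1] by (cases "s = 0") auto
  moreover have "cmod (p - q) \<le> r + s" using norm_triangle_ineq4[of p q] pq by simp
  moreover have "1 - r * s \<le> cmod (1 - q * cnj p)"
    using norm_triangle_ineq2[of 1 "q * cnj p"] mult_mono[of "cmod p" r "cmod q" s] pq 0
    by (simp add: norm_mult mult.commute)
  ultimately have "cmod (mobius p q) \<le> (r + s) / (1 - r * s)"
    unfolding mobius_def norm_divide using 0 by (intro frac_le) auto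
  then show ?thesis using assms by (simp add: p_def q_def cmod_mobius_comp)
qed

lemma measurable_mobius [measurable (raw)]:
  assumes "f \<in> borel_measurable M" "g \<in> borel_measurable M"
  shows "(\<lambda>x. mobius (f x) (g x)) \<in> borel_measurable M"
proof -
  have "(\<lambda>x. cnj (f x)) \<in> borel_measurable M"
    by (rule borel_measurable_continuous_on[OF _ assms(1)]) (intro continuous_intros)
  then show ?thesis using assms unfolding mobius_def by measurable
qed

section \<open>The automorphisms of the polydisc\<close>

definition mob :: "complex ^ 'n \<Rightarrow> complex ^ 'n \<Rightarrow> complex ^ 'n" where
  "mob z u = (\<chi> i. mobius (z $ i) (u $ i))"

text \<open>The formula of the normalized reproducing kernel without the cut-off outside the
  polydisc. Up to the sign (-1)^n it is also the complex Jacobian of \<open>mob z\<close> at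
  \<open>u\<close>; this double role makes \<open>mobU\<close> isometric.\<close>

definition kf :: "complex ^ 'n \<Rightarrow> complex ^ 'n \<Rightarrow> complex" where
  "kf z u = (\<Prod>i\<in>UNIV. complex_of_real (1 - (cmod (z $ i))\<^sup>2) / (1 - u $ i * cnj (z $ i))\<^sup>2)"

text \<open>For \<open>z\<close> in the polydisc, the reciprocal of the norm of the unnormalized
  reproducing kernel at \<open>z\<close>.\<close>

definition om :: "complex ^ 'n \<Rightarrow> real" where
  "om z = (\<Prod>i\<in>UNIV. 1 - (cmod (z $ i))\<^sup>2)"

text \<open>Distances between points are expressed through this set:
  \<open>mob z u \<in> pd r\<close> says that every coordinate of \<open>z\<close> and
  \<open>u\<close> is at pseudohyperbolic distance at most \<open>r\<close>.\<close>

definition pd :: "real \<Rightarrow> (complex ^ 'n) set" where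
  "pd r = {u. \<forall>i. cmod (u $ i) \<le> r}"

lemma mob_nth [simp]: "mob z u $ i = mobius (z $ i) (u $ i)"
  by (simp add: mob_def)

lemma polydiscD: "z \<in> polydisc \<Longrightarrow> cmod (z $ i) < 1"
  by (simp add: polydisc_def)

lemma mob_in_polydisc [simp]: "z \<in> polydisc \<Longrightarrow> u \<in> polydisc \<Longrightarrow> mob z u \<in> polydisc"
  by (simp add: polydisc_def cmod_mobius_lt_1)

lemma mob_mob [simp]: "z \<in> polydisc \<Longrightarrow> u \<in> polydisc \<Longrightarrow> mob z (mob z u) = u"
  by (simp add: vec_eq_iff mobius_mobius polydiscD)

lemma mob_self [simp]: "mob z z = 0" and mob_0 [simp]: "mob z 0 = z"
  by (simp_all add: vec_eq_iff)

lemma one_minus_sq_pos: "cmod z < 1 \<Longrightarrow> 0 < 1 - (cmod z)\<^sup>2"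
  by (simp add: abs_square_less_1)

lemma om_pos: "z \<in> polydisc \<Longrightarrow> 0 < om z"
  unfolding om_def by (intro prod_pos ballI one_minus_sq_pos polydiscD)

lemma om_le_1: "z \<in> polydisc \<Longrightarrow> om z \<le> 1"
  unfolding om_def using one_minus_sq_pos[OF polydiscD] by (intro prod_le_1) (auto intro!: less_imp_le)

lemma kf_0 [simp]: "kf z 0 = om z"
  by (simp add: kf_def om_def)

lemma kf_nz: "z \<in> polydisc \<Longrightarrow> u \<in> polydisc \<Longrightarrow> kf z u \<noteq> 0"
  unfolding kf_def prod_zero_iff[OF finite]
  using one_minus_cmod_nz[OF polydiscD[of z]] den_nz[OF polydiscD[of z] polydiscD[of u]] by (simp del: of_real_diff)

text \<open>The chain rule for the involution \<open>mob z\<close>; the two signs cancel.\<close>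

lemma kf_mob:
  assumes "z \<in> polydisc" "u \<in> polydisc"
  shows "kf z (mob z u) * kf z u = 1"
  unfolding kf_def prod.distrib[symmetric]
proof (intro prod.neutral ballI)
  fix i
  note d = polydiscD[OF assms(1), of i] polydiscD[OF assms(2), of i]
  show "complex_of_real (1 - (cmod (z $ i))\<^sup>2) / (1 - mob z u $ i * cnj (z $ i))\<^sup>2 *
      (complex_of_real (1 - (cmod (z $ i))\<^sup>2) / (1 - u $ i * cnj (z $ i))\<^sup>2) = 1"
    unfolding mob_nth one_minus_mobius_cnj[OF d]
    using den_nz[OF d] one_minus_cmod_nz[OF d(1)] by (simp add: power2_eq_square del: of_real_diff)
qed

text \<open>The product over the coordinates of the Schwarz-Pick identity
  \<open>one_minus_cmod_mobius\<close>. It is the reason why dividing the volume by the square of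
  \<open>om\<close> gives an invariant measure.\<close>

lemma om_mob:
  assumes "z \<in> polydisc" "u \<in> polydisc"
  shows "om (mob z u) = om u * cmod (kf z u)"
  unfolding om_def kf_def prod_norm[symmetric] prod.distrib[symmetric]
proof (intro prod.cong refl)
  fix i
  note d = polydiscD[OF assms(1), of i] polydiscD[OF assms(2), of i]
  show "1 - (cmod (mob z u $ i))\<^sup>2 = (1 - (cmod (u $ i))\<^sup>2) *
         cmod (complex_of_real (1 - (cmod (z $ i))\<^sup>2) / (1 - u $ i * cnj (z $ i))\<^sup>2)"
    unfolding mob_nth one_minus_cmod_mobius[OF d] norm_divide norm_of_real norm_power
    using one_minus_sq_pos[OF d(1)] by simp
qed

lemma pd_subset: "r < 1 \<Longrightarrow> pd r \<subseteq> polydisc"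
  by (auto simp: pd_def polydisc_def intro: le_less_trans)

lemma pd_mono: "r \<le> s \<Longrightarrow> pd r \<subseteq> pd s"
  by (auto simp: pd_def intro: order_trans)

lemma mob_pd_commute: "mob z u \<in> pd r \<longleftrightarrow> mob u z \<in> pd r"
  by (simp add: pd_def cmod_mobius_commute)

text \<open>The point is uniformity: \<open>t\<close> solves the equality case of
  \<open>mobius_triangle_ge\<close> and depends on \<open>r\<close> and \<open>s\<close> only, not
  on the three points.\<close>

lemma mob_pd_triangle:
  assumes "0 \<le> r" "r < 1" "0 \<le> s" "s < 1"
  obtains t where "0 \<le> t" "t < 1"
    "\<And>x y z :: complex ^ 'n. x \<in> polydisc \<Longrightarrow> y \<in> polydisc \<Longrightarrow> z \<in> polydisc \<Longrightarrow>
       mob x y \<in> pd r \<Longrightarrow> mob y z \<in> pd s \<Longrightarrow> mob x z \<in> pd t"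
proof
  define t where "t = sqrt (1 - (1 - r\<^sup>2) * (1 - s\<^sup>2) / 4)"
  have rs: "0 < (1 - r\<^sup>2) * (1 - s\<^sup>2)" "(1 - r\<^sup>2) * (1 - s\<^sup>2) \<le> 1"
    using assms by (auto intro!: mult_pos_pos mult_le_one simp: power_le_one power_less_one_iff abs_square_less_1)
  then show "0 \<le> t" "t < 1" by (auto simp: t_def)
  fix x y z :: "complex ^ 'n"
  assume *: "x \<in> polydisc" "y \<in> polydisc" "z \<in> polydisc" "mob x y \<in> pd r" "mob y z \<in> pd s"
  show "mob x z \<in> pd t"
    unfolding pd_def
  proof safe
    fix i
    have "(1 - r\<^sup>2) * (1 - s\<^sup>2) / 4 \<le> 1 - (cmod (mobius (x $ i) (z $ i)))\<^sup>2"
      using * assms by (intro mobius_triangle_ge[of _ "y $ i"]) (auto simp: polydiscD pd_def)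
    then show "cmod (mob x z $ i) \<le> t"
      unfolding t_def by (intro real_le_rsqrt) simp
  qed
qed

text \<open>The triangle with the origin in the middle: \<open>mob x 0\<close> is \<open>x\<close>
  and \<open>mob 0 y\<close> is \<open>- y\<close>.\<close>

lemma mob_pd_pd:
  assumes "0 \<le> r" "r < 1" "0 \<le> s" "s < 1"
  obtains t where "0 \<le> t" "t < 1"
    "\<And>x y :: complex ^ 'n. x \<in> pd r \<Longrightarrow> y \<in> pd s \<Longrightarrow> mob x y \<in> pd t"
proof -
  obtain t where t: "0 \<le> t" "t < 1"
    "\<And>x y z :: complex ^ 'n. x \<in> polydisc \<Longrightarrow> y \<in> polydisc \<Longrightarrow> z \<in> polydisc \<Longrightarrow>
       mob x y \<in> pd r \<Longrightarrow> mob y z \<in> pd s \<Longrightarrow> mob x z \<in> pd t"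
    using mob_pd_triangle[OF assms] by metis
  have "mob x y \<in> pd t" if "x \<in> pd r" "y \<in> pd s" for x y :: "complex ^ 'n"
    using t(3)[of x 0 y] that pd_subset[of r] pd_subset[of s] assms zero_in_polydisc
    by (auto simp: pd_def mobius_def)
  with t that show ?thesis by blast
qed

lemma measurable_mob [measurable (raw)]:
  assumes "f \<in> borel_measurable M" "g \<in> borel_measurable M"
  shows "(\<lambda>x. mob (f x) (g x)) \<in> borel_measurable M"
  unfolding mob_def using assms by measurable

lemma measurable_om [measurable]: "om \<in> borel_measurable borel"
  unfolding om_def[abs_def] by measurable

lemma measurable_kf [measurable (raw)]:
  assumes "f \<in> borel_measurable M" "g \<in> borel_measurable M"
  shows "(\<lambda>x. kf (f x) (g x)) \<in> borel_measurable M"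
proof -
  have [measurable]: "(\<lambda>x. f x $ i) \<in> borel_measurable M" "(\<lambda>x. g x $ i) \<in> borel_measurable M" for i
    using assms by measurable
  have [measurable]: "(\<lambda>x. cnj (f x $ i)) \<in> borel_measurable M" for i
    by (rule borel_measurable_continuous_on[of cnj]) (auto intro!: continuous_intros)
  show ?thesis
    unfolding kf_def by measurable
qed

lemma closed_pd: "closed (pd r :: (complex ^ 'n) set)"
proof -
  have "(pd r :: (complex ^ 'n) set) = (\<Inter>i. {u. cmod (u $ i) \<le> r})"
    by (auto simp: pd_def)
  moreover have "closed {u :: complex ^ 'n. cmod (u $ i) \<le> r}" for i
    by (intro closed_Collect_le continuous_intros)
  ultimately show ?thesis by (metis closed_INT UNIV_I)
qed

lemma pd_borel [measurable]: "(pd r :: (complex ^ 'n) set) \<in> sets borel"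
  by (simp add: closed_pd borel_closed)

lemma mobius_image_disc: "cmod z < 1 \<Longrightarrow> mobius z ` ball 0 1 = ball 0 1"
  by (auto simp: cmod_mobius_lt_1 image_iff) (metis cmod_mobius_lt_1 dist_0_norm mem_ball mobius_mobius)

lemma dvb_mob_distr:
  assumes z: "z \<in> polydisc"
  shows "distr (density dvb (\<lambda>u. ennreal ((cmod (kf z u))\<^sup>2))) borel (mob z) = dvb"
proof -
  define g' where "g' i u = - complex_of_real (1 - (cmod (z $ i))\<^sup>2) / (1 - u * cnj (z $ i))\<^sup>2" for i u
  have [measurable]: "g' i \<in> borel_measurable borel" for i
    unfolding g'_def[abs_def] by measurable
  have [measurable]: "mobius (z $ i) \<in> borel_measurable borel" for i
    by measurable
  have inv: "(\<integral>\<^sup>+u. f (mobius (z $ i) u) * ennreal ((cmod (g' i u))\<^sup>2) \<partial>dv1) = (\<integral>\<^sup>+u. f u \<partial>dv1)"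
    if [measurable]: "f \<in> borel_measurable borel" for i and f :: "complex \<Rightarrow> ennreal"
  proof (rule nn_integral_dv1_transform)
    show "mobius (z $ i) ` ball 0 1 = ball 0 1"
      using z by (simp add: mobius_image_disc polydiscD)
    show "inj_on (mobius (z $ i)) (ball 0 1)"
      by (rule inj_on_inverseI[of _ "mobius (z $ i)"]) (use z in \<open>auto simp: mobius_mobius polydiscD\<close>)
    show "(mobius (z $ i) has_field_derivative g' i u) (at u)" if "u \<in> ball 0 1" for u
      unfolding g'_def using that z by (intro DERIV_mobius) (auto simp: polydiscD)
  qed auto
  have "(\<Prod>i\<in>UNIV. ennreal ((cmod (g' i (u $ i)))\<^sup>2)) = ennreal ((cmod (kf z u))\<^sup>2)" for u
    by (subst prod_ennreal)
      (auto simp: kf_def g'_def prod_norm[symmetric] norm_divide prod_power_distrib norm_minus_commute)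
  then show ?thesis
    using dvb_transform[of "\<lambda>i. mobius (z $ i)" "\<lambda>i u. ennreal ((cmod (g' i u))\<^sup>2)", OF _ _ inv]
    by (simp add: mob_def[abs_def])
qed

lemma nn_integral_dvb_mob:
  assumes "z \<in> polydisc" and [measurable]: "F \<in> borel_measurable borel"
  shows "(\<integral>\<^sup>+u. F (mob z u) * ennreal ((cmod (kf z u))\<^sup>2) \<partial>dvb) = (\<integral>\<^sup>+u. F u \<partial>dvb)"
  by (subst (2) dvb_mob_distr[OF assms(1), symmetric])
    (simp add: nn_integral_distr nn_integral_density mult.commute)

lemma integral_dvb_mob:
  fixes F :: "complex ^ 'n \<Rightarrow> complex"
  assumes "z \<in> polydisc" and [measurable]: "F \<in> borel_measurable borel"
  shows "(\<integral>u. F (mob z u) * (cmod (kf z u))\<^sup>2 \<partial>dvb) = (\<integral>u. F u \<partial>dvb)"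
    and "integrable dvb (\<lambda>u. F (mob z u) * (cmod (kf z u))\<^sup>2) \<longleftrightarrow> integrable dvb F"
proof -
  show "(\<integral>u. F (mob z u) * (cmod (kf z u))\<^sup>2 \<partial>dvb) = (\<integral>u. F u \<partial>dvb)"
    by (subst (2) dvb_mob_distr[OF assms(1), symmetric])
      (simp add: integral_distr integral_density scaleR_conv_of_real mult.commute)
  show "integrable dvb (\<lambda>u. F (mob z u) * (cmod (kf z u))\<^sup>2) \<longleftrightarrow> integrable dvb F"
    by (subst (2) dvb_mob_distr[OF assms(1), symmetric])
      (simp add: integrable_distr_eq integrable_density scaleR_conv_of_real mult.commute)
qed

section \<open>Rotation invariance of the normalized measures\<close>

lemma dv1_rotate:
  assumes c: "cmod c = 1" and [measurable]: "f \<in> borel_measurable borel"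
  shows "(\<integral>\<^sup>+u. f (c * u) \<partial>dv1) = (\<integral>\<^sup>+u. f u \<partial>dv1)"
proof -
  have c0: "c \<noteq> 0" using c by auto
  have "(\<integral>\<^sup>+u. f (c * u) * ennreal ((cmod c)\<^sup>2) \<partial>dv1) = (\<integral>\<^sup>+u. f u \<partial>dv1)"
  proof (rule nn_integral_dv1_transform)
    show "(*) c ` ball 0 1 = ball 0 1"
    proof safe
      fix x :: complex assume "x \<in> ball 0 1"
      then have "x = c * (x / c)" "x / c \<in> ball 0 1" using c c0 by (auto simp: norm_divide)
      then show "x \<in> (*) c ` ball 0 1" by blast
    qed (use c in \<open>auto simp: norm_mult\<close>)
  qed (use c0 in \<open>auto simp: inj_on_def intro!: derivative_eq_intros\<close>)
  then show ?thesis using c by simp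
qed

lemma dv1_rotate_distr: "cmod c = 1 \<Longrightarrow> distr dv1 borel ((*) c) = dv1"
  using dv1_rotate[of c "indicator A" for A]
  by (intro measure_eqI) (simp_all add: nn_integral_indicator[symmetric] nn_integral_distr del: nn_integral_indicator)

lemma measurable_vec_scale [measurable (raw)]:
  fixes g :: "'a \<Rightarrow> complex ^ 'n"
  assumes "f \<in> borel_measurable M" "g \<in> borel_measurable M"
  shows "(\<lambda>x. f x *s g x) \<in> borel_measurable M"
  unfolding vector_scalar_mult_def using assms by measurable

lemma dvb_rotate_distr:
  assumes c: "cmod c = 1"
  shows "distr dvb borel ((*s) c) = (dvb :: (complex ^ 'n) measure)"
proof -
  have "distr (density dvb (\<lambda>u. \<Prod>i\<in>(UNIV :: 'n set). 1)) borel (\<lambda>u. \<chi> i. c * u $ i) = (dvb :: (complex ^ 'n) measure)"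
    by (rule dvb_transform) (auto simp: dv1_rotate[OF c])
  moreover have "density dvb (\<lambda>u. 1) = (dvb :: (complex ^ 'n) measure)" by (rule density_1)
  ultimately show ?thesis
    by (simp add: vector_scalar_mult_def[abs_def])
qed

section \<open>Mean values\<close>

text \<open>Cauchy's formula at the centre, with the circle parametrized by [0, 1] and the contour
  integral rewritten as a Lebesgue integral so that Fubini applies to it.\<close>

lemma circle_mean_value:
  fixes f :: "complex \<Rightarrow> complex"
  assumes "f holomorphic_on cball 0 1"
  shows "integrable (restrict_space lborel {0..1}) (\<lambda>t. f (exp (2 * of_real pi * \<i> * of_real t)))"
    and "(\<integral>t. f (exp (2 * of_real pi * \<i> * of_real t)) \<partial>(restrict_space lborel {0..1::real})) = f 0"
proof -
  define e where "e t = exp (2 * of_real pi * \<i> * of_real t)" for t :: real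
  have "((\<lambda>u. f u / (u - 0)) has_contour_integral (2 * of_real pi * \<i> * f 0)) (circlepath 0 1)"
    by (rule Cauchy_integral_circlepath_simple) (use assms in auto)
  then have "((\<lambda>t. f (e t) / e t * (2 * pi * \<i> * e t)) has_integral 2 * of_real pi * \<i> * f 0) {0..1}"
    unfolding has_contour_integral vector_derivative_circlepath
    by (simp add: circlepath e_def)
  moreover have "f (e t) / e t * (2 * pi * \<i> * e t) = (2 * pi * \<i>) * f (e t)" for t
    by (simp add: e_def)
  ultimately have "((\<lambda>t. (2 * pi * \<i>) * f (e t)) has_integral (2 * of_real pi * \<i>) * f 0) {0..1}"
    by simp
  then have "((\<lambda>t. inverse (2 * pi * \<i>) * ((2 * pi * \<i>) * f (e t))) has_integral inverse (2 * pi * \<i>) * ((2 * of_real pi * \<i>) * f 0)) {0..1}"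
    by (rule has_integral_mult_right)
  moreover have k: "inverse k * (k * x) = x" if "k \<noteq> 0" for k x :: complex
    using that by simp
  have "2 * complex_of_real pi * \<i> \<noteq> 0" by simp
  note k[OF this]
  ultimately have hi: "((\<lambda>t. f (e t)) has_integral f 0) {0..1}"
    by (simp only: of_real_mult of_real_numeral)
  have ne: "cmod (e t) = 1" for t by (simp add: e_def)
  have "continuous_on {0..1} (\<lambda>t. f (e t))"
  proof (rule continuous_on_compose2[OF holomorphic_on_imp_continuous_on[OF assms]])
    show "continuous_on {0..1} e"
      unfolding e_def[abs_def] by (intro continuous_intros)
  qed (auto simp: ne)
  then have si: "set_integrable lborel {0..1} (\<lambda>t. f (e t))"
    by (rule borel_integrable_atLeastAtMost')
  then show "integrable (restrict_space lborel {0..1}) (\<lambda>t. f (exp (2 * of_real pi * \<i> * of_real t)))"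
    unfolding e_def set_integrable_def by (subst integrable_restrict_space) auto
  have "(\<integral>t. f (e t) \<partial>(restrict_space lborel {0..1::real})) = (LINT t:{0..1}|lborel. f (e t))"
    unfolding set_lebesgue_integral_def by (rule integral_restrict_space) auto
  also have "\<dots> = f 0"
    using set_borel_integral_eq_integral(2)[OF si] hi by (simp add: integral_unique)
  finally show "(\<integral>t. f (exp (2 * of_real pi * \<i> * of_real t)) \<partial>(restrict_space lborel {0..1::real})) = f 0"
    by (simp add: e_def)
qed

text \<open>All rotated copies of \<open>F\<close> have the same integral, so \<open>F\<close> may
  be replaced by its mean along the orbits once the integrals are exchanged. The action
  \<open>R\<close> is abstract because both the polydisc and the disc with a radial weight are
  treated this way.\<close>

lemma rotation_mean_value:
  fixes F F0 :: "'a \<Rightarrow> complex" and R :: "complex \<Rightarrow> 'a \<Rightarrow> 'a"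
  assumes "sigma_finite_measure M" and F: "integrable M F"
    and inv: "\<And>c. cmod c = 1 \<Longrightarrow> distr M M (R c) = M"
    and meas [measurable]: "(\<lambda>(c, w). R c w) \<in> borel \<Otimes>\<^sub>M M \<rightarrow>\<^sub>M M"
    and avg: "\<And>w. w \<in> space M \<Longrightarrow>
       (\<integral>t. F (R (exp (2 * of_real pi * \<i> * of_real t)) w) \<partial>(restrict_space lborel {0..1::real})) = F0 w"
  shows "(\<integral>w. F w \<partial>M) = (\<integral>w. F0 w \<partial>M)"
proof -
  define U where "U = restrict_space lborel {0..1::real}"
  have U1: "emeasure U (space U) = 1"
    by (simp add: U_def emeasure_restrict_space space_restrict_space)
  interpret M: sigma_finite_measure M by fact
  interpret U: finite_measure U by (rule finite_measureI) (simp add: U1)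
  interpret UM: pair_sigma_finite U M ..
  define e where "e t = exp (2 * of_real pi * \<i> * of_real t)" for t :: real
  have ne: "cmod (e t) = 1" for t by (simp add: e_def)
  have [measurable]: "e \<in> borel_measurable U"
    unfolding U_def e_def[abs_def]
    by (intro measurable_restrict_space1)
      (simp add: borel_measurable_continuous_onI continuous_intros)
  have [measurable]: "F \<in> borel_measurable M" using F by auto
  have Rm: "R c \<in> M \<rightarrow>\<^sub>M M" for c
    using measurable_compose[OF measurable_Pair1' meas, of c] by simp
  have m2 [measurable]: "(\<lambda>(t, w). F (R (e t) w)) \<in> borel_measurable (U \<Otimes>\<^sub>M M)"
    by measurable
  have i1: "integrable M (\<lambda>w. F (R (e t) w))" for t
    using F inv[OF ne, of t] integrable_distr_eq[OF Rm, of F "e t"] by auto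
  \<comment> \<open>Invariance makes the norm independent of t as well, and on the finite interval
    this gives integrability on the product.\<close>
  have "(\<integral>w. norm (F (R (e t) w)) \<partial>M) = (\<integral>w. norm (F w) \<partial>M)" for t
    using inv[OF ne, of t] integral_distr[OF Rm, of "\<lambda>w. norm (F w)" "e t"] by auto
  then have "integrable (U \<Otimes>\<^sub>M M) (\<lambda>(t, w). F (R (e t) w))"
    by (intro UM.Fubini_integrable) (auto simp: i1)
  then have "(\<integral>w. (\<integral>t. F (R (e t) w) \<partial>U) \<partial>M) = (\<integral>t. (\<integral>w. F (R (e t) w) \<partial>M) \<partial>U)"
    by (rule UM.Fubini_integral)
  also have "\<dots> = (\<integral>t. (\<integral>w. F w \<partial>M) \<partial>U)"
  proof (rule Bochner_Integration.integral_cong[OF refl])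
    fix t show "(\<integral>w. F (R (e t) w) \<partial>M) = (\<integral>w. F w \<partial>M)"
      using inv[OF ne, of t] integral_distr[OF Rm, of F "e t"] by auto
  qed
  also have "(\<integral>t. (\<integral>w. F w \<partial>M) \<partial>U) = (\<integral>w. F w \<partial>M)"
    using U1 by (simp add: measure_def)
  finally show ?thesis
    using avg by (simp add: U_def e_def cong: Bochner_Integration.integral_cong)
qed

section \<open>Elements of the Bergman space\<close>

lemma borel_measurable_evalI:
  assumes "continuous_on polydisc f" "\<And>z. z \<notin> polydisc \<Longrightarrow> f z = (0::complex)"
  shows "f \<in> borel_measurable (borel :: (complex ^ 'n) measure)"
proof -
  have "(\<lambda>z. indicator polydisc z *\<^sub>R f z) \<in> borel_measurable borel"
    by (rule borel_measurable_continuous_on_indicator) (simp_all add: assms)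
  moreover have "(\<lambda>z. indicator polydisc z *\<^sub>R f z) = f"
    using assms(2) by (auto simp: indicator_def)
  ultimately show ?thesis by simp
qed

lemma measurable_eval [measurable (raw)]:
  "g \<in> borel_measurable M \<Longrightarrow> (\<lambda>x. eval h (g x)) \<in> borel_measurable M"
  by (rule measurable_compose[of g M borel "eval h"])
    (auto intro!: borel_measurable_evalI analytic_vec_continuous_on eval_analytic eval_outside)

lemma measurable_cnj [measurable (raw)]:
  "f \<in> borel_measurable M \<Longrightarrow> (\<lambda>x. cnj (f x)) \<in> borel_measurable M"
  by (rule borel_measurable_continuous_on[of cnj]) (auto intro!: continuous_intros)

lemma L2_borel_iff:
  assumes [measurable]: "f \<in> borel_measurable borel"
  shows "f \<in> L2 \<longleftrightarrow> integrable dvb (\<lambda>z. (cmod (f z))\<^sup>2)"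
proof -
  have "(\<lambda>z. (cmod (f z))\<^sup>2) \<in> borel_measurable borel"
    by measurable
  from integral_dv_eq(2)[OF this] show ?thesis
    unfolding L2_def using borel_imp_measurable_dv[OF assms] by blast
qed

lemma integrable_eval_sq: "integrable dvb (\<lambda>z. (cmod (eval h z))\<^sup>2)"
  using eval_L2[of h] L2_borel_iff[of "eval h"] by simp

lemma integrable_eval_cnj: "integrable dvb (\<lambda>z. eval h z * cnj (eval g z))"
  using L2_integrable_cnj[OF eval_L2 eval_L2, of h g] by (simp add: integral_dv_eq(2))

lemma cinner_dvb: "cinner f g = (\<integral>z. eval f z * cnj (eval g z) \<partial>dvb)"
  unfolding cinner_def by (rule integral_dv_eq) measurable

lemma norm_sq_dvb: "(norm h)\<^sup>2 = (\<integral>z. (cmod (eval h z))\<^sup>2 \<partial>dvb)"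
  unfolding norm_bergman_eq by (subst integral_dv_eq) (simp_all add: Bochner_Integration.integral_nonneg)

lemma nn_norm_sq: "(\<integral>\<^sup>+z. ennreal ((cmod (eval h z))\<^sup>2) \<partial>dvb) = ennreal ((norm h)\<^sup>2)"
  unfolding norm_sq_dvb by (rule nn_integral_eq_integral) (simp_all add: integrable_eval_sq)

lemma integrable_eval: "integrable dvb (eval h)"
proof (rule Bochner_Integration.integrable_bound)
  show "integrable dvb (\<lambda>z. 1 + (cmod (eval h z))\<^sup>2)"
    by (intro Bochner_Integration.integrable_add integrable_eval_sq) simp
  have "cmod (eval h z) \<le> norm (1 + (cmod (eval h z))\<^sup>2)" for z
    using sum_squares_bound[of 1 "cmod (eval h z)"] norm_ge_zero[of "eval h z"] by (simp del: norm_ge_zero)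
  then show "AE z in dvb. cmod (eval h z) \<le> norm (1 + (cmod (eval h z))\<^sup>2)" by simp
qed simp

lemma AE_dvb_polydisc: "AE z in dvb. z \<in> polydisc"
  unfolding dvb_uniform by (rule AE_uniform_measureI) auto

text \<open>Complex linearity of \<open>f'\<close> turns the derivative along the line into
  multiplication by the number \<open>f' v\<close>. Through this lemma one-variable function theory
  enters on complex lines.\<close>

lemma has_field_derivative_line:
  fixes z v :: "complex ^ 'n"
  assumes "(f has_derivative f') (at (z + l *s v))" "\<And>c v. f' (c *s v) = c * f' v"
  shows "((\<lambda>l. f (z + l *s v)) has_field_derivative f' v) (at l)"
proof -
  have "((\<lambda>l. l *s v) has_derivative (\<lambda>l. l *s v)) (at l)"
  proof (rule bounded_linear_imp_has_derivative)
    have "linear (\<lambda>l :: complex. l *s v)"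
    proof (rule linearI)
      show "(a + b) *s v = a *s v + b *s v" for a b :: complex
        by (simp add: vec_eq_iff distrib_right)
      show "(c *\<^sub>R a) *s v = c *\<^sub>R (a *s v)" for c and a :: complex
        by (simp add: vec_eq_iff)
    qed
    then show "bounded_linear (\<lambda>l :: complex. l *s v)" by (simp add: linear_conv_bounded_linear)
  qed
  then have "((\<lambda>l. z + l *s v) has_derivative (\<lambda>l. l *s v)) (at l)"
    by (auto intro!: derivative_eq_intros)
  from has_derivative_compose[OF this assms(1)]
  have "((\<lambda>l. f (z + l *s v)) has_derivative (\<lambda>l. l * f' v)) (at l)"
    unfolding assms(2) .
  moreover have "(*) (f' v) = (\<lambda>l. l * f' v)" by (rule ext) (rule mult.commute)
  ultimately show ?thesis unfolding has_field_derivative_def by simp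
qed

lemma holomorphic_on_line:
  fixes z v :: "complex ^ 'n"
  assumes "analytic_vec f S" "\<And>l. l \<in> A \<Longrightarrow> z + l *s v \<in> S"
  shows "(\<lambda>l. f (z + l *s v)) holomorphic_on A"
  unfolding holomorphic_on_def field_differentiable_def
  using assms has_field_derivative_line[of f _ z _ v] has_field_derivative_at_within
  unfolding analytic_vec_def by meson

lemma polydisc_scale: "z \<in> polydisc \<Longrightarrow> cmod c \<le> 1 \<Longrightarrow> c *s z \<in> polydisc"
  unfolding polydisc_def by (auto simp: norm_mult intro: le_less_trans[OF mult_left_le_one_le])

text \<open>One common phase rotates all coordinates. On the orbit of \<open>w\<close> the function
  is the restriction of a holomorphic function on the complex line through \<open>w\<close>, with
  mean \<open>f 0\<close>; invariance of \<open>S\<close> under common phases is enough to integrate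
  this over \<open>S\<close>.\<close>

lemma mean_value:
  fixes S :: "(complex ^ 'n) set"
  assumes f: "analytic_vec f polydisc" and S: "S \<subseteq> polydisc" "S \<in> sets borel"
    and int: "integrable dvb (\<lambda>w. indicator S w * f w)"
    and rot: "\<And>c w. cmod c = 1 \<Longrightarrow> c *s w \<in> S \<longleftrightarrow> w \<in> S"
  shows "(\<integral>w. indicator S w * f w \<partial>dvb) = f 0 * measure dvb S"
proof -
  have "(\<integral>w. indicator S w * f w \<partial>dvb) = (\<integral>w. indicator S w * f 0 \<partial>dvb)"
  proof (rule rotation_mean_value[where R = "(*s)"])
    fix w :: "complex ^ 'n"
    show "(\<integral>t. indicator S (exp (2 * of_real pi * \<i> * of_real t) *s w) * f (exp (2 * of_real pi * \<i> * of_real t) *s w)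
         \<partial>(restrict_space lborel {0..1::real})) = indicator S w * f 0"
    proof (cases "w \<in> S")
      case True
      have "(\<lambda>l. f (0 + l *s w)) holomorphic_on cball 0 1"
        using True S by (intro holomorphic_on_line[OF f] ) (auto intro: polydisc_scale)
      from circle_mean_value(2)[OF this] show ?thesis
        using True by (simp add: rot indicator_def)
    qed (simp add: rot indicator_def)
  qed (use int in \<open>auto simp: dvb_rotate_distr dvb.sigma_finite_measure_axioms cong: distr_cong\<close>)
  also have "(\<lambda>w. indicator S w * f 0) = (\<lambda>w. (indicator S w :: real) *\<^sub>R f 0)"
    by (rule ext) (simp split: split_indicator)
  also have "(\<integral>w. (indicator S w :: real) *\<^sub>R f 0 \<partial>dvb) = f 0 * measure dvb S"
  proof (subst integral_scaleR_left)
    show "integrable dvb (indicat_real S)"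
      using S by (intro integrable_real_indicator) (auto simp: dvb.emeasure_finite less_top[symmetric])
  qed (use S in \<open>simp add: scaleR_conv_of_real mult.commute\<close>)
  finally show ?thesis .
qed

lemma pd_rot: "cmod c = 1 \<Longrightarrow> c *s w \<in> pd r \<longleftrightarrow> w \<in> pd r"
  and polydisc_rot: "cmod c = 1 \<Longrightarrow> c *s w \<in> polydisc \<longleftrightarrow> w \<in> polydisc"
  by (auto simp: pd_def polydisc_def norm_mult)

lemma mean_value_polydisc: "(\<integral>w. eval h w \<partial>dvb) = eval h 0"
proof -
  have e: "(\<lambda>w. indicator polydisc w * eval h w) = eval h"
    by (rule ext) (auto simp: indicator_def eval_outside)
  have "measure dvb (polydisc :: (complex ^ 'a) set) = measure (dvb :: (complex ^ 'a) measure) UNIV"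
    by (rule measure_eq_AE) (use AE_dvb_polydisc in auto)
  then have "measure dvb (polydisc :: (complex ^ 'a) set) = 1"
    by (simp add: measure_def emeasure_dvb_UNIV)
  then show ?thesis
    using mean_value[OF eval_analytic, of polydisc h] e integrable_eval[of h]
    by (simp add: polydisc_rot)
qed

section \<open>The unitary action of the automorphisms\<close>

lemma has_derivative_vec_lambda:
  fixes f :: "'n::finite \<Rightarrow> 'a::real_normed_vector \<Rightarrow> 'b::euclidean_space"
  assumes "\<And>i. (f i has_derivative f' i) (at x)"
  shows "((\<lambda>x. \<chi> i. f i x) has_derivative (\<lambda>h. \<chi> i. f' i h)) (at x)"
proof (subst has_derivative_componentwise_within, intro ballI)
  fix b :: "'b ^ 'n" assume "b \<in> Basis"
  then obtain i c where "b = axis i c" "c \<in> Basis" by (auto simp: Basis_vec_def)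
  then show "((\<lambda>x. (\<chi> i. f i x) \<bullet> b) has_derivative (\<lambda>h. (\<chi> i. f' i h) \<bullet> b)) (at x)"
    using has_derivative_inner_left[OF assms[of i], of c] by (simp add: inner_axis)
qed

lemma analytic_vec_mob:
  fixes z :: "complex ^ 'n"
  assumes f: "analytic_vec f polydisc" and z: "z \<in> polydisc"
  shows "analytic_vec (\<lambda>u. f (mob z u)) polydisc"
  unfolding analytic_vec_def
proof
  fix u :: "complex ^ 'n" assume u: "u \<in> polydisc"
  define d where "d i = - complex_of_real (1 - (cmod (z $ i))\<^sup>2) / (1 - u $ i * cnj (z $ i))\<^sup>2" for i
  obtain f' where f': "(f has_derivative f') (at (mob z u))" "\<And>c v. f' (c *s v) = c * f' v"
    using f z u unfolding analytic_vec_def by (meson mob_in_polydisc)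
  have "(mob z has_derivative (\<lambda>h. \<chi> i. d i * h $ i)) (at u)"
    unfolding mob_def[abs_def]
  proof (rule has_derivative_vec_lambda)
    fix i
    have "(mobius (z $ i) has_derivative (*) (d i)) (at (u $ i))"
      using DERIV_mobius[of "z $ i" "u $ i"] z u by (simp add: polydiscD d_def has_field_derivative_def)
    moreover have "((\<lambda>u. u $ i) has_derivative (\<lambda>h. h $ i)) (at u)"
      by (rule bounded_linear_imp_has_derivative[OF bounded_linear_vec_nth])
    ultimately show "((\<lambda>u. mobius (z $ i) (u $ i)) has_derivative (\<lambda>h. d i * h $ i)) (at u)"
      using has_derivative_compose[of "\<lambda>u. u $ i" "\<lambda>h. h $ i" u UNIV "mobius (z $ i)" "(*) (d i)"] by simp
  qed
  from has_derivative_compose[OF this f'(1)]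
  have "((\<lambda>u. f (mob z u)) has_derivative (\<lambda>h. f' (\<chi> i. d i * h $ i))) (at u)" .
  moreover have "f' (\<chi> i. d i * (c *s v) $ i) = c * f' (\<chi> i. d i * v $ i)" for c v
    unfolding f'(2)[symmetric] by (rule arg_cong[where f = f']) (auto simp: vec_eq_iff)
  ultimately show "\<exists>f'. ((\<lambda>u. f (mob z u)) has_derivative f') (at u) \<and> (\<forall>c v. f' (c *s v) = c * f' v)"
    by blast
qed

text \<open>The weighted composition operator attached to \<open>mob z\<close>. Taking the
  multiplier from \<open>normalized_kernel\<close> makes the function vanish off the polydisc, and
  makes \<open>mobU z h\<close> zero for \<open>z\<close> outside, so that it is measurable in
  \<open>z\<close> on the whole space.\<close>

definition mobU :: "complex ^ 'n \<Rightarrow> 'n::finite bergman \<Rightarrow> 'n bergman" where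
  "mobU z h = Bergman (\<lambda>u. eval h (mob z u) * eval (normalized_kernel z) u)"

lemma eval_normalized_kernel_kf:
  "eval (normalized_kernel z) u = (if z \<in> polydisc \<and> u \<in> polydisc then kf z u else 0)"
  by (simp add: eval_normalized_kernel kf_def)

lemma eval_mobU: "eval (mobU z h) u = (if z \<in> polydisc \<and> u \<in> polydisc then eval h (mob z u) * kf z u else 0)"
proof -
  let ?f = "\<lambda>u. eval h (mob z u) * eval (normalized_kernel z) u"
  have "?f \<in> L2 \<and> analytic_vec ?f polydisc \<and> (\<forall>z. z \<notin> polydisc \<longrightarrow> ?f z = 0)"
  proof (cases "z \<in> polydisc")
    case True
    have "integrable dvb (\<lambda>u. complex_of_real ((cmod (eval h (mob z u)))\<^sup>2) * (cmod (kf z u))\<^sup>2)"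
      by (subst integral_dvb_mob(2)[OF True])
        (simp_all add: integrable_eval_sq del: of_real_power)
    then have "integrable dvb (\<lambda>u. cmod (complex_of_real ((cmod (eval h (mob z u)))\<^sup>2) * (cmod (kf z u))\<^sup>2))"
      by (rule Bochner_Integration.integrable_norm)
    then have "integrable dvb (\<lambda>u. (cmod (eval h (mob z u)))\<^sup>2 * (cmod (kf z u))\<^sup>2)"
      by (simp add: norm_mult norm_power)
    then have "integrable dvb (\<lambda>u. (cmod (?f u))\<^sup>2)"
      by (rule Bochner_Integration.integrable_bound)
        (auto simp: norm_mult power_mult_distrib eval_normalized_kernel_kf)
    then have "?f \<in> L2" by (subst L2_borel_iff) measurable
    then show ?thesis
      by (auto simp: eval_outside intro!: analytic_vec_mult analytic_vec_mob eval_analytic True)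
  next
    case False
    then have f0: "?f u = 0" for u by (simp add: eval_normalized_kernel_kf)
    then have eq: "?f = (\<lambda>_. 0)" by blast
    have "?f \<in> L2" unfolding eq by (simp add: L2_def)
    moreover have "analytic_vec ?f polydisc" unfolding eq by (rule analytic_vec_const)
    ultimately show ?thesis using f0 by blast
  qed
  then have "eval (mobU z h) u = ?f u"
    unfolding mobU_def by (subst Bergman_inverse) auto
  then show ?thesis by (simp add: eval_normalized_kernel_kf)
qed

lemma eval_mobU_0: "z \<in> polydisc \<Longrightarrow> eval (mobU z h) 0 = om z * eval h z"
  by (simp add: eval_mobU zero_in_polydisc)

text \<open>Change of variables x = \<open>mob z u\<close>: the Jacobian is absorbed by the two
  multipliers. For p = 1 this says that \<open>mobU z\<close> preserves inner products; in general
  it moves the symbol \<open>p\<close> from 0 to \<open>z\<close>.\<close>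

lemma integral_mobU_sesq:
  assumes z: "z \<in> polydisc" and [measurable]: "p \<in> borel_measurable borel"
  shows "(\<integral>u. p u * (eval (mobU z h) u * cnj (eval (mobU z g) u)) \<partial>dvb) =
    (\<integral>x. p (mob z x) * (eval h x * cnj (eval g x)) \<partial>dvb)"
proof -
  have "(\<integral>x. p (mob z x) * (eval h x * cnj (eval g x)) \<partial>dvb) =
    (\<integral>u. p (mob z (mob z u)) * (eval h (mob z u) * cnj (eval g (mob z u))) * (cmod (kf z u))\<^sup>2 \<partial>dvb)"
    by (rule integral_dvb_mob(1)[OF z, where F = "\<lambda>x. p (mob z x) * (eval h x * cnj (eval g x))", symmetric]) simp
  also have "\<dots> = (\<integral>u. p u * (eval (mobU z h) u * cnj (eval (mobU z g) u)) \<partial>dvb)"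
  proof (rule integral_cong_AE)
    show "AE u in dvb. p (mob z (mob z u)) * (eval h (mob z u) * cnj (eval g (mob z u))) * (cmod (kf z u))\<^sup>2
       = p u * (eval (mobU z h) u * cnj (eval (mobU z g) u))"
      using AE_dvb_polydisc
    proof eventually_elim
      case (elim u)
      then have e: "mob z (mob z u) = u" "eval (mobU z h) u = eval h (mob z u) * kf z u" for h
        using z by (simp_all add: eval_mobU)
      show ?case
        unfolding e complex_cnj_mult of_real_power[symmetric] complex_norm_square by (simp only: mult_ac)
    qed
  qed (simp_all add: eval_mobU[abs_def])
  finally show ?thesis ..
qed

lemma nn_integral_mobU:
  assumes z: "z \<in> polydisc" and [measurable]: "p \<in> borel_measurable borel"
  shows "(\<integral>\<^sup>+u. p u * ennreal ((cmod (eval (mobU z h) u))\<^sup>2) \<partial>dvb) =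
    (\<integral>\<^sup>+x. p (mob z x) * ennreal ((cmod (eval h x))\<^sup>2) \<partial>dvb)"
proof -
  have "(\<integral>\<^sup>+x. p (mob z x) * ennreal ((cmod (eval h x))\<^sup>2) \<partial>dvb) =
    (\<integral>\<^sup>+u. p (mob z (mob z u)) * ennreal ((cmod (eval h (mob z u)))\<^sup>2) * ennreal ((cmod (kf z u))\<^sup>2) \<partial>dvb)"
    by (rule nn_integral_dvb_mob[OF z, where F = "\<lambda>x. p (mob z x) * ennreal ((cmod (eval h x))\<^sup>2)", symmetric]) simp
  also have "\<dots> = (\<integral>\<^sup>+u. p u * ennreal ((cmod (eval (mobU z h) u))\<^sup>2) \<partial>dvb)"
  proof (rule nn_integral_cong_AE)
    show "AE u in dvb. p (mob z (mob z u)) * ennreal ((cmod (eval h (mob z u)))\<^sup>2) * ennreal ((cmod (kf z u))\<^sup>2)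
       = p u * ennreal ((cmod (eval (mobU z h) u))\<^sup>2)"
      using AE_dvb_polydisc
    proof eventually_elim
      case (elim u)
      then show ?case
        using z by (simp add: eval_mobU norm_mult power_mult_distrib ennreal_mult mult.assoc)
    qed
  qed
  finally show ?thesis ..
qed

text \<open>In the variable u with x = \<open>mob z u\<close>, the conjugate kernel at
  \<open>mob z u\<close> times the Jacobian leaves exactly one factor \<open>kf z u\<close>, by
  \<open>kf_mob\<close>. The left side is \<open>om z\<close> times the value at \<open>z\<close> of
  the projection of \<open>p h\<close>, so this expresses a Toeplitz operator at a point through
  \<open>mobU z h\<close>.\<close>

lemma integral_mobU_kernel:
  assumes z: "z \<in> polydisc" and [measurable]: "p \<in> borel_measurable borel"
  shows "(\<integral>x. p x * (eval h x * cnj (eval (normalized_kernel z) x)) \<partial>dvb) =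
    (\<integral>u. p (mob z u) * eval (mobU z h) u \<partial>dvb)"
proof -
  have "(\<integral>x. p x * (eval h x * cnj (eval (normalized_kernel z) x)) \<partial>dvb) =
    (\<integral>u. p (mob z u) * (eval h (mob z u) * cnj (eval (normalized_kernel z) (mob z u))) * (cmod (kf z u))\<^sup>2 \<partial>dvb)"
    by (rule integral_dvb_mob(1)[OF z, where F = "\<lambda>x. p x * (eval h x * cnj (eval (normalized_kernel z) x))", symmetric]) simp
  also have "\<dots> = (\<integral>u. p (mob z u) * eval (mobU z h) u \<partial>dvb)"
  proof (rule integral_cong_AE)
    show "AE u in dvb. p (mob z u) * (eval h (mob z u) * cnj (eval (normalized_kernel z) (mob z u))) * (cmod (kf z u))\<^sup>2
       = p (mob z u) * eval (mobU z h) u"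
      using AE_dvb_polydisc
    proof eventually_elim
      case (elim u)
      have "cnj (kf z (mob z u)) * cnj (kf z u) = 1"
        using kf_mob[OF z elim] by (metis complex_cnj_mult complex_cnj_one)
      then have "cnj (kf z (mob z u)) * (cmod (kf z u))\<^sup>2 = kf z u"
        unfolding of_real_power[symmetric] complex_norm_square by (metis mult.assoc mult.commute mult.right_neutral)
      then show ?case
        using z elim by (simp add: eval_mobU eval_normalized_kernel_kf mult.assoc)
    qed
  qed (simp_all add: eval_mobU[abs_def])
  finally show ?thesis .
qed

text \<open>The reproducing property, obtained by moving \<open>z\<close> to the origin, where
  evaluation is the mean over the polydisc.\<close>

lemma cinner_normalized_kernel: "z \<in> polydisc \<Longrightarrow> cinner h (normalized_kernel z) = om z * eval h z"
  using integral_mobU_kernel[of z "\<lambda>_. 1" h] mean_value_polydisc[of "mobU z h"]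
  by (simp add: cinner_dvb eval_mobU_0)

section \<open>Local estimates\<close>

definition locnorm :: "real \<Rightarrow> 'n::finite bergman \<Rightarrow> real" where
  "locnorm r h = sqrt (\<integral>w. indicator (pd r) w * (cmod (eval h w))\<^sup>2 \<partial>dvb)"

lemma integrable_loc: "A \<in> sets borel \<Longrightarrow> integrable dvb (\<lambda>w. indicator A w * (cmod (eval h w))\<^sup>2)"
  by (rule Bochner_Integration.integrable_bound[OF integrable_eval_sq[of h]])
    (auto simp: indicator_def)

lemma locnorm_nonneg [simp]: "0 \<le> locnorm r h"
  by (simp add: locnorm_def Bochner_Integration.integral_nonneg)

lemma locnorm_sq: "(locnorm r h)\<^sup>2 = (\<integral>w. indicator (pd r) w * (cmod (eval h w))\<^sup>2 \<partial>dvb)"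
  by (simp add: locnorm_def Bochner_Integration.integral_nonneg)

lemma nn_locnorm_sq:
  "ennreal ((locnorm r h)\<^sup>2) = (\<integral>\<^sup>+w. indicator (pd r) w * ennreal ((cmod (eval h w))\<^sup>2) \<partial>dvb)"
proof -
  have "(\<integral>\<^sup>+w. indicator (pd r) w * ennreal ((cmod (eval h w))\<^sup>2) \<partial>dvb) =
      (\<integral>\<^sup>+w. ennreal (indicator (pd r) w * (cmod (eval h w))\<^sup>2) \<partial>dvb)"
    by (rule nn_integral_cong) (simp split: split_indicator)
  also have "\<dots> = ennreal (\<integral>w. indicator (pd r) w * (cmod (eval h w))\<^sup>2 \<partial>dvb)"
    by (rule nn_integral_eq_integral[OF integrable_loc]) auto
  finally show ?thesis by (simp add: locnorm_sq)
qed

lemma locnorm_le_norm: "locnorm r h \<le> norm h"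
proof -
  have "(locnorm r h)\<^sup>2 \<le> (norm h)\<^sup>2"
    unfolding locnorm_sq norm_sq_dvb
    by (rule integral_mono[OF integrable_loc integrable_eval_sq]) (simp_all split: split_indicator)
  then show ?thesis by (rule power2_le_imp_le) simp
qed

lemma locnorm_mono: "r \<le> s \<Longrightarrow> locnorm r h \<le> locnorm s h"
proof -
  assume rs: "r \<le> s"
  have "(\<integral>w. indicator (pd r) w * (cmod (eval h w))\<^sup>2 \<partial>dvb) \<le> (\<integral>w. indicator (pd s) w * (cmod (eval h w))\<^sup>2 \<partial>dvb)"
    by (rule integral_mono[OF integrable_loc integrable_loc])
      (use pd_mono[OF rs] in \<open>auto split: split_indicator\<close>)
  then show ?thesis unfolding locnorm_def by (rule real_sqrt_le_mono)
qed

lemma measure_pd_pos: "0 < r \<Longrightarrow> r < 1 \<Longrightarrow> 0 < measure dvb (pd r :: (complex ^ 'n) set)"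
proof -
  assume r: "0 < r" "r < 1"
  have "ball 0 r \<subseteq> (pd r :: (complex ^ 'n) set)"
    by (auto simp: pd_def intro: order_trans[OF Finite_Cartesian_Product.norm_nth_le less_imp_le])
  moreover have "\<not> negligible (ball 0 r :: (complex ^ 'n) set)"
    using r by (intro open_not_negligible) auto
  ultimately have "\<not> negligible (pd r :: (complex ^ 'n) set)"
    using negligible_subset by blast
  then have "emeasure lborel (pd r :: (complex ^ 'n) set) \<noteq> 0"
    by (auto simp: negligible_iff_null_sets null_sets_def emeasure_completion)
  moreover have "polydisc \<inter> pd r = (pd r :: (complex ^ 'n) set)" using pd_subset[OF r(2)] by auto
  ultimately have "emeasure dvb (pd r :: (complex ^ 'n) set) \<noteq> 0"
    unfolding dvb_uniform using emeasure_lborel_polydisc[where 'n = 'n]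
    by (subst emeasure_uniform_measure) (auto simp: ennreal_divide_eq_0_iff)
  then show ?thesis
    by (simp add: dvb.emeasure_eq_measure zero_less_measure_iff)
qed

text \<open>The mean value property is applied to the square of \<open>h\<close>, which is again
  analytic, so the L2 bound follows directly from the triangle inequality for integrals.\<close>

lemma eval_0_le_loc:
  fixes h :: "'n::finite bergman"
  assumes "r < 1"
  shows "(cmod (eval h 0))\<^sup>2 * measure dvb (pd r :: (complex ^ 'n) set) \<le> (locnorm r h)\<^sup>2"
proof -
  have i: "integrable dvb (\<lambda>w. indicator (pd r) w * (eval h w * eval h w))"
    by (rule Bochner_Integration.integrable_bound[OF integrable_eval_sq[of h]])
      (auto simp: indicator_def norm_mult power2_eq_square)
  have "eval h 0 * eval h 0 * measure dvb (pd r :: (complex ^ 'n) set) = (\<integral>w. indicator (pd r) w * (eval h w * eval h w) \<partial>dvb)"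
    using mean_value[of "\<lambda>w. eval h w * eval h w" "pd r", OF analytic_vec_mult[OF eval_analytic eval_analytic] _ _ i] assms
    by (simp add: pd_rot pd_subset)
  then have "(cmod (eval h 0))\<^sup>2 * measure dvb (pd r :: (complex ^ 'n) set) = cmod (\<integral>w. indicator (pd r) w * (eval h w * eval h w) \<partial>dvb)"
    by (metis norm_mult norm_of_real abs_of_nonneg measure_nonneg power2_eq_square)
  also have "\<dots> \<le> (\<integral>w. cmod (indicator (pd r) w * (eval h w * eval h w)) \<partial>dvb)"
    by (rule integral_norm_bound)
  also have "\<dots> = (locnorm r h)\<^sup>2"
    unfolding locnorm_sq by (intro Bochner_Integration.integral_cong) (auto simp: indicator_def norm_mult power2_eq_square)
  finally show ?thesis .
qed

lemma om_ge_pd: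
  fixes u :: "complex ^ 'n"
  assumes "u \<in> pd r" "0 \<le> r" "r < 1"
  shows "(1 - r\<^sup>2) ^ CARD('n) \<le> om u"
proof -
  have "(\<Prod>i\<in>(UNIV :: 'n set). 1 - r\<^sup>2) \<le> om u"
    unfolding om_def
  proof (rule prod_mono, intro conjI)
    fix i show "0 \<le> 1 - r\<^sup>2" using assms by (simp add: power_le_one)
    show "1 - r\<^sup>2 \<le> 1 - (cmod (u $ i))\<^sup>2"
      using assms by (auto simp: pd_def intro!: power_mono)
  qed
  then show ?thesis by simp
qed

text \<open>The value at \<open>u\<close> is, up to \<open>om u\<close>, the value of
  \<open>mobU u h\<close> at the origin. There \<open>eval_0_le_loc\<close> on
  \<open>pd (1/2)\<close> applies, and \<open>mob u\<close> carries \<open>pd (1/2)\<close> into a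
  fixed \<open>pd t\<close>.\<close>

lemma eval_le_locnorm:
  assumes r: "0 \<le> r" "r < 1"
  obtains C t where "0 \<le> C" "0 \<le> t" "t < 1"
    "\<And>h :: 'n::finite bergman. \<And>u. u \<in> pd r \<Longrightarrow> cmod (eval h u) \<le> C * locnorm t h"
proof -
  obtain t where t: "0 \<le> t" "t < 1" "\<And>x y :: complex ^ 'n. x \<in> pd r \<Longrightarrow> y \<in> pd (1/2) \<Longrightarrow> mob x y \<in> pd t"
    using mob_pd_pd[OF r, of "1/2"] by auto
  define m where "m = measure dvb (pd (1/2) :: (complex ^ 'n) set)"
  define a where "a = (1 - r\<^sup>2) ^ CARD('n)"
  have m: "0 < m" unfolding m_def by (rule measure_pd_pos) auto
  have a: "0 < a" using r by (simp add: a_def abs_square_less_1)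
  have "cmod (eval h u) \<le> (1 / (a * sqrt m)) * locnorm t h" if u: "u \<in> pd r" for h :: "'n bergman" and u
  proof -
    have up: "u \<in> polydisc" using u pd_subset[OF r(2)] by auto
    have "a \<le> om u" using om_ge_pd[OF u r] by (simp add: a_def)
    then have "(a * cmod (eval h u))\<^sup>2 \<le> (om u * cmod (eval h u))\<^sup>2"
      using a by (intro power_mono mult_right_mono) auto
    also have "\<dots> = (cmod (eval (mobU u h) 0))\<^sup>2"
      using om_pos[OF up] by (simp add: eval_mobU_0[OF up] norm_mult)
    finally have "(a * cmod (eval h u))\<^sup>2 * m \<le> (cmod (eval (mobU u h) 0))\<^sup>2 * m"
      using m by (intro mult_right_mono) auto
    also have "\<dots> \<le> (locnorm (1/2) (mobU u h))\<^sup>2"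
      unfolding m_def by (rule eval_0_le_loc) simp
    also have "\<dots> \<le> (locnorm t h)\<^sup>2"
    proof -
      have "ennreal ((locnorm (1/2) (mobU u h))\<^sup>2) = (\<integral>\<^sup>+x. indicator (pd (1/2)) (mob u x) * ennreal ((cmod (eval h x))\<^sup>2) \<partial>dvb)"
        unfolding nn_locnorm_sq by (rule nn_integral_mobU[OF up]) simp
      also have "\<dots> \<le> (\<integral>\<^sup>+x. indicator (pd t) x * ennreal ((cmod (eval h x))\<^sup>2) \<partial>dvb)"
      proof (rule nn_integral_mono)
        fix x
        show "indicator (pd (1/2)) (mob u x) * ennreal ((cmod (eval h x))\<^sup>2) \<le> indicator (pd t) x * ennreal ((cmod (eval h x))\<^sup>2)"
        proof (cases "x \<in> polydisc \<and> mob u x \<in> pd (1/2)")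
          case True
          then have "x \<in> pd t" using t(3)[OF u, of "mob u x"] up by simp
          then show ?thesis using True by simp
        qed (auto simp: eval_outside)
      qed
      also have "\<dots> = ennreal ((locnorm t h)\<^sup>2)" by (rule nn_locnorm_sq[symmetric])
      finally show ?thesis by simp
    qed
    finally have "(a * sqrt m * cmod (eval h u))\<^sup>2 \<le> (locnorm t h)\<^sup>2"
      using m by (simp add: power_mult_distrib mult_ac)
    then have "a * sqrt m * cmod (eval h u) \<le> locnorm t h"
      by (rule power2_le_imp_le) simp
    then show ?thesis using a m by (simp add: field_simps)
  qed
  then show ?thesis
    using that[of "1 / (a * sqrt m)" t] t a m by simp
qed

text \<open>Cauchy's inequality on the complex line through \<open>u\<close> in direction
  \<open>v\<close>.\<close>

lemma derivative_le_locnorm: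
  assumes r: "0 \<le> r" "r < 1"
  obtains C t where "0 \<le> C" "0 \<le> t" "t < 1"
    "\<And>h :: 'n::finite bergman. \<And>u D v. u \<in> pd r \<Longrightarrow> (eval h has_derivative D) (at u) \<Longrightarrow>
       (\<And>c v. D (c *s v) = c * D v) \<Longrightarrow> cmod (D v) \<le> C * locnorm t h * norm v"
proof -
  define s where "s = (r + 1) / 2"
  have s: "0 \<le> s" "s < 1" "r < s" using r by (auto simp: s_def)
  obtain C t where C: "0 \<le> C" "0 \<le> t" "t < 1"
    and le: "\<And>h :: 'n bergman. \<And>u. u \<in> pd s \<Longrightarrow> cmod (eval h u) \<le> C * locnorm t h"
    using eval_le_locnorm[OF s(1,2)] by metis
  have "cmod (D v) \<le> (C / (s - r)) * locnorm t h * norm v"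
    if u: "u \<in> pd r" and D: "(eval h has_derivative D) (at u)" "\<And>c v. D (c *s v) = c * D v"
    for h :: "'n bergman" and u D v
  proof (cases "v = 0")
    case True
    then have "D v = 0" using D(2)[of 0 v] by simp
    then show ?thesis using C s by simp
  next
    case False
    \<comment> \<open>The largest radius for which the estimate r + \<rho> |v| \<le> s keeps the
      whole disc on the line inside \<open>pd s\<close>.\<close>
    define \<rho> where "\<rho> = (s - r) / norm v"
    have \<rho>: "\<rho> > 0" using s False by (simp add: \<rho>_def)
    have in_s: "u + l *s v \<in> pd s" if "cmod l \<le> \<rho>" for l
      unfolding pd_def
    proof safe
      fix i
      have "cmod ((u + l *s v) $ i) \<le> cmod (u $ i) + cmod l * cmod (v $ i)"
        using norm_triangle_ineq[of "u $ i" "l * v $ i"] by (simp add: norm_mult)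
      also have "\<dots> \<le> r + \<rho> * norm v"
        using u that \<rho> by (intro add_mono mult_mono Finite_Cartesian_Product.norm_nth_le) (auto simp: pd_def)
      also have "\<dots> = s" using False by (simp add: \<rho>_def)
      finally show "cmod ((u + l *s v) $ i) \<le> s" .
    qed
    have hol: "(\<lambda>l. eval h (u + l *s v)) holomorphic_on cball 0 \<rho>"
      using in_s pd_subset[OF s(2)] by (intro holomorphic_on_line[OF eval_analytic]) auto
    have "norm ((deriv ^^ 1) (\<lambda>l. eval h (u + l *s v)) 0) \<le> fact 1 * (C * locnorm t h) / \<rho> ^ 1"
    proof (rule Cauchy_inequality)
      show "(\<lambda>l. eval h (u + l *s v)) holomorphic_on ball 0 \<rho>"
        using hol by (rule holomorphic_on_subset) auto
      show "continuous_on (cball 0 \<rho>) (\<lambda>l. eval h (u + l *s v))"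
        using hol by (rule holomorphic_on_imp_continuous_on)
      show "norm (eval h (u + l *s v)) \<le> C * locnorm t h" if "norm (0 - l) = \<rho>" for l
        by (rule le[OF in_s]) (use that in simp)
    qed (rule \<rho>)
    moreover have "((\<lambda>l. eval h (u + l *s v)) has_field_derivative D v) (at 0)"
      using has_field_derivative_line[of "eval h" D u 0 v] D by simp
    ultimately have "cmod (D v) \<le> C * locnorm t h / \<rho>"
      by (simp add: DERIV_imp_deriv)
    then show ?thesis by (simp add: \<rho>_def mult_ac)
  qed
  moreover have "0 \<le> C / (s - r)" using C s by simp
  ultimately show ?thesis using that C by blast
qed

lemma convex_pd: "convex (pd r)"
proof (rule convexI)
  fix x y :: "complex ^ 'n" and a b :: real
  assume *: "x \<in> pd r" "y \<in> pd r" "0 \<le> a" "0 \<le> b" "a + b = 1"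
  show "a *\<^sub>R x + b *\<^sub>R y \<in> pd r"
    unfolding pd_def
  proof safe
    fix i
    have "cmod ((a *\<^sub>R x + b *\<^sub>R y) $ i) \<le> a * cmod (x $ i) + b * cmod (y $ i)"
      using norm_triangle_ineq[of "a *\<^sub>R (x $ i)" "b *\<^sub>R (y $ i)"] * by simp
    also have "\<dots> \<le> a * r + b * r"
      using * by (intro add_mono mult_left_mono) (auto simp: pd_def)
    also have "\<dots> = r" using * by (simp add: distrib_right[symmetric])
    finally show "cmod ((a *\<^sub>R x + b *\<^sub>R y) $ i) \<le> r" .
  qed
qed

lemma eval_lipschitz_locnorm:
  assumes r: "0 \<le> r" "r < 1"
  obtains C t where "0 \<le> C" "0 \<le> t" "t < 1"
    "\<And>h :: 'n::finite bergman. \<And>u v. u \<in> pd r \<Longrightarrow> v \<in> pd r \<Longrightarrow>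
       cmod (eval h u - eval h v) \<le> C * locnorm t h * norm (u - v)"
proof -
  obtain C t where C: "0 \<le> C" "0 \<le> t" "t < 1"
    and le: "\<And>h :: 'n bergman. \<And>u D v. u \<in> pd r \<Longrightarrow> (eval h has_derivative D) (at u) \<Longrightarrow>
       (\<And>c v. D (c *s v) = c * D v) \<Longrightarrow> cmod (D v) \<le> C * locnorm t h * norm v"
    using derivative_le_locnorm[OF r] by metis
  have "cmod (eval h u - eval h v) \<le> C * locnorm t h * norm (u - v)"
    if uv: "u \<in> pd r" "v \<in> pd r" for h :: "'n bergman" and u v
  proof -
    obtain D where D: "\<And>x. x \<in> polydisc \<Longrightarrow> (eval h has_derivative D x) (at x)"
      "\<And>x c v. x \<in> polydisc \<Longrightarrow> D x (c *s v) = c * D x v"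
      using eval_analytic[of h] unfolding analytic_vec_def by metis
    show ?thesis
    proof (rule differentiable_bound[OF convex_pd _ _ uv])
      fix x :: "complex ^ 'n" assume x: "x \<in> pd r"
      then have xp: "x \<in> polydisc" using pd_subset[OF r(2)] by auto
      show "(eval h has_derivative D x) (at x within pd r)"
        using D(1)[OF xp] by (rule has_derivative_at_withinI)
      show "onorm (D x) \<le> C * locnorm t h"
        using C by (intro onorm_bound mult_nonneg_nonneg le[OF x D(1)[OF xp]] D(2)[OF xp]) auto
    qed
  qed
  then show ?thesis using that C by blast
qed

text \<open>The disc of radius \<open>R\<close> > 1 on the line through \<open>b\<close> still lies
  in a compact \<open>pd s\<close>. Cauchy's estimates there give geometric decay of the
  coefficients, with constants independent of \<open>h\<close>.\<close>

lemma eval_power_series: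
  fixes b :: "complex ^ 'n::finite"
  assumes b: "b \<in> polydisc"
  obtains C R t where "0 \<le> C" "1 < R" "0 \<le> t" "t < 1"
    "\<And>h :: 'n bergman. \<exists>a. (\<forall>k. cmod (a k) \<le> C * locnorm t h / R ^ k) \<and>
       (\<forall>m. cmod m \<le> 1 \<longrightarrow> (\<lambda>k. a k * m ^ k) sums eval h (m *s b))"
proof -
  \<comment> \<open>The maximum with 1/2 keeps \<open>r0\<close> positive, so that
    \<open>R = s / r0\<close> also makes sense for b = 0.\<close>
  define r0 where "r0 = max (1/2) (Max (range (\<lambda>i. cmod (b $ i))))"
  have "cmod (b $ i) \<le> Max (range (\<lambda>i. cmod (b $ i)))" for i
    by (rule Max_ge) auto
  then have r0: "0 < r0" "r0 < 1" "\<And>i. cmod (b $ i) \<le> r0"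
    using polydiscD[OF b] by (auto simp: r0_def le_max_iff_disj)
  define s where "s = (r0 + 1) / 2"
  have s: "0 \<le> s" "s < 1" using r0 by (auto simp: s_def)
  define R where "R = s / r0"
  have R: "1 < R" using r0 by (simp add: R_def s_def)
  obtain C t where C: "0 \<le> C" "0 \<le> t" "t < 1"
    and le: "\<And>h :: 'n bergman. \<And>u. u \<in> pd s \<Longrightarrow> cmod (eval h u) \<le> C * locnorm t h"
    using eval_le_locnorm[OF s] by metis
  have in_s: "l *s b \<in> pd s" if "cmod l \<le> R" for l
    unfolding pd_def
  proof safe
    fix i
    have "cmod ((l *s b) $ i) \<le> R * r0"
      using that r0 R by (auto simp: norm_mult intro!: mult_mono)
    then show "cmod ((l *s b) $ i) \<le> s" using r0 by (simp add: R_def)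
  qed
  show ?thesis
  proof (rule that[OF C(1) R C(2,3)])
    fix h :: "'n bergman"
    define g where "g l = eval h (l *s b)" for l
    have hol: "g holomorphic_on cball 0 R"
      using in_s pd_subset[OF s(2)] holomorphic_on_line[OF eval_analytic, of "cball 0 R" 0 b h]
      by (auto simp: g_def[abs_def])
    then have hol': "g holomorphic_on ball 0 R" by (rule holomorphic_on_subset) auto
    have "cmod ((deriv ^^ k) g 0) \<le> fact k * (C * locnorm t h) / R ^ k" for k
    proof (rule Cauchy_inequality[OF hol'])
      show "continuous_on (cball 0 R) g" using hol by (rule holomorphic_on_imp_continuous_on)
      show "norm (g l) \<le> C * locnorm t h" if "norm (0 - l) = R" for l
        unfolding g_def by (rule le[OF in_s]) (use that in simp)
    qed (use R in simp)
    then have "cmod ((deriv ^^ k) g 0 / fact k) \<le> C * locnorm t h / R ^ k" for k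
      by (simp add: norm_divide divide_le_eq mult_ac)
    moreover have "(\<lambda>k. (deriv ^^ k) g 0 / fact k * m ^ k) sums eval h (m *s b)" if "cmod m \<le> 1" for m
      using holomorphic_power_series[OF hol', of m] that R by (simp add: g_def)
    ultimately show "\<exists>a. (\<forall>k. cmod (a k) \<le> C * locnorm t h / R ^ k) \<and>
       (\<forall>m. cmod m \<le> 1 \<longrightarrow> (\<lambda>k. a k * m ^ k) sums eval h (m *s b))"
      by (intro exI[of _ "\<lambda>k. (deriv ^^ k) g 0 / fact k"]) auto
  qed
qed

section \<open>Completeness and the Riesz representation\<close>

lemma polydisc_nbhd:
  fixes u :: "complex ^ 'n::finite"
  assumes "u \<in> polydisc"
  obtains r d where "0 \<le> r" "r < 1" "0 < d" "ball u d \<subseteq> pd r"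
proof -
  define m where "m = Max (range (\<lambda>i. cmod (u $ i)))"
  have m: "cmod (u $ i) \<le> m" for i unfolding m_def by (rule Max_ge) auto
  have m1: "m < 1" unfolding m_def using polydiscD[OF assms] by (subst Max_less_iff) auto
  have m0: "0 \<le> m" using m order_trans[OF norm_ge_zero] by blast
  have "v \<in> pd ((m + 1) / 2)" if "v \<in> ball u ((1 - m) / 2)" for v
    unfolding pd_def
  proof safe
    fix i
    have "cmod (v $ i) \<le> cmod (u $ i) + cmod ((v - u) $ i)"
      using norm_triangle_ineq[of "u $ i" "(v - u) $ i"] by simp
    also have "cmod ((v - u) $ i) \<le> norm (v - u)" by (rule Finite_Cartesian_Product.norm_nth_le)
    also have "norm (v - u) \<le> (1 - m) / 2" using that by (simp add: dist_norm norm_minus_commute)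
    finally show "cmod (v $ i) \<le> (m + 1) / 2" using m[of i] by (simp add: field_simps)
  qed
  then have "ball u ((1 - m) / 2) \<subseteq> pd ((m + 1) / 2)" by blast
  with m0 m1 show ?thesis
    by (intro that[of "(m + 1) / 2" "(1 - m) / 2"]) auto
qed

lemma eval_has_derivative_ex:
  "\<exists>D. \<forall>u\<in>polydisc. (eval h has_derivative D u) (at u) \<and> (\<forall>c v. D u (c *s v) = c * D u v)"
  using eval_analytic[of h] unfolding analytic_vec_def by (rule bchoice)

text \<open>The local norm is dominated by the norm, so a Cauchy sequence converges locally
  uniformly together with its derivatives. On a small ball the theorem on sequences with uniformly
  convergent derivatives then applies, and complex linearity passes to the limit.\<close>

lemma bergman_limit_analytic:
  fixes X :: "nat \<Rightarrow> 'n::finite bergman"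
  assumes X: "Cauchy X"
  obtains f where "\<And>u. (\<lambda>n. eval (X n) u) \<longlonglongrightarrow> f u" "analytic_vec f polydisc"
    "\<And>u. u \<notin> polydisc \<Longrightarrow> f u = 0"
proof -
  have D: "\<forall>n. \<exists>D. \<forall>u\<in>polydisc. (eval (X n) has_derivative D u) (at u) \<and> (\<forall>c v. D u (c *s v) = c * D u v)"
    using eval_has_derivative_ex by blast
  from choice[OF this] obtain D where
    D: "\<And>n u. u \<in> polydisc \<Longrightarrow> (eval (X n) has_derivative D n u) (at u)"
     "\<And>n u c v. u \<in> polydisc \<Longrightarrow> D n u (c *s v) = c * D n u v"
    by blast
  have CauchyX: "\<exists>N. \<forall>m\<ge>N. \<forall>n\<ge>N. norm (X m - X n) < e" if "e > 0" for e
    using X that unfolding Cauchy_def dist_norm by blast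
  have loc: "\<exists>g. (\<forall>x\<in>ball u d. (\<lambda>n. eval (X n) x) \<longlonglongrightarrow> g x \<and>
      (\<exists>g'. (g has_derivative g') (at x) \<and> (\<forall>c v. g' (c *s v) = c * g' v)))"
    if r: "0 \<le> r" "r < 1" and d: "0 < d" "ball u d \<subseteq> pd r" for u :: "complex ^ 'n" and r d
  proof -
    have sub: "ball u d \<subseteq> polydisc" using d(2) pd_subset[OF r(2)] by blast
    obtain C t where C: "0 \<le> C"
      and le: "\<And>h :: 'n bergman. \<And>u. u \<in> pd r \<Longrightarrow> cmod (eval h u) \<le> C * locnorm t h"
      using eval_le_locnorm[OF r] by metis
    have evle: "cmod (eval (X m) x - eval (X n) x) \<le> C * norm (X m - X n)" if "x \<in> ball u d" for x m n
    proof -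
      have "cmod (eval (X m - X n) x) \<le> C * locnorm t (X m - X n)" using that d(2) by (intro le) auto
      also have "\<dots> \<le> C * norm (X m - X n)" using C by (intro mult_left_mono locnorm_le_norm)
      finally show ?thesis by (simp add: eval_minus)
    qed
    obtain C' t' where C': "0 \<le> C'"
      and le': "\<And>h :: 'n bergman. \<And>u D v. u \<in> pd r \<Longrightarrow> (eval h has_derivative D) (at u) \<Longrightarrow>
       (\<And>c v. D (c *s v) = c * D v) \<Longrightarrow> cmod (D v) \<le> C' * locnorm t' h * norm v"
      using derivative_le_locnorm[OF r] by metis
    have Dle: "cmod (D m x v - D n x v) \<le> C' * norm (X m - X n) * norm v" if x: "x \<in> ball u d" for x m n v
    proof -
      have xp: "x \<in> polydisc" using x sub by auto
      have "(eval (X m - X n) has_derivative (\<lambda>v. D m x v - D n x v)) (at x)"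
        using has_derivative_diff[OF D(1)[OF xp] D(1)[OF xp]] by (simp add: eval_minus[abs_def])
      then have "cmod (D m x v - D n x v) \<le> C' * locnorm t' (X m - X n) * norm v"
        using x d(2) by (intro le'[where D = "\<lambda>v. D m x v - D n x v"]) (auto simp: D(2)[OF xp] right_diff_distrib)
      also have "\<dots> \<le> C' * norm (X m - X n) * norm v"
        using C' by (intro mult_right_mono mult_left_mono locnorm_le_norm) auto
      finally show ?thesis .
    qed
    have cauchyI: "Cauchy (\<lambda>n. a n)" if aK: "\<And>m n. cmod (a m - a n) \<le> K * norm (X m - X n)" "0 \<le> K"
      for K and a :: "nat \<Rightarrow> complex"
    proof (rule CauchyI)
      fix e :: real assume "0 < e"
      then have "e / (K + 1) > 0" using aK(2) by simp
      from CauchyX[OF this] obtain N where N: "\<And>m n. m \<ge> N \<Longrightarrow> n \<ge> N \<Longrightarrow> norm (X m - X n) < e / (K + 1)"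
        by blast
      have "norm (a m - a n) < e" if mn: "m \<ge> N" "n \<ge> N" for m n
      proof -
        have "norm (a m - a n) \<le> K * norm (X m - X n)" by (rule aK(1))
        also have "\<dots> \<le> (K + 1) * norm (X m - X n)" by (intro mult_right_mono) auto
        also have "\<dots> < (K + 1) * (e / (K + 1))" using N[OF mn] \<open>0 \<le> K\<close> by (intro mult_strict_left_mono) auto
        finally show ?thesis using \<open>0 \<le> K\<close> by simp
      qed
      then show "\<exists>M. \<forall>m\<ge>M. \<forall>n\<ge>M. norm (a m - a n) < e" by blast
    qed
    define g' where "g' x v = lim (\<lambda>n. D n x v)" for x v
    have g': "(\<lambda>n. D n x v) \<longlonglongrightarrow> g' x v" if "x \<in> ball u d" for x v
    proof -
      have "Cauchy (\<lambda>n. D n x v)"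
        using Dle[OF that, of _ v] C' by (intro cauchyI[of _ "C' * norm v"]) (auto simp: mult_ac)
      then show ?thesis unfolding g'_def by (simp add: Cauchy_convergent_iff convergent_LIMSEQ_iff)
    qed
    have g'lin: "g' x (c *s v) = c * g' x v" if "x \<in> ball u d" for x c v
    proof (rule LIMSEQ_unique[OF g'[OF that]])
      have "x \<in> polydisc" using that sub by auto
      then show "(\<lambda>n. D n x (c *s v)) \<longlonglongrightarrow> c * g' x v"
        using tendsto_mult_left[OF g'[OF that], of c v] by (simp add: D(2))
    qed
    have "convergent (\<lambda>n. eval (X n) u)"
      using evle[of u] d(1) C by (intro Cauchy_convergent cauchyI[of _ C]) auto
    then obtain l where l: "(\<lambda>n. eval (X n) u) \<longlonglongrightarrow> l" unfolding convergent_def by blast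
    have "\<exists>g. \<forall>x\<in>ball u d. (\<lambda>n. eval (X n) x) \<longlonglongrightarrow> g x \<and> (g has_derivative g' x) (at x within ball u d)"
    proof (rule has_derivative_sequence[where f = "\<lambda>n. eval (X n)" and f' = D and g' = g' and l = l])
      show "(eval (X n) has_derivative D n x) (at x within ball u d)" if "x \<in> ball u d" for n x
        by (rule has_derivative_at_withinI[OF D(1)]) (use that sub in blast)
      show "convex (ball u d)" by (rule convex_ball)
      show "(\<lambda>n. eval (X n) u) \<longlonglongrightarrow> l" by (rule l)
      show "u \<in> ball u d" using d by simp
      fix e :: real assume e: "0 < e"
      then have "e / (C' + 1) > 0" using C' by simp
      from CauchyX[OF this] obtain N where N: "\<And>m n. m \<ge> N \<Longrightarrow> n \<ge> N \<Longrightarrow> norm (X m - X n) < e / (C' + 1)"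
        by blast
      have "cmod (D n x v - g' x v) \<le> e * norm v" if n: "n \<ge> N" and x: "x \<in> ball u d" for n x v
      proof (rule tendsto_upperbound)
        show "(\<lambda>m. cmod (D n x v - D m x v)) \<longlonglongrightarrow> cmod (D n x v - g' x v)"
          by (intro tendsto_intros g'[OF x])
        have "cmod (D n x v - D m x v) \<le> e * norm v" if m: "m \<ge> N" for m
        proof -
          have "cmod (D n x v - D m x v) \<le> C' * norm (X n - X m) * norm v" by (rule Dle[OF x])
          also have "\<dots> \<le> (C' + 1) * (e / (C' + 1)) * norm v"
            using C' N[OF n m] by (intro mult_right_mono mult_mono) auto
          finally show ?thesis using C' by simp
        qed
        then show "\<forall>\<^sub>F m in sequentially. cmod (D n x v - D m x v) \<le> e * norm v"
          by (auto simp: eventually_sequentially)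
      qed simp
      then show "\<forall>\<^sub>F n in sequentially. \<forall>x\<in>ball u d. \<forall>v. cmod (D n x v - g' x v) \<le> e * norm v"
        unfolding eventually_sequentially by blast
    qed
    then obtain g where g: "\<And>x. x \<in> ball u d \<Longrightarrow> (\<lambda>n. eval (X n) x) \<longlonglongrightarrow> g x"
       "\<And>x. x \<in> ball u d \<Longrightarrow> (g has_derivative g' x) (at x within ball u d)" by blast
    show ?thesis
    proof (intro exI[of _ g] ballI)
      fix x assume x: "x \<in> ball u d"
      have "(g has_derivative g' x) (at x)"
        using g(2)[OF x] unfolding at_within_open[OF x open_ball] .
      then show "(\<lambda>n. eval (X n) x) \<longlonglongrightarrow> g x \<and>
          (\<exists>g'. (g has_derivative g') (at x) \<and> (\<forall>c v. g' (c *s v) = c * g' v))"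
        using g(1)[OF x] g'lin[OF x] by blast
    qed
  qed
  define f where "f u = lim (\<lambda>n. eval (X n) u)" for u
  have f: "(\<lambda>n. eval (X n) u) \<longlonglongrightarrow> f u" for u
  proof (cases "u \<in> polydisc")
    case True
    then obtain r d where "0 \<le> r" "r < 1" "0 < d" "ball u d \<subseteq> pd r" by (rule polydisc_nbhd)
    from loc[OF this] have "convergent (\<lambda>n. eval (X n) u)"
      using \<open>0 < d\<close> unfolding convergent_def by (metis centre_in_ball)
    then show ?thesis unfolding f_def by (simp add: convergent_LIMSEQ_iff)
  qed (simp add: f_def eval_outside)
  show ?thesis
  proof (rule that[OF f])
    show "f u = 0" if "u \<notin> polydisc" for u
      using that by (simp add: f_def eval_outside)
    show "analytic_vec f polydisc"
      unfolding analytic_vec_def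
    proof
      fix u :: "complex ^ 'n" assume "u \<in> polydisc"
      then obtain r d where rd: "0 \<le> r" "r < 1" "0 < d" "ball u d \<subseteq> pd r" by (rule polydisc_nbhd)
      from loc[OF this] obtain g where g: "\<And>x. x \<in> ball u d \<Longrightarrow> (\<lambda>n. eval (X n) x) \<longlonglongrightarrow> g x"
        "\<exists>g'. (g has_derivative g') (at u) \<and> (\<forall>c v. g' (c *s v) = c * g' v)"
        using rd(3) by (metis centre_in_ball)
      obtain g' where g': "(g has_derivative g') (at u)" "\<forall>c v. g' (c *s v) = c * g' v"
        using g(2) by blast
      have "(f has_derivative g') (at u)"
      proof (rule has_derivative_transform_within_open[OF g'(1), of "ball u d"])
        show "g x = f x" if "x \<in> ball u d" for x
          using LIMSEQ_unique[OF g(1)[OF that] f] .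
      qed (use rd in auto)
      then show "\<exists>f'. (f has_derivative f') (at u) \<and> (\<forall>c v. f' (c *s v) = c * f' v)"
        using g'(2) by blast
    qed
  qed
qed

text \<open>The pointwise limit is analytic by the preceding lemma. Fatou's lemma along m, with n
  fixed, shows that it is square integrable and that it is also the limit in norm.\<close>

instance bergman :: (finite) complete_space
proof
  fix X :: "nat \<Rightarrow> 'a bergman"
  assume X: "Cauchy X"
  obtain f where f: "\<And>u. (\<lambda>n. eval (X n) u) \<longlonglongrightarrow> f u" "analytic_vec f polydisc"
    "\<And>u. u \<notin> polydisc \<Longrightarrow> f u = 0"
    using bergman_limit_analytic[OF X] by metis
  have fm [measurable]: "f \<in> borel_measurable borel"
    using f(2,3) by (intro borel_measurable_evalI analytic_vec_continuous_on)
  have fatou: "(\<integral>\<^sup>+u. ennreal ((cmod (f u - eval (X n) u))\<^sup>2) \<partial>dvb) \<le> ennreal (e\<^sup>2)"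
    if N: "\<And>m. m \<ge> N \<Longrightarrow> norm (X m - X n) \<le> e" for N n e
  proof -
    have "(\<integral>\<^sup>+u. ennreal ((cmod (f u - eval (X n) u))\<^sup>2) \<partial>dvb) =
        (\<integral>\<^sup>+u. liminf (\<lambda>m. ennreal ((cmod (eval (X m) u - eval (X n) u))\<^sup>2)) \<partial>dvb)"
    proof (rule nn_integral_cong)
      fix u
      have "(\<lambda>m. ennreal ((cmod (eval (X m) u - eval (X n) u))\<^sup>2)) \<longlonglongrightarrow> ennreal ((cmod (f u - eval (X n) u))\<^sup>2)"
        by (intro tendsto_intros f(1))
      then show "ennreal ((cmod (f u - eval (X n) u))\<^sup>2) = liminf (\<lambda>m. ennreal ((cmod (eval (X m) u - eval (X n) u))\<^sup>2))"
        by (intro lim_imp_Liminf[symmetric]) auto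
    qed
    also have "\<dots> \<le> liminf (\<lambda>m. \<integral>\<^sup>+u. ennreal ((cmod (eval (X m) u - eval (X n) u))\<^sup>2) \<partial>dvb)"
      by (intro nn_integral_liminf) measurable
    also have "\<dots> = liminf (\<lambda>m. ennreal ((norm (X m - X n))\<^sup>2))"
      by (simp add: nn_norm_sq[symmetric] eval_minus)
    also have "\<dots> \<le> ennreal (e\<^sup>2)"
    proof (rule Liminf_le)
      have "ennreal ((norm (X m - X n))\<^sup>2) \<le> ennreal (e\<^sup>2)" if "m \<ge> N" for m
        using N[OF that] by (intro ennreal_leI power_mono) auto
      then show "\<forall>\<^sub>F m in sequentially. ennreal ((norm (X m - X n))\<^sup>2) \<le> ennreal (e\<^sup>2)"
        by (auto simp: eventually_sequentially)
    qed simp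
    finally show ?thesis .
  qed
  have CauchyX: "\<exists>N. \<forall>m\<ge>N. \<forall>n\<ge>N. norm (X m - X n) < e" if "e > 0" for e
    using X that unfolding Cauchy_def dist_norm by blast
  obtain N where N: "\<And>m. m \<ge> N \<Longrightarrow> norm (X m - X N) < 1"
    using CauchyX[of 1] by auto
  have "(\<integral>\<^sup>+u. ennreal ((cmod (f u - eval (X N) u))\<^sup>2) \<partial>dvb) \<le> ennreal (1\<^sup>2)"
    using N by (intro fatou[of N]) (auto intro: less_imp_le)
  also have "\<dots> < \<infinity>" by simp
  finally have "integrable dvb (\<lambda>u. (cmod (f u - eval (X N) u))\<^sup>2)"
    by (intro integrableI_nonneg) auto
  then have "(\<lambda>u. f u - eval (X N) u) \<in> L2"
    by (subst L2_borel_iff) measurable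
  then have "(\<lambda>u. (f u - eval (X N) u) + eval (X N) u) \<in> L2"
    by (rule L2_add[OF _ eval_L2])
  then have "f \<in> L2" by simp
  then have F: "eval (Bergman f) = f"
    using f(2,3) by (intro Bergman_inverse) auto
  have "X \<longlonglongrightarrow> Bergman f"
  proof (rule LIMSEQ_I)
    fix r :: real assume r: "0 < r"
    then obtain N where N: "\<And>m n. m \<ge> N \<Longrightarrow> n \<ge> N \<Longrightarrow> norm (X m - X n) < r / 2"
      using CauchyX[of "r / 2"] by auto
    have "norm (X n - Bergman f) < r" if n: "n \<ge> N" for n
    proof -
      have "ennreal ((norm (Bergman f - X n))\<^sup>2) \<le> ennreal ((r / 2)\<^sup>2)"
        unfolding nn_norm_sq[symmetric] eval_minus F
        by (rule fatou[of N]) (use N[OF _ n] in \<open>auto intro: less_imp_le\<close>)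
      then have "(norm (Bergman f - X n))\<^sup>2 \<le> (r / 2)\<^sup>2" by simp
      then have "norm (Bergman f - X n) \<le> r / 2" by (rule power2_le_imp_le) (use r in simp)
      then show ?thesis using r by (simp add: norm_minus_commute)
    qed
    then show "\<exists>no. \<forall>n\<ge>no. norm (X n - Bergman f) < r" by blast
  qed
  then show "convergent X" unfolding convergent_def by blast
qed

instance bergman :: (finite) banach ..

text \<open>The representing vector is the minimizer of the energy \<open>J\<close>; a minimizing
  sequence is Cauchy by the parallelogram law.\<close>

lemma riesz_real:
  fixes \<phi> :: "'a::{real_inner, complete_space} \<Rightarrow> real"
  assumes "bounded_linear \<phi>"
  obtains g where "\<And>h. \<phi> h = h \<bullet> g"
proof -
  interpret bounded_linear \<phi> by fact
  obtain K where K: "\<And>x. norm (\<phi> x) \<le> norm x * K" "0 < K" using pos_bounded by blast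
  define J where "J x = (norm x)\<^sup>2 / 2 - \<phi> x" for x
  have lower: "- K\<^sup>2 / 2 \<le> J x" for x
  proof -
    have "\<phi> x \<le> norm x * K" using K(1)[of x] by simp
    moreover have "0 \<le> (norm x - K)\<^sup>2" by simp
    ultimately show ?thesis unfolding J_def power2_diff by (simp add: field_simps)
  qed
  define m where "m = Inf (range J)"
  have bdd: "bdd_below (range J)" using lower by (intro bdd_belowI[of _ "- K\<^sup>2 / 2"]) auto
  have m: "m \<le> J x" for x unfolding m_def by (rule cInf_lower[OF _ bdd]) simp
  have "\<exists>x. J x < m + 1 / Suc n" for n
  proof -
    have "Inf (range J) < m + 1 / Suc n" by (simp add: m_def)
    then show ?thesis using cInf_less_iff[of "range J", OF _ bdd] by auto
  qed
  then obtain X where X: "\<And>n. J (X n) < m + 1 / Suc n" by metis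
  \<comment> \<open>The parallelogram identity evaluates \<open>J\<close> at the midpoint, where it
    is still at least \<open>m\<close>.\<close>
  have par: "(norm (x - y))\<^sup>2 \<le> 4 * (J x - m + (J y - m))" for x y
  proof -
    have "J ((1/2) *\<^sub>R (x + y)) = (J x + J y) / 2 - (norm (x - y))\<^sup>2 / 8"
      unfolding J_def scaleR add by (simp add: power2_norm_eq_inner inner_simps inner_commute field_simps)
    with m[of "(1/2) *\<^sub>R (x + y)"] show ?thesis by argo
  qed
  have "Cauchy X"
  proof (rule CauchyI)
    fix e :: real assume e: "0 < e"
    obtain N where N: "inverse (real (Suc N)) < e\<^sup>2 / 8"
      using reals_Archimedean[of "e\<^sup>2 / 8"] e by auto
    define d where "d = 1 / real (Suc N)"
    have d: "8 * d < e\<^sup>2" using N by (simp add: d_def inverse_eq_divide del: of_nat_Suc)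
    have gen: "a < m + d \<Longrightarrow> b < m + d \<Longrightarrow> s \<le> 4 * (a - m + (b - m)) \<Longrightarrow> 8 * d < t \<Longrightarrow> s < t" for a b s t
      by argo
    have "norm (X k - X n) < e" if "k \<ge> N" "n \<ge> N" for k n
    proof -
      have "1 / real (Suc k) \<le> d" "1 / real (Suc n) \<le> d"
        unfolding d_def using that by (auto intro!: divide_left_mono)
      then have J: "J (X k) < m + d" "J (X n) < m + d"
        using X[of k] X[of n] by linarith+
      have "(norm (X k - X n))\<^sup>2 < e\<^sup>2"
        by (rule gen[OF J par d])
      then show ?thesis by (rule power2_less_imp_less) (use e in simp)
    qed
    then show "\<exists>M. \<forall>m\<ge>M. \<forall>n\<ge>M. norm (X m - X n) < e" by blast
  qed
  then have "convergent X" by (rule Cauchy_convergent)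
  then obtain g where g: "X \<longlonglongrightarrow> g" unfolding convergent_def by blast
  have "J g \<le> m"
  proof (rule tendsto_le[OF _ _ _])
    show "(\<lambda>n. J (X n)) \<longlonglongrightarrow> J g" unfolding J_def by (intro tendsto_intros g tendsto) simp_all
    show "(\<lambda>n. m + 1 / real (Suc n)) \<longlonglongrightarrow> m"
      using LIMSEQ_inverse_real_of_nat_add[of m] by (simp add: inverse_eq_divide)
    show "\<forall>\<^sub>F n in sequentially. J (X n) \<le> m + 1 / real (Suc n)"
      by (intro always_eventually allI less_imp_le[OF X])
  qed simp
  have "\<phi> h = h \<bullet> g" for h
  proof (cases "h = 0")
    case False
    define a where "a = g \<bullet> h - \<phi> h"
    \<comment> \<open>The minimizer of the quadratic \<open>J (g + t *\<^sub>R h)\<close> in t: the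
      value drops by a^2 / (2 |h|^2), which minimality of \<open>g\<close> excludes unless a =
      0.\<close>
    define t where "t = - a / (norm h)\<^sup>2"
    have h: "(norm h)\<^sup>2 > 0" using False by simp
    have "(norm (g + t *\<^sub>R h))\<^sup>2 = (norm g)\<^sup>2 + 2 * t * (g \<bullet> h) + t\<^sup>2 * (norm h)\<^sup>2"
      unfolding power2_norm_eq_inner
      by (simp add: inner_simps inner_commute power2_eq_square algebra_simps)
    then have "J (g + t *\<^sub>R h) = J g + t * a + t\<^sup>2 * (norm h)\<^sup>2 / 2"
      unfolding J_def scaleR add a_def by (simp add: field_simps)
    also have "\<dots> = J g - a\<^sup>2 / (2 * (norm h)\<^sup>2)"
      using h unfolding t_def by (simp add: field_simps power2_eq_square)
    finally have "a\<^sup>2 / (2 * (norm h)\<^sup>2) \<le> 0" using m[of "g + t *\<^sub>R h"] \<open>J g \<le> m\<close> by simp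
    then have "a\<^sup>2 \<le> 0" using h by (simp add: divide_le_0_iff)
    then have "a = 0" by simp
    then show ?thesis by (simp add: a_def inner_commute)
  qed (simp add: zero)
  then show ?thesis by (rule that)
qed

section \<open>Duality: complex Riesz representation and adjoints\<close>

lemma cinner_cnj: "cnj (cinner f g) = cinner g f"
proof -
  have "cnj (cinner f g) = (\<integral>z. cnj (eval f z * cnj (eval g z)) \<partial>dvb)"
    unfolding cinner_dvb by (rule Bochner_Integration.integral_cnj[symmetric])
  then show ?thesis by (simp add: cinner_dvb mult.commute)
qed

lemma cinner_diff_left: "cinner (f - g) h = cinner f h - cinner g h"
  using cinner_add_left[of "f - g" g h] by simp

lemma cinner_add_right: "cinner h (f + g) = cinner h f + cinner h g"
  by (metis cinner_add_left cinner_cnj complex_cnj_add)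

lemma cinner_scale_right: "cinner f (scale_vec c g) = cnj c * cinner f g"
  by (metis cinner_scale_left cinner_cnj complex_cnj_mult)

lemma cinner_norm: "cinner f f = (norm f)\<^sup>2"
  unfolding norm_bergman_eq cinner_self by (simp add: Bochner_Integration.integral_nonneg)

lemma cinner_eqI: "(\<And>g. cinner f g = cinner f' g) \<Longrightarrow> f = f'"
proof -
  assume "\<And>g. cinner f g = cinner f' g"
  then have "cinner (f - f') (f - f') = 0" by (simp add: cinner_diff_left)
  then show ?thesis by (simp add: cinner_norm)
qed

lemma cinner_eqI_right: "(\<And>g. cinner g f = cinner g f') \<Longrightarrow> f = f'"
  by (rule cinner_eqI) (metis cinner_cnj)

lemma norm_le_cinnerI:
  assumes "\<And>g. cmod (cinner f g) \<le> K * norm g"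
  shows "norm f \<le> K"
proof (cases "f = 0")
  case True
  show ?thesis
  proof (cases "\<exists>g :: 'a bergman. g \<noteq> 0")
    case True
    then obtain g :: "'a bergman" where "g \<noteq> 0" by blast
    then show ?thesis using order_trans[OF norm_ge_zero assms[of g]] \<open>f = 0\<close> by (simp add: zero_le_mult_iff)
  next
    case False
    \<comment> \<open>The kernel at the origin is the constant 1 on the polydisc, hence the Bergman
      space is not trivial.\<close>
    have "normalized_kernel 0 = (0 :: 'a bergman)" using False by blast
    then have "eval (normalized_kernel 0 :: 'a bergman) 0 = 0" by (simp add: zero_bergman.rep_eq)
    then show ?thesis by (simp add: eval_normalized_kernel zero_in_polydisc)
  qed
next
  case False
  have "(norm f)\<^sup>2 \<le> K * norm f" using assms[of f] by (simp add: cinner_norm norm_power)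
  then show ?thesis using False by (simp add: power2_eq_square)
qed

text \<open>The real theorem represents the real part of \<open>\<phi>\<close>; applying that to
  \<open>- \<i>\<close> times \<open>h\<close> recovers the imaginary part.\<close>

lemma riesz_bergman:
  fixes \<phi> :: "'n::finite bergman \<Rightarrow> complex"
  assumes add: "\<And>f g. \<phi> (f + g) = \<phi> f + \<phi> g" and scale: "\<And>c f. \<phi> (scale_vec c f) = c * \<phi> f"
    and bound: "\<And>f. cmod (\<phi> f) \<le> K * norm f"
  obtains g where "\<And>h. \<phi> h = cinner h g"
proof -
  have "bounded_linear (\<lambda>h. Re (\<phi> h))"
  proof (rule bounded_linear_intro[where K = K])
    show "Re (\<phi> (r *\<^sub>R x)) = r *\<^sub>R Re (\<phi> x)" for r x
      by (simp add: scale_vec_of_real[symmetric] scale)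
    show "norm (Re (\<phi> x)) \<le> norm x * K" for x
      using bound[of x] abs_Re_le_cmod[of "\<phi> x"] by (simp add: mult.commute)
  qed (simp add: add)
  then obtain g where g: "\<And>h. Re (\<phi> h) = h \<bullet> g" by (rule riesz_real) blast
  have Re: "Re (\<phi> h) = Re (cinner h g)" for h using g by (simp add: inner_bergman_def)
  have "Im (\<phi> h) = Im (cinner h g)" for h
    using Re[of "scale_vec (- \<i>) h"] by (simp add: scale cinner_scale_left)
  then have "\<phi> h = cinner h g" for h using Re by (simp add: complex_eq_iff)
  then show ?thesis by (rule that)
qed

lemma op_norm_le_cinnerI:
  fixes A :: "'n::finite op"
  assumes "0 \<le> e" "\<And>h g. cmod (cinner (A h) g) \<le> e * norm h * norm g"
  shows "norm A \<le> e"
  by (rule norm_blinfun_bound[OF assms(1)]) (rule norm_le_cinnerI[OF assms(2)])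

lemma adjoint_op_eq:
  fixes A B :: "'n::finite op"
  assumes "\<And>f g. cinner (A f) g = cinner f (B g)"
  shows "adjoint_op A = B"
  unfolding adjoint_op_def
proof (rule the_equality)
  show "\<forall>f g. cinner (A f) g = cinner f (B g)" using assms by blast
  fix B' :: "'n op" assume "\<forall>f g. cinner (A f) g = cinner f (B' g)"
  then show "B' = B" by (intro blinfun_eqI cinner_eqI_right) (metis assms)
qed

text \<open>\<open>adjoint_op\<close> is a definite description, so an operator with the defining
  property must be produced: Riesz gives it pointwise, and uniqueness makes it linear and
  bounded.\<close>

lemma adjoint_op:
  fixes A :: "'n::finite op"
  assumes A: "clinear_op A"
  shows "cinner (A f) g = cinner f (adjoint_op A g)"
proof -
  have "\<exists>b. \<forall>f. cinner (A f) g = cinner f b" for g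
  proof -
    have "cmod (cinner (A f) g) \<le> (norm A * norm g) * norm f" for f
      using order_trans[OF cmod_cinner_le mult_right_mono[OF norm_blinfun[of A f], of "norm g"]]
      by (simp add: mult_ac)
    then show ?thesis
      using riesz_bergman[of "\<lambda>f. cinner (A f) g" "norm A * norm g"] A
      by (simp add: clinear_op_def blinfun.add_right cinner_add_left cinner_scale_left) metis
  qed
  then obtain b where b: "\<And>f g. cinner (A f) g = cinner f (b g)" by metis
  have "bounded_linear b"
  proof (rule bounded_linear_intro[where K = "norm A"])
    show "b (x + y) = b x + b y" for x y
      by (rule cinner_eqI_right) (simp add: b[symmetric] cinner_add_right)
    show "b (r *\<^sub>R x) = r *\<^sub>R b x" for r x
      by (rule cinner_eqI_right) (simp add: b[symmetric] cinner_scale_right scale_vec_of_real[symmetric])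
    show "norm (b x) \<le> norm x * norm A" for x
    proof (rule norm_le_cinnerI)
      fix g
      have "cmod (cinner (b x) g) = cmod (cinner (A g) x)"
        by (metis b cinner_cnj complex_mod_cnj)
      also have "\<dots> \<le> norm (A g) * norm x" by (rule cmod_cinner_le)
      also have "\<dots> \<le> norm A * norm g * norm x" by (intro mult_right_mono norm_blinfun) auto
      finally show "cmod (cinner (b x) g) \<le> norm x * norm A * norm g" by (simp add: mult_ac)
    qed
  qed
  then have "adjoint_op A = Blinfun b"
    by (intro adjoint_op_eq) (simp add: bounded_linear_Blinfun_apply b)
  then show ?thesis using b \<open>bounded_linear b\<close> by (simp add: bounded_linear_Blinfun_apply)
qed

section \<open>Toeplitz operators and their forms\<close>

text \<open>A Lebesgue measurable function agrees almost everywhere with a Borel one; setting it to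
  0 where it exceeds the essential bound makes the bound hold everywhere.\<close>

lemma Linfty_borel:
  fixes f :: "complex ^ 'n \<Rightarrow> complex"
  assumes "f \<in> Linfty"
  obtains g C where "g \<in> borel_measurable borel" "\<And>z. cmod (g z) \<le> C" "AE z in dv. f z = g z"
proof -
  obtain C where f: "f \<in> borel_measurable lebesgue" and C: "AE z in dv. cmod (f z) \<le> C"
    using assms measurable_cong_sets[OF sets_dv refl, of borel] by (auto simp: Linfty_def)
  have "(\<lambda>z. Re (f z)) \<in> borel_measurable lebesgue" "(\<lambda>z. Im (f z)) \<in> borel_measurable lebesgue"
    using f by (auto intro: borel_measurable_continuous_on[of Re] borel_measurable_continuous_on[of Im] continuous_intros)
  from this[THEN completion_ex_borel_measurable_real]
  obtain a b where ab: "a \<in> borel_measurable lborel" "AE z in lborel. Re (f z) = a z"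
      "b \<in> borel_measurable lborel" "AE z in lborel. Im (f z) = b z"
    by blast
  define g where "g z = (if cmod (Complex (a z) (b z)) \<le> C then Complex (a z) (b z) else 0)" for z
  have [measurable]: "a \<in> borel_measurable borel" "b \<in> borel_measurable borel" using ab by auto
  have [measurable]: "(\<lambda>z. Complex (a z) (b z)) \<in> borel_measurable borel"
    unfolding Complex_eq by measurable
  show ?thesis
  proof (rule that)
    show "g \<in> borel_measurable borel" unfolding g_def[abs_def] by measurable
    show "cmod (g z) \<le> max C 0" for z by (auto simp: g_def)
    have "AE z in lebesgue. Re (f z) = a z" "AE z in lebesgue. Im (f z) = b z"
      using ab by (auto intro: AE_completion)
    then have "AE z in lebesgue. f z = Complex (a z) (b z)"
      by eventually_elim (simp add: complex_eq_iff)
    then have "AE z in dv. f z = Complex (a z) (b z)"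
      unfolding AE_dv by eventually_elim simp
    with C show "AE z in dv. f z = g z"
      by eventually_elim (simp add: g_def)
  qed
qed

lemma toeplitz_cong_AE:
  fixes f g :: "complex ^ 'n::finite \<Rightarrow> complex"
  assumes [measurable]: "f \<in> borel_measurable dv" "g \<in> borel_measurable dv" and eq: "AE z in dv. f z = g z"
  shows "toeplitz f = toeplitz g"
proof -
  have em [measurable]: "eval h \<in> borel_measurable dv" for h :: "'n bergman"
    by (rule borel_imp_measurable_dv) measurable
  have "(\<integral>z. (f z * eval h z - eval k z) * cnj (eval l z) \<partial>dv) = (\<integral>z. (g z * eval h z - eval k z) * cnj (eval l z) \<partial>dv)"
    for h k l :: "'n bergman"
  proof (rule integral_cong_AE)
    show "AE z in dv. (f z * eval h z - eval k z) * cnj (eval l z) = (g z * eval h z - eval k z) * cnj (eval l z)"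
      using eq by eventually_elim simp
  qed measurable
  then show ?thesis unfolding toeplitz_def bergman_proj_def by simp
qed

lemma bounded_borel_Linfty:
  "f \<in> borel_measurable borel \<Longrightarrow> (\<And>z. cmod (f z) \<le> C) \<Longrightarrow> f \<in> Linfty"
  unfolding Linfty_def using borel_imp_measurable_dv by (blast intro: AE_I2)

lemma cauchy_schwarz_eval: "(\<integral>z. cmod (eval h z) * cmod (eval g z) \<partial>dvb) \<le> norm h * norm g"
proof -
  have i: "integrable dvb (\<lambda>z. cmod (eval h z) * cmod (eval g z))"
    using Bochner_Integration.integrable_norm[OF integrable_eval_cnj[of h g]] by (simp add: norm_mult)
  have "(ennreal (\<integral>z. cmod (eval h z) * cmod (eval g z) \<partial>dvb))\<^sup>2 =
     (\<integral>\<^sup>+z. ennreal (cmod (eval h z)) * ennreal (cmod (eval g z)) \<partial>dvb)\<^sup>2"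
    by (subst nn_integral_eq_integral[OF i, symmetric]) (auto simp: ennreal_mult)
  also have "\<dots> \<le> (\<integral>\<^sup>+z. (ennreal (cmod (eval h z)))\<^sup>2 \<partial>dvb) * (\<integral>\<^sup>+z. (ennreal (cmod (eval g z)))\<^sup>2 \<partial>dvb)"
    by (rule Cauchy_Schwarz_nn_integral) measurable
  also have "\<dots> = ennreal ((norm h)\<^sup>2) * ennreal ((norm g)\<^sup>2)"
    by (simp add: ennreal_power nn_norm_sq)
  finally have "(\<integral>z. cmod (eval h z) * cmod (eval g z) \<partial>dvb)\<^sup>2 \<le> (norm h * norm g)\<^sup>2"
    by (simp add: ennreal_power ennreal_mult[symmetric] power_mult_distrib Bochner_Integration.integral_nonneg)
  then show ?thesis by (rule power2_le_imp_le) simp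
qed

lemma integrable_bounded_sesq:
  assumes [measurable]: "f \<in> borel_measurable borel" and b: "\<And>z. cmod (f z) \<le> C"
  shows "integrable dvb (\<lambda>z. f z * (eval h z * cnj (eval g z)))"
proof (rule Bochner_Integration.integrable_bound)
  show "integrable dvb (\<lambda>z. C * (cmod (eval h z) * cmod (eval g z)))"
    using Bochner_Integration.integrable_norm[OF integrable_eval_cnj[of h g]] by (simp add: norm_mult)
  show "AE z in dvb. norm (f z * (eval h z * cnj (eval g z))) \<le> norm (C * (cmod (eval h z) * cmod (eval g z)))"
  proof (rule AE_I2)
    fix z
    have "0 \<le> C" using order_trans[OF norm_ge_zero b] .
    then show "norm (f z * (eval h z * cnj (eval g z))) \<le> norm (C * (cmod (eval h z) * cmod (eval g z)))"
      using b[of z] by (simp add: norm_mult mult_right_mono)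
  qed
qed measurable

lemma bounded_sesq_le:
  assumes [measurable]: "f \<in> borel_measurable borel" and b: "\<And>z. cmod (f z) \<le> C"
  shows "cmod (\<integral>z. f z * (eval h z * cnj (eval g z)) \<partial>dvb) \<le> C * norm h * norm g"
proof -
  have C: "0 \<le> C" using order_trans[OF norm_ge_zero b] .
  have "cmod (\<integral>z. f z * (eval h z * cnj (eval g z)) \<partial>dvb) \<le> (\<integral>z. cmod (f z * (eval h z * cnj (eval g z))) \<partial>dvb)"
    by (rule integral_norm_bound)
  also have "\<dots> \<le> (\<integral>z. C * (cmod (eval h z) * cmod (eval g z)) \<partial>dvb)"
  proof (rule integral_mono)
    show "integrable dvb (\<lambda>z. cmod (f z * (eval h z * cnj (eval g z))))"
      by (rule Bochner_Integration.integrable_norm[OF integrable_bounded_sesq[OF assms]])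
    show "integrable dvb (\<lambda>z. C * (cmod (eval h z) * cmod (eval g z)))"
      using Bochner_Integration.integrable_norm[OF integrable_eval_cnj[of h g]] by (simp add: norm_mult)
    show "cmod (f z * (eval h z * cnj (eval g z))) \<le> C * (cmod (eval h z) * cmod (eval g z))" for z
      using b[of z] by (simp add: norm_mult mult_right_mono)
  qed
  also have "\<dots> \<le> C * (norm h * norm g)"
    using C cauchy_schwarz_eval[of h g] by (simp add: mult_left_mono)
  finally show ?thesis by (simp add: mult.assoc)
qed

text \<open>Both \<open>bergman_proj\<close> and \<open>toeplitz\<close> hide existence claims: the
  Riesz vector of the form is shown to satisfy the description of the projection, and the resulting
  map is shown to be bounded before \<open>Blinfun\<close> is opened.\<close>

lemma
  fixes f :: "complex ^ 'n::finite \<Rightarrow> complex"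
  assumes f [measurable]: "f \<in> borel_measurable borel" and b: "\<And>z. cmod (f z) \<le> C"
  shows cinner_toeplitz: "cinner (toeplitz f h) g = (\<integral>z. f z * (eval h z * cnj (eval g z)) \<partial>dvb)"
    and clinear_toeplitz: "clinear_op (toeplitz f)"
proof -
  define T where "T h = bergman_proj (\<lambda>z. f z * eval h z)" for h :: "'n bergman"
  have T: "cinner (T h) g = (\<integral>z. f z * (eval h z * cnj (eval g z)) \<partial>dvb)" for h g
  proof -
    have int: "integrable dvb (\<lambda>z. f z * (eval h z * cnj (eval g z)))" for g
      by (rule integrable_bounded_sesq[OF f b])
    \<comment> \<open>The form is antilinear in \<open>g\<close>; conjugation makes it linear, as
      \<open>riesz_bergman\<close> requires.\<close>
    define \<phi> where "\<phi> g = cnj (\<integral>z. f z * (eval h z * cnj (eval g z)) \<partial>dvb)" for g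
    have "\<phi> (g + k) = \<phi> g + \<phi> k" for g k
    proof -
      have "(\<integral>z. f z * (eval h z * cnj (eval (g + k) z)) \<partial>dvb) =
        (\<integral>z. f z * (eval h z * cnj (eval g z)) + f z * (eval h z * cnj (eval k z)) \<partial>dvb)"
        by (simp add: plus_bergman.rep_eq distrib_left)
      then show ?thesis unfolding \<phi>_def by (simp add: int)
    qed
    moreover have "\<phi> (scale_vec c g) = c * \<phi> g" for c g
    proof -
      have "(\<integral>z. f z * (eval h z * cnj (eval (scale_vec c g) z)) \<partial>dvb) =
        (\<integral>z. cnj c * (f z * (eval h z * cnj (eval g z))) \<partial>dvb)"
        by (simp add: scale_vec.rep_eq mult_ac)
      then show ?thesis unfolding \<phi>_def by simp
    qed
    moreover have "cmod (\<phi> g) \<le> (C * norm h) * norm g" for g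
      unfolding \<phi>_def using bounded_sesq_le[OF f b, of h g] by simp
    ultimately obtain p where p: "\<And>g. \<phi> g = cinner g p"
      by (rule riesz_bergman) blast
    have pg: "cinner p g = (\<integral>z. f z * (eval h z * cnj (eval g z)) \<partial>dvb)" for g
      using p[of g] unfolding \<phi>_def by (metis cinner_cnj complex_cnj_cnj)
    have split: "(\<integral>z. (f z * eval h z - eval k z) * cnj (eval g z) \<partial>dv) =
       (\<integral>z. f z * (eval h z * cnj (eval g z)) \<partial>dvb) - cinner k g" for k g
    proof -
      have "(\<integral>z. (f z * eval h z - eval k z) * cnj (eval g z) \<partial>dv) =
        (\<integral>z. (f z * eval h z - eval k z) * cnj (eval g z) \<partial>dvb)"
        by (rule integral_dv_eq) measurable
      also have "\<dots> = (\<integral>z. f z * (eval h z * cnj (eval g z)) - eval k z * cnj (eval g z) \<partial>dvb)"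
        by (simp add: left_diff_distrib mult.assoc)
      also have "\<dots> = (\<integral>z. f z * (eval h z * cnj (eval g z)) \<partial>dvb) - cinner k g"
        unfolding cinner_dvb by (rule Bochner_Integration.integral_diff[OF int integrable_eval_cnj])
      finally show ?thesis .
    qed
    have "T h = p"
      unfolding T_def bergman_proj_def
    proof (rule the_equality)
      show "\<forall>g. (\<integral>z. (f z * eval h z - eval p z) * cnj (eval g z) \<partial>dv) = 0"
        by (simp add: split pg)
      fix k assume "\<forall>g. (\<integral>z. (f z * eval h z - eval k z) * cnj (eval g z) \<partial>dv) = 0"
      then show "k = p" by (intro cinner_eqI) (simp add: split pg)
    qed
    then show ?thesis by (simp add: pg)
  qed
  have int: "integrable dvb (\<lambda>z. f z * (eval h z * cnj (eval g z)))" for h g :: "'n bergman"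
    by (rule integrable_bounded_sesq[OF f b])
  have Tadd: "T (x + y) = T x + T y" for x y
  proof (rule cinner_eqI)
    fix g
    have "(\<integral>z. f z * (eval (x + y) z * cnj (eval g z)) \<partial>dvb) =
      (\<integral>z. f z * (eval x z * cnj (eval g z)) + f z * (eval y z * cnj (eval g z)) \<partial>dvb)"
      by (simp add: plus_bergman.rep_eq distrib_left distrib_right)
    then show "cinner (T (x + y)) g = cinner (T x + T y) g" by (simp add: T cinner_add_left int)
  qed
  have Tscale: "T (scale_vec c x) = scale_vec c (T x)" for c x
  proof (rule cinner_eqI)
    fix g
    have "(\<integral>z. f z * (eval (scale_vec c x) z * cnj (eval g z)) \<partial>dvb) =
      (\<integral>z. c * (f z * (eval x z * cnj (eval g z))) \<partial>dvb)"
      by (simp add: scale_vec.rep_eq mult_ac)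
    then show "cinner (T (scale_vec c x)) g = cinner (scale_vec c (T x)) g" by (simp add: T cinner_scale_left)
  qed
  have "bounded_linear T"
  proof (rule bounded_linear_intro[where K = C])
    show "T (r *\<^sub>R x) = r *\<^sub>R T x" for r x by (simp add: scale_vec_of_real[symmetric] Tscale)
    show "norm (T x) \<le> norm x * C" for x
      by (rule norm_le_cinnerI) (use bounded_sesq_le[OF f b, of x] in \<open>simp add: T mult_ac\<close>)
  qed (rule Tadd)
  then have app: "toeplitz f h = T h" for h
    unfolding toeplitz_def T_def[symmetric] by (simp add: bounded_linear_Blinfun_apply)
  show "cinner (toeplitz f h) g = (\<integral>z. f z * (eval h z * cnj (eval g z)) \<partial>dvb)"
    by (simp add: app T)
  show "clinear_op (toeplitz f)" by (simp add: clinear_op_def app Tscale)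
qed

section \<open>Sesquilinear forms that are norm limits of Toeplitz forms\<close>

definition toeplitz_form :: "(complex ^ 'n \<Rightarrow> complex) \<Rightarrow> 'n::finite bergman \<Rightarrow> 'n bergman \<Rightarrow> complex" where
  "toeplitz_form f h g = (\<integral>z. f z * (eval h z * cnj (eval g z)) \<partial>dvb)"

text \<open>Stated for arbitrary functions of two vectors, not for operators, so that integrals of
  point evaluations over \<open>M\<close> can be handled before any operator is known to induce
  them. The bound relative to \<open>norm h * norm g\<close> is the operator norm once there is an
  operator.\<close>

definition approx_form :: "('n::finite bergman \<Rightarrow> 'n bergman \<Rightarrow> complex) \<Rightarrow> bool" where
  "approx_form q \<longleftrightarrow> (\<forall>e>0. \<exists>f C. f \<in> borel_measurable borel \<and> (\<forall>z. cmod (f z) \<le> C) \<and>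
     (\<forall>h g. cmod (q h g - toeplitz_form f h g) \<le> e * norm h * norm g))"

lemma approx_formE:
  assumes "approx_form q" "e > 0"
  obtains f C where "f \<in> borel_measurable borel" "\<And>z. cmod (f z) \<le> C"
     "\<And>h g. cmod (q h g - toeplitz_form f h g) \<le> e * norm h * norm g"
  using assms unfolding approx_form_def by blast

lemma approx_form_toeplitz:
  "f \<in> borel_measurable borel \<Longrightarrow> (\<And>z. cmod (f z) \<le> C) \<Longrightarrow> approx_form (toeplitz_form f)"
  unfolding approx_form_def by (intro allI impI exI[of _ f] exI[of _ C] conjI) simp_all

lemma approx_form_limit:
  assumes "\<And>e. e > 0 \<Longrightarrow> \<exists>q'. approx_form q' \<and> (\<forall>h g. cmod (q h g - q' h g) \<le> e * norm h * norm g)"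
  shows "approx_form q"
  unfolding approx_form_def
proof (intro allI impI)
  fix e :: real assume "e > 0"
  then obtain q' where q': "approx_form q'" "\<And>h g. cmod (q h g - q' h g) \<le> e / 2 * norm h * norm g"
    using assms[of "e / 2"] by auto
  obtain f C where f: "f \<in> borel_measurable borel" "\<And>z. cmod (f z) \<le> C"
     "\<And>h g. cmod (q' h g - toeplitz_form f h g) \<le> e / 2 * norm h * norm g"
    using approx_formE[OF q'(1), of "e / 2"] \<open>e > 0\<close> by (metis half_gt_zero)
  have "cmod (q h g - toeplitz_form f h g) \<le> e * norm h * norm g" for h g
    using norm_triangle_ineq[of "q h g - q' h g" "q' h g - toeplitz_form f h g"] q'(2)[of h g] f(3)[of h g]
    by simp
  then show "\<exists>f C. f \<in> borel_measurable borel \<and> (\<forall>z. cmod (f z) \<le> C) \<and>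
     (\<forall>h g. cmod (q h g - toeplitz_form f h g) \<le> e * norm h * norm g)"
    using f by blast
qed

lemma approx_form_add:
  assumes "approx_form p" "approx_form q"
  shows "approx_form (\<lambda>h g. p h g + q h g)"
  unfolding approx_form_def
proof (intro allI impI)
  fix e :: real assume e: "e > 0"
  then have e2: "e / 2 > 0" by simp
  obtain f C where f: "f \<in> borel_measurable borel" "\<And>z. cmod (f z) \<le> C"
     "\<And>h g. cmod (p h g - toeplitz_form f h g) \<le> e / 2 * norm h * norm g"
    using approx_formE[OF assms(1) e2] by metis
  obtain f' C' where f': "f' \<in> borel_measurable borel" "\<And>z. cmod (f' z) \<le> C'"
     "\<And>h g. cmod (q h g - toeplitz_form f' h g) \<le> e / 2 * norm h * norm g"
    using approx_formE[OF assms(2) e2] by metis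
  have "cmod ((p h g + q h g) - toeplitz_form (\<lambda>z. f z + f' z) h g) \<le> e * norm h * norm g" for h g
  proof -
    have "toeplitz_form (\<lambda>z. f z + f' z) h g = toeplitz_form f h g + toeplitz_form f' h g"
      unfolding toeplitz_form_def distrib_right
      by (intro Bochner_Integration.integral_add integrable_bounded_sesq[OF f(1,2)] integrable_bounded_sesq[OF f'(1,2)])
    then have "(p h g + q h g) - toeplitz_form (\<lambda>z. f z + f' z) h g = (p h g - toeplitz_form f h g) + (q h g - toeplitz_form f' h g)"
      by simp
    then show ?thesis
      using norm_triangle_ineq[of "p h g - toeplitz_form f h g" "q h g - toeplitz_form f' h g"] f(3)[of h g] f'(3)[of h g]
      by (simp only:)
  qed
  moreover have "cmod (f z + f' z) \<le> C + C'" for z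
    using norm_triangle_ineq[of "f z" "f' z"] f(2)[of z] f'(2)[of z] by simp
  ultimately show "\<exists>f C. f \<in> borel_measurable borel \<and> (\<forall>z. cmod (f z) \<le> C) \<and>
     (\<forall>h g. cmod ((p h g + q h g) - toeplitz_form f h g) \<le> e * norm h * norm g)"
    using f(1) f'(1) by (intro exI[of _ "\<lambda>z. f z + f' z"] exI[of _ "C + C'"]) auto
qed

lemma approx_form_cmult:
  assumes "approx_form p"
  shows "approx_form (\<lambda>h g. c * p h g)"
  unfolding approx_form_def
proof (intro allI impI)
  fix e :: real assume e: "e > 0"
  then have e2: "e / (cmod c + 1) > 0" by (intro divide_pos_pos) (auto intro: add_nonneg_pos)
  obtain f C where f: "f \<in> borel_measurable borel" "\<And>z. cmod (f z) \<le> C"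
     "\<And>h g. cmod (p h g - toeplitz_form f h g) \<le> e / (cmod c + 1) * norm h * norm g"
    using approx_formE[OF assms(1) e2] by metis
  have "cmod (c * p h g - toeplitz_form (\<lambda>z. c * f z) h g) \<le> e * norm h * norm g" for h g
  proof -
    have "toeplitz_form (\<lambda>z. c * f z) h g = c * toeplitz_form f h g"
      unfolding toeplitz_form_def mult.assoc by simp
    then have "cmod (c * p h g - toeplitz_form (\<lambda>z. c * f z) h g) = cmod c * cmod (p h g - toeplitz_form f h g)"
      by (simp add: right_diff_distrib[symmetric] norm_mult)
    also have "\<dots> \<le> (cmod c + 1) * (e / (cmod c + 1) * norm h * norm g)"
      by (intro mult_mono f(3)) auto
    also have "\<dots> = e * norm h * norm g"
      using norm_ge_zero[of c] by (simp add: add_nonneg_eq_0_iff)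
    finally show ?thesis .
  qed
  moreover have "cmod (c * f z) \<le> cmod c * C" for z
    using f(2)[of z] by (simp add: norm_mult mult_left_mono)
  ultimately show "\<exists>f C. f \<in> borel_measurable borel \<and> (\<forall>z. cmod (f z) \<le> C) \<and>
     (\<forall>h g. cmod (c * p h g - toeplitz_form f h g) \<le> e * norm h * norm g)"
    using f(1) by (intro exI[of _ "\<lambda>z. c * f z"] exI[of _ "cmod c * C"]) auto
qed

lemma approx_form_0: "approx_form (\<lambda>h g. 0)"
  using approx_form_toeplitz[of "\<lambda>_. 0" 0] by (simp add: toeplitz_form_def[abs_def])

lemma approx_form_sum: "(\<And>i. i \<in> I \<Longrightarrow> approx_form (p i)) \<Longrightarrow> approx_form (\<lambda>h g. \<Sum>i\<in>I. p i h g)"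
  by (induction I rule: infinite_finite_induct) (simp_all add: approx_form_0 approx_form_add)

lemma approx_form_adjoint:
  assumes "approx_form p"
  shows "approx_form (\<lambda>h g. cnj (p g h))"
  unfolding approx_form_def
proof (intro allI impI)
  fix e :: real assume e: "e > 0"
  obtain f C where f: "f \<in> borel_measurable borel" "\<And>z. cmod (f z) \<le> C"
     "\<And>h g. cmod (p h g - toeplitz_form f h g) \<le> e * norm h * norm g"
    using approx_formE[OF assms(1) e] by metis
  have "cmod (cnj (p g h) - toeplitz_form (\<lambda>z. cnj (f z)) h g) \<le> e * norm h * norm g" for h g
  proof -
    have "toeplitz_form (\<lambda>z. cnj (f z)) h g = (\<integral>z. cnj (f z * (eval g z * cnj (eval h z))) \<partial>dvb)"
      unfolding toeplitz_form_def by (simp add: mult_ac)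
    also have "\<dots> = cnj (toeplitz_form f g h)"
      unfolding toeplitz_form_def by (rule Bochner_Integration.integral_cnj)
    finally have "cmod (cnj (p g h) - toeplitz_form (\<lambda>z. cnj (f z)) h g) = cmod (p g h - toeplitz_form f g h)"
      by (metis complex_cnj_diff complex_mod_cnj)
    then show ?thesis using f(3)[of g h] by (simp add: mult_ac)
  qed
  then show "\<exists>f C. f \<in> borel_measurable borel \<and> (\<forall>z. cmod (f z) \<le> C) \<and>
     (\<forall>h g. cmod (cnj (p g h) - toeplitz_form f h g) \<le> e * norm h * norm g)"
    using f(1,2) by (intro exI[of _ "\<lambda>z. cnj (f z)"] exI[of _ C]) auto
qed

abbreviation toeplitz_closure :: "'n::finite op set" where
  "toeplitz_closure \<equiv> closure {toeplitz f | f. f \<in> Linfty}"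

lemma toeplitz_Linfty:
  assumes "f \<in> Linfty"
  obtains f0 C where "f0 \<in> borel_measurable borel" "\<And>z. cmod (f0 z) \<le> C" "toeplitz f = toeplitz f0"
proof -
  obtain g C where g: "g \<in> borel_measurable borel" "\<And>z. cmod (g z) \<le> C" "AE z in dv. f z = g z"
    using Linfty_borel[OF assms] by metis
  have "f \<in> borel_measurable dv" using assms by (simp add: Linfty_def)
  then show ?thesis
    using that[OF g(1,2)] toeplitz_cong_AE[OF _ borel_imp_measurable_dv[OF g(1)] g(3)] by blast
qed

text \<open>The operator norm is the norm of the associated form, and by
  \<open>toeplitz_Linfty\<close> symbols may be taken Borel and bounded everywhere.\<close>

lemma toeplitz_closure_iff:
  fixes A :: "'n::finite op"
  shows "A \<in> toeplitz_closure \<longleftrightarrow> approx_form (\<lambda>h g. cinner (A h) g)"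
proof
  assume A: "A \<in> toeplitz_closure"
  show "approx_form (\<lambda>h g. cinner (A h) g)"
    unfolding approx_form_def
  proof (intro allI impI)
    fix e :: real assume "e > 0"
    then obtain f where f: "f \<in> Linfty" "dist (toeplitz f) A < e"
      using A unfolding closure_approachable by blast
    obtain f0 C where f0: "f0 \<in> borel_measurable borel" "\<And>z. cmod (f0 z) \<le> C" "toeplitz f = toeplitz f0"
      using toeplitz_Linfty[OF f(1)] by metis
    have "cmod (cinner (A h) g - toeplitz_form f0 h g) \<le> e * norm h * norm g" for h g
    proof -
      have "cinner (A h) g - toeplitz_form f0 h g = cinner ((A - toeplitz f0) h) g"
        unfolding toeplitz_form_def cinner_toeplitz[OF f0(1,2), symmetric]
        by (simp add: blinfun.diff_left cinner_diff_left)
      also have "cmod \<dots> \<le> norm ((A - toeplitz f0) h) * norm g" by (rule cmod_cinner_le)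
      also have "\<dots> \<le> norm (A - toeplitz f0) * norm h * norm g"
        by (intro mult_right_mono norm_blinfun) auto
      also have "\<dots> \<le> e * norm h * norm g"
        using f(2) f0(3) by (intro mult_right_mono) (auto simp: dist_norm norm_minus_commute)
      finally show ?thesis .
    qed
    then show "\<exists>f C. f \<in> borel_measurable borel \<and> (\<forall>z. cmod (f z) \<le> C) \<and>
     (\<forall>h g. cmod (cinner (A h) g - toeplitz_form f h g) \<le> e * norm h * norm g)"
      using f0 by blast
  qed
next
  assume A: "approx_form (\<lambda>h g. cinner (A h) g)"
  show "A \<in> toeplitz_closure"
    unfolding closure_approachable
  proof (intro allI impI)
    fix e :: real assume "e > 0"
    then have e2: "e / 2 > 0" by simp
    obtain f C where f: "f \<in> borel_measurable borel" "\<And>z. cmod (f z) \<le> C"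
      "\<And>h g. cmod (cinner (A h) g - toeplitz_form f h g) \<le> e / 2 * norm h * norm g"
      using approx_formE[OF A e2] by metis
    have "norm (A - toeplitz f) \<le> e / 2"
      using f(3) e2 unfolding toeplitz_form_def cinner_toeplitz[OF f(1,2), symmetric]
      by (intro op_norm_le_cinnerI) (auto simp: blinfun.diff_left cinner_diff_left)
    then show "\<exists>T\<in>{toeplitz f | f. f \<in> Linfty}. dist T A < e"
      using \<open>e > 0\<close> bounded_borel_Linfty[OF f(1,2)]
      by (intro bexI[of _ "toeplitz f"]) (auto simp: dist_norm norm_minus_commute)
  qed
qed

section \<open>Uniformly locally finite measures\<close>

lemma measurable_mobU [measurable (raw)]:
  assumes [measurable]: "f \<in> borel_measurable M" "g \<in> borel_measurable M"
  shows "(\<lambda>x. eval (mobU (f x) h) (g x)) \<in> borel_measurable M"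
proof -
  have [measurable]: "Measurable.pred M (\<lambda>x. f x \<in> polydisc)" "Measurable.pred M (\<lambda>x. g x \<in> polydisc)"
    by (rule pred_sets2[of polydisc borel], simp, fact)+
  show ?thesis unfolding eval_mobU by measurable
qed

text \<open>One constant and one radius for all four estimates, possible because
  \<open>locnorm\<close> grows with the radius. The second one splits a difference of products in
  the usual way.\<close>

lemma local_sesq_estimates:
  assumes r: "0 \<le> r" "r < 1"
  obtains C t where "0 \<le> C" "0 \<le> t" "t < 1"
    "\<And>(k :: 'n::finite bergman) (l :: 'n bergman) u v. u \<in> pd r \<Longrightarrow> v \<in> pd r \<Longrightarrow>
       cmod (eval k u * cnj (eval l v)) \<le> C * locnorm t k * locnorm t l"
    "\<And>(k :: 'n bergman) (l :: 'n bergman) u v. u \<in> pd r \<Longrightarrow> v \<in> pd r \<Longrightarrow>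
       cmod (eval k u * cnj (eval l u) - eval k v * cnj (eval l v)) \<le> C * locnorm t k * locnorm t l * norm (u - v)"
    "\<And>k :: 'n bergman. \<And>u. u \<in> pd r \<Longrightarrow> cmod (eval k u) \<le> C * locnorm t k"
    "\<And>k :: 'n bergman. \<And>u v. u \<in> pd r \<Longrightarrow> v \<in> pd r \<Longrightarrow> cmod (eval k u - eval k v) \<le> C * locnorm t k * norm (u - v)"
proof -
  obtain C1 t1 where 1: "0 \<le> C1" "0 \<le> t1" "t1 < 1"
    "\<And>k :: 'n bergman. \<And>u. u \<in> pd r \<Longrightarrow> cmod (eval k u) \<le> C1 * locnorm t1 k"
    using eval_le_locnorm[OF r] by metis
  obtain C2 t2 where 2: "0 \<le> C2" "0 \<le> t2" "t2 < 1"
    "\<And>k :: 'n bergman. \<And>u v. u \<in> pd r \<Longrightarrow> v \<in> pd r \<Longrightarrow> cmod (eval k u - eval k v) \<le> C2 * locnorm t2 k * norm (u - v)"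
    using eval_lipschitz_locnorm[OF r] by metis
  define t where "t = max t1 t2"
  define A where "A = max C1 C2"
  have A: "0 \<le> A" "C1 \<le> A" "C2 \<le> A" using 1 by (auto simp: A_def)
  have t: "0 \<le> t" "t < 1" "t1 \<le> t" "t2 \<le> t" using 1 2 by (auto simp: t_def)
  have e1: "cmod (eval k u) \<le> A * locnorm t k" if "u \<in> pd r" for k :: "'n bergman" and u
    by (rule order_trans[OF 1(4)[OF that]], rule mult_mono[OF A(2) locnorm_mono[OF t(3)]]) (use A in auto)
  have e2: "cmod (eval k u - eval k v) \<le> A * locnorm t k * norm (u - v)" if "u \<in> pd r" "v \<in> pd r" for k :: "'n bergman" and u v
    by (rule order_trans[OF 2(4)[OF that]], rule mult_right_mono[OF mult_mono[OF A(3) locnorm_mono[OF t(4)]]]) (use A in auto)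
  define C where "C = max (2 * A * A) A"
  have C: "0 \<le> C" "2 * A * A \<le> C" "A \<le> C" "A * A \<le> C" using A(1) by (auto simp: C_def le_max_iff_disj)
  have lnn: "0 \<le> locnorm t k * locnorm t l" for k l :: "'n bergman" by simp
  have e3: "cmod (eval k u * cnj (eval l v)) \<le> C * locnorm t k * locnorm t l"
    if uv: "u \<in> pd r" "v \<in> pd r" for k l :: "'n bergman" and u v
  proof -
    have "cmod (eval k u * cnj (eval l v)) \<le> (A * locnorm t k) * (A * locnorm t l)"
      unfolding norm_mult complex_mod_cnj using A by (intro mult_mono e1 uv) auto
    also have "\<dots> = A * A * (locnorm t k * locnorm t l)" by simp
    also have "\<dots> \<le> C * (locnorm t k * locnorm t l)" by (rule mult_right_mono[OF C(4) lnn])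
    finally show ?thesis by (simp add: mult.assoc)
  qed
  have e4: "cmod (eval k u * cnj (eval l u) - eval k v * cnj (eval l v)) \<le> C * locnorm t k * locnorm t l * norm (u - v)"
    if uv: "u \<in> pd r" "v \<in> pd r" for k l :: "'n bergman" and u v
  proof -
    have "eval k u * cnj (eval l u) - eval k v * cnj (eval l v) =
       (eval k u - eval k v) * cnj (eval l u) + eval k v * cnj (eval l u - eval l v)"
      by (simp add: algebra_simps)
    then have "cmod (eval k u * cnj (eval l u) - eval k v * cnj (eval l v)) \<le>
       cmod ((eval k u - eval k v) * cnj (eval l u)) + cmod (eval k v * cnj (eval l u - eval l v))"
      by (metis norm_triangle_ineq)
    also have "\<dots> \<le> (A * locnorm t k * norm (u - v)) * (A * locnorm t l) + (A * locnorm t k) * (A * locnorm t l * norm (u - v))"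
      unfolding norm_mult complex_mod_cnj using A by (intro add_mono mult_mono e1 e2 uv) auto
    also have "\<dots> = 2 * A * A * (locnorm t k * locnorm t l * norm (u - v))" by simp
    also have "\<dots> \<le> C * (locnorm t k * locnorm t l * norm (u - v))" by (rule mult_right_mono[OF C(2)]) simp
    finally show ?thesis by (simp add: mult.assoc)
  qed
  have e5: "cmod (eval k u) \<le> C * locnorm t k" if u: "u \<in> pd r" for k :: "'n bergman" and u
    by (rule order_trans[OF e1[OF u] mult_right_mono[OF C(3)]]) simp
  have e6: "cmod (eval k u - eval k v) \<le> C * locnorm t k * norm (u - v)"
    if uv: "u \<in> pd r" "v \<in> pd r" for k :: "'n bergman" and u v
    by (rule order_trans[OF e2[OF uv] mult_right_mono[OF mult_right_mono[OF C(3)]]]) simp_all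
  show ?thesis by (rule that[OF C(1) t(1,2) e3 e4 e5 e6])
qed

text \<open>The local norm of \<open>mobU z h\<close> is the mass of |h|^2 on the hyperbolic ball
  around \<open>z\<close>, which is what makes integration over \<open>z\<close> a matter of
  counting overlaps.\<close>

lemma locnorm_mobU_nn:
  "ennreal ((locnorm r (mobU z h))\<^sup>2) =
     (\<integral>\<^sup>+x. indicator polydisc z * indicator (pd r) (mob z x) * ennreal ((cmod (eval h x))\<^sup>2) \<partial>dvb)"
proof (cases "z \<in> polydisc")
  case True
  then show ?thesis
    unfolding nn_locnorm_sq by (subst nn_integral_mobU[OF True]) simp_all
next
  case False
  then show ?thesis by (simp add: nn_locnorm_sq eval_mobU)
qed

lemma ennreal_power2_le_imp_le: "a\<^sup>2 \<le> (ennreal b)\<^sup>2 \<Longrightarrow> 0 \<le> b \<Longrightarrow> a \<le> ennreal b"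
proof (cases a)
  case (real x)
  assume "a\<^sup>2 \<le> (ennreal b)\<^sup>2" "0 \<le> b"
  then have "x\<^sup>2 \<le> b\<^sup>2" using real by (simp add: ennreal_power)
  then have "x \<le> b" by (rule power2_le_imp_le) fact
  then show ?thesis using real by (simp add: ennreal_leI)
next
  case top
  assume "a\<^sup>2 \<le> (ennreal b)\<^sup>2" "0 \<le> b"
  then have "(top :: ennreal)\<^sup>2 \<le> ennreal (b\<^sup>2)" using top by (simp add: ennreal_power)
  moreover have "(top :: ennreal)\<^sup>2 = top" by (simp add: power2_eq_square)
  ultimately show ?thesis by (simp add: top_unique)
qed

lemma nn_integral_eval_sq_cmult:
  "(\<integral>\<^sup>+x. c * ennreal ((cmod (eval h x))\<^sup>2) \<partial>dvb) = c * ennreal ((norm h)\<^sup>2)"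
  by (subst nn_integral_cmult) (simp_all add: nn_norm_sq)

lemma nn_integral_eval_sesq_cmult:
  assumes "c < \<infinity>"
  shows "(\<integral>\<^sup>+x. c * ennreal (cmod (eval h x * cnj (eval g x))) \<partial>dvb) < \<infinity>"
proof -
  have "(\<integral>\<^sup>+x. c * ennreal (cmod (eval h x * cnj (eval g x))) \<partial>dvb) = c * (\<integral>\<^sup>+x. ennreal (cmod (eval h x * cnj (eval g x))) \<partial>dvb)"
    by (rule nn_integral_cmult) measurable
  then show ?thesis
    using integrable_eval_cnj[of h g] assms by (simp add: integrable_iff_bounded ennreal_mult_less_top)
qed

text \<open>\<open>loc_fin\<close> bounds the mass of hyperbolic balls of a given radius uniformly
  in the centre. Only the inclusion map is required to be measurable, since for a counting measure
  on a separated set neither the space nor the measurable sets are those of \<open>borel\<close>;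
  statements about \<open>M\<close> accordingly restrict to \<open>z \<in> space M\<close>.\<close>

locale lf_measure = sigma_finite_measure M for M :: "(complex ^ 'n::finite) measure" +
  assumes id_meas [measurable]: "(\<lambda>z. z) \<in> M \<rightarrow>\<^sub>M borel"
    and loc_fin: "\<And>r. 0 \<le> r \<Longrightarrow> r < 1 \<Longrightarrow>
      \<exists>B\<ge>0. \<forall>x\<in>polydisc. (\<integral>\<^sup>+z. indicator polydisc z * indicator (pd r) (mob z x) \<partial>M) \<le> ennreal B"
begin

lemma fst_meas [measurable]: "(\<lambda>p. fst p) \<in> M \<Otimes>\<^sub>M N \<rightarrow>\<^sub>M borel"
  and snd_meas [measurable]: "(\<lambda>p. snd p) \<in> N \<Otimes>\<^sub>M M \<rightarrow>\<^sub>M borel"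
  using measurable_compose[OF measurable_fst id_meas] measurable_compose[OF measurable_snd id_meas] by auto

sublocale pair: pair_sigma_finite M dvb
  by unfold_locales

text \<open>Tonelli: each x contributes |h(x)|^2 times the mass of the z whose ball contains it, and
  that mass is bounded by \<open>B\<close>.\<close>

lemma bessel:
  assumes "0 \<le> r" "r < 1"
  obtains B where "0 \<le> B" "\<And>h. (\<integral>\<^sup>+z. ennreal ((locnorm r (mobU z h))\<^sup>2) \<partial>M) \<le> ennreal (B * (norm h)\<^sup>2)"
proof -
  obtain B where B: "0 \<le> B" "\<And>x. x \<in> polydisc \<Longrightarrow> (\<integral>\<^sup>+z. indicator polydisc z * indicator (pd r) (mob z x) \<partial>M) \<le> ennreal B"
    using loc_fin[OF assms] by blast
  have "(\<integral>\<^sup>+z. ennreal ((locnorm r (mobU z h))\<^sup>2) \<partial>M) \<le> ennreal (B * (norm h)\<^sup>2)" for h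
  proof -
    have m: "(\<lambda>p. indicator polydisc (fst p) * indicator (pd r) (mob (fst p) (snd p)) * ennreal ((cmod (eval h (snd p)))\<^sup>2))
        \<in> borel_measurable (M \<Otimes>\<^sub>M dvb)"
      by measurable
    have "(\<integral>\<^sup>+z. ennreal ((locnorm r (mobU z h))\<^sup>2) \<partial>M) =
       (\<integral>\<^sup>+z. \<integral>\<^sup>+x. indicator polydisc z * indicator (pd r) (mob z x) * ennreal ((cmod (eval h x))\<^sup>2) \<partial>dvb \<partial>M)"
      by (simp add: locnorm_mobU_nn)
    also have "\<dots> = (\<integral>\<^sup>+x. \<integral>\<^sup>+z. indicator polydisc z * indicator (pd r) (mob z x) * ennreal ((cmod (eval h x))\<^sup>2) \<partial>M \<partial>dvb)"
      using pair.Fubini[OF m] by simp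
    also have "\<dots> = (\<integral>\<^sup>+x. (\<integral>\<^sup>+z. indicator polydisc z * indicator (pd r) (mob z x) \<partial>M) * ennreal ((cmod (eval h x))\<^sup>2) \<partial>dvb)"
      by (intro nn_integral_cong nn_integral_multc) measurable
    also have "\<dots> \<le> (\<integral>\<^sup>+x. ennreal B * ennreal ((cmod (eval h x))\<^sup>2) \<partial>dvb)"
    proof (rule nn_integral_mono)
      fix x
      show "(\<integral>\<^sup>+z. indicator polydisc z * indicator (pd r) (mob z x) \<partial>M) * ennreal ((cmod (eval h x))\<^sup>2)
         \<le> ennreal B * ennreal ((cmod (eval h x))\<^sup>2)"
        by (cases "x \<in> polydisc") (auto intro!: mult_right_mono B(2) simp: eval_outside)
    qed
    also have "\<dots> = ennreal B * ennreal ((norm h)\<^sup>2)"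
      by (rule nn_integral_eval_sq_cmult)
    finally show ?thesis using B(1) by (simp add: ennreal_mult)
  qed
  with B(1) show ?thesis by (rule that)
qed

lemma measurable_locnorm: "(\<lambda>z. ennreal (locnorm r (mobU z h))) \<in> borel_measurable M"
proof -
  have "(\<lambda>z. \<integral>w. indicator (pd r) w * (cmod (eval (mobU z h) w))\<^sup>2 \<partial>dvb) \<in> borel_measurable M"
    by (rule dvb.borel_measurable_lebesgue_integral) measurable
  then show ?thesis unfolding locnorm_def by measurable
qed

text \<open>Cauchy-Schwarz in \<open>M\<close> combined with \<open>bessel\<close>. In every
  approximation that follows, \<open>e\<close> is the error of a pointwise estimate in local norms,
  and this lemma turns it into an error of the form.\<close>

lemma sesq_bound:
  assumes "0 \<le> r" "r < 1"
  obtains B where "0 \<le> B"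
    "\<And>F e h g. F \<in> borel_measurable M \<Longrightarrow> 0 \<le> e \<Longrightarrow>
      (\<And>z. z \<in> space M \<Longrightarrow> cmod (F z) \<le> e * locnorm r (mobU z h) * locnorm r (mobU z g)) \<Longrightarrow>
      integrable M F \<and> cmod (\<integral>z. F z \<partial>M) \<le> e * B * norm h * norm g"
proof -
  obtain B where B: "0 \<le> B" "\<And>h. (\<integral>\<^sup>+z. ennreal ((locnorm r (mobU z h))\<^sup>2) \<partial>M) \<le> ennreal (B * (norm h)\<^sup>2)"
    using bessel[OF assms] by blast
  show ?thesis
  proof (rule that[OF B(1)])
    fix F :: "complex ^ 'n \<Rightarrow> complex" and e :: real and h g :: "'n bergman"
    assume F [measurable]: "F \<in> borel_measurable M" and e: "0 \<le> e"
      and le: "\<And>z. z \<in> space M \<Longrightarrow> cmod (F z) \<le> e * locnorm r (mobU z h) * locnorm r (mobU z g)"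
    note m = measurable_locnorm[of r]
    define I where "I = (\<integral>\<^sup>+z. ennreal (locnorm r (mobU z h)) * ennreal (locnorm r (mobU z g)) \<partial>M)"
    have "I\<^sup>2 \<le> (\<integral>\<^sup>+z. (ennreal (locnorm r (mobU z h)))\<^sup>2 \<partial>M) * (\<integral>\<^sup>+z. (ennreal (locnorm r (mobU z g)))\<^sup>2 \<partial>M)"
      unfolding I_def by (rule Cauchy_Schwarz_nn_integral[OF m m])
    also have "\<dots> = (\<integral>\<^sup>+z. ennreal ((locnorm r (mobU z h))\<^sup>2) \<partial>M) * (\<integral>\<^sup>+z. ennreal ((locnorm r (mobU z g))\<^sup>2) \<partial>M)"
      by (simp add: ennreal_power)
    also have "\<dots> \<le> ennreal (B * (norm h)\<^sup>2) * ennreal (B * (norm g)\<^sup>2)"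
      by (rule mult_mono[OF B(2) B(2)]) auto
    also have "\<dots> = (ennreal (B * norm h * norm g))\<^sup>2"
      using B(1) by (simp add: ennreal_power ennreal_mult[symmetric] power_mult_distrib power2_eq_square mult_ac)
    finally have I: "I \<le> ennreal (B * norm h * norm g)"
      by (rule ennreal_power2_le_imp_le) (use B(1) in simp)
    have "(\<integral>\<^sup>+z. ennreal (cmod (F z)) \<partial>M) \<le> (\<integral>\<^sup>+z. ennreal e * (ennreal (locnorm r (mobU z h)) * ennreal (locnorm r (mobU z g))) \<partial>M)"
    proof (rule nn_integral_mono)
      fix z assume "z \<in> space M"
      from ennreal_leI[OF le[OF this]]
      show "ennreal (cmod (F z)) \<le> ennreal e * (ennreal (locnorm r (mobU z h)) * ennreal (locnorm r (mobU z g)))"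
        using e by (simp add: ennreal_mult mult.assoc)
    qed
    also have "\<dots> = ennreal e * I"
      unfolding I_def by (rule nn_integral_cmult) (intro borel_measurable_times_ennreal m)
    also have "\<dots> \<le> ennreal e * ennreal (B * norm h * norm g)"
      by (rule mult_left_mono[OF I]) simp
    also have "\<dots> = ennreal (e * B * norm h * norm g)"
      using e B(1) by (simp add: ennreal_mult[symmetric] mult.assoc)
    finally have *: "(\<integral>\<^sup>+z. ennreal (cmod (F z)) \<partial>M) \<le> ennreal (e * B * norm h * norm g)" .
    then have i: "integrable M F"
      by (intro integrableI_bounded) (auto intro: le_less_trans)
    have "ennreal (cmod (\<integral>z. F z \<partial>M)) \<le> (\<integral>\<^sup>+z. ennreal (cmod (F z)) \<partial>M)"
      by (rule integral_norm_bound_ennreal[OF i])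
    with * have "ennreal (cmod (\<integral>z. F z \<partial>M)) \<le> ennreal (e * B * norm h * norm g)" by (rule order_trans[rotated])
    then have "cmod (\<integral>z. F z \<partial>M) \<le> e * B * norm h * norm g"
      using e B(1) by (simp add: ennreal_le_iff)
    with i show "integrable M F \<and> cmod (\<integral>z. F z \<partial>M) \<le> e * B * norm h * norm g" by blast
  qed
qed

text \<open>By Fubini and \<open>integral_mobU_sesq\<close> the integral is exactly the Toeplitz
  form of the symbol \<open>F\<close>, the superposition of the translates of \<open>p\<close> with
  weights \<open>c\<close>. As \<open>p\<close> lives on \<open>pd r\<close>, local finiteness
  bounds \<open>F\<close>.\<close>

lemma toeplitz_average:
  assumes c [measurable]: "c \<in> borel_measurable M" and cK: "\<And>z. cmod (c z) \<le> K"
    and p [measurable]: "p \<in> borel_measurable borel" and pP: "\<And>u. cmod (p u) \<le> P * indicator (pd r) u"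
    and r: "0 \<le> r" "r < 1"
  shows "approx_form (\<lambda>h g. \<integral>z. c z * (\<integral>u. p u * (eval (mobU z h) u * cnj (eval (mobU z g) u)) \<partial>dvb) \<partial>M)"
proof -
  obtain B where B: "0 \<le> B" "\<And>x. x \<in> polydisc \<Longrightarrow> (\<integral>\<^sup>+z. indicator polydisc z * indicator (pd r) (mob z x) \<partial>M) \<le> ennreal B"
    using loc_fin[OF r] by blast
  have K: "0 \<le> K" using order_trans[OF norm_ge_zero cK] .
  have P: "0 \<le> P" using order_trans[OF norm_ge_zero pP[of 0]] r by (simp add: pd_def)
  \<comment> \<open>The cut-off in x makes \<open>F\<close> bounded everywhere, since local
    finiteness speaks of centres in the polydisc; the one in z matches that \<open>mobU z\<close>
    vanishes outside.\<close>
  define f where "f x z = indicator polydisc x * (indicator polydisc z * c z * p (mob z x))" for x z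
  have fm: "(\<lambda>q. f (fst q) (snd q)) \<in> borel_measurable (borel \<Otimes>\<^sub>M M)"
    unfolding f_def by measurable
  have fle: "cmod (f x z) \<le> K * P * (indicator polydisc z * indicator (pd r) (mob z x))" for x z
  proof -
    have "cmod (f x z) \<le> indicator polydisc z * (cmod (c z) * cmod (p (mob z x)))"
      unfolding f_def norm_mult by (auto simp: indicator_def)
    also have "\<dots> \<le> indicator polydisc z * (K * (P * indicator (pd r) (mob z x)))"
      using K by (intro mult_left_mono mult_mono cK pP) auto
    finally show ?thesis by (simp add: mult_ac)
  qed
  have nnf: "(\<integral>\<^sup>+z. ennreal (cmod (f x z)) \<partial>M) \<le> ennreal (K * P * B)" for x
  proof (cases "x \<in> polydisc")
    case True
    have "(\<integral>\<^sup>+z. ennreal (cmod (f x z)) \<partial>M) \<le> (\<integral>\<^sup>+z. ennreal (K * P) * (indicator polydisc z * indicator (pd r) (mob z x)) \<partial>M)"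
    proof (rule nn_integral_mono)
      fix z
      have "ennreal (cmod (f x z)) \<le> ennreal (K * P * (indicator polydisc z * indicator (pd r) (mob z x)))"
        by (rule ennreal_leI[OF fle])
      also have "\<dots> = ennreal (K * P) * (indicator polydisc z * indicator (pd r) (mob z x))"
        using K P by (auto simp: indicator_def)
      finally show "ennreal (cmod (f x z)) \<le> ennreal (K * P) * (indicator polydisc z * indicator (pd r) (mob z x))" .
    qed
    also have "\<dots> = ennreal (K * P) * (\<integral>\<^sup>+z. indicator polydisc z * indicator (pd r) (mob z x) \<partial>M)"
      by (rule nn_integral_cmult) measurable
    also have "\<dots> \<le> ennreal (K * P) * ennreal B"
      by (rule mult_left_mono[OF B(2)[OF True]]) simp
    finally show ?thesis using K P B(1) by (simp add: ennreal_mult[symmetric])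
  next
    case False
    then show ?thesis by (simp add: f_def)
  qed
  define F where "F x = (\<integral>z. f x z \<partial>M)" for x
  have Fm: "F \<in> borel_measurable borel"
    unfolding F_def using fm by (intro borel_measurable_lebesgue_integral) (simp add: case_prod_beta')
  have fxm: "f x \<in> borel_measurable M" for x
    unfolding f_def[abs_def] by measurable
  have fi: "integrable M (f x)" for x
    by (rule integrableI_bounded[OF fxm]) (rule le_less_trans[OF nnf], simp)
  have Fb: "cmod (F x) \<le> K * P * B" for x
  proof -
    have "ennreal (cmod (F x)) \<le> ennreal (K * P * B)"
      unfolding F_def by (rule order_trans[OF integral_norm_bound_ennreal[OF fi] nnf])
    then show ?thesis using K P B(1) by (simp add: ennreal_le_iff)
  qed
  have "toeplitz_form F h g = (\<integral>z. c z * (\<integral>u. p u * (eval (mobU z h) u * cnj (eval (mobU z g) u)) \<partial>dvb) \<partial>M)" for h g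
  proof -
    define G where "G z x = f x z * (eval h x * cnj (eval g x))" for z x
    have Gm: "(\<lambda>q. G (fst q) (snd q)) \<in> borel_measurable (M \<Otimes>\<^sub>M dvb)"
      unfolding G_def f_def by measurable
    have "(\<integral>\<^sup>+q. ennreal (cmod (G (fst q) (snd q))) \<partial>(M \<Otimes>\<^sub>M dvb)) = (\<integral>\<^sup>+x. \<integral>\<^sup>+z. ennreal (cmod (G z x)) \<partial>M \<partial>dvb)"
      using pair.nn_integral_snd[of "\<lambda>q. ennreal (cmod (G (fst q) (snd q)))"] Gm by simp
    also have "\<dots> = (\<integral>\<^sup>+x. (\<integral>\<^sup>+z. ennreal (cmod (f x z)) \<partial>M) * ennreal (cmod (eval h x * cnj (eval g x))) \<partial>dvb)"
      unfolding G_def norm_mult[of "f _ _"]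
      by (subst ennreal_mult, simp, simp, subst nn_integral_multc) (use fxm in measurable)
    also have "\<dots> \<le> (\<integral>\<^sup>+x. ennreal (K * P * B) * ennreal (cmod (eval h x * cnj (eval g x))) \<partial>dvb)"
      by (rule nn_integral_mono, rule mult_right_mono[OF nnf]) simp
    also have "\<dots> < \<infinity>"
      by (rule nn_integral_eval_sesq_cmult) simp
    finally have "integrable (M \<Otimes>\<^sub>M dvb) (\<lambda>q. G (fst q) (snd q))"
      by (rule integrableI_bounded[OF Gm])
    then have "integrable (M \<Otimes>\<^sub>M dvb) (\<lambda>(z, x). G z x)"
      by (simp add: case_prod_beta')
    from pair.Fubini_integral[OF this]
    have Fub: "(\<integral>x. (\<integral>z. G z x \<partial>M) \<partial>dvb) = (\<integral>z. (\<integral>x. G z x \<partial>dvb) \<partial>M)" .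
    have "toeplitz_form F h g = (\<integral>x. (\<integral>z. G z x \<partial>M) \<partial>dvb)"
      unfolding toeplitz_form_def F_def G_def by simp
    also have "\<dots> = (\<integral>z. c z * (\<integral>u. p u * (eval (mobU z h) u * cnj (eval (mobU z g) u)) \<partial>dvb) \<partial>M)"
      unfolding Fub
    proof (rule Bochner_Integration.integral_cong[OF refl])
      fix z
      show "(\<integral>x. G z x \<partial>dvb) = c z * (\<integral>u. p u * (eval (mobU z h) u * cnj (eval (mobU z g) u)) \<partial>dvb)"
      proof (cases "z \<in> polydisc")
        case True
        have "(\<integral>x. G z x \<partial>dvb) = (\<integral>x. c z * (p (mob z x) * (eval h x * cnj (eval g x))) \<partial>dvb)"
        proof (rule Bochner_Integration.integral_cong[OF refl])
          fix x
          show "G z x = c z * (p (mob z x) * (eval h x * cnj (eval g x)))"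
            by (cases "x \<in> polydisc") (use True in \<open>simp_all add: G_def f_def eval_outside mult.assoc\<close>)
        qed
        also have "\<dots> = c z * (\<integral>x. p (mob z x) * (eval h x * cnj (eval g x)) \<partial>dvb)" by simp
        finally show ?thesis unfolding integral_mobU_sesq[OF True p] .
      next
        case False
        then show ?thesis by (simp add: G_def f_def eval_mobU)
      qed
    qed
    finally show ?thesis .
  qed
  then have "toeplitz_form F = (\<lambda>h g. \<integral>z. c z * (\<integral>u. p u * (eval (mobU z h) u * cnj (eval (mobU z g) u)) \<partial>dvb) \<partial>M)"
    by blast
  then show ?thesis using approx_form_toeplitz[OF Fm Fb] by simp
qed

end

lemma measure_open_pos:
  fixes S :: "(complex ^ 'n) set"
  assumes "open S" "S \<noteq> {}" "S \<subseteq> polydisc"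
  shows "0 < measure dvb S"
proof -
  have "\<not> negligible S" using assms by (intro open_not_negligible)
  then have "emeasure lborel S \<noteq> 0"
    using assms(1) by (auto simp: negligible_iff_null_sets null_sets_def emeasure_completion)
  moreover have "polydisc \<inter> S = S" using assms(3) by auto
  ultimately have "emeasure dvb S \<noteq> 0"
    unfolding dvb_uniform using emeasure_lborel_polydisc[where 'n = 'n] assms(1)
    by (subst emeasure_uniform_measure) (auto simp: ennreal_divide_eq_0_iff)
  then show ?thesis
    by (simp add: dvb.emeasure_eq_measure zero_less_measure_iff)
qed

context lf_measure
begin

text \<open>Replacing the value at \<open>w\<close> by the mean over a ball of radius
  \<open>s\<close> costs at most \<open>C * s\<close> times local norms, by the Lipschitz estimate;
  \<open>sesq_bound\<close> makes this uniform, and the means are covered by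
  \<open>toeplitz_average\<close>.\<close>

lemma diag_approx:
  assumes c [measurable]: "c \<in> borel_measurable M" and cK: "\<And>z. cmod (c z) \<le> K" and w: "w \<in> polydisc"
  shows "approx_form (\<lambda>h g. \<integral>z. c z * (eval (mobU z h) w * cnj (eval (mobU z g) w)) \<partial>M)"
proof -
  obtain r d where rd: "0 \<le> r" "r < 1" "0 < d" "ball w d \<subseteq> pd r"
    using polydisc_nbhd[OF w] by metis
  obtain C t where C: "0 \<le> C" "0 \<le> t" "t < 1"
    and est: "\<And>(k :: 'n bergman) (l :: 'n bergman) u v. u \<in> pd r \<Longrightarrow> v \<in> pd r \<Longrightarrow>
       cmod (eval k u * cnj (eval l v)) \<le> C * locnorm t k * locnorm t l"
     "\<And>(k :: 'n bergman) (l :: 'n bergman) u v. u \<in> pd r \<Longrightarrow> v \<in> pd r \<Longrightarrow>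
       cmod (eval k u * cnj (eval l u) - eval k v * cnj (eval l v)) \<le> C * locnorm t k * locnorm t l * norm (u - v)"
    using local_sesq_estimates[OF rd(1,2)] by metis
  obtain B where B: "0 \<le> B"
    "\<And>F e h g. F \<in> borel_measurable M \<Longrightarrow> 0 \<le> e \<Longrightarrow>
      (\<And>z. z \<in> space M \<Longrightarrow> cmod (F z) \<le> e * locnorm t (mobU z h) * locnorm t (mobU z g)) \<Longrightarrow>
      integrable M F \<and> cmod (\<integral>z. F z \<partial>M) \<le> e * B * norm h * norm g"
    using sesq_bound[OF C(2,3)] by metis
  have K: "0 \<le> K" using order_trans[OF norm_ge_zero cK] .
  have wr: "w \<in> pd r" using rd by auto
  show ?thesis
  proof (rule approx_form_limit)
    fix e :: real assume e: "0 < e"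
    \<comment> \<open>Small enough for a total error of e, and at most \<open>d\<close> so that the
      ball stays in \<open>pd r\<close>. The summand 1 guards against division by zero, here and in
      the analogous choices below.\<close>
    define s where "s = min d (e / (K * C * B + 1))"
    have KCB: "0 \<le> K * C * B" using K C B by simp
    have s: "0 < s" "s \<le> d" using rd e KCB by (auto simp: s_def intro!: divide_pos_pos)
    have sKCB: "K * (C * s) * B \<le> e"
    proof -
      have "s * (K * C * B) \<le> e / (K * C * B + 1) * (K * C * B + 1)"
        using KCB e by (intro mult_mono) (auto simp: s_def)
      also have "\<dots> = e" using KCB by (simp add: add_nonneg_eq_0_iff)
      finally show ?thesis by (simp add: mult_ac)
    qed
    define S where "S = ball w s"
    have S: "open S" "S \<noteq> {}" "S \<subseteq> pd r" "S \<subseteq> ball w d" using s rd by (auto simp: S_def)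
    have Sp: "S \<subseteq> polydisc" using S(3) pd_subset[OF rd(2)] by auto
    define v where "v = measure dvb S"
    have v: "0 < v" unfolding v_def by (rule measure_open_pos[OF S(1,2) Sp])
    define p :: "complex ^ 'n \<Rightarrow> complex" where "p u = complex_of_real (indicator S u / v)" for u
    have [measurable]: "S \<in> sets borel" using S(1) by simp
    have pm [measurable]: "p \<in> borel_measurable borel" unfolding p_def[abs_def] by measurable
    have pb: "cmod (p u) \<le> (1 / v) * indicator (pd r) u" for u
      using S(3) v by (auto simp: p_def indicator_def norm_divide)
    have ip: "integrable dvb (\<lambda>u. indicat_real S u / v)"
      by (intro integrable_divide integrable_real_indicator) (auto simp: dvb.emeasure_finite less_top[symmetric])
    have intp: "(\<integral>u. indicat_real S u / v \<partial>dvb) = 1"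
      using v by (simp add: v_def)
    define A where "A k l = (\<integral>u. p u * (eval k u * cnj (eval l u)) \<partial>dvb)" for k l
    have Ale: "cmod (A k l - eval k w * cnj (eval l w)) \<le> C * s * (locnorm t k * locnorm t l)" for k l :: "'n bergman"
    proof -
      have ik: "integrable dvb (\<lambda>u. p u * (eval k u * cnj (eval l u)))"
        by (rule integrable_bounded_sesq[where C = "1 / v"]) (use v in \<open>auto simp: p_def norm_divide indicator_def\<close>)
      have ip': "integrable dvb p" unfolding p_def using ip by (rule integrable_of_real)
      have "(\<integral>u. p u \<partial>dvb) = 1" unfolding p_def using intp by (simp only: integral_complex_of_real of_real_1)
      then have "A k l - eval k w * cnj (eval l w) = (\<integral>u. p u * (eval k u * cnj (eval l u)) \<partial>dvb) - (\<integral>u. p u * (eval k w * cnj (eval l w)) \<partial>dvb)"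
        by (simp add: A_def)
      also have "\<dots> = (\<integral>u. p u * (eval k u * cnj (eval l u)) - p u * (eval k w * cnj (eval l w)) \<partial>dvb)"
        by (rule Bochner_Integration.integral_diff[symmetric, OF ik integrable_mult_left[OF ip']])
      also have "cmod \<dots> \<le> (\<integral>u. C * s * (locnorm t k * locnorm t l) * (indicat_real S u / v) \<partial>dvb)"
      proof (rule Bochner_Integration.integral_norm_bound_integral)
        show "integrable dvb (\<lambda>u. p u * (eval k u * cnj (eval l u)) - p u * (eval k w * cnj (eval l w)))"
          by (rule Bochner_Integration.integrable_diff[OF ik integrable_mult_left[OF ip']])
        show "integrable dvb (\<lambda>u. C * s * (locnorm t k * locnorm t l) * (indicat_real S u / v))"
          by (rule integrable_mult_right[OF ip])
        fix u
        show "norm (p u * (eval k u * cnj (eval l u)) - p u * (eval k w * cnj (eval l w)))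
           \<le> C * s * (locnorm t k * locnorm t l) * (indicat_real S u / v)"
        proof (cases "u \<in> S")
          case True
          then have "norm (u - w) \<le> s" by (simp add: S_def dist_norm norm_minus_commute)
          then have "C * locnorm t k * locnorm t l * norm (u - w) \<le> C * locnorm t k * locnorm t l * s"
            using C by (intro mult_left_mono) auto
          then have le: "cmod (eval k u * cnj (eval l u) - eval k w * cnj (eval l w)) \<le> C * locnorm t k * locnorm t l * s"
            using est(2)[of u w k l] True S(3) wr by auto
          have "norm (p u * (eval k u * cnj (eval l u)) - p u * (eval k w * cnj (eval l w))) =
             cmod (p u) * cmod (eval k u * cnj (eval l u) - eval k w * cnj (eval l w))"
            by (simp only: right_diff_distrib[symmetric] norm_mult)
          also have "\<dots> \<le> (1 / v) * (C * locnorm t k * locnorm t l * s)"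
            using v le True by (intro mult_mono) (auto simp: p_def norm_divide)
          finally show ?thesis using True by (simp add: mult_ac)
        qed (simp add: p_def)
      qed
      also have "\<dots> = C * s * (locnorm t k * locnorm t l)"
        by (simp only: integral_mult_right_zero intp mult_1_right)
      finally show ?thesis .
    qed
    have Am: "(\<lambda>z. A (mobU z h) (mobU z g)) \<in> borel_measurable M" for h g
      unfolding A_def by (rule dvb.borel_measurable_lebesgue_integral) measurable
    show "\<exists>q'. approx_form q' \<and> (\<forall>h g. cmod ((\<integral>z. c z * (eval (mobU z h) w * cnj (eval (mobU z g) w)) \<partial>M) - q' h g)
       \<le> e * norm h * norm g)"
    proof (intro exI conjI allI)
      show "approx_form (\<lambda>h g. \<integral>z. c z * A (mobU z h) (mobU z g) \<partial>M)"
        unfolding A_def by (rule toeplitz_average[OF c cK pm pb rd(1,2)])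
      fix h g
      define F where "F z = c z * (eval (mobU z h) w * cnj (eval (mobU z g) w))" for z
      define G where "G z = c z * A (mobU z h) (mobU z g)" for z
      have Fm: "F \<in> borel_measurable M" unfolding F_def[abs_def] by measurable
      have Gm: "G \<in> borel_measurable M" unfolding G_def[abs_def] using Am by measurable
      have iF: "integrable M F"
      proof (rule conjunct1[OF B(2)[OF Fm]])
        show "0 \<le> K * C" using K C by simp
        fix z
        have "cmod (F z) \<le> K * (C * locnorm t (mobU z h) * locnorm t (mobU z g))"
          unfolding F_def norm_mult[of "c z"] using K by (intro mult_mono cK est(1) wr) auto
        then show "cmod (F z) \<le> K * C * locnorm t (mobU z h) * locnorm t (mobU z g)" by (simp add: mult.assoc)
      qed
      have FG: "integrable M (\<lambda>z. F z - G z) \<and> cmod (\<integral>z. F z - G z \<partial>M) \<le> K * (C * s) * B * norm h * norm g"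
      proof (rule B(2))
        show "(\<lambda>z. F z - G z) \<in> borel_measurable M" using Fm Gm by measurable
        show "0 \<le> K * (C * s)" using K C s by simp
        fix z
        have "cmod (F z - G z) = cmod (c z) * cmod (A (mobU z h) (mobU z g) - eval (mobU z h) w * cnj (eval (mobU z g) w))"
          unfolding F_def G_def right_diff_distrib[symmetric] norm_mult[of "c z"] by (simp add: norm_minus_commute)
        also have "\<dots> \<le> K * (C * s * (locnorm t (mobU z h) * locnorm t (mobU z g)))"
          using K by (intro mult_mono cK Ale) auto
        finally show "cmod (F z - G z) \<le> K * (C * s) * locnorm t (mobU z h) * locnorm t (mobU z g)" by (simp add: mult.assoc)
      qed
      then have iG: "integrable M G"
        using Bochner_Integration.integrable_diff[OF iF, of "\<lambda>z. F z - G z"] by simp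
      have "cmod ((\<integral>z. F z \<partial>M) - (\<integral>z. G z \<partial>M)) \<le> K * (C * s) * B * norm h * norm g"
        using FG Bochner_Integration.integral_diff[OF iF iG] by simp
      also have "\<dots> \<le> e * norm h * norm g"
        using sKCB by (intro mult_right_mono) auto
      finally show "cmod ((\<integral>z. c z * (eval (mobU z h) w * cnj (eval (mobU z g) w)) \<partial>M) - (\<integral>z. c z * A (mobU z h) (mobU z g) \<partial>M))
          \<le> e * norm h * norm g"
        unfolding F_def G_def .
    qed
  qed
qed

end

section \<open>Off-diagonal kernels from diagonal ones\<close>

text \<open>Multiplying out, the term with indices k and l carries the factor \<open>\<zeta>\<close>
  to the power j (m + l - k). For k, l \<le> m the number m + l - k lies between 0 and 2 m, hence
  below \<open>N\<close>, so summing over j keeps only the exponent 0, that is k = m and l =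
  0.\<close>

lemma root_of_unity_filter:
  fixes a b :: "nat \<Rightarrow> complex" and m :: nat and s :: real
  defines "N \<equiv> 2 * m + 1"
  defines "\<zeta> \<equiv> exp (2 * of_real pi * \<i> * of_nat 1 / of_nat N)"
  assumes s: "0 < s"
  shows "(\<Sum>j<N. (\<zeta> ^ j) ^ m / (of_nat N * of_real s ^ m) *
      ((\<Sum>k\<le>m. a k * (of_real s * cnj (\<zeta> ^ j)) ^ k) * cnj (\<Sum>k\<le>m. b k * (of_real s * cnj (\<zeta> ^ j)) ^ k))) = a m * cnj (b 0)"
proof -
  have N: "1 \<le> N" by (simp add: N_def)
  have z\<zeta>: "cnj \<zeta> * \<zeta> = 1"
  proof -
    have "cmod \<zeta> = 1" by (simp add: \<zeta>_def)
    then show ?thesis by (simp add: mult.commute[of "cnj \<zeta>"] complex_norm_square[symmetric])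
  qed
  have \<zeta>N: "\<zeta> ^ N = 1" unfolding \<zeta>_def by (rule complex_root_unity) (use N in simp)
  have \<zeta>p: "\<zeta> ^ p = exp (2 * of_real pi * \<i> * of_nat p / of_nat N)" for p
    unfolding \<zeta>_def exp_of_nat_mult[symmetric] by (simp add: mult_ac)
  have ne: "\<zeta> ^ p \<noteq> 1" if "0 < p" "p < N" for p
  proof
    assume "\<zeta> ^ p = 1"
    then have "exp (2 * of_real pi * \<i> * of_nat p / of_nat N) = exp (2 * of_real pi * \<i> * of_nat 0 / of_nat N)"
      by (simp add: \<zeta>p)
    then have "p mod N = 0 mod N" using complex_root_unity_eq[OF N, of p 0] by (simp add: cong_def)
    then show False using that by simp
  qed
  have geo: "(\<Sum>j<N. (\<zeta> ^ p) ^ j) = (if p = 0 then of_nat N else 0)" if "p < N" for p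
  proof (cases "p = 0")
    case False
    have "(\<zeta> ^ p) ^ N = 1" by (metis \<zeta>N mult.commute power_mult power_one)
    then show ?thesis using ne[of p] False that by (simp add: geometric_sum)
  qed simp
  \<comment> \<open>The extra factor with exponent m makes the total exponent nonnegative; for k
    \<le> m the subtraction of naturals is exact.\<close>
  have tm: "(\<zeta> ^ j) ^ m * ((of_real s * cnj (\<zeta> ^ j)) ^ k * cnj ((of_real s * cnj (\<zeta> ^ j)) ^ l)) =
      of_real s ^ (k + l) * (\<zeta> ^ (m + l - k)) ^ j" if "k \<le> m" for j k l
  proof -
    have u: "(cnj (\<zeta> ^ j)) ^ k * (\<zeta> ^ j) ^ k = 1"
      unfolding power_mult_distrib[symmetric] complex_cnj_power
      by (metis power_mult_distrib power_one z\<zeta>)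
    have "(\<zeta> ^ j) ^ m * ((of_real s * cnj (\<zeta> ^ j)) ^ k * cnj ((of_real s * cnj (\<zeta> ^ j)) ^ l)) =
       of_real s ^ (k + l) * ((cnj (\<zeta> ^ j)) ^ k * (\<zeta> ^ j) ^ (m + l))"
      by (simp add: power_mult_distrib power_add mult_ac)
    also have "(\<zeta> ^ j) ^ (m + l) = (\<zeta> ^ j) ^ k * (\<zeta> ^ j) ^ (m + l - k)"
      unfolding power_add[symmetric] using that by simp
    also have "(cnj (\<zeta> ^ j)) ^ k * ((\<zeta> ^ j) ^ k * (\<zeta> ^ j) ^ (m + l - k)) = (\<zeta> ^ j) ^ (m + l - k)"
      unfolding mult.assoc[symmetric] u by simp
    also have "\<dots> = (\<zeta> ^ (m + l - k)) ^ j" by (simp add: power_mult[symmetric] mult.commute)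
    finally show ?thesis .
  qed
  define D where "D = of_nat N * complex_of_real s ^ m"
  have D: "D \<noteq> 0" using s N by (simp add: D_def)
  have "(\<Sum>j<N. (\<zeta> ^ j) ^ m / D *
      ((\<Sum>k\<le>m. a k * (of_real s * cnj (\<zeta> ^ j)) ^ k) * cnj (\<Sum>k\<le>m. b k * (of_real s * cnj (\<zeta> ^ j)) ^ k))) =
     (\<Sum>j<N. \<Sum>k\<le>m. \<Sum>l\<le>m. a k * cnj (b l) / D *
       ((\<zeta> ^ j) ^ m * ((of_real s * cnj (\<zeta> ^ j)) ^ k * cnj ((of_real s * cnj (\<zeta> ^ j)) ^ l))))"
  proof (intro sum.cong refl)
    fix j
    define x where "x = of_real s * cnj (\<zeta> ^ j)"
    have "(\<Sum>k\<le>m. a k * x ^ k) * cnj (\<Sum>k\<le>m. b k * x ^ k) = (\<Sum>k\<le>m. \<Sum>l\<le>m. (a k * x ^ k) * (cnj (b l) * cnj (x ^ l)))"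
      by (simp only: cnj_sum sum_product complex_cnj_mult)
    then have "(\<zeta> ^ j) ^ m / D * ((\<Sum>k\<le>m. a k * x ^ k) * cnj (\<Sum>k\<le>m. b k * x ^ k)) =
      (\<Sum>k\<le>m. \<Sum>l\<le>m. (\<zeta> ^ j) ^ m / D * ((a k * x ^ k) * (cnj (b l) * cnj (x ^ l))))"
      by (simp only: sum_distrib_left)
    also have "\<dots> = (\<Sum>k\<le>m. \<Sum>l\<le>m. a k * cnj (b l) / D * ((\<zeta> ^ j) ^ m * (x ^ k * cnj (x ^ l))))"
      by (intro sum.cong refl) simp
    finally show "(\<zeta> ^ j) ^ m / D * ((\<Sum>k\<le>m. a k * (of_real s * cnj (\<zeta> ^ j)) ^ k) * cnj (\<Sum>k\<le>m. b k * (of_real s * cnj (\<zeta> ^ j)) ^ k)) =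
      (\<Sum>k\<le>m. \<Sum>l\<le>m. a k * cnj (b l) / D *
       ((\<zeta> ^ j) ^ m * ((of_real s * cnj (\<zeta> ^ j)) ^ k * cnj ((of_real s * cnj (\<zeta> ^ j)) ^ l))))"
      unfolding x_def .
  qed
  also have "\<dots> = (\<Sum>j<N. \<Sum>k\<le>m. \<Sum>l\<le>m. a k * cnj (b l) / D * (of_real s ^ (k + l) * (\<zeta> ^ (m + l - k)) ^ j))"
    by (intro sum.cong refl) (simp add: tm del: complex_cnj_power complex_cnj_mult)
  also have "\<dots> = (\<Sum>k\<le>m. \<Sum>l\<le>m. \<Sum>j<N. a k * cnj (b l) / D * (of_real s ^ (k + l) * (\<zeta> ^ (m + l - k)) ^ j))"
    by (rule trans[OF sum.swap], rule sum.cong[OF refl], rule sum.swap)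
  also have "\<dots> = (\<Sum>k\<le>m. \<Sum>l\<le>m. a k * cnj (b l) / D * of_real s ^ (k + l) * (\<Sum>j<N. (\<zeta> ^ (m + l - k)) ^ j))"
    by (simp add: sum_distrib_left mult.assoc)
  also have "\<dots> = (\<Sum>k\<le>m. \<Sum>l\<le>m. if k = m \<and> l = 0 then a m * cnj (b 0) else 0)"
  proof (intro sum.cong refl)
    fix k l assume kl: "k \<in> {..m}" "l \<in> {..m}"
    have "m + l - k < N" using kl by (simp add: N_def)
    moreover have "m + l - k = 0 \<longleftrightarrow> k = m \<and> l = 0" using kl by auto
    ultimately show "a k * cnj (b l) / D * of_real s ^ (k + l) * (\<Sum>j<N. (\<zeta> ^ (m + l - k)) ^ j) =
      (if k = m \<and> l = 0 then a m * cnj (b 0) else 0)"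
      using geo[of "m + l - k"] D s N by (auto simp: D_def)
  qed
  also have "\<dots> = (\<Sum>k\<le>m. if k = m then a m * cnj (b 0) else 0)"
  proof (intro sum.cong refl)
    fix k
    show "(\<Sum>l\<le>m. if k = m \<and> l = 0 then a m * cnj (b 0) else 0) = (if k = m then a m * cnj (b 0) else 0)"
      by (cases "k = m") (simp_all add: sum.delta)
  qed
  also have "\<dots> = a m * cnj (b 0)" by (simp add: sum.delta)
  finally show ?thesis unfolding D_def .
qed

text \<open>Geometric series in 1/R. The factor of order m + 1 in the modulus of
  \<open>\<mu>\<close> is essential: dividing by the m-th power of the scale, as the filter does,
  still leaves one power of it.\<close>

lemma power_series_tail:
  fixes a :: "nat \<Rightarrow> complex"
  assumes A: "0 \<le> A" and R: "1 < R" and a: "\<And>i. cmod (a i) \<le> A / R ^ i" and \<mu>: "cmod \<mu> \<le> 1"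
    and f: "(\<lambda>i. a i * \<mu> ^ i) sums f"
  defines "S \<equiv> R / (R - 1)"
  shows "cmod (f - (\<Sum>i\<le>m. a i * \<mu> ^ i)) \<le> A * S * cmod \<mu> ^ (m + 1) / R ^ (m + 1)"
    and "cmod (\<Sum>i\<le>m. a i * \<mu> ^ i) \<le> A * S" and "cmod f \<le> A * S"
proof -
  have geo: "(\<lambda>i. (1 / R) ^ i) sums S"
    using geometric_sums[of "1 / R"] R by (simp add: S_def field_simps)
  have t: "cmod (a i * \<mu> ^ i) \<le> A * (1 / R) ^ i" for i
  proof -
    have "cmod (a i * \<mu> ^ i) \<le> (A / R ^ i) * 1"
      unfolding norm_mult norm_power using A R by (intro mult_mono a power_le_one \<mu>) auto
    then show ?thesis by (simp add: power_one_over)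
  qed
  have gA: "(\<lambda>i. A * (1 / R) ^ i) sums (A * S)" by (rule sums_mult[OF geo])
  show "cmod f \<le> A * S"
    using norm_sums_le[OF f gA t] .
  have "cmod (\<Sum>i\<le>m. a i * \<mu> ^ i) \<le> (\<Sum>i\<le>m. A * (1 / R) ^ i)"
    by (rule sum_norm_le) (rule t)
  also have "\<dots> \<le> (\<Sum>i. A * (1 / R) ^ i)"
    by (rule sum_le_suminf) (use gA A R in \<open>auto simp: sums_iff\<close>)
  also have "\<dots> = A * S" using gA by (simp add: sums_iff)
  finally show "cmod (\<Sum>i\<le>m. a i * \<mu> ^ i) \<le> A * S" .
  have s1: "(\<lambda>i. a (i + (m + 1)) * \<mu> ^ (i + (m + 1))) sums (f - (\<Sum>i<m + 1. a i * \<mu> ^ i))"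
    by (rule sums_split_initial_segment[OF f])
  have s2: "(\<lambda>i. (A * cmod \<mu> ^ (m + 1) / R ^ (m + 1)) * (1 / R) ^ i) sums ((A * cmod \<mu> ^ (m + 1) / R ^ (m + 1)) * S)"
    by (rule sums_mult[OF geo])
  have "cmod (f - (\<Sum>i<m + 1. a i * \<mu> ^ i)) \<le> (A * cmod \<mu> ^ (m + 1) / R ^ (m + 1)) * S"
  proof (rule norm_sums_le[OF s1 s2])
    fix i
    have "cmod (a (i + (m + 1)) * \<mu> ^ (i + (m + 1))) \<le> (A / R ^ (i + (m + 1))) * (cmod \<mu> ^ (m + 1))"
      unfolding norm_mult norm_power using A R
      by (intro mult_mono a power_decreasing \<mu>) auto
    also have "\<dots> = (A * cmod \<mu> ^ (m + 1) / R ^ (m + 1)) * (1 / R) ^ i"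
      using R by (simp add: power_add power_one_over field_simps)
    finally show "norm (a (i + (m + 1)) * \<mu> ^ (i + (m + 1))) \<le> (A * cmod \<mu> ^ (m + 1) / R ^ (m + 1)) * (1 / R) ^ i" .
  qed
  also have "{..<m + 1} = {..m}" by auto
  finally show "cmod (f - (\<Sum>i\<le>m. a i * \<mu> ^ i)) \<le> A * S * cmod \<mu> ^ (m + 1) / R ^ (m + 1)"
    by (simp add: mult_ac)
qed

text \<open>\<open>K\<^sub>0 \<otimes> K\<^sub>b\<close> is a limit of combinations of the diagonal kernels \<open>K\<^sub>w \<otimes> K\<^sub>w\<close> with
  \<open>w\<close> on the complex line through \<open>b\<close>: with \<open>h(\<mu> b) = \<Sum> a\<^sub>k \<mu>\<^sup>k\<close>, averaging over the scaled
  roots of unity of order \<open>2 m + 1\<close> isolates \<open>a\<^sub>m(h)\<close> times the conjugate of \<open>a\<^sub>0(g)\<close> up to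
  \<open>O(s)\<close>, where \<open>s\<close> is the scale.\<close>

lemma off_diagonal_span:
  fixes b :: "complex ^ 'n::finite"
  assumes b: "b \<in> polydisc"
  obtains t where "0 \<le> t" "t < 1"
    "\<And>e. e > 0 \<Longrightarrow> \<exists>(n :: nat) (N :: nat \<Rightarrow> nat) \<alpha> w. (\<forall>m j. w m j \<in> polydisc) \<and>
      (\<forall>(k :: 'n bergman) (l :: 'n bergman). cmod (eval k b * cnj (eval l 0) -
         (\<Sum>m\<le>n. \<Sum>j<N m. \<alpha> m j * (eval k (w m j) * cnj (eval l (w m j))))) \<le> e * locnorm t k * locnorm t l)"
proof -
  show ?thesis
  proof (rule eval_power_series[OF b])
  fix C R t assume C: "0 \<le> C" "1 < R" "0 \<le> t" "t < 1" and
    ser: "\<And>h :: 'n bergman. \<exists>a. (\<forall>k. cmod (a k) \<le> C * locnorm t h / R ^ k) \<and>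
       (\<forall>m. cmod m \<le> 1 \<longrightarrow> (\<lambda>k. a k * m ^ k) sums eval h (m *s b))"
  define S where "S = R / (R - 1)"
  have S: "0 \<le> S" using C by (simp add: S_def)
  show thesis
  proof (rule that[OF C(3,4)])
    fix e :: real assume e: "e > 0"
    \<comment> \<open>Truncation of the expansion at \<open>b\<close> itself, that is at \<mu> = 1,
      where only the decay in R helps.\<close>
    obtain n where n: "C * C * S / R ^ (n + 1) \<le> e / 2"
    proof -
      obtain n where "2 * (C * C * S) / e < R ^ n" using real_arch_pow[OF C(2)] by blast
      also have "R ^ n \<le> R ^ (n + 1)" using C by (intro power_increasing) auto
      finally have "C * C * S / R ^ (n + 1) \<le> e / 2" using e C by (simp add: field_simps)
      then show ?thesis by (rule that)
    qed
    \<comment> \<open>The errors of the n + 1 filtered coefficients add up to \<open>s * Q\<close>.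
      The order of choice matters: n is fixed, and only then is the scale \<open>s\<close> made
      small.\<close>
    define Q where "Q = (real n + 1) * (2 * (C * C) * (S * S))"
    have Q: "0 \<le> Q" using C S by (simp add: Q_def)
    define s where "s = min 1 (e / 2 / (Q + 1))"
    have s: "0 < s" "s \<le> 1" using e Q by (auto simp: s_def)
    have sQ: "s * Q \<le> e / 2"
    proof -
      have "s * Q \<le> e / 2 / (Q + 1) * (Q + 1)" using Q e s by (intro mult_mono) (auto simp: s_def)
      also have "\<dots> = e / 2"
      proof -
        have g: "x / y * y = x" if "y \<noteq> 0" for x y :: real using that by simp
        show ?thesis by (rule g) (use Q in simp)
      qed
      finally show ?thesis .
    qed
    define N where "N m = 2 * m + 1" for m :: nat
    define \<zeta> where "\<zeta> m = exp (2 * of_real pi * \<i> * of_nat 1 / of_nat (N m))" for m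
    define \<mu> where "\<mu> m j = complex_of_real s * cnj (\<zeta> m ^ j)" for m j
    define \<alpha> where "\<alpha> m j = (\<zeta> m ^ j) ^ m / (of_nat (N m) * complex_of_real s ^ m)" for m j
    define w where "w m j = \<mu> m j *s b" for m j
    have \<zeta>1: "cmod (\<zeta> m) = 1" for m by (simp add: \<zeta>_def)
    have \<mu>s: "cmod (\<mu> m j) = s" for m j
      using s by (simp add: \<mu>_def norm_mult norm_power \<zeta>1 del: complex_cnj_power)
    have \<alpha>s: "cmod (\<alpha> m j) = 1 / (real (N m) * s ^ m)" for m j
      using s by (simp add: \<alpha>_def norm_divide norm_mult norm_power \<zeta>1)
    have wp: "w m j \<in> polydisc" for m j
      unfolding w_def using \<mu>s s by (intro polydisc_scale b) simp
    have "cmod (eval k b * cnj (eval l 0) -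
         (\<Sum>m\<le>n. \<Sum>j<N m. \<alpha> m j * (eval k (w m j) * cnj (eval l (w m j))))) \<le> e * locnorm t k * locnorm t l"
      for k l :: "'n bergman"
    proof -
      define A where "A = C * locnorm t k"
      define A' where "A' = C * locnorm t l"
      have A: "0 \<le> A" "0 \<le> A'" using C by (auto simp: A_def A'_def)
      obtain a where a: "\<And>i. cmod (a i) \<le> A / R ^ i" "\<And>\<mu>. cmod \<mu> \<le> 1 \<Longrightarrow> (\<lambda>i. a i * \<mu> ^ i) sums eval k (\<mu> *s b)"
        using ser[of k] unfolding A_def by blast
      obtain a' where a': "\<And>i. cmod (a' i) \<le> A' / R ^ i" "\<And>\<mu>. cmod \<mu> \<le> 1 \<Longrightarrow> (\<lambda>i. a' i * \<mu> ^ i) sums eval l (\<mu> *s b)"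
        using ser[of l] unfolding A'_def by blast
      have l0: "eval l 0 = a' 0"
        using sums_unique2[OF a'(2)[of 0] powser_sums_zero[of a']] by simp
      have a'0: "cmod (a' 0) \<le> A'" using a'(1)[of 0] by simp
      define T where "T m \<mu> = (\<Sum>i\<le>m. a i * \<mu> ^ i)" for m \<mu>
      define T' where "T' m \<mu> = (\<Sum>i\<le>m. a' i * \<mu> ^ i)" for m \<mu>
      note tl = power_series_tail[OF A(1) C(2) a(1) _ a(2), folded T_def S_def]
      note tl' = power_series_tail[OF A(2) C(2) a'(1) _ a'(2), folded T'_def S_def]
      have step: "cmod (a m * cnj (a' 0) - (\<Sum>j<N m. \<alpha> m j * (eval k (w m j) * cnj (eval l (w m j))))) \<le> 2 * (A * A') * (S * S) * s" for m
      proof -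
        have filter: "a m * cnj (a' 0) = (\<Sum>j<N m. \<alpha> m j * (T m (\<mu> m j) * cnj (T' m (\<mu> m j))))"
          unfolding \<alpha>_def T_def T'_def \<mu>_def \<zeta>_def N_def by (rule root_of_unity_filter[symmetric, OF s(1)])
        have each: "cmod (T m (\<mu> m j) * cnj (T' m (\<mu> m j)) - eval k (w m j) * cnj (eval l (w m j))) \<le> 2 * (A * A') * (S * S) * s ^ (m + 1)" for j
        proof -
          define x x' y y' where "x = T m (\<mu> m j)" and "x' = T' m (\<mu> m j)" and "y = eval k (w m j)" and "y' = eval l (w m j)"
          have m1: "cmod (\<mu> m j) \<le> 1" using \<mu>s s by simp
          have Rp: "1 \<le> R ^ (m + 1)" using C by (intro one_le_power) simp
          have q: "B * S * s ^ (m + 1) / R ^ (m + 1) \<le> B * S * s ^ (m + 1)" if "0 \<le> B" for B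
          proof -
            have "0 \<le> B * S * s ^ (m + 1)" using that S s by simp
            then show ?thesis using divide_left_mono[OF Rp, of "B * S * s ^ (m + 1)"] Rp by simp
          qed
          have 1: "cmod (y - x) \<le> A * S * s ^ (m + 1)"
            using order_trans[OF tl(1)[OF m1 m1] _] q[OF A(1)] unfolding x_def y_def w_def \<mu>s by blast
          have 2: "cmod (y' - x') \<le> A' * S * s ^ (m + 1)"
            using order_trans[OF tl'(1)[OF m1 m1] _] q[OF A(2)] unfolding x'_def y'_def w_def \<mu>s by blast
          have 3: "cmod x \<le> A * S" unfolding x_def by (rule tl(2)[OF m1 m1])
          have 4: "cmod y' \<le> A' * S" unfolding y'_def w_def by (rule tl'(3)[OF m1 m1])
          have "x * cnj x' - y * cnj y' = (x - y) * cnj y' + x * cnj (x' - y')" by (simp add: algebra_simps)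
          then have "cmod (x * cnj x' - y * cnj y') \<le> cmod ((x - y) * cnj y') + cmod (x * cnj (x' - y'))"
            by (metis norm_triangle_ineq)
          also have "\<dots> = cmod (y - x) * cmod y' + cmod x * cmod (y' - x')"
            unfolding norm_mult complex_mod_cnj by (simp add: norm_minus_commute)
          also have "\<dots> \<le> (A * S * s ^ (m + 1)) * (A' * S) + (A * S) * (A' * S * s ^ (m + 1))"
            using A S s by (intro add_mono mult_mono 1 2 3 4) auto
          also have "\<dots> = 2 * (A * A') * (S * S) * s ^ (m + 1)" by simp
          finally show ?thesis unfolding x_def x'_def y_def y'_def .
        qed
        have "a m * cnj (a' 0) - (\<Sum>j<N m. \<alpha> m j * (eval k (w m j) * cnj (eval l (w m j)))) =
          (\<Sum>j<N m. \<alpha> m j * (T m (\<mu> m j) * cnj (T' m (\<mu> m j)) - eval k (w m j) * cnj (eval l (w m j))))"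
          unfolding filter by (simp add: sum_subtractf right_diff_distrib)
        also have "cmod \<dots> \<le> (\<Sum>j<N m. 1 / (real (N m) * s ^ m) * (2 * (A * A') * (S * S) * s ^ (m + 1)))"
        proof (rule sum_norm_le)
          fix j
          show "cmod (\<alpha> m j * (T m (\<mu> m j) * cnj (T' m (\<mu> m j)) - eval k (w m j) * cnj (eval l (w m j))))
            \<le> 1 / (real (N m) * s ^ m) * (2 * (A * A') * (S * S) * s ^ (m + 1))"
            unfolding norm_mult[of "\<alpha> m j"] \<alpha>s using s by (intro mult_left_mono each) auto
        qed
        also have "\<dots> = real (N m) * (1 / (real (N m) * s ^ m) * (2 * (A * A') * (S * S) * (s ^ m * s)))"
          by simp
        also have "\<dots> = 2 * (A * A') * (S * S) * s"
          using s by (simp add: N_def)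
        finally show ?thesis .
      qed
      have kb: "cmod (eval k b - (\<Sum>m\<le>n. a m)) \<le> A * S / R ^ (n + 1)"
        using tl(1)[of 1 n] by (simp add: T_def)
      define P where "P m = (\<Sum>j<N m. \<alpha> m j * (eval k (w m j) * cnj (eval l (w m j))))" for m
      have eq: "eval k b * cnj (eval l 0) - (\<Sum>m\<le>n. P m) =
        (eval k b - (\<Sum>m\<le>n. a m)) * cnj (a' 0) + (\<Sum>m\<le>n. a m * cnj (a' 0) - P m)"
        unfolding l0 sum_subtractf left_diff_distrib sum_distrib_right by simp
      have gen: "(C * x * S / r) * (C * y) + N1 * (2 * ((C * x) * (C * y)) * (S * S) * s) =
         (C * C * S / r + s * (N1 * (2 * (C * C) * (S * S)))) * (x * y)" for x y r N1 :: real
        by (simp add: divide_inverse algebra_simps)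
      have sn: "cmod (\<Sum>m\<le>n. a m * cnj (a' 0) - P m) \<le> (\<Sum>m\<le>n. 2 * (A * A') * (S * S) * s)"
        unfolding P_def by (rule sum_norm_le) (rule step)
      have "cmod (eval k b * cnj (eval l 0) - (\<Sum>m\<le>n. P m)) \<le>
        cmod ((eval k b - (\<Sum>m\<le>n. a m)) * cnj (a' 0)) + cmod (\<Sum>m\<le>n. a m * cnj (a' 0) - P m)"
        unfolding eq by (rule norm_triangle_ineq)
      also have "\<dots> \<le> (A * S / R ^ (n + 1)) * A' + (\<Sum>m\<le>n. 2 * (A * A') * (S * S) * s)"
        unfolding norm_mult complex_mod_cnj
        by (rule add_mono[OF mult_mono[OF kb a'0] sn]) (use A S C in auto)
      also have "\<dots> = (A * S / R ^ (n + 1)) * A' + (real n + 1) * (2 * (A * A') * (S * S) * s)"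
        by simp
      also have "\<dots> = (C * C * S / R ^ (n + 1) + s * Q) * (locnorm t k * locnorm t l)"
        unfolding A_def A'_def Q_def by (rule gen)
      also have "\<dots> \<le> e * (locnorm t k * locnorm t l)"
        by (rule mult_right_mono[OF order_trans[OF add_mono[OF n sQ]]]) simp_all
      finally show ?thesis unfolding P_def by (simp only: mult.assoc)
    qed
    note main = this
    show "\<exists>(n :: nat) (N :: nat \<Rightarrow> nat) \<alpha> w. (\<forall>m j. w m j \<in> polydisc) \<and>
      (\<forall>(k :: 'n bergman) (l :: 'n bergman). cmod (eval k b * cnj (eval l 0) -
         (\<Sum>m\<le>n. \<Sum>j<N m. \<alpha> m j * (eval k (w m j) * cnj (eval l (w m j))))) \<le> e * locnorm t k * locnorm t l)"
      by (rule exI[where x = n], rule exI[where x = N], rule exI[where x = \<alpha>], rule exI[where x = w])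
        (intro conjI allI wp main)
  qed
  qed
qed

lemma eval_0_le_locnorm:
  obtains C t where "0 \<le> C" "0 \<le> t" "t < 1" "\<And>k :: 'n::finite bergman. cmod (eval k 0) \<le> C * locnorm t k"
proof -
  obtain C t where "0 \<le> C" "0 \<le> t" "t < 1" "\<And>h :: 'n bergman. \<And>u. u \<in> pd 0 \<Longrightarrow> cmod (eval h u) \<le> C * locnorm t h"
    using eval_le_locnorm[of 0] by auto
  then show ?thesis using that[of C t] by (simp add: pd_def)
qed

context lf_measure
begin

lemma integrable_point_sesq:
  assumes c [measurable]: "c \<in> borel_measurable M" and cK: "\<And>z. cmod (c z) \<le> K"
    and u: "u \<in> polydisc" and v: "v \<in> polydisc"
  shows "integrable M (\<lambda>z. c z * (eval (mobU z h) u * cnj (eval (mobU z g) v)))"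
proof -
  obtain r d where r: "0 \<le> r" "r < 1" "0 < d" "ball u d \<subseteq> pd r" using polydisc_nbhd[OF u] by metis
  obtain r' d' where r': "0 \<le> r'" "r' < 1" "0 < d'" "ball v d' \<subseteq> pd r'" using polydisc_nbhd[OF v] by metis
  have R: "0 \<le> max r r'" "max r r' < 1" using r r' by auto
  have uv: "u \<in> pd (max r r')" "v \<in> pd (max r r')"
  proof -
    have "u \<in> ball u d" "v \<in> ball v d'" using r r' by auto
    then have "u \<in> pd r" "v \<in> pd r'" using r(4) r'(4) by blast+
    then show "u \<in> pd (max r r')" "v \<in> pd (max r r')"
      using pd_mono[of r "max r r'"] pd_mono[of r' "max r r'"] by auto
  qed
  obtain C t where C: "0 \<le> C" "0 \<le> t" "t < 1"
    and est: "\<And>(k :: 'n bergman) (l :: 'n bergman) u v. u \<in> pd (max r r') \<Longrightarrow> v \<in> pd (max r r') \<Longrightarrow>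
       cmod (eval k u * cnj (eval l v)) \<le> C * locnorm t k * locnorm t l"
    using local_sesq_estimates[OF R] by metis
  obtain B where B: "0 \<le> B"
    "\<And>F e h g. F \<in> borel_measurable M \<Longrightarrow> 0 \<le> e \<Longrightarrow>
      (\<And>z. z \<in> space M \<Longrightarrow> cmod (F z) \<le> e * locnorm t (mobU z h) * locnorm t (mobU z g)) \<Longrightarrow>
      integrable M F \<and> cmod (\<integral>z. F z \<partial>M) \<le> e * B * norm h * norm g"
    using sesq_bound[OF C(2,3)] by metis
  have K: "0 \<le> K" using order_trans[OF norm_ge_zero cK] .
  show ?thesis
  proof (rule conjunct1[OF B(2)])
    show "(\<lambda>z. c z * (eval (mobU z h) u * cnj (eval (mobU z g) v))) \<in> borel_measurable M" by measurable
    show "0 \<le> K * C" using K C by simp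
    fix z
    have "cmod (c z * (eval (mobU z h) u * cnj (eval (mobU z g) v))) \<le> K * (C * locnorm t (mobU z h) * locnorm t (mobU z g))"
      unfolding norm_mult[of "c z"] using K by (intro mult_mono cK est uv) auto
    then show "cmod (c z * (eval (mobU z h) u * cnj (eval (mobU z g) v))) \<le> K * C * locnorm t (mobU z h) * locnorm t (mobU z g)"
      by (simp add: mult.assoc)
  qed
qed

text \<open>The nodes and weights of \<open>off_diagonal_span\<close> do not depend on z, so
  inserting \<open>mobU z h\<close> and \<open>mobU z g\<close> and integrating gives a finite
  combination of the forms of \<open>diag_approx\<close>, up to an error in local norms.\<close>

lemma off_diag_approx:
  assumes c [measurable]: "c \<in> borel_measurable M" and cK: "\<And>z. cmod (c z) \<le> K" and b: "b \<in> polydisc"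
  shows "approx_form (\<lambda>h g. \<integral>z. c z * (eval (mobU z h) b * cnj (eval (mobU z g) 0)) \<partial>M)"
proof -
  have K: "0 \<le> K" using order_trans[OF norm_ge_zero cK] .
  show ?thesis
  proof (rule off_diagonal_span[OF b])
    fix t :: real
    assume t: "0 \<le> t" "t < 1"
    assume span: "\<And>e. e > 0 \<Longrightarrow> \<exists>(n :: nat) (N :: nat \<Rightarrow> nat) \<alpha> w. (\<forall>m j. w m j \<in> polydisc) \<and>
      (\<forall>(k :: 'n bergman) (l :: 'n bergman). cmod (eval k b * cnj (eval l 0) -
         (\<Sum>m\<le>n. \<Sum>j<N m. \<alpha> m j * (eval k (w m j) * cnj (eval l (w m j))))) \<le> e * locnorm t k * locnorm t l)"
    obtain B where B: "0 \<le> B"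
      "\<And>F e h g. F \<in> borel_measurable M \<Longrightarrow> 0 \<le> e \<Longrightarrow>
        (\<And>z. z \<in> space M \<Longrightarrow> cmod (F z) \<le> e * locnorm t (mobU z h) * locnorm t (mobU z g)) \<Longrightarrow>
        integrable M F \<and> cmod (\<integral>z. F z \<partial>M) \<le> e * B * norm h * norm g"
      using sesq_bound[OF t] by metis
    show ?thesis
    proof (rule approx_form_limit)
      fix e :: real assume e: "e > 0"
      define d where "d = e / (K * B + 1)"
      have KB: "0 \<le> K * B" using K B by simp
      have d: "0 < d" using e KB by (simp add: d_def add_nonneg_pos)
      have dKB: "K * d * B \<le> e"
      proof -
        have "K * d * B = (K * B) * d" by simp
        also have "\<dots> \<le> (K * B + 1) * d" using d by (intro mult_right_mono) auto
        also have "\<dots> = e" using KB by (simp add: d_def add_nonneg_eq_0_iff)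
        finally show ?thesis .
      qed
      from span[OF d] obtain n :: nat and N :: "nat \<Rightarrow> nat" and \<alpha> w where W: "(\<forall>m j. w m j \<in> polydisc) \<and>
        (\<forall>(k :: 'n bergman) (l :: 'n bergman). cmod (eval k b * cnj (eval l 0) -
         (\<Sum>m\<le>n. \<Sum>j<N m. \<alpha> m j * (eval k (w m j) * cnj (eval l (w m j))))) \<le> d * locnorm t k * locnorm t l)"
        by (elim exE) (rule that)
      note w = W[THEN conjunct1, rule_format] and le = W[THEN conjunct2, rule_format]
      define q where "q h g = (\<Sum>m\<le>n. \<Sum>j<N m. \<alpha> m j * (\<integral>z. c z * (eval (mobU z h) (w m j) * cnj (eval (mobU z g) (w m j))) \<partial>M))" for h g
      have "approx_form q"
        unfolding q_def[abs_def]
        by (rule approx_form_sum, rule approx_form_sum, rule approx_form_cmult, rule diag_approx[OF c cK w])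
      moreover have "cmod ((\<integral>z. c z * (eval (mobU z h) b * cnj (eval (mobU z g) 0)) \<partial>M) - q h g) \<le> e * norm h * norm g" for h g
      proof -
        define F where "F z = c z * (eval (mobU z h) b * cnj (eval (mobU z g) 0))" for z
        define G where "G m j z = c z * (eval (mobU z h) (w m j) * cnj (eval (mobU z g) (w m j)))" for m j z
        have iF: "integrable M F" unfolding F_def by (rule integrable_point_sesq[OF c cK b zero_in_polydisc])
        have iG: "integrable M (G m j)" for m j unfolding G_def by (rule integrable_point_sesq[OF c cK w w])
        have iS: "integrable M (\<lambda>z. \<Sum>m\<le>n. \<Sum>j<N m. \<alpha> m j * G m j z)"
          by (intro Bochner_Integration.integrable_sum integrable_mult_right iG)
        have "q h g = (\<integral>z. (\<Sum>m\<le>n. \<Sum>j<N m. \<alpha> m j * G m j z) \<partial>M)"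
          unfolding q_def G_def[symmetric]
          by (simp add: Bochner_Integration.integral_sum iG)
        then have "(\<integral>z. F z \<partial>M) - q h g = (\<integral>z. F z - (\<Sum>m\<le>n. \<Sum>j<N m. \<alpha> m j * G m j z) \<partial>M)"
          using Bochner_Integration.integral_diff[OF iF iS] by simp
        also have "cmod \<dots> \<le> (K * d) * B * norm h * norm g"
        proof (rule conjunct2[OF B(2)])
          show "(\<lambda>z. F z - (\<Sum>m\<le>n. \<Sum>j<N m. \<alpha> m j * G m j z)) \<in> borel_measurable M"
            using Bochner_Integration.integrable_diff[OF iF iS] by (rule borel_measurable_integrable)
          show "0 \<le> K * d" using K d by simp
          fix z
          have "F z - (\<Sum>m\<le>n. \<Sum>j<N m. \<alpha> m j * G m j z) = c z * (eval (mobU z h) b * cnj (eval (mobU z g) 0) -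
             (\<Sum>m\<le>n. \<Sum>j<N m. \<alpha> m j * (eval (mobU z h) (w m j) * cnj (eval (mobU z g) (w m j)))))"
            unfolding F_def G_def right_diff_distrib sum_distrib_left by (simp add: mult.left_commute)
          then have "cmod (F z - (\<Sum>m\<le>n. \<Sum>j<N m. \<alpha> m j * G m j z)) \<le> K * (d * locnorm t (mobU z h) * locnorm t (mobU z g))"
            unfolding norm_mult[of "c z"] by (simp only: norm_mult[of "c z"]) (intro mult_mono cK le K norm_ge_zero)
          then show "cmod (F z - (\<Sum>m\<le>n. \<Sum>j<N m. \<alpha> m j * G m j z)) \<le> K * d * locnorm t (mobU z h) * locnorm t (mobU z g)"
            by (simp add: mult.assoc)
        qed
        also have "\<dots> \<le> e * norm h * norm g"
          using dKB by (intro mult_right_mono) auto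
        finally show ?thesis unfolding F_def .
      qed
      ultimately show "\<exists>q'. approx_form q' \<and> (\<forall>h g. cmod ((\<integral>z. c z * (eval (mobU z h) b * cnj (eval (mobU z g) 0)) \<partial>M) - q' h g)
         \<le> e * norm h * norm g)"
        by blast
    qed
  qed
qed

text \<open>A functional varying with z is admissible if, uniformly in z, it is close to evaluations
  at finitely many fixed points with coefficients that are bounded functions of z: these
  coefficients can play the role of \<open>c\<close> in \<open>off_diag_approx\<close>. The bound
  \<open>K\<close> may depend on the accuracy.\<close>

lemma functional_approx:
  fixes L :: "complex ^ 'n \<Rightarrow> 'n bergman \<Rightarrow> complex"
  assumes Lm: "\<And>h. (\<lambda>z. L z (mobU z h)) \<in> borel_measurable M" and t: "0 \<le> t" "t < 1"
    and appr: "\<And>d. d > 0 \<Longrightarrow> \<exists>Z c K. finite Z \<and> Z \<subseteq> polydisc \<and>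
      (\<forall>p\<in>Z. c p \<in> borel_measurable M \<and> (\<forall>z. cmod (c p z) \<le> K)) \<and>
      (\<forall>z\<in>space M. \<forall>k. cmod (L z k - (\<Sum>p\<in>Z. c p z * eval k p)) \<le> d * locnorm t k)"
  shows "approx_form (\<lambda>h g. \<integral>z. L z (mobU z h) * cnj (eval (mobU z g) 0) \<partial>M)"
proof -
  obtain C0 t0 where C0: "0 \<le> C0" "0 \<le> t0" "t0 < 1" "\<And>k :: 'n bergman. cmod (eval k 0) \<le> C0 * locnorm t0 k"
    using eval_0_le_locnorm by metis
  define s where "s = max t t0"
  have s: "0 \<le> s" "s < 1" "t \<le> s" "t0 \<le> s" using t C0 by (auto simp: s_def)
  obtain B where B: "0 \<le> B"
    "\<And>F e h g. F \<in> borel_measurable M \<Longrightarrow> 0 \<le> e \<Longrightarrow>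
      (\<And>z. z \<in> space M \<Longrightarrow> cmod (F z) \<le> e * locnorm s (mobU z h) * locnorm s (mobU z g)) \<Longrightarrow>
      integrable M F \<and> cmod (\<integral>z. F z \<partial>M) \<le> e * B * norm h * norm g"
    using sesq_bound[OF s(1,2)] by metis
  show ?thesis
  proof (rule approx_form_limit)
    fix e :: real assume e: "e > 0"
    define d where "d = e / (C0 * B + 1)"
    have CB: "0 \<le> C0 * B" using C0 B by simp
    have d: "0 < d" using e CB by (simp add: d_def add_nonneg_pos)
    have dCB: "d * C0 * B \<le> e"
    proof -
      have "d * C0 * B = (C0 * B) * d" by simp
      also have "\<dots> \<le> (C0 * B + 1) * d" using d by (intro mult_right_mono) auto
      also have "\<dots> = e" using CB by (simp add: d_def add_nonneg_eq_0_iff)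
      finally show ?thesis .
    qed
    from appr[OF d] obtain Z c K where W: "finite Z \<and> Z \<subseteq> polydisc \<and>
      (\<forall>p\<in>Z. c p \<in> borel_measurable M \<and> (\<forall>z. cmod (c p z) \<le> K)) \<and>
      (\<forall>z\<in>space M. \<forall>k. cmod (L z k - (\<Sum>p\<in>Z. c p z * eval k p)) \<le> d * locnorm t k)"
      by (elim exE) (rule that)
    then have Z: "finite Z" "Z \<subseteq> polydisc"
      and c: "\<And>p. p \<in> Z \<Longrightarrow> c p \<in> borel_measurable M" "\<And>p z. p \<in> Z \<Longrightarrow> cmod (c p z) \<le> K"
      and le: "\<And>z k. z \<in> space M \<Longrightarrow> cmod (L z k - (\<Sum>p\<in>Z. c p z * eval k p)) \<le> d * locnorm t k"
      by simp_all
    define q where "q h g = (\<Sum>p\<in>Z. \<integral>z. c p z * (eval (mobU z h) p * cnj (eval (mobU z g) 0)) \<partial>M)" for h g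
    have "approx_form q"
      unfolding q_def[abs_def]
      by (rule approx_form_sum, rule off_diag_approx[OF c]) (use Z(2) in blast)+
    moreover have "cmod ((\<integral>z. L z (mobU z h) * cnj (eval (mobU z g) 0) \<partial>M) - q h g) \<le> e * norm h * norm g" for h g
    proof -
      define G where "G p z = c p z * (eval (mobU z h) p * cnj (eval (mobU z g) 0))" for p z
      have iG: "integrable M (G p)" if "p \<in> Z" for p
        unfolding G_def using Z(2) that by (intro integrable_point_sesq[OF c[OF that]] zero_in_polydisc) auto
      have iS: "integrable M (\<lambda>z. \<Sum>p\<in>Z. G p z)"
        by (intro Bochner_Integration.integrable_sum iG)
      define D where "D z = (L z (mobU z h) - (\<Sum>p\<in>Z. c p z * eval (mobU z h) p)) * cnj (eval (mobU z g) 0)" for z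
      have DG: "L z (mobU z h) * cnj (eval (mobU z g) 0) = D z + (\<Sum>p\<in>Z. G p z)" for z
        unfolding D_def G_def left_diff_distrib sum_distrib_right by (simp add: mult.assoc)
      have cm: "(\<lambda>z. \<Sum>p\<in>Z. c p z * eval (mobU z h) p) \<in> borel_measurable M"
      proof (rule borel_measurable_sum)
        fix p assume "p \<in> Z"
        note [measurable] = c(1)[OF this]
        show "(\<lambda>z. c p z * eval (mobU z h) p) \<in> borel_measurable M" by measurable
      qed
      have Dm: "D \<in> borel_measurable M"
        unfolding D_def[abs_def]
        by (intro borel_measurable_times borel_measurable_diff Lm cm) measurable
      have D: "integrable M D \<and> cmod (\<integral>z. D z \<partial>M) \<le> (d * C0) * B * norm h * norm g"
      proof (rule B(2)[OF Dm])
        show "0 \<le> d * C0" using d C0 by simp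
        fix z assume z: "z \<in> space M"
        have "cmod (D z) \<le> (d * locnorm t (mobU z h)) * (C0 * locnorm t0 (mobU z g))"
          unfolding D_def norm_mult complex_mod_cnj using d by (intro mult_mono le[OF z] C0(4)) auto
        also have "\<dots> \<le> (d * locnorm s (mobU z h)) * (C0 * locnorm s (mobU z g))"
          using d C0(1) by (intro mult_mono mult_left_mono locnorm_mono s) auto
        finally show "cmod (D z) \<le> d * C0 * locnorm s (mobU z h) * locnorm s (mobU z g)" by (simp add: mult_ac)
      qed
      have "(\<integral>z. L z (mobU z h) * cnj (eval (mobU z g) 0) \<partial>M) = (\<integral>z. D z \<partial>M) + (\<integral>z. (\<Sum>p\<in>Z. G p z) \<partial>M)"
        unfolding DG using D iS by (intro Bochner_Integration.integral_add) auto
      also have "(\<integral>z. (\<Sum>p\<in>Z. G p z) \<partial>M) = q h g"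
        unfolding q_def G_def[symmetric] by (rule Bochner_Integration.integral_sum[OF iG])
      finally have "cmod ((\<integral>z. L z (mobU z h) * cnj (eval (mobU z g) 0) \<partial>M) - q h g) \<le> (d * C0) * B * norm h * norm g"
        using D by simp
      also have "\<dots> \<le> e * norm h * norm g"
        using dCB by (intro mult_right_mono) auto
      finally show ?thesis .
    qed
    ultimately show "\<exists>q'. approx_form q' \<and> (\<forall>h g. cmod ((\<integral>z. L z (mobU z h) * cnj (eval (mobU z g) 0) \<partial>M) - q' h g)
         \<le> e * norm h * norm g)"
      by blast
  qed
qed

end

section \<open>Functionals that vary with the base point\<close>

text \<open>A measurable choice of a nearby net point: take the first centre in a list of finitely
  many that lies within distance \<open>d\<close>.\<close>

lemma finite_net_function:
  fixes S :: "'a::euclidean_space set"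
  assumes "compact S" "0 < d"
  obtains \<sigma> where "\<sigma> \<in> borel_measurable borel" "finite (\<sigma> ` S)" "\<sigma> ` S \<subseteq> S" "\<And>u. u \<in> S \<Longrightarrow> norm (u - \<sigma> u) \<le> d"
proof -
  have cover: "S \<subseteq> (\<Union>x\<in>S. ball x d)" using assms(2) by auto
  obtain F where F: "F \<subseteq> S" "finite F" "S \<subseteq> (\<Union>x\<in>F. ball x d)"
    by (rule compactE_image[OF assms(1) open_ball cover])
  obtain xs where xs: "set xs = F" using finite_list[OF F(2)] by blast
  \<comment> \<open>The default 0 is reached only if no centre is near, which does not happen on
    \<open>S\<close>.\<close>
  define \<sigma> where "\<sigma> u = foldr (\<lambda>x y. if dist u x < d then x else y) xs 0" for u
  have m: "(\<lambda>u. foldr (\<lambda>x y. if dist u x < d then x else y) ys 0) \<in> borel_measurable borel" for ys :: "'a list"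
  proof (induction ys)
    case (Cons y ys)
    note [measurable] = Cons.IH
    show ?case by simp
  qed simp
  have v: "foldr (\<lambda>x y. if dist u x < d then x else y) ys 0 \<in> set ys \<and>
      dist u (foldr (\<lambda>x y. if dist u x < d then x else y) ys 0) < d"
    if "\<exists>x\<in>set ys. dist u x < d" for u and ys :: "'a list"
    using that by (induction ys) auto
  have ex: "\<exists>x\<in>set xs. dist u x < d" if "u \<in> S" for u
  proof -
    obtain x where "x \<in> F" "u \<in> ball x d" using F(3) \<open>u \<in> S\<close> by blast
    then show ?thesis unfolding xs by (intro bexI[of _ x]) (simp_all add: dist_commute)
  qed
  have vs: "\<sigma> u \<in> F \<and> dist u (\<sigma> u) < d" if "u \<in> S" for u
    using v[OF ex[OF that]] unfolding \<sigma>_def xs by blast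
  show ?thesis
  proof (rule that)
    show "\<sigma> \<in> borel_measurable borel" unfolding \<sigma>_def by (rule m)
    have "\<sigma> ` S \<subseteq> F" using vs by blast
    then show "finite (\<sigma> ` S)" "\<sigma> ` S \<subseteq> S" using F finite_subset by auto
    show "norm (u - \<sigma> u) \<le> d" if "u \<in> S" for u
      using vs[OF that] by (simp add: dist_norm)
  qed
qed

lemma compact_pd: "compact (pd r :: (complex ^ 'n) set)"
proof (cases "r < 0")
  case True
  then have "(pd r :: (complex ^ 'n) set) = {}"
    unfolding pd_def using norm_ge_zero order_trans linorder_not_le by (metis (mono_tags, lifting) empty_Collect_eq)
  then show ?thesis by simp
next
  case False
  have "bounded (pd r :: (complex ^ 'n) set)"
  proof (rule boundedI)
    fix z :: "complex ^ 'n" assume z: "z \<in> pd r"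
    have "norm z \<le> (\<Sum>i\<in>UNIV. norm (z $ i))"
      unfolding norm_vec_def by (rule L2_set_le_sum) simp
    also have "\<dots> \<le> (\<Sum>i\<in>(UNIV :: 'n set). r)"
      using z by (intro sum_mono) (auto simp: pd_def)
    finally show "norm z \<le> (\<Sum>i\<in>(UNIV :: 'n set). r)" .
  qed
  then show ?thesis using closed_pd by (simp add: compact_eq_bounded_closed)
qed

context lf_measure
begin

text \<open>Rounding \<open>b z\<close> to a finite net of the compact \<open>pd r\<close> costs
  little by the Lipschitz estimate. The coefficient of a net point is then \<open>c\<close> cut to
  the set where \<open>b z\<close> is rounded to that point.\<close>

lemma point_functional:
  assumes c [measurable]: "c \<in> borel_measurable M" and cK: "\<And>z. cmod (c z) \<le> K"
    and b [measurable]: "b \<in> borel_measurable M" and br: "\<And>z. b z \<in> pd r" and r: "0 \<le> r" "r < 1"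
  shows "approx_form (\<lambda>h g. \<integral>z. c z * eval (mobU z h) (b z) * cnj (eval (mobU z g) 0) \<partial>M)"
proof -
  obtain C t where C: "0 \<le> C" "0 \<le> t" "t < 1" and
    lip: "\<And>k :: 'n bergman. \<And>u v. u \<in> pd r \<Longrightarrow> v \<in> pd r \<Longrightarrow> cmod (eval k u - eval k v) \<le> C * locnorm t k * norm (u - v)"
    using eval_lipschitz_locnorm[OF r] by metis
  have K: "0 \<le> K" using order_trans[OF norm_ge_zero cK] .
  show ?thesis
  proof (rule functional_approx[OF _ C(2,3), where L = "\<lambda>z k. c z * eval k (b z)"])
    show "(\<lambda>z. c z * eval (mobU z h) (b z)) \<in> borel_measurable M" for h by measurable
    fix d :: real assume d: "0 < d"
    define s where "s = d / (K * C + 1)"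
    have KC: "0 \<le> K * C" using K C by simp
    have s: "0 < s" using d KC by (simp add: s_def add_nonneg_pos)
    have sd: "K * C * s \<le> d"
    proof -
      have "K * C * s \<le> (K * C + 1) * s" using s by (intro mult_right_mono) auto
      also have "\<dots> = d" using KC by (simp add: s_def add_nonneg_eq_0_iff)
      finally show ?thesis .
    qed
    obtain \<sigma> where \<sigma> [measurable]: "\<sigma> \<in> borel_measurable borel" and \<sigma>': "finite (\<sigma> ` pd r)" "\<sigma> ` pd r \<subseteq> pd r"
      "\<And>u :: complex ^ 'n. u \<in> pd r \<Longrightarrow> norm (u - \<sigma> u) \<le> s"
      using finite_net_function[OF compact_pd s] by metis
    show "\<exists>Z cf K. finite Z \<and> Z \<subseteq> polydisc \<and>
      (\<forall>p\<in>Z. cf p \<in> borel_measurable M \<and> (\<forall>z. cmod (cf p z) \<le> K)) \<and>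
      (\<forall>z\<in>space M. \<forall>k. cmod (c z * eval k (b z) - (\<Sum>p\<in>Z. cf p z * eval k p)) \<le> d * locnorm t k)"
    proof (intro exI conjI ballI allI)
      show "finite (\<sigma> ` pd r)" by fact
      show "\<sigma> ` pd r \<subseteq> polydisc" using \<sigma>'(2) pd_subset[OF r(2)] by blast
      show "(\<lambda>z. if \<sigma> (b z) = p then c z else 0) \<in> borel_measurable M" for p
      proof -
        have [measurable]: "Measurable.pred M (\<lambda>z. \<sigma> (b z) = p)"
          by (rule pred_eq_const1[of _ _ borel]) (simp_all add: measurable_compose[OF b \<sigma>])
        show ?thesis by measurable
      qed
      show "cmod (if \<sigma> (b z) = p then c z else 0) \<le> K" for p z using cK K by simp
      fix z k
      have "(\<Sum>p\<in>\<sigma> ` pd r. (if \<sigma> (b z) = p then c z else 0) * eval k p) = (\<Sum>p\<in>\<sigma> ` pd r. if p = \<sigma> (b z) then c z * eval k p else 0)"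
        by (intro sum.cong refl) auto
      also have "\<dots> = c z * eval k (\<sigma> (b z))"
        using \<sigma>'(1) br[of z] by (subst sum.delta) auto
      finally have e: "(\<Sum>p\<in>\<sigma> ` pd r. (if \<sigma> (b z) = p then c z else 0) * eval k p) = c z * eval k (\<sigma> (b z))" .
      have "cmod (c z * eval k (b z) - c z * eval k (\<sigma> (b z))) = cmod (c z) * cmod (eval k (b z) - eval k (\<sigma> (b z)))"
        by (simp add: right_diff_distrib[symmetric] norm_mult)
      also have "\<dots> \<le> K * (C * locnorm t k * norm (b z - \<sigma> (b z)))"
        using K br[of z] \<sigma>'(2) by (intro mult_mono cK lip) auto
      also have "\<dots> \<le> K * (C * locnorm t k * s)"
        using K C \<sigma>'(3)[OF br[of z]] by (intro mult_left_mono) auto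
      also have "\<dots> = K * C * s * locnorm t k" by simp
      also have "\<dots> \<le> d * locnorm t k" using sd by (intro mult_right_mono) auto
      finally show "cmod (c z * eval k (b z) - (\<Sum>p\<in>\<sigma> ` pd r. (if \<sigma> (b z) = p then c z else 0) * eval k p)) \<le> d * locnorm t k"
        unfolding e .
    qed
  qed
qed

text \<open>The evaluation point, rather than the coefficient \<open>p z u\<close>, is rounded to a
  net: the coefficient of a net point is the integral of \<open>p z\<close> over the u rounded to
  it. No regularity of \<open>p\<close> beyond measurability and boundedness enters.\<close>

lemma integral_functional:
  assumes c [measurable]: "c \<in> borel_measurable M" and cK: "\<And>z. cmod (c z) \<le> K"
    and p [measurable]: "(\<lambda>q. p (fst q) (snd q)) \<in> borel_measurable (M \<Otimes>\<^sub>M borel)" and pP: "\<And>z u. cmod (p z u) \<le> P"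
    and r: "0 \<le> r" "r < 1"
  shows "approx_form (\<lambda>h g. \<integral>z. c z * (\<integral>u. indicator (pd r) u * (p z u * eval (mobU z h) u) \<partial>dvb) * cnj (eval (mobU z g) 0) \<partial>M)"
proof -
  obtain C t where C: "0 \<le> C" "0 \<le> t" "t < 1" and
    lip: "\<And>k :: 'n bergman. \<And>u v. u \<in> pd r \<Longrightarrow> v \<in> pd r \<Longrightarrow> cmod (eval k u - eval k v) \<le> C * locnorm t k * norm (u - v)"
    using eval_lipschitz_locnorm[OF r] by metis
  have K: "0 \<le> K" using order_trans[OF norm_ge_zero cK] .
  have P: "0 \<le> P" using order_trans[OF norm_ge_zero pP] .
  have pd: "(\<lambda>q. p (fst q) (snd q)) \<in> borel_measurable (M \<Otimes>\<^sub>M dvb)"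
    using p by (simp cong: measurable_cong_sets sets_pair_measure_cong)
  have pz [measurable]: "p z \<in> borel_measurable borel" if "z \<in> space M" for z
    using measurable_compose[OF measurable_Pair1'[OF that] p] by simp
  show ?thesis
  proof (rule functional_approx[OF _ C(2,3), where L = "\<lambda>z k. c z * (\<integral>u. indicator (pd r) u * (p z u * eval k u) \<partial>dvb)"])
    show "(\<lambda>z. c z * (\<integral>u. indicator (pd r) u * (p z u * eval (mobU z h) u) \<partial>dvb)) \<in> borel_measurable M" for h
    proof -
      have "(\<lambda>q. indicator (pd r) (snd q) * (p (fst q) (snd q) * eval (mobU (fst q) h) (snd q))) \<in> borel_measurable (M \<Otimes>\<^sub>M dvb)"
        using pd by measurable
      then have "(\<lambda>z. \<integral>u. indicator (pd r) u * (p z u * eval (mobU z h) u) \<partial>dvb) \<in> borel_measurable M"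
        by (intro dvb.borel_measurable_lebesgue_integral) (simp add: case_prod_beta')
      then show ?thesis by measurable
    qed
    fix d :: real assume d: "0 < d"
    define s where "s = d / (K * P * C + 1)"
    have KC: "0 \<le> K * P * C" using K C P by simp
    have s: "0 < s" using d KC by (simp add: s_def add_nonneg_pos)
    have sd: "K * P * C * s \<le> d"
    proof -
      have "K * P * C * s \<le> (K * P * C + 1) * s" using s by (intro mult_right_mono) auto
      also have "\<dots> = d" using KC by (simp add: s_def add_nonneg_eq_0_iff)
      finally show ?thesis .
    qed
    obtain \<sigma> where \<sigma> [measurable]: "\<sigma> \<in> borel_measurable borel" and \<sigma>': "finite (\<sigma> ` pd r)" "\<sigma> ` pd r \<subseteq> pd r"
      "\<And>u :: complex ^ 'n. u \<in> pd r \<Longrightarrow> norm (u - \<sigma> u) \<le> s"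
      using finite_net_function[OF compact_pd s] by metis
    have [measurable]: "Measurable.pred borel (\<lambda>u. \<sigma> u = q)" for q
      by (rule pred_eq_const1[of _ _ borel]) simp_all
    define a where "a q z = (\<integral>u. indicator (pd r) u * (if \<sigma> u = q then p z u else 0) \<partial>dvb)" for q z
    \<comment> \<open>Required for every z, while measurability of \<open>p z\<close> is known for
      \<open>z \<in> space M\<close>; where the integrand is not integrable, the integral is 0 by
      convention.\<close>
    have ale: "cmod (a q z) \<le> P" for q z
    proof (cases "integrable dvb (\<lambda>u. indicator (pd r) u * (if \<sigma> u = q then p z u else 0))")
      case True
      have "cmod (a q z) \<le> (\<integral>u. P \<partial>(dvb :: (complex ^ 'n) measure))"
        unfolding a_def
      proof (rule Bochner_Integration.integral_norm_bound_integral[OF True])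
        show "norm (indicator (pd r) u * (if \<sigma> u = q then p z u else 0)) \<le> P" for u
          using pP P by (simp add: indicator_def)
      qed simp
      then show ?thesis by (simp add: measure_def emeasure_dvb_UNIV)
    qed (simp add: a_def not_integrable_integral_eq P)
    show "\<exists>Z cf K. finite Z \<and> Z \<subseteq> polydisc \<and>
      (\<forall>p\<in>Z. cf p \<in> borel_measurable M \<and> (\<forall>z. cmod (cf p z) \<le> K)) \<and>
      (\<forall>z\<in>space M. \<forall>k. cmod (c z * (\<integral>u. indicator (pd r) u * (p z u * eval k u) \<partial>dvb) - (\<Sum>p\<in>Z. cf p z * eval k p)) \<le> d * locnorm t k)"
    proof (intro exI conjI ballI allI)
      show "finite (\<sigma> ` pd r)" by fact
      show "\<sigma> ` pd r \<subseteq> polydisc" using \<sigma>'(2) pd_subset[OF r(2)] by blast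
      show "(\<lambda>z. c z * a q z) \<in> borel_measurable M" for q
      proof -
        have [measurable]: "Measurable.pred (M \<Otimes>\<^sub>M dvb) (\<lambda>x. \<sigma> (snd x) = q)"
          by (rule pred_eq_const1[of _ _ borel]) (use \<sigma> in measurable)
        have "(\<lambda>x. indicator (pd r) (snd x) * (if \<sigma> (snd x) = q then p (fst x) (snd x) else 0)) \<in> borel_measurable (M \<Otimes>\<^sub>M dvb)"
          using pd by measurable
        then have "a q \<in> borel_measurable M"
          unfolding a_def by (intro dvb.borel_measurable_lebesgue_integral) (simp add: case_prod_beta')
        then show ?thesis by measurable
      qed
      show "cmod (c z * a q z) \<le> K * P" for q z
        unfolding norm_mult using K by (intro mult_mono cK ale) auto
      fix z :: "complex ^ 'n" and k :: "'n bergman" assume z: "z \<in> space M"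
      note [measurable] = pz[OF z]
      have iq: "integrable dvb (\<lambda>u. indicator (pd r) u * (if \<sigma> u = q then p z u else 0))" for q
      proof (rule dvb.integrable_const_bound[where B = P])
        have "norm (indicator (pd r) u * (if \<sigma> u = q then p z u else 0)) \<le> P" for u
          using pP[of z u] P by (simp add: indicator_def)
        then show "AE u in dvb. norm (indicator (pd r) u * (if \<sigma> u = q then p z u else 0)) \<le> P" by simp
        have "(\<lambda>u. if \<sigma> u = q then p z u else 0) \<in> borel_measurable borel"
          by (rule measurable_If) (use pz[OF z] in auto)
        then show "(\<lambda>u. indicator (pd r) u * (if \<sigma> u = q then p z u else 0)) \<in> borel_measurable dvb"
          unfolding measurable_cong_sets[OF sets_dvb refl]
          by (intro borel_measurable_times borel_measurable_indicator) simp_all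
      qed
      have ik: "integrable dvb (\<lambda>u. indicator (pd r) u * (p z u * eval k u))"
      proof (rule Bochner_Integration.integrable_bound)
        show "integrable dvb (\<lambda>u. P * cmod (eval k u))"
          by (intro integrable_mult_right Bochner_Integration.integrable_norm integrable_eval)
        have "norm (indicator (pd r) u * (p z u * eval k u)) \<le> norm (P * cmod (eval k u))" for u
        proof -
          have "cmod (p z u) * cmod (eval k u) \<le> P * cmod (eval k u)" by (intro mult_right_mono pP) simp
          then show ?thesis using P by (simp add: norm_mult indicator_def)
        qed
        then show "AE u in dvb. norm (indicator (pd r) u * (p z u * eval k u)) \<le> norm (P * cmod (eval k u))" by simp
        show "(\<lambda>u. indicator (pd r) u * (p z u * eval k u)) \<in> borel_measurable dvb"
          unfolding measurable_cong_sets[OF sets_dvb refl]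
          by (intro borel_measurable_times borel_measurable_indicator pz[OF z] measurable_eval) simp_all
      qed
      have sum: "(\<Sum>q\<in>\<sigma> ` pd r. (indicator (pd r) u * (if \<sigma> u = q then p z u else 0)) * eval k q) =
          indicator (pd r) u * (p z u * eval k (\<sigma> u))" for u
      proof (cases "u \<in> pd r")
        case True
        have "(\<Sum>q\<in>\<sigma> ` pd r. (indicator (pd r) u * (if \<sigma> u = q then p z u else 0)) * eval k q) =
          (\<Sum>q\<in>\<sigma> ` pd r. if q = \<sigma> u then p z u * eval k q else 0)"
          using True by (intro sum.cong refl) auto
        also have "\<dots> = p z u * eval k (\<sigma> u)"
          using \<sigma>'(1) True by (subst sum.delta) auto
        finally show ?thesis using True by simp
      qed simp
      have is': "integrable dvb (\<lambda>u. indicator (pd r) u * (p z u * eval k (\<sigma> u)))"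
        unfolding sum[symmetric] by (intro Bochner_Integration.integrable_sum integrable_mult_left iq)
      have "(\<Sum>q\<in>\<sigma> ` pd r. a q z * eval k q) = (\<integral>u. indicator (pd r) u * (p z u * eval k (\<sigma> u)) \<partial>dvb)"
        unfolding sum[symmetric] a_def
        by (subst Bochner_Integration.integral_sum) (auto intro!: integrable_mult_left iq)
      then have "(\<integral>u. indicator (pd r) u * (p z u * eval k u) \<partial>dvb) - (\<Sum>q\<in>\<sigma> ` pd r. a q z * eval k q) =
        (\<integral>u. indicator (pd r) u * (p z u * eval k u) - indicator (pd r) u * (p z u * eval k (\<sigma> u)) \<partial>dvb)"
        using Bochner_Integration.integral_diff[OF ik is'] by simp
      also have "cmod \<dots> \<le> (\<integral>u. P * (C * locnorm t k * s) \<partial>(dvb :: (complex ^ 'n) measure))"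
      proof (rule Bochner_Integration.integral_norm_bound_integral)
        show "integrable dvb (\<lambda>u. indicator (pd r) u * (p z u * eval k u) - indicator (pd r) u * (p z u * eval k (\<sigma> u)))"
          by (rule Bochner_Integration.integrable_diff[OF ik is'])
        show "integrable (dvb :: (complex ^ 'n) measure) (\<lambda>u. P * (C * locnorm t k * s))" by simp
        fix u :: "complex ^ 'n"
        show "norm (indicator (pd r) u * (p z u * eval k u) - indicator (pd r) u * (p z u * eval k (\<sigma> u))) \<le> P * (C * locnorm t k * s)"
        proof (cases "u \<in> pd r")
          case True
          then have "\<sigma> u \<in> pd r" using \<sigma>'(2) by blast
          then have "cmod (eval k u - eval k (\<sigma> u)) \<le> C * locnorm t k * norm (u - \<sigma> u)"
            by (rule lip[OF True])
          also have "\<dots> \<le> C * locnorm t k * s"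
            using C \<sigma>'(3)[OF True] by (intro mult_left_mono) auto
          finally have "cmod (p z u * (eval k u - eval k (\<sigma> u))) \<le> P * (C * locnorm t k * s)"
            unfolding norm_mult using P by (intro mult_mono pP) auto
          then show ?thesis using True by (simp add: right_diff_distrib)
        next
          case False
          then show ?thesis using P C s by simp
        qed
      qed
      also have "\<dots> = P * (C * locnorm t k * s)" by (simp add: measure_def emeasure_dvb_UNIV)
      finally have fin: "cmod ((\<integral>u. indicator (pd r) u * (p z u * eval k u) \<partial>dvb) - (\<Sum>q\<in>\<sigma> ` pd r. a q z * eval k q)) \<le> P * (C * locnorm t k * s)" .
      have "c z * (\<integral>u. indicator (pd r) u * (p z u * eval k u) \<partial>dvb) - (\<Sum>q\<in>\<sigma> ` pd r. c z * a q z * eval k q) =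
        c z * ((\<integral>u. indicator (pd r) u * (p z u * eval k u) \<partial>dvb) - (\<Sum>q\<in>\<sigma> ` pd r. a q z * eval k q))"
        by (simp add: right_diff_distrib sum_distrib_left mult.assoc)
      then have "cmod (c z * (\<integral>u. indicator (pd r) u * (p z u * eval k u) \<partial>dvb) - (\<Sum>q\<in>\<sigma> ` pd r. c z * a q z * eval k q))
         \<le> K * (P * (C * locnorm t k * s))"
        by (simp only: norm_mult) (intro mult_mono cK fin K norm_ge_zero)
      also have "\<dots> = K * P * C * s * locnorm t k" by simp
      also have "\<dots> \<le> d * locnorm t k" using sd by (intro mult_right_mono) auto
      finally show "cmod (c z * (\<integral>u. indicator (pd r) u * (p z u * eval k u) \<partial>dvb) - (\<Sum>q\<in>\<sigma> ` pd r. c z * a q z * eval k q)) \<le> d * locnorm t k" .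
    qed
  qed
qed

end

section \<open>The invariant measure\<close>

text \<open>The density is the unnormalized reproducing kernel on the diagonal. By
  \<open>om_mob\<close> it compensates the Jacobian of \<open>mob z\<close>.\<close>

definition lam :: "(complex ^ 'n) measure" where
  "lam = density dvb (\<lambda>z. ennreal (1 / (om z)\<^sup>2))"

lemma sets_lam [simp, measurable_cong]: "sets lam = sets borel"
  and space_lam [simp]: "space lam = UNIV"
  by (simp_all add: lam_def)

lemma nn_integral_lam:
  "F \<in> borel_measurable borel \<Longrightarrow> (\<integral>\<^sup>+z. F z \<partial>lam) = (\<integral>\<^sup>+z. ennreal (1 / (om z)\<^sup>2) * F z \<partial>dvb)"
  unfolding lam_def by (rule nn_integral_density) measurable

text \<open>By invariance the ball around \<open>x\<close> has the mass of \<open>pd r\<close>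
  around the origin, where \<open>om\<close> is at least the constant \<open>a\<close>.\<close>

lemma lf_measure_lam: "lf_measure (lam :: (complex ^ 'n::finite) measure)"
proof (unfold_locales)
  have "sigma_finite_measure (lam :: (complex ^ 'n) measure)"
    unfolding lam_def by (subst dvb.sigma_finite_iff_density_finite) auto
  then show "\<exists>A :: (complex ^ 'n) set set. countable A \<and> A \<subseteq> sets lam \<and> \<Union> A = space lam \<and> (\<forall>a\<in>A. emeasure lam a \<noteq> \<infinity>)"
    by (rule sigma_finite_measure.sigma_finite_countable)
  show "(\<lambda>z. z) \<in> lam \<rightarrow>\<^sub>M borel" by measurable
  fix r :: real assume r: "0 \<le> r" "r < 1"
  define a where "a = (1 - r\<^sup>2) ^ CARD('n)"
  have a: "0 < a" using r by (simp add: a_def abs_square_less_1)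
  have "(\<integral>\<^sup>+z. indicator polydisc z * indicator (pd r) (mob z x) \<partial>lam) \<le> ennreal (1 / a\<^sup>2)"
    if x: "x \<in> polydisc" for x :: "complex ^ 'n"
  proof -
    define F where "F z = ennreal (1 / (om z)\<^sup>2) * (indicator polydisc z * indicator (pd r) (mob x z))" for z
    have Fm [measurable]: "F \<in> borel_measurable borel" unfolding F_def[abs_def] by measurable
    have "(\<integral>\<^sup>+z. indicator polydisc z * indicator (pd r) (mob z x) \<partial>lam) = (\<integral>\<^sup>+z. F z \<partial>dvb)"
      unfolding F_def by (subst nn_integral_lam) (simp_all add: indicator_def mob_pd_commute[of x])
    also have "\<dots> = (\<integral>\<^sup>+u. F (mob x u) * ennreal ((cmod (kf x u))\<^sup>2) \<partial>dvb)"
      by (rule nn_integral_dvb_mob[OF x Fm, symmetric])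
    also have "\<dots> \<le> (\<integral>\<^sup>+u. ennreal (1 / a\<^sup>2) \<partial>(dvb :: (complex ^ 'n) measure))"
    proof (rule nn_integral_mono_AE)
      show "AE u in dvb. F (mob x u) * ennreal ((cmod (kf x u))\<^sup>2) \<le> ennreal (1 / a\<^sup>2)"
        using AE_dvb_polydisc
      proof eventually_elim
        case (elim u)
        show ?case
        proof (cases "u \<in> pd r")
          case True
          have om: "om (mob x u) = om u * cmod (kf x u)" by (rule om_mob[OF x elim])
          have k: "cmod (kf x u) > 0" using kf_nz[OF x elim] by simp
          have "F (mob x u) * ennreal ((cmod (kf x u))\<^sup>2) = ennreal (1 / (om (mob x u))\<^sup>2 * (cmod (kf x u))\<^sup>2)"
            using True elim x by (simp add: F_def ennreal_mult[symmetric])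
          also have "1 / (om (mob x u))\<^sup>2 * (cmod (kf x u))\<^sup>2 = 1 / (om u)\<^sup>2"
            unfolding om using k by (simp add: power_mult_distrib)
          also have "ennreal (1 / (om u)\<^sup>2) \<le> ennreal (1 / a\<^sup>2)"
            using om_ge_pd[OF True r] a unfolding a_def[symmetric]
            by (intro ennreal_leI divide_left_mono power_mono) auto
          finally show ?thesis .
        next
          case False
          then show ?thesis using elim x by (simp add: F_def)
        qed
      qed
    qed
    also have "\<dots> = ennreal (1 / a\<^sup>2)" by (simp add: emeasure_dvb_UNIV)
    finally show ?thesis .
  qed
  then show "\<exists>B\<ge>0. \<forall>x\<in>polydisc. (\<integral>\<^sup>+z. indicator polydisc z * indicator (pd r) (mob z x) \<partial>(lam :: (complex ^ 'n) measure)) \<le> ennreal B"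
    by (intro exI[of _ "1 / a\<^sup>2"]) simp
qed

interpretation lam: lf_measure lam
  by (rule lf_measure_lam)

section \<open>A Schur test\<close>

lemma emeasure_dv1_annulus:
  assumes "0 \<le> t" "t \<le> 1"
  shows "emeasure dv1 {w. 1 - (cmod w)\<^sup>2 \<le> t} \<le> ennreal t"
proof -
  define \<rho> where "\<rho> = sqrt (1 - t)"
  have \<rho>: "0 \<le> \<rho>" "\<rho> \<le> 1" "\<rho>\<^sup>2 = 1 - t" using assms by (auto simp: \<rho>_def)
  have sub: "ball 0 1 \<inter> {w. 1 - (cmod w)\<^sup>2 \<le> t} \<subseteq> ball 0 1 - ball 0 \<rho>"
  proof safe
    fix w :: complex assume "1 - (cmod w)\<^sup>2 \<le> t" "w \<in> ball 0 \<rho>"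
    then have "cmod w < \<rho>" "\<rho>\<^sup>2 \<le> (cmod w)\<^sup>2" using \<rho> by auto
    then show False using power2_le_imp_le[of \<rho> "cmod w"] by simp
  qed
  define V where "V = unit_ball_vol 2"
  have V: "0 < V" by (simp add: V_def)
  have vb: "emeasure lborel (ball 0 s :: complex set) = ennreal (V * s\<^sup>2)" if "0 \<le> s" for s
    using that by (simp add: emeasure_ball V_def)
  have m: "{w :: complex. 1 - (cmod w)\<^sup>2 \<le> t} \<in> sets lborel" by measurable
  have "emeasure dv1 {w. 1 - (cmod w)\<^sup>2 \<le> t} =
      emeasure lborel (ball 0 1 \<inter> {w. 1 - (cmod w)\<^sup>2 \<le> t}) / emeasure lborel (ball 0 1 :: complex set)"
    unfolding dv1_def using m by (intro emeasure_uniform_measure) auto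
  also have "\<dots> \<le> emeasure lborel (ball 0 1 - ball 0 \<rho> :: complex set) / emeasure lborel (ball 0 1 :: complex set)"
    by (intro divide_right_mono_ennreal emeasure_mono sub) auto
  also have "emeasure lborel (ball 0 1 - ball 0 \<rho> :: complex set) = ennreal (V * 1\<^sup>2) - ennreal (V * \<rho>\<^sup>2)"
    using \<rho> V by (subst emeasure_Diff) (auto simp: vb)
  also have "\<dots> = ennreal (V * t)"
    using V assms by (simp add: \<rho>(3) ennreal_minus algebra_simps)
  also have "ennreal (V * t) / emeasure lborel (ball 0 1 :: complex set) = ennreal t"
    using V assms by (simp add: vb divide_ennreal)
  finally show ?thesis .
qed

lemma dyadic_bracket:
  fixes t :: real
  assumes "0 < t" "t \<le> 1"
  obtains k where "1 / 2 ^ Suc k < t" "t \<le> 1 / 2 ^ k"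
proof -
  obtain n0 where "(1/2 :: real) ^ n0 < t" using real_arch_pow_inv[OF assms(1), of "1/2"] by auto
  then have ex: "1 / 2 ^ n0 < t" by (simp add: power_one_over)
  define n where "n = (LEAST n. 1 / 2 ^ n < t)"
  have n: "1 / 2 ^ n < t" unfolding n_def by (rule LeastI[of "\<lambda>n. 1 / 2 ^ n < t" n0]) (rule ex)
  have "n \<noteq> 0" using n assms by (intro notI) simp
  then obtain k where k: "n = Suc k" using not0_implies_Suc by blast
  have "\<not> 1 / 2 ^ k < t"
    using not_less_Least[of k "\<lambda>n. 1 / 2 ^ n < t"] k unfolding n_def by simp
  then show ?thesis using n k by (intro that[of k]) auto
qed

text \<open>The exponent -7/8 is -3/4 - 1/8: the Schur weight, and the price of the factor that
  makes the tail small. It exceeds -1, so the weight is integrable.\<close>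

definition radw :: "complex \<Rightarrow> real" where
  "radw w = indicator (ball 0 1) w * (1 - (cmod w)\<^sup>2) powr (- 7/8)"

lemma measurable_radw [measurable]: "radw \<in> borel_measurable borel"
  unfolding radw_def[abs_def] powr_def
  by (intro borel_measurable_times borel_measurable_indicator) simp_all

lemma radw_nonneg [simp]: "0 \<le> radw w"
  by (simp add: radw_def)

text \<open>Dyadic annuli: the k-th has normalized area at most 1/2^k and the weight there is at
  most the power \<open>a ^ Suc k\<close> with a < 2.\<close>

lemma nn_integral_radw: "(\<integral>\<^sup>+w. ennreal (radw w) \<partial>dv1) < \<infinity>"
proof -
  define a where "a = (2 :: real) powr (7/8)"
  have a: "0 < a" "a < 2" using powr_less_mono[of "7/8" 1 2] by (auto simp: a_def)
  define f where "f k w = ennreal (a ^ Suc k) * indicator {w. 1 - (cmod w)\<^sup>2 \<le> 1 / 2 ^ k} w" for k :: nat and w :: complex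
  have [measurable]: "{w :: complex. 1 - (cmod w)\<^sup>2 \<le> c} \<in> sets borel" for c by measurable
  have fm: "f k \<in> borel_measurable borel" for k unfolding f_def[abs_def] by measurable
  have le: "ennreal (radw w) \<le> (\<Sum>k. f k w)" for w
  proof (cases "w \<in> ball 0 1")
    case True
    define t where "t = 1 - (cmod w)\<^sup>2"
    have t: "0 < t" "t \<le> 1" using True by (auto simp: t_def abs_square_less_1)
    obtain k where k: "1 / 2 ^ Suc k < t" "t \<le> 1 / 2 ^ k" by (rule dyadic_bracket[OF t])
    have "t powr (- 7/8) \<le> (1 / 2 ^ Suc k) powr (- 7/8)"
      using k t by (intro powr_mono2') auto
    also have "\<dots> = a ^ Suc k"
      unfolding a_def by (simp add: powr_minus_divide powr_divide powr_power[symmetric] powr_realpow[symmetric] powr_powr mult.commute del: power_Suc)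
    finally have "ennreal (radw w) \<le> f k w"
      using True k(2) by (simp add: radw_def f_def t_def ennreal_leI)
    also have "f k w \<le> (\<Sum>k. f k w)"
      using sum_le_suminf[of "\<lambda>k. f k w" "{k}"] by simp
    finally show ?thesis .
  qed (simp add: radw_def)
  have geo: "summable (\<lambda>k. a ^ Suc k * (1 / 2 ^ k))"
  proof -
    have "(\<lambda>k. a ^ Suc k * (1 / 2 ^ k)) = (\<lambda>k. a * (a / 2) ^ k)"
      by (simp add: power_divide)
    then show ?thesis using a by (simp add: summable_mult summable_geometric)
  qed
  have "(\<integral>\<^sup>+w. ennreal (radw w) \<partial>dv1) \<le> (\<integral>\<^sup>+w. (\<Sum>k. f k w) \<partial>dv1)"
    by (rule nn_integral_mono[OF le])
  also have "\<dots> = (\<Sum>k. \<integral>\<^sup>+w. f k w \<partial>dv1)"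
    by (rule nn_integral_suminf) (use fm in simp)
  also have "\<dots> \<le> (\<Sum>k. ennreal (a ^ Suc k * (1 / 2 ^ k)))"
  proof (rule suminf_le)
    fix k
    have "(\<integral>\<^sup>+w. f k w \<partial>dv1) = ennreal (a ^ Suc k) * emeasure dv1 {w. 1 - (cmod w)\<^sup>2 \<le> 1 / 2 ^ k}"
      unfolding f_def by (rule nn_integral_cmult_indicator) simp
    also have "\<dots> \<le> ennreal (a ^ Suc k) * ennreal (1 / 2 ^ k)"
      by (intro mult_left_mono emeasure_dv1_annulus) auto
    finally show "(\<integral>\<^sup>+w. f k w \<partial>dv1) \<le> ennreal (a ^ Suc k * (1 / 2 ^ k))"
      using a by (subst ennreal_mult) (simp_all del: power_Suc)
  qed auto
  also have "\<dots> = ennreal (\<Sum>k. a ^ Suc k * (1 / 2 ^ k))"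
    using a by (intro suminf_ennreal2 geo) (auto simp del: power_Suc)
  also have "\<dots> < \<infinity>" by simp
  finally show ?thesis .
qed

lemma integrable_radw: "integrable dv1 radw"
  using nn_integral_radw by (intro integrableI_nonneg) auto

text \<open>The real part of \<open>(1 - w \<zeta>)\<^sup>-\<^sup>1\<^sup>/\<^sup>2\<close>, with \<open>\<zeta>\<close> the conjugate of \<open>z\<close>, is
  comparable to its modulus, and its mean over the circles around 0 is 1.\<close>

lemma radial_kernel_bound:
  assumes z: "cmod z < 1"
  shows "(\<integral>\<^sup>+w. ennreal (radw w * cmod (1 - w * cnj z) powr (- 1/2)) \<partial>dv1) \<le> ennreal (sqrt 2 * (\<integral>w. radw w \<partial>dv1))"
proof -
  define f where "f w = inverse (csqrt (1 - w * cnj z))" for w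
  have Re1: "0 < Re (1 - w * cnj z)" if "cmod w \<le> 1" for w
  proof -
    have "cmod (w * cnj z) \<le> 1 * cmod z" unfolding norm_mult complex_mod_cnj using that by (intro mult_right_mono) auto
    then have "cmod (w * cnj z) < 1" using z by simp
    then show ?thesis using complex_Re_le_cmod[of "w * cnj z"] by simp
  qed
  have comp: "cmod (1 - w * cnj z) powr (- 1/2) \<le> sqrt 2 * Re (f w)" if "cmod w \<le> 1" for w
  proof -
    define s where "s = csqrt (1 - w * cnj z)"
    have s2: "s\<^sup>2 = 1 - w * cnj z" by (simp add: s_def)
    have "0 < Re (s\<^sup>2)" using Re1[OF that] by (simp add: s2)
    \<comment> \<open>The root \<open>s\<close> has argument below \<pi>/4 in modulus, so its
      modulus is at most sqrt 2 times its real part.\<close>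
    then have q: "(Im s)\<^sup>2 < (Re s)\<^sup>2" by (simp add: power2_eq_square)
    have Re0: "0 \<le> Re s" unfolding s_def using csqrt_principal[of "1 - w * cnj z"] by auto
    have s0: "s \<noteq> 0" using \<open>0 < Re (s\<^sup>2)\<close> by auto
    have "(cmod s)\<^sup>2 \<le> (sqrt 2 * Re s)\<^sup>2"
      using q by (simp add: cmod_power2 power_mult_distrib)
    then have sq: "cmod s \<le> sqrt 2 * Re s" by (rule power2_le_imp_le) (use Re0 in simp)
    have "cmod (1 - w * cnj z) = (cmod s)\<^sup>2" by (simp add: s2[symmetric] norm_power)
    then have "cmod (1 - w * cnj z) powr (- 1/2) = 1 / cmod s"
      using s0 by (simp add: powr_minus_divide powr_half_sqrt)
    also have "\<dots> = cmod s / (cmod s)\<^sup>2" by (simp add: power2_eq_square)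
    also have "\<dots> \<le> sqrt 2 * Re s / (cmod s)\<^sup>2" by (rule divide_right_mono[OF sq]) simp
    also have "\<dots> = sqrt 2 * Re (inverse s)" by (simp add: cmod_power2)
    finally show ?thesis by (simp add: f_def s_def)
  qed
  have fm: "(\<lambda>w. radw w * f w) \<in> borel_measurable borel"
  proof -
    have "f holomorphic_on ball 0 1"
      unfolding f_def
    proof (intro holomorphic_intros)
      fix w :: complex assume "w \<in> ball 0 1"
      then have "cmod w \<le> 1" by simp
      from Re1[OF this] have R: "0 < Re (1 - w * cnj z)" .
      then show "1 - w * cnj z \<notin> \<real>\<^sub>\<le>\<^sub>0" by (auto simp: complex_nonpos_Reals_iff)
      show "csqrt (1 - w * cnj z) \<noteq> 0" using R unfolding csqrt_eq_0 by (metis less_irrefl zero_complex.sel(1))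
    qed
    then have [measurable]: "(\<lambda>w. indicator (ball 0 1) w *\<^sub>R f w) \<in> borel_measurable borel"
      by (intro borel_measurable_continuous_on_indicator holomorphic_on_imp_continuous_on) auto
    have "(\<lambda>w. radw w * (indicator (ball 0 1) w *\<^sub>R f w)) \<in> borel_measurable borel" by measurable
    also have "(\<lambda>w. radw w * (indicator (ball 0 1) w *\<^sub>R f w)) = (\<lambda>w. radw w * f w)"
      by (auto simp: fun_eq_iff radw_def indicator_def)
    finally show ?thesis .
  qed
  \<comment> \<open>This bound depends on \<open>z\<close> and serves integrability only; the final
    estimate, obtained from the mean value, is uniform in \<open>z\<close>.\<close>
  have fb: "cmod (f w) \<le> 1 / sqrt (1 - cmod z)" if "cmod w \<le> 1" for w
  proof -
    have "cmod (w * cnj z) \<le> 1 * cmod z" unfolding norm_mult complex_mod_cnj using that by (intro mult_right_mono) auto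
    then have "1 - cmod z \<le> cmod (1 - w * cnj z)" using norm_triangle_ineq2[of 1 "w * cnj z"] by simp
    then have "sqrt (1 - cmod z) \<le> sqrt (cmod (1 - w * cnj z))" by simp
    then show ?thesis using z unfolding f_def norm_inverse norm_csqrt inverse_eq_divide[where 'a = real] by (intro frac_le) auto
  qed
  have F: "integrable dv1 (\<lambda>w. radw w * f w)"
  proof (rule Bochner_Integration.integrable_bound)
    show "integrable dv1 (\<lambda>w. radw w * (1 / sqrt (1 - cmod z)))" by (intro integrable_mult_left integrable_radw)
    have "norm (radw w * f w) \<le> norm (radw w * (1 / sqrt (1 - cmod z)))" for w
    proof (cases "cmod w \<le> 1")
      case True
      have "radw w * cmod (f w) \<le> radw w * (1 / sqrt (1 - cmod z))" by (intro mult_left_mono fb True) simp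
      then show ?thesis using z by (simp add: norm_mult)
    next
      case False
      then show ?thesis by (simp add: radw_def)
    qed
    then show "AE w in dv1. norm (radw w * f w) \<le> norm (radw w * (1 / sqrt (1 - cmod z)))" by simp
  qed (use fm in simp)
  have rot: "radw (c * w) = radw w" if "cmod c = 1" for c w
    using that by (simp add: radw_def indicator_def norm_mult)
  have mean: "(\<integral>w. radw w * f w \<partial>dv1) = (\<integral>w. complex_of_real (radw w) \<partial>dv1)"
  proof (rule rotation_mean_value[where R = "(*)"])
    show "sigma_finite_measure dv1" by (rule dv1.sigma_finite_measure_axioms)
    show "distr dv1 dv1 ((*) c) = dv1" if "cmod c = 1" for c
      using dv1_rotate_distr[OF that] by (simp cong: distr_cong)
    show "(\<lambda>(c, w). c * w) \<in> borel \<Otimes>\<^sub>M dv1 \<rightarrow>\<^sub>M dv1" by measurable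
    fix w :: complex
    show "(\<integral>t. complex_of_real (radw (exp (2 * of_real pi * \<i> * of_real t) * w)) * f (exp (2 * of_real pi * \<i> * of_real t) * w)
       \<partial>(restrict_space lborel {0..1::real})) = complex_of_real (radw w)"
    proof (cases "cmod w < 1")
      case True
      have "(\<lambda>l. f (l * w)) holomorphic_on cball 0 1"
        unfolding f_def
      proof (intro holomorphic_intros)
        fix l :: complex assume "l \<in> cball 0 1"
        then have "cmod (l * w) \<le> 1" using True by (auto simp: norm_mult intro!: mult_le_one)
        from Re1[OF this] have R: "0 < Re (1 - l * w * cnj z)" by simp
        then show "1 - l * w * cnj z \<notin> \<real>\<^sub>\<le>\<^sub>0" by (auto simp: complex_nonpos_Reals_iff)
        show "csqrt (1 - l * w * cnj z) \<noteq> 0" using R unfolding csqrt_eq_0 by (metis less_irrefl zero_complex.sel(1))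
      qed
      from circle_mean_value(2)[OF this] show ?thesis by (simp add: rot f_def)
    next
      case False
      then have "radw w = 0" by (simp add: radw_def)
      then show ?thesis by (simp add: rot)
    qed
  qed (rule F)
  have iRe: "integrable dv1 (\<lambda>w. sqrt 2 * (radw w * Re (f w)))"
    using integrable_Re[OF F] by (intro integrable_mult_right) simp
  have "(\<integral>\<^sup>+w. ennreal (radw w * cmod (1 - w * cnj z) powr (- 1/2)) \<partial>dv1) \<le> (\<integral>\<^sup>+w. ennreal (sqrt 2 * (radw w * Re (f w))) \<partial>dv1)"
  proof (rule nn_integral_mono, rule ennreal_leI)
    fix w
    show "radw w * cmod (1 - w * cnj z) powr (- 1/2) \<le> sqrt 2 * (radw w * Re (f w))"
    proof (cases "cmod w \<le> 1")
      case True
      then show ?thesis using mult_left_mono[OF comp[OF True], of "radw w"] by (simp add: mult.left_commute)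
    next
      case False
      then show ?thesis by (simp add: radw_def)
    qed
  qed
  also have "\<dots> = ennreal (\<integral>w. sqrt 2 * (radw w * Re (f w)) \<partial>dv1)"
  proof (rule nn_integral_eq_integral[OF iRe])
    have "0 \<le> sqrt 2 * (radw w * Re (f w))" for w
    proof (cases "cmod w \<le> 1")
      case True
      have "0 \<le> sqrt 2 * Re (f w)" using order_trans[OF powr_ge_zero comp[OF True]] .
      then have "0 \<le> Re (f w)" by (simp add: zero_le_mult_iff)
      then show ?thesis by simp
    next
      case False
      then show ?thesis by (simp add: radw_def)
    qed
    then show "AE w in dv1. 0 \<le> sqrt 2 * (radw w * Re (f w))" by simp
  qed
  also have "(\<integral>w. sqrt 2 * (radw w * Re (f w)) \<partial>dv1) = sqrt 2 * Re (\<integral>w. radw w * f w \<partial>dv1)"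
    using integral_Re[OF F] by simp
  also have "\<dots> = sqrt 2 * (\<integral>w. radw w \<partial>dv1)"
    unfolding mean by (simp add: integral_complex_of_real)
  finally show ?thesis .
qed

section \<open>The Schur test for the kernel far from the diagonal\<close>

lemma prod_powr:
  fixes f :: "'a \<Rightarrow> real"
  assumes "\<And>i. i \<in> I \<Longrightarrow> 0 \<le> f i"
  shows "(\<Prod>i\<in>I. f i) powr a = (\<Prod>i\<in>I. f i powr a)"
  using assms
proof (induction I rule: infinite_finite_induct)
  case (insert i I)
  then show ?case by (simp add: powr_mult prod_nonneg)
qed simp_all

text \<open>The modulus of the unnormalized reproducing kernel, cut off outside the
  polydisc.\<close>

definition skern :: "complex ^ 'n \<Rightarrow> complex ^ 'n \<Rightarrow> real" where
  "skern z x = indicator polydisc z * indicator polydisc x * (\<Prod>i\<in>UNIV. 1 / (cmod (1 - x $ i * cnj (z $ i)))\<^sup>2)"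

lemma skern_sym: "skern z x = skern x z"
  unfolding skern_def by (subst cmod_one_minus_commute) simp

lemma skern_nonneg [simp]: "0 \<le> skern z x"
  unfolding skern_def by (intro mult_nonneg_nonneg prod_nonneg) auto

lemma cmod_kf: "z \<in> polydisc \<Longrightarrow> cmod (kf z x) = om z * (\<Prod>i\<in>UNIV. 1 / (cmod (1 - x $ i * cnj (z $ i)))\<^sup>2)"
  unfolding kf_def om_def prod_norm[symmetric] prod.distrib[symmetric]
proof (intro prod.cong refl)
  fix i assume z: "z \<in> polydisc"
  have "0 < 1 - (cmod (z $ i))\<^sup>2" by (intro one_minus_sq_pos polydiscD z)
  then show "cmod (complex_of_real (1 - (cmod (z $ i))\<^sup>2) / (1 - x $ i * cnj (z $ i))\<^sup>2) =
     (1 - (cmod (z $ i))\<^sup>2) * (1 / (cmod (1 - x $ i * cnj (z $ i)))\<^sup>2)"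
    unfolding norm_divide norm_of_real norm_power by simp
qed

lemma skern_kf: "z \<in> polydisc \<Longrightarrow> x \<in> polydisc \<Longrightarrow> cmod (kf z x) = om z * skern z x"
  by (simp add: skern_def cmod_kf)

lemma measurable_skern: "(\<lambda>q. skern (fst q) (snd q)) \<in> borel_measurable (borel \<Otimes>\<^sub>M borel)"
proof -
  have [measurable]: "(\<lambda>q :: (complex ^ 'n) \<times> (complex ^ 'n). cmod (1 - snd q $ i * cnj (fst q $ i))) \<in> borel_measurable (borel \<Otimes>\<^sub>M borel)" for i
    by measurable
  show ?thesis unfolding skern_def by measurable
qed

text \<open>The part of the kernel on pairs of points that are not within pseudohyperbolic distance
  \<open>r\<close> in all coordinates.\<close>

definition tkern :: "real \<Rightarrow> complex ^ 'n \<Rightarrow> complex ^ 'n \<Rightarrow> real" where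
  "tkern r z x = skern z x * indicator (- pd r) (mob z x)"

lemma tkern_sym: "tkern r z x = tkern r x z"
  unfolding tkern_def by (simp add: skern_sym[of z x] indicator_def mob_pd_commute[of z x])

lemma tkern_nonneg [simp]: "0 \<le> tkern r z x"
  by (simp add: tkern_def)

lemma measurable_tkern: "(\<lambda>q. tkern r (fst q) (snd q)) \<in> borel_measurable (borel \<Otimes>\<^sub>M borel)"
  unfolding tkern_def using measurable_skern by measurable

text \<open>Substituting x = \<open>mob z u\<close> extracts om(z) to the power -3/4 and leaves a
  product over the coordinates. The Schur exponent -3/4 is chosen so that the remaining kernel
  factor is |1 - u cnj(z)| to the power -1/2, the case treated by
  \<open>radial_kernel_bound\<close>.\<close>

lemma tkern_row:
  fixes z :: "complex ^ 'n::finite"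
  assumes z: "z \<in> polydisc" and r: "0 \<le> r" "r < 1"
  shows "(\<integral>\<^sup>+x. ennreal (tkern r z x * om x powr (- 3/4)) \<partial>dvb) \<le>
    ennreal ((sqrt 2 * (\<integral>w. radw w \<partial>dv1)) ^ CARD('n) * (1 - r\<^sup>2) powr (1/8) * om z powr (- 3/4))"
proof -
  have omz: "0 < om z" by (rule om_pos[OF z])
  have r2: "0 < 1 - r\<^sup>2" using r by (simp add: abs_square_less_1)
  define c where "c = (1 - r\<^sup>2) powr (1/8) * om z powr (- 3/4)"
  have c: "0 \<le> c" by (simp add: c_def)
  define F where "F x = ennreal (tkern r z x * om x powr (- 3/4))" for x
  have Fm [measurable]: "F \<in> borel_measurable borel"
  proof -
    have "(\<lambda>x. tkern r z x) \<in> borel_measurable borel"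
      using measurable_compose[OF measurable_Pair1'[of z borel borel] measurable_tkern[of r]] by simp
    then show ?thesis unfolding F_def[abs_def] by measurable
  qed
  define h where "h i w = ennreal (radw w * cmod (1 - w * cnj (z $ i)) powr (- 1/2))" for i w
  have hm: "h i \<in> borel_measurable borel" for i unfolding h_def[abs_def] by measurable
  have pt: "F (mob z u) * ennreal ((cmod (kf z u))\<^sup>2) \<le> ennreal c * (\<Prod>i\<in>UNIV. h i (u $ i))" if u: "u \<in> polydisc" for u
  proof (cases "u \<in> pd r")
    case True
    then show ?thesis using z u by (simp add: F_def tkern_def)
  next
    case False
    define \<kappa> where "\<kappa> = cmod (kf z u)"
    define P where "P = (\<Prod>i\<in>UNIV. 1 / (cmod (1 - u $ i * cnj (z $ i)))\<^sup>2)"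
    have nz: "0 < cmod (1 - u $ i * cnj (z $ i))" for i
      using den_nz[OF polydiscD[OF z] polydiscD[OF u], of i i] by simp
    have P0: "0 < P" unfolding P_def using nz by (intro prod_pos) auto
    have "0 < \<kappa>" using kf_nz[OF z u] by (simp add: \<kappa>_def)
    moreover have "\<kappa> = om z * P" unfolding \<kappa>_def P_def by (rule cmod_kf[OF z])
    ultimately have \<kappa>: "0 < \<kappa>" "\<kappa> = om z * P" by auto
    have omu: "0 < om u" by (rule om_pos[OF u])
    have inv: "cmod (kf z (mob z u)) = 1 / \<kappa>"
    proof -
      have "cmod (kf z (mob z u)) * \<kappa> = 1"
        using kf_mob[OF z u] by (metis \<kappa>_def norm_mult norm_one)
      then show ?thesis using \<kappa>(1) by (simp add: field_simps)
    qed
    have sk: "skern z (mob z u) = 1 / (\<kappa> * om z)"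
    proof -
      have "om z * skern z (mob z u) = 1 / \<kappa>" using skern_kf[OF z mob_in_polydisc[OF z u]] unfolding inv by simp
      then have "skern z (mob z u) = (1 / \<kappa>) / om z" unfolding nonzero_eq_divide_eq[OF less_imp_neq[OF omz, symmetric]] by (simp only: mult.commute)
      then show ?thesis by simp
    qed
    obtain i where i: "r < cmod (u $ i)" using False by (auto simp: pd_def not_le)
    have omr: "om u \<le> 1 - r\<^sup>2"
    proof -
      have "om u = (1 - (cmod (u $ i))\<^sup>2) * (\<Prod>j\<in>UNIV - {i}. 1 - (cmod (u $ j))\<^sup>2)"
        unfolding om_def by (rule prod.remove) auto
      also have "\<dots> \<le> (1 - (cmod (u $ i))\<^sup>2) * 1"
        using one_minus_sq_pos[OF polydiscD[OF u]]
        by (intro mult_left_mono prod_le_1) (auto intro: less_imp_le)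
      also have "\<dots> \<le> 1 - r\<^sup>2" using i r by (auto intro!: power_mono)
      finally show ?thesis .
    qed
    \<comment> \<open>Off \<open>pd r\<close> some coordinate is large and \<open>om u\<close> is at
      most 1 - r^2. Inserting this factor \<ge> 1 trades the power 1/8 of \<open>om u\<close> for
      the smallness in \<open>r\<close>.\<close>
    have one: "1 \<le> (1 - r\<^sup>2) powr (1/8) * om u powr (- 1/8)"
    proof -
      have "om u powr (1/8) \<le> (1 - r\<^sup>2) powr (1/8)" using omr omu by (intro powr_mono2) auto
      then have "om u powr (1/8) * om u powr (- 1/8) \<le> (1 - r\<^sup>2) powr (1/8) * om u powr (- 1/8)"
        by (intro mult_right_mono) auto
      moreover have "om u powr (1/8) * om u powr (- 1/8) = 1" using omu by (simp add: powr_add[symmetric])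
      ultimately show ?thesis by simp
    qed
    have Pq: "P powr (1/4) = (\<Prod>i\<in>UNIV. cmod (1 - u $ i * cnj (z $ i)) powr (- 1/2))"
      unfolding P_def
    proof (subst prod_powr)
      show "(\<Prod>i\<in>UNIV. (1 / (cmod (1 - u $ i * cnj (z $ i)))\<^sup>2) powr (1/4)) = (\<Prod>i\<in>UNIV. cmod (1 - u $ i * cnj (z $ i)) powr (- 1/2))"
      proof (intro prod.cong refl)
        fix i
        define d where "d = cmod (1 - u $ i * cnj (z $ i))"
        have d: "0 < d" using nz[of i] by (simp add: d_def)
        have "(1 / d\<^sup>2) = d powr (- 2)" using d by (simp add: powr_minus_divide)
        then have "(1 / d\<^sup>2) powr (1/4) = d powr (- 1/2)" by (simp add: powr_powr)
        then show "(1 / (cmod (1 - u $ i * cnj (z $ i)))\<^sup>2) powr (1/4) = cmod (1 - u $ i * cnj (z $ i)) powr (- 1/2)"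
          unfolding d_def .
      qed
    qed simp
    have omq: "om u powr (- 7/8) = (\<Prod>i\<in>UNIV. radw (u $ i))"
      unfolding om_def
    proof (subst prod_powr)
      show "(\<Prod>i\<in>UNIV. (1 - (cmod (u $ i))\<^sup>2) powr (- 7/8)) = (\<Prod>i\<in>UNIV. radw (u $ i))"
        by (intro prod.cong refl) (simp add: radw_def polydiscD[OF u])
    qed (use one_minus_sq_pos[OF polydiscD[OF u]] in \<open>auto intro: less_imp_le\<close>)
    have "F (mob z u) * ennreal ((cmod (kf z u))\<^sup>2) = ennreal (1 / (\<kappa> * om z) * om (mob z u) powr (- 3/4) * \<kappa>\<^sup>2)"
      unfolding F_def tkern_def sk using False z u \<kappa> omz
      by (simp add: \<kappa>_def[symmetric] ennreal_mult[symmetric])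
    also have "1 / (\<kappa> * om z) * om (mob z u) powr (- 3/4) * \<kappa>\<^sup>2 = (om z powr (- 3/4) * P powr (1/4)) * om u powr (- 3/4)"
    \<comment> \<open>The kernel and the Jacobian contribute \<kappa> / om z and the weight
      contributes \<kappa> to the power -3/4; the remaining power 1/4 of \<kappa> = om z * P splits
      into the two factors.\<close>
    proof -
      have e1: "om (mob z u) powr (- 3/4) = om u powr (- 3/4) * \<kappa> powr (- 3/4)"
        unfolding om_mob[OF z u] \<kappa>_def[symmetric] using omu \<kappa> by (simp add: powr_mult)
      have e2: "1 / (\<kappa> * om z) * \<kappa>\<^sup>2 = \<kappa> / om z" using \<kappa>(1) by (simp add: power2_eq_square)
      have e3: "\<kappa> * \<kappa> powr (- 3/4) = \<kappa> powr (1/4)"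
        using \<kappa>(1) powr_add[of \<kappa> 1 "- 3/4"] by simp
      have e4: "\<kappa> powr (1/4) = om z powr (1/4) * P powr (1/4)"
        unfolding \<kappa>(2) using omz P0 by (simp add: powr_mult)
      have e5: "om z powr (1/4) / om z = om z powr (- 3/4)"
        using omz powr_diff[of "om z" "1/4" 1] by simp
      have "1 / (\<kappa> * om z) * om (mob z u) powr (- 3/4) * \<kappa>\<^sup>2 = (1 / (\<kappa> * om z) * \<kappa>\<^sup>2) * (om u powr (- 3/4) * \<kappa> powr (- 3/4))"
        unfolding e1 by simp
      also have "\<dots> = (\<kappa> * \<kappa> powr (- 3/4)) / om z * om u powr (- 3/4)" unfolding e2 by simp
      also have "\<dots> = (om z powr (1/4) / om z) * P powr (1/4) * om u powr (- 3/4)" unfolding e3 e4 by simp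
      finally show ?thesis unfolding e5 .
    qed
    also have "ennreal ((om z powr (- 3/4) * P powr (1/4)) * om u powr (- 3/4)) \<le>
       ennreal (((om z powr (- 3/4) * P powr (1/4)) * om u powr (- 3/4)) * ((1 - r\<^sup>2) powr (1/8) * om u powr (- 1/8)))"
    proof (rule ennreal_leI)
      have "0 \<le> (om z powr (- 3/4) * P powr (1/4)) * om u powr (- 3/4)" by simp
      from mult_left_mono[OF one this]
      show "(om z powr (- 3/4) * P powr (1/4)) * om u powr (- 3/4) \<le>
         ((om z powr (- 3/4) * P powr (1/4)) * om u powr (- 3/4)) * ((1 - r\<^sup>2) powr (1/8) * om u powr (- 1/8))"
        by simp
    qed
    also have "((om z powr (- 3/4) * P powr (1/4)) * om u powr (- 3/4)) * ((1 - r\<^sup>2) powr (1/8) * om u powr (- 1/8)) =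
       c * ((om u powr (- 3/4) * om u powr (- 1/8)) * P powr (1/4))"
      by (simp add: c_def)
    also have "om u powr (- 3/4) * om u powr (- 1/8) = om u powr (- 7/8)"
      by (simp add: powr_add[symmetric])
    also have "ennreal (c * (om u powr (- 7/8) * P powr (1/4))) = ennreal c * (\<Prod>i\<in>UNIV. h i (u $ i))"
      unfolding omq Pq h_def prod.distrib[symmetric] using c
      by (subst ennreal_mult) (auto intro!: prod_nonneg simp: prod_ennreal)
    finally show ?thesis .
  qed
  have "(\<integral>\<^sup>+x. F x \<partial>dvb) = (\<integral>\<^sup>+u. F (mob z u) * ennreal ((cmod (kf z u))\<^sup>2) \<partial>dvb)"
    by (rule nn_integral_dvb_mob[OF z Fm, symmetric])
  also have "\<dots> \<le> (\<integral>\<^sup>+u. ennreal c * (\<Prod>i\<in>UNIV. h i (u $ i)) \<partial>dvb)"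
  proof (rule nn_integral_mono_AE)
    show "AE u in dvb. F (mob z u) * ennreal ((cmod (kf z u))\<^sup>2) \<le> ennreal c * (\<Prod>i\<in>UNIV. h i (u $ i))"
      using AE_dvb_polydisc by eventually_elim (rule pt)
  qed
  also have "\<dots> = ennreal c * (\<integral>\<^sup>+u. (\<Prod>i\<in>UNIV. h i (u $ i)) \<partial>dvb)"
  proof (rule nn_integral_cmult)
    have "(\<lambda>u. h i (u $ i)) \<in> borel_measurable borel" for i
      by (rule measurable_compose[OF measurable_vec_nth hm])
    then show "(\<lambda>u. \<Prod>i\<in>UNIV. h i (u $ i)) \<in> borel_measurable dvb"
      unfolding measurable_cong_sets[OF sets_dvb refl] by (intro borel_measurable_prod_ennreal)
  qed
  also have "\<dots> = ennreal c * (\<Prod>i\<in>UNIV. \<integral>\<^sup>+w. h i w \<partial>dv1)"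
    by (subst nn_integral_dvb_prod[OF hm]) simp
  also have "\<dots> \<le> ennreal c * (\<Prod>i\<in>(UNIV :: 'n set). ennreal (sqrt 2 * (\<integral>w. radw w \<partial>dv1)))"
    unfolding h_def
    by (intro mult_left_mono prod_mono_ennreal radial_kernel_bound polydiscD[OF z]) auto
  also have "\<dots> = ennreal ((sqrt 2 * (\<integral>w. radw w \<partial>dv1)) ^ CARD('n) * (1 - r\<^sup>2) powr (1/8) * om z powr (- 3/4))"
    unfolding c_def
    by (simp add: ennreal_power ennreal_mult[symmetric] Bochner_Integration.integral_nonneg mult_ac)
  finally show ?thesis unfolding F_def .
qed

text \<open>Schur's test: the kernel is split into \<open>a g z x\<close> and
  \<open>a h x z\<close>, with the weight quotient p(x)/p(z) under the root in one and its inverse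
  in the other. After Cauchy-Schwarz on the product measure, symmetry of the kernel lets
  \<open>tkern_row\<close> bound both factors.\<close>

lemma tkern_bound:
  fixes g h :: "'n::finite bergman"
  assumes r: "0 \<le> r" "r < 1"
  shows "(\<integral>\<^sup>+z. \<integral>\<^sup>+x. ennreal (tkern r z x * (cmod (eval g z) * cmod (eval h x))) \<partial>dvb \<partial>dvb) \<le>
    ennreal ((sqrt 2 * (\<integral>w. radw w \<partial>dv1)) ^ CARD('n) * (1 - r\<^sup>2) powr (1/8) * norm g * norm h)"
proof -
  define \<epsilon> where "\<epsilon> = (sqrt 2 * (\<integral>w. radw w \<partial>dv1)) ^ CARD('n) * (1 - r\<^sup>2) powr (1/8)"
  have \<epsilon>: "0 \<le> \<epsilon>" by (simp add: \<epsilon>_def Bochner_Integration.integral_nonneg)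
  define p where "p z = om z powr (- 3/4)" for z :: "complex ^ 'n"
  have p0: "0 < p z" if "z \<in> polydisc" for z using om_pos[OF that] by (simp add: p_def)
  have pn: "0 \<le> p z" for z by (simp add: p_def)
  have pm [measurable]: "p \<in> borel_measurable borel" unfolding p_def[abs_def] by measurable
  have row: "(\<integral>\<^sup>+x. ennreal (tkern r z x * p x) \<partial>dvb) \<le> ennreal (\<epsilon> * p z)" if "z \<in> polydisc" for z
    unfolding p_def \<epsilon>_def by (rule tkern_row[OF that r])
  interpret P: pair_sigma_finite "dvb :: (complex ^ 'n) measure" "dvb :: (complex ^ 'n) measure"
    by unfold_locales
  have km: "(\<lambda>q. tkern r (fst q) (snd q)) \<in> borel_measurable (dvb \<Otimes>\<^sub>M dvb)"
    using measurable_tkern[of r] by (simp cong: measurable_cong_sets sets_pair_measure_cong)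
  define a where "a k z x = sqrt (tkern r z x * p x / p z) * cmod (eval k z)" for k :: "'n bergman" and z x
  have am: "(\<lambda>q. ennreal (a k (fst q) (snd q))) \<in> borel_measurable (dvb \<Otimes>\<^sub>M dvb)"
    and am': "(\<lambda>q. ennreal (a k (snd q) (fst q))) \<in> borel_measurable (dvb \<Otimes>\<^sub>M dvb)" for k
  proof -
    have km': "(\<lambda>q. tkern r (snd q) (fst q)) \<in> borel_measurable (dvb \<Otimes>\<^sub>M dvb)"
      unfolding tkern_sym[of r "snd _"] by (rule km)
    have m: "(\<lambda>q. p (fst q)) \<in> borel_measurable (dvb \<Otimes>\<^sub>M dvb)" "(\<lambda>q. p (snd q)) \<in> borel_measurable (dvb \<Otimes>\<^sub>M dvb)"
      "(\<lambda>q. eval k (fst q)) \<in> borel_measurable (dvb \<Otimes>\<^sub>M dvb)" "(\<lambda>q. eval k (snd q)) \<in> borel_measurable (dvb \<Otimes>\<^sub>M dvb)"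
      by measurable
    show "(\<lambda>q. ennreal (a k (fst q) (snd q))) \<in> borel_measurable (dvb \<Otimes>\<^sub>M dvb)"
      unfolding a_def using km m by measurable
    show "(\<lambda>q. ennreal (a k (snd q) (fst q))) \<in> borel_measurable (dvb \<Otimes>\<^sub>M dvb)"
      unfolding a_def using km' m by measurable
  qed
  have an: "0 \<le> a k z x" for k z x using pn by (simp add: a_def)
  have sq: "(\<integral>\<^sup>+z. \<integral>\<^sup>+x. (ennreal (a k z x))\<^sup>2 \<partial>dvb \<partial>dvb) \<le> ennreal \<epsilon> * ennreal ((norm k)\<^sup>2)" for k
  proof -
    have "(\<integral>\<^sup>+z. \<integral>\<^sup>+x. (ennreal (a k z x))\<^sup>2 \<partial>dvb \<partial>dvb) \<le> (\<integral>\<^sup>+z. ennreal \<epsilon> * ennreal ((cmod (eval k z))\<^sup>2) \<partial>dvb)"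
    proof (rule nn_integral_mono)
      fix z :: "complex ^ 'n"
      show "(\<integral>\<^sup>+x. (ennreal (a k z x))\<^sup>2 \<partial>dvb) \<le> ennreal \<epsilon> * ennreal ((cmod (eval k z))\<^sup>2)"
      proof (cases "z \<in> polydisc")
        case True
        define q where "q = (cmod (eval k z))\<^sup>2 / p z"
        have q: "0 \<le> q" using pn by (simp add: q_def)
        have "(ennreal (a k z x))\<^sup>2 = ennreal q * ennreal (tkern r z x * p x)" for x
        proof -
          have "(a k z x)\<^sup>2 = q * (tkern r z x * p x)"
            unfolding a_def q_def using pn by (simp add: power_mult_distrib)
          then show ?thesis using q pn an by (simp add: ennreal_power ennreal_mult[symmetric])
        qed
        then have "(\<integral>\<^sup>+x. (ennreal (a k z x))\<^sup>2 \<partial>dvb) = (\<integral>\<^sup>+x. ennreal q * ennreal (tkern r z x * p x) \<partial>dvb)"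
          by simp
        also have "\<dots> = ennreal q * (\<integral>\<^sup>+x. ennreal (tkern r z x * p x) \<partial>dvb)"
        proof (rule nn_integral_cmult)
          have "(\<lambda>x. tkern r z x) \<in> borel_measurable borel"
            using measurable_compose[OF measurable_Pair1'[of z borel borel] measurable_tkern[of r]] by simp
          then have "(\<lambda>x. ennreal (tkern r z x * p x)) \<in> borel_measurable borel" using pm by measurable
          then show "(\<lambda>x. ennreal (tkern r z x * p x)) \<in> borel_measurable dvb"
            unfolding measurable_cong_sets[OF sets_dvb refl] .
        qed
        also have "\<dots> \<le> ennreal q * ennreal (\<epsilon> * p z)"
          by (intro mult_left_mono row True) simp
        also have "\<dots> = ennreal (\<epsilon> * (cmod (eval k z))\<^sup>2)"
          using q \<epsilon> p0[OF True] by (simp add: ennreal_mult[symmetric] q_def mult_ac)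
        finally show ?thesis using \<epsilon> by (simp add: ennreal_mult)
      next
        case False
        then show ?thesis by (simp add: a_def eval_outside)
      qed
    qed
    also have "\<dots> = ennreal \<epsilon> * ennreal ((norm k)\<^sup>2)" by (rule nn_integral_eval_sq_cmult)
    finally show ?thesis .
  qed
  have prod: "ennreal (tkern r z x * (cmod (eval g z) * cmod (eval h x))) = ennreal (a g z x) * ennreal (a h x z)" for z x
  proof (cases "z \<in> polydisc \<and> x \<in> polydisc")
    case True
    then have pp: "0 < p z" "0 < p x" using p0 by auto
    have "sqrt (tkern r z x * p x / p z) * sqrt (tkern r x z * p z / p x) = tkern r z x"
      unfolding tkern_sym[of r x z] real_sqrt_mult[symmetric] using pp by simp
    then have "a g z x * a h x z = tkern r z x * (cmod (eval g z) * cmod (eval h x))"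
      unfolding a_def by (metis mult.assoc mult.commute)
    then show ?thesis using an by (simp add: ennreal_mult[symmetric])
  next
    case False
    then show ?thesis by (auto simp: a_def eval_outside)
  qed
  define I where "I = (\<integral>\<^sup>+z. \<integral>\<^sup>+x. ennreal (tkern r z x * (cmod (eval g z) * cmod (eval h x))) \<partial>dvb \<partial>dvb)"
  have "I = (\<integral>\<^sup>+q. ennreal (a g (fst q) (snd q)) * ennreal (a h (snd q) (fst q)) \<partial>(dvb \<Otimes>\<^sub>M dvb))"
    unfolding I_def prod
    using dvb.nn_integral_fst[of "\<lambda>q. ennreal (a g (fst q) (snd q)) * ennreal (a h (snd q) (fst q))" dvb] am[of g] am'[of h]
    by simp
  then have "I\<^sup>2 \<le> (\<integral>\<^sup>+q. (ennreal (a g (fst q) (snd q)))\<^sup>2 \<partial>(dvb \<Otimes>\<^sub>M dvb)) * (\<integral>\<^sup>+q. (ennreal (a h (snd q) (fst q)))\<^sup>2 \<partial>(dvb \<Otimes>\<^sub>M dvb))"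
    using Cauchy_Schwarz_nn_integral[OF am[of g] am'[of h]] by simp
  also have "(\<integral>\<^sup>+q. (ennreal (a g (fst q) (snd q)))\<^sup>2 \<partial>(dvb \<Otimes>\<^sub>M dvb)) = (\<integral>\<^sup>+z. \<integral>\<^sup>+x. (ennreal (a g z x))\<^sup>2 \<partial>dvb \<partial>dvb)"
    using dvb.nn_integral_fst[of "\<lambda>q. (ennreal (a g (fst q) (snd q)))\<^sup>2" dvb] am[of g] by simp
  also have "(\<integral>\<^sup>+q. (ennreal (a h (snd q) (fst q)))\<^sup>2 \<partial>(dvb \<Otimes>\<^sub>M dvb)) = (\<integral>\<^sup>+x. \<integral>\<^sup>+z. (ennreal (a h x z))\<^sup>2 \<partial>dvb \<partial>dvb)"
    using P.nn_integral_snd[of "\<lambda>q. (ennreal (a h (snd q) (fst q)))\<^sup>2"] am'[of h] by simp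
  also have "(\<integral>\<^sup>+z. \<integral>\<^sup>+x. (ennreal (a g z x))\<^sup>2 \<partial>dvb \<partial>dvb) * (\<integral>\<^sup>+x. \<integral>\<^sup>+z. (ennreal (a h x z))\<^sup>2 \<partial>dvb \<partial>dvb)
     \<le> (ennreal \<epsilon> * ennreal ((norm g)\<^sup>2)) * (ennreal \<epsilon> * ennreal ((norm h)\<^sup>2))"
    by (rule mult_mono[OF sq sq]) auto
  also have "\<dots> = (ennreal (\<epsilon> * norm g * norm h))\<^sup>2"
    using \<epsilon> by (simp add: ennreal_power ennreal_mult[symmetric] power_mult_distrib power2_eq_square mult_ac)
  finally have "I \<le> ennreal (\<epsilon> * norm g * norm h)"
    by (rule ennreal_power2_le_imp_le) (use \<epsilon> in simp)
  then show ?thesis unfolding I_def \<epsilon>_def .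
qed

section \<open>Products of Toeplitz operators\<close>

lemma tkern_small:
  assumes "0 < e"
  obtains r where "0 \<le> r" "r < 1"
    "\<And>g h :: 'n::finite bergman. (\<integral>\<^sup>+z. \<integral>\<^sup>+x. ennreal (tkern r z x * (cmod (eval g z) * cmod (eval h x))) \<partial>dvb \<partial>dvb) \<le>
       ennreal (e * norm g * norm h)"
proof -
  define A where "A = (sqrt 2 * (\<integral>w. radw w \<partial>dv1)) ^ CARD('n)"
  have A: "0 \<le> A" by (simp add: A_def Bochner_Integration.integral_nonneg)
  \<comment> \<open>The value of 1 - r^2. The power 8 undoes the exponent 1/8 of
    \<open>tkern_bound\<close>; the minimum with 1 keeps the radicand of \<open>r\<close>
    nonnegative.\<close>
  define \<delta> where "\<delta> = min 1 ((e / (A + 1)) powr 8)"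
  have B: "0 < e / (A + 1)" using A assms by simp
  have \<delta>: "0 < \<delta>" "\<delta> \<le> 1" using B by (auto simp: \<delta>_def)
  define r where "r = sqrt (1 - \<delta>)"
  have r: "0 \<le> r" "r < 1" using \<delta> by (auto simp: r_def)
  have r2: "1 - r\<^sup>2 = \<delta>" using \<delta> by (simp add: r_def)
  have "\<delta> powr (1/8) \<le> ((e / (A + 1)) powr 8) powr (1/8)"
    using \<delta> by (intro powr_mono2) (auto simp: \<delta>_def)
  also have "\<dots> = e / (A + 1)" using B A assms unfolding powr_powr by simp
  finally have "A * \<delta> powr (1/8) \<le> A * (e / (A + 1))" by (rule mult_left_mono[OF _ A])
  also have "\<dots> \<le> e" using A assms by (simp add: field_simps)
  finally have le: "A * (1 - r\<^sup>2) powr (1/8) \<le> e" unfolding r2 .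
  show ?thesis
  proof (rule that[OF r])
    fix g h :: "'n bergman"
    have "A * (1 - r\<^sup>2) powr (1/8) * norm g * norm h \<le> e * norm g * norm h"
      by (intro mult_right_mono le) auto
    then show "(\<integral>\<^sup>+z. \<integral>\<^sup>+x. ennreal (tkern r z x * (cmod (eval g z) * cmod (eval h x))) \<partial>dvb \<partial>dvb) \<le>
       ennreal (e * norm g * norm h)"
      using tkern_bound[OF r, of g h] unfolding A_def by (blast intro: order_trans ennreal_leI)
  qed
qed

text \<open>In the variable x = \<open>mob z u\<close> one of the two Jacobian factors cancels
  against the multiplier, by \<open>kf_mob\<close>, and what remains is the far part of the kernel
  integral operator applied to |h|.\<close>

lemma nn_integral_mobU_tail:
  assumes z: "z \<in> polydisc"
  shows "(\<integral>\<^sup>+u. indicator (- pd r) u * ennreal (cmod (eval (mobU z h) u)) \<partial>dvb) =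
    (\<integral>\<^sup>+x. ennreal (om z * (tkern r z x * cmod (eval h x))) \<partial>dvb)"
proof -
  define F where "F x = ennreal (om z * (tkern r z x * cmod (eval h x)))" for x
  have [measurable]: "F \<in> borel_measurable borel"
  proof -
    have "(\<lambda>x. tkern r z x) \<in> borel_measurable borel"
      using measurable_compose[OF measurable_Pair1'[of z borel borel] measurable_tkern[of r]] by simp
    then show ?thesis unfolding F_def[abs_def] by measurable
  qed
  have pt: "F (mob z u) * ennreal ((cmod (kf z u))\<^sup>2) = indicator (- pd r) u * ennreal (cmod (eval (mobU z h) u))"
    if u: "u \<in> polydisc" for u
  proof (cases "u \<in> pd r")
    case True
    then show ?thesis using z u by (simp add: F_def tkern_def)
  next
    case False
    have e: "cmod (kf z (mob z u)) * cmod (kf z u) = 1"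
      using kf_mob[OF z u] by (metis norm_mult norm_one)
    have "om z * (tkern r z (mob z u) * cmod (eval h (mob z u))) * (cmod (kf z u))\<^sup>2 =
       (om z * skern z (mob z u)) * cmod (kf z u) * (cmod (kf z u) * cmod (eval h (mob z u)))"
      using False z u by (simp add: tkern_def power2_eq_square)
    also have "\<dots> = cmod (eval (mobU z h) u)"
      unfolding skern_kf[OF z mob_in_polydisc[OF z u], symmetric] e using z u
      by (simp add: eval_mobU norm_mult)
    finally show ?thesis using False om_pos[OF z]
      by (simp add: F_def ennreal_mult[symmetric])
  qed
  have "(\<integral>\<^sup>+x. F x \<partial>dvb) = (\<integral>\<^sup>+u. F (mob z u) * ennreal ((cmod (kf z u))\<^sup>2) \<partial>dvb)"
    by (rule nn_integral_dvb_mob[OF z, symmetric]) simp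
  also have "\<dots> = (\<integral>\<^sup>+u. indicator (- pd r) u * ennreal (cmod (eval (mobU z h) u)) \<partial>dvb)"
  proof (rule nn_integral_cong_AE)
    show "AE u in dvb. F (mob z u) * ennreal ((cmod (kf z u))\<^sup>2) = indicator (- pd r) u * ennreal (cmod (eval (mobU z h) u))"
      using AE_dvb_polydisc by eventually_elim (rule pt)
  qed
  finally show ?thesis unfolding F_def by simp
qed

lemma integral_lam:
  fixes F :: "complex ^ 'n::finite \<Rightarrow> complex"
  assumes [measurable]: "F \<in> borel_measurable borel"
  shows "(\<integral>z. F z \<partial>lam) = (\<integral>z. (1 / (om z)\<^sup>2) *\<^sub>R F z \<partial>dvb)"
    and "integrable lam F \<longleftrightarrow> integrable dvb (\<lambda>z. (1 / (om z)\<^sup>2) *\<^sub>R F z)"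
  unfolding lam_def by (rule integral_density integrable_density; simp)+

text \<open>\<open>om z\<close> times the value of \<open>toeplitz g h\<close> at z is the integral
  \<open>J h z\<close> of the bounded function \<open>g (mob z u)\<close> against
  \<open>mobU z h\<close>. The second factor \<open>om z\<close> comes from \<open>mobU z h'\<close>
  at 0, and together they cancel the density of \<open>lam\<close>. The part of \<open>J\<close>
  over \<open>pd r\<close> is of the type of \<open>integral_functional\<close>; the rest,
  \<open>T\<close>, is small by the Schur test.\<close>

lemma approx_form_toeplitz_compose:
  fixes f g :: "complex ^ 'n::finite \<Rightarrow> complex"
  assumes f [measurable]: "f \<in> borel_measurable borel" and fK: "\<And>z. cmod (f z) \<le> K"
    and g [measurable]: "g \<in> borel_measurable borel" and gL: "\<And>z. cmod (g z) \<le> L"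
  shows "approx_form (\<lambda>h h'. cinner (toeplitz f (toeplitz g h)) h')"
proof -
  have K: "0 \<le> K" and L: "0 \<le> L" using order_trans[OF norm_ge_zero fK] order_trans[OF norm_ge_zero gL] by auto
  define J where "J h z = (\<integral>u. g (mob z u) * eval (mobU z h) u \<partial>dvb)" for h :: "'n bergman" and z
  have J: "J h z = complex_of_real (om z) * eval (blinfun_apply (toeplitz g) h) z" for h z
  proof (cases "z \<in> polydisc")
    case True
    show ?thesis
      unfolding J_def cinner_normalized_kernel[OF True, symmetric] cinner_toeplitz[OF g gL]
      by (rule integral_mobU_kernel[OF True g, symmetric])
  next
    case False
    then show ?thesis by (simp add: J_def eval_mobU eval_outside)
  qed
  have Jm [measurable]: "J h \<in> borel_measurable borel" for h unfolding J[abs_def] by measurable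
  define q where "q h h' z = f z * J h z * cnj (eval (mobU z h') 0)" for h h' z
  have q_dvb: "(1 / (om z)\<^sup>2) *\<^sub>R q h h' z = f z * (eval (toeplitz g h) z * cnj (eval h' z))" if "z \<in> polydisc" for h h' z
    using om_pos[OF that] by (simp add: q_def J eval_mobU_0[OF that] scaleR_conv_of_real power2_eq_square)
  have qm [measurable]: "q h h' \<in> borel_measurable borel" for h h' unfolding q_def[abs_def] by measurable
  have AEq: "AE z in dvb. (1 / (om z)\<^sup>2) *\<^sub>R q h h' z = f z * (eval (toeplitz g h) z * cnj (eval h' z))" for h h'
    using AE_dvb_polydisc by eventually_elim (rule q_dvb)
  have q_int: "integrable lam (q h h')" for h h'
    unfolding integral_lam(2)[OF qm]
    by (subst integrable_cong_AE[OF _ _ AEq]) (use integrable_bounded_sesq[OF f fK] in simp_all)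
  have q: "cinner (toeplitz f (toeplitz g h)) h' = (\<integral>z. q h h' z \<partial>lam)" for h h'
    unfolding integral_lam(1)[OF qm] cinner_toeplitz[OF f fK]
    by (rule integral_cong_AE[symmetric]) (use AEq in simp_all)
  show ?thesis
  proof (rule approx_form_limit)
    fix e :: real assume e: "0 < e"
    define e' where "e' = e / (K * L + 1)"
    have KL: "0 < K * L + 1" using K L by (simp add: add_nonneg_pos)
    have e': "0 < e'" "K * L * e' \<le> e" using e KL K L by (auto simp: e'_def field_simps)
    obtain r where r: "0 \<le> r" "r < 1" and small: "\<And>g h :: 'n bergman.
       (\<integral>\<^sup>+z. \<integral>\<^sup>+x. ennreal (tkern r z x * (cmod (eval g z) * cmod (eval h x))) \<partial>dvb \<partial>dvb) \<le> ennreal (e' * norm g * norm h)"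
      using tkern_small[OF e'(1)] by blast
    define Jr where "Jr h z = (\<integral>u. indicator (pd r) u * (g (mob z u) * eval (mobU z h) u) \<partial>dvb)" for h :: "'n bergman" and z
    define T where "T h z = (\<integral>u. indicator (- pd r) u * (g (mob z u) * eval (mobU z h) u) \<partial>dvb)" for h :: "'n bergman" and z
    have iJ: "integrable dvb (\<lambda>u. indicator S u * (g (mob z u) * eval (mobU z h) u))" if [measurable]: "S \<in> sets borel" for S z and h :: "'n bergman"
    proof (rule Bochner_Integration.integrable_bound[OF integrable_mult_right[OF integrable_eval[of "mobU z h"], of "complex_of_real L"]])
      show "(\<lambda>u. indicator S u * (g (mob z u) * eval (mobU z h) u)) \<in> borel_measurable dvb"
        unfolding measurable_cong_sets[OF sets_dvb refl] by measurable
      have "norm (indicator S u * (g (mob z u) * eval (mobU z h) u)) \<le> norm (complex_of_real L * eval (mobU z h) u)" for u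
        using mult_right_mono[OF gL, of "cmod (eval (mobU z h) u)" "mob z u"] L
        by (auto simp: norm_mult indicator_def)
      then show "AE u in dvb. norm (indicator S u * (g (mob z u) * eval (mobU z h) u)) \<le> norm (complex_of_real L * eval (mobU z h) u)" by simp
    qed
    have JT: "Jr h z = J h z - T h z" for h z
    proof -
      have "Jr h z + T h z = (\<integral>u. indicator (pd r) u * (g (mob z u) * eval (mobU z h) u) + indicator (- pd r) u * (g (mob z u) * eval (mobU z h) u) \<partial>dvb)"
        unfolding Jr_def T_def by (rule Bochner_Integration.integral_add[symmetric]) (rule iJ, simp)+
      also have "\<dots> = J h z" unfolding J_def
        by (rule Bochner_Integration.integral_cong[OF refl]) (simp add: indicator_def)
      finally show ?thesis by (simp add: eq_diff_eq)
    qed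
    have Tm [measurable]: "T h \<in> borel_measurable borel" for h
      unfolding T_def[abs_def]
    proof (rule dvb.borel_measurable_lebesgue_integral)
      show "(\<lambda>(z, u). indicator (- pd r) u * (g (mob z u) * eval (mobU z h) u)) \<in> borel_measurable (borel \<Otimes>\<^sub>M dvb)"
        by measurable
    qed
    have Tle: "ennreal (cmod (T h z)) \<le> ennreal L * (\<integral>\<^sup>+x. ennreal (om z * (tkern r z x * cmod (eval h x))) \<partial>dvb)" if z: "z \<in> polydisc" for h z
    proof -
      have "ennreal (cmod (T h z)) \<le> (\<integral>\<^sup>+u. ennreal (norm (indicator (- pd r) u * (g (mob z u) * eval (mobU z h) u))) \<partial>dvb)"
        unfolding T_def by (rule integral_norm_bound_ennreal[OF iJ]) simp
      also have "\<dots> \<le> (\<integral>\<^sup>+u. ennreal L * (indicator (- pd r) u * ennreal (cmod (eval (mobU z h) u))) \<partial>dvb)"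
      proof (rule nn_integral_mono)
        fix u
        show "ennreal (norm (indicator (- pd r) u * (g (mob z u) * eval (mobU z h) u))) \<le> ennreal L * (indicator (- pd r) u * ennreal (cmod (eval (mobU z h) u)))"
          using mult_right_mono[OF gL, of "cmod (eval (mobU z h) u)" "mob z u"] L
          by (auto simp: norm_mult indicator_def ennreal_mult[symmetric] intro!: ennreal_leI)
      qed
      also have "\<dots> = ennreal L * (\<integral>\<^sup>+u. indicator (- pd r) u * ennreal (cmod (eval (mobU z h) u)) \<partial>dvb)"
      proof (rule nn_integral_cmult)
        show "(\<lambda>u. indicator (- pd r) u * ennreal (cmod (eval (mobU z h) u))) \<in> borel_measurable dvb"
          unfolding measurable_cong_sets[OF sets_dvb refl] by measurable
      qed
      finally show ?thesis unfolding nn_integral_mobU_tail[OF z] .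
    qed
    define D where "D h h' z = f z * T h z * cnj (eval (mobU z h') 0)" for h h' z
    have Dm [measurable]: "D h h' \<in> borel_measurable borel" for h h' unfolding D_def[abs_def] by measurable
    have Dle: "(\<integral>\<^sup>+z. ennreal (cmod (D h h' z)) \<partial>lam) \<le> ennreal (e * norm h * norm h')" for h h'
    proof -
      define I where "I z = (\<integral>\<^sup>+x. ennreal (tkern r z x * (cmod (eval h' z) * cmod (eval h x))) \<partial>dvb)" for z
      have tm: "(\<lambda>x. tkern r z x) \<in> borel_measurable borel" for z
        using measurable_compose[OF measurable_Pair1'[of z borel borel] measurable_tkern[of r]] by simp
      have pt: "ennreal (1 / (om z)\<^sup>2) * ennreal (cmod (D h h' z)) \<le> ennreal (K * L) * I z" if z: "z \<in> polydisc" for z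
      proof -
        have o: "0 < om z" by (rule om_pos[OF z])
        have "1 / (om z)\<^sup>2 * cmod (D h h' z) = cmod (f z) * cmod (eval h' z) / om z * cmod (T h z)"
          using o by (simp add: D_def eval_mobU_0[OF z] norm_mult power2_eq_square)
        also have "\<dots> \<le> K * (cmod (eval h' z) / om z) * cmod (T h z)"
        proof -
          have "cmod (f z) * (cmod (eval h' z) / om z * cmod (T h z)) \<le> K * (cmod (eval h' z) / om z * cmod (T h z))"
            using o by (intro mult_right_mono fK) auto
          then show ?thesis by simp
        qed
        finally have "ennreal (1 / (om z)\<^sup>2) * ennreal (cmod (D h h' z)) \<le> ennreal (K * (cmod (eval h' z) / om z)) * ennreal (cmod (T h z))"
          using o K by (simp add: ennreal_mult[symmetric] ennreal_leI)
        also have "\<dots> \<le> ennreal (K * (cmod (eval h' z) / om z)) * (ennreal L * (\<integral>\<^sup>+x. ennreal (om z * (tkern r z x * cmod (eval h x))) \<partial>dvb))"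
          by (intro mult_left_mono Tle z) simp
        also have "\<dots> = ennreal (K * (cmod (eval h' z) / om z) * L) * (\<integral>\<^sup>+x. ennreal (om z * (tkern r z x * cmod (eval h x))) \<partial>dvb)"
          by (subst ennreal_mult''[OF L]) (rule mult.assoc[symmetric])
        also have "\<dots> = (\<integral>\<^sup>+x. ennreal (K * (cmod (eval h' z) / om z) * L) * ennreal (om z * (tkern r z x * cmod (eval h x))) \<partial>dvb)"
        proof (rule nn_integral_cmult[symmetric])
          show "(\<lambda>x. ennreal (om z * (tkern r z x * cmod (eval h x)))) \<in> borel_measurable dvb"
            unfolding measurable_cong_sets[OF sets_dvb refl] using tm by measurable
        qed
        also have "\<dots> = (\<integral>\<^sup>+x. ennreal (K * L) * ennreal (tkern r z x * (cmod (eval h' z) * cmod (eval h x))) \<partial>dvb)"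
          using o K L by (intro nn_integral_cong) (simp add: ennreal_mult[symmetric] mult_ac)
        also have "\<dots> = ennreal (K * L) * I z"
          unfolding I_def
        proof (rule nn_integral_cmult)
          show "(\<lambda>x. ennreal (tkern r z x * (cmod (eval h' z) * cmod (eval h x)))) \<in> borel_measurable dvb"
            unfolding measurable_cong_sets[OF sets_dvb refl] using tm by measurable
        qed
        finally show ?thesis .
      qed
      have "(\<integral>\<^sup>+z. ennreal (cmod (D h h' z)) \<partial>lam) = (\<integral>\<^sup>+z. ennreal (1 / (om z)\<^sup>2) * ennreal (cmod (D h h' z)) \<partial>dvb)"
        by (rule nn_integral_lam) simp
      also have "\<dots> \<le> (\<integral>\<^sup>+z. ennreal (K * L) * I z \<partial>dvb)"
      proof (rule nn_integral_mono_AE)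
        show "AE z in dvb. ennreal (1 / (om z)\<^sup>2) * ennreal (cmod (D h h' z)) \<le> ennreal (K * L) * I z"
          using AE_dvb_polydisc by eventually_elim (rule pt)
      qed
      also have "\<dots> = ennreal (K * L) * (\<integral>\<^sup>+z. I z \<partial>dvb)"
      proof (rule nn_integral_cmult)
        show "I \<in> borel_measurable dvb"
          unfolding I_def[abs_def]
        proof (rule dvb.borel_measurable_nn_integral)
          have "(\<lambda>q. tkern r (fst q) (snd q)) \<in> borel_measurable (dvb \<Otimes>\<^sub>M dvb)"
            using measurable_tkern[of r] by (simp cong: measurable_cong_sets sets_pair_measure_cong)
          then show "(\<lambda>(z, x). ennreal (tkern r z x * (cmod (eval h' z) * cmod (eval h x)))) \<in> borel_measurable (dvb \<Otimes>\<^sub>M dvb)"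
            unfolding split_beta by measurable
        qed
      qed
      also have "\<dots> \<le> ennreal (K * L) * ennreal (e' * norm h' * norm h)"
        unfolding I_def by (intro mult_left_mono small) simp
      also have "\<dots> = ennreal ((K * L * e') * (norm h' * norm h))"
        using K L e' by (simp add: ennreal_mult[symmetric] mult_ac)
      also have "\<dots> \<le> ennreal (e * (norm h' * norm h))"
        by (intro ennreal_leI mult_right_mono e') simp
      finally show ?thesis by (simp add: mult_ac)
    qed
    have D_int: "integrable lam (D h h')" for h h'
    proof (rule integrableI_bounded)
      show "(\<integral>\<^sup>+z. ennreal (norm (D h h' z)) \<partial>lam) < \<infinity>"
        by (rule le_less_trans[OF Dle]) simp
    qed (simp add: measurable_cong_sets[OF sets_lam refl])
    have main: "approx_form (\<lambda>h h'. \<integral>z. f z * Jr h z * cnj (eval (mobU z h') 0) \<partial>lam)"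
      unfolding Jr_def
    proof (rule lam.integral_functional[OF _ fK _ gL r])
      show "f \<in> borel_measurable lam" by (simp add: measurable_cong_sets[OF sets_lam refl])
      show "(\<lambda>q. g (mob (fst q) (snd q))) \<in> borel_measurable (lam \<Otimes>\<^sub>M borel)"
        by (rule measurable_compose[OF _ g]) measurable
    qed
    have "cmod (cinner (toeplitz f (toeplitz g h)) h' - (\<integral>z. f z * Jr h z * cnj (eval (mobU z h') 0) \<partial>lam)) \<le> e * norm h * norm h'" for h h'
    proof -
      have "(\<integral>z. f z * Jr h z * cnj (eval (mobU z h') 0) \<partial>lam) = (\<integral>z. q h h' z - D h h' z \<partial>lam)"
        by (rule Bochner_Integration.integral_cong[OF refl]) (simp add: JT q_def D_def algebra_simps)
      also have "\<dots> = (\<integral>z. q h h' z \<partial>lam) - (\<integral>z. D h h' z \<partial>lam)"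
        by (rule Bochner_Integration.integral_diff[OF q_int D_int])
      finally have "cinner (toeplitz f (toeplitz g h)) h' - (\<integral>z. f z * Jr h z * cnj (eval (mobU z h') 0) \<partial>lam) = (\<integral>z. D h h' z \<partial>lam)"
        unfolding q by simp
      moreover have "ennreal (cmod (\<integral>z. D h h' z \<partial>lam)) \<le> ennreal (e * norm h * norm h')"
        by (rule order_trans[OF integral_norm_bound_ennreal[OF D_int] Dle])
      ultimately show ?thesis using e by (simp add: ennreal_le_iff)
    qed
    with main show "\<exists>q'. approx_form q' \<and> (\<forall>h h'. cmod (cinner (toeplitz f (toeplitz g h)) h' - q' h h') \<le> e * norm h * norm h')"
      by blast
  qed
qed

lemma toeplitz_closure_compose:
  fixes A B :: "'n::finite op"
  assumes "A \<in> toeplitz_closure" "B \<in> toeplitz_closure"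
  shows "A o\<^sub>L B \<in> toeplitz_closure"
proof -
  obtain a b :: "nat \<Rightarrow> 'n op" where a: "\<And>n. a n \<in> {toeplitz f | f. f \<in> Linfty}" "a \<longlonglongrightarrow> A"
    and b: "\<And>n. b n \<in> {toeplitz f | f. f \<in> Linfty}" "b \<longlonglongrightarrow> B"
    using assms unfolding closure_sequential by blast
  have "a n o\<^sub>L b n \<in> toeplitz_closure" for n
  proof -
    obtain f g :: "complex ^ 'n \<Rightarrow> complex" where f: "f \<in> Linfty" "a n = toeplitz f" and g: "g \<in> Linfty" "b n = toeplitz g"
      using a(1)[of n] b(1)[of n] by blast
    obtain f0 K where f0: "f0 \<in> borel_measurable borel" "\<And>z. cmod (f0 z) \<le> K" "toeplitz f = toeplitz f0"
      using toeplitz_Linfty[OF f(1)] by blast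
    obtain g0 L where g0: "g0 \<in> borel_measurable borel" "\<And>z. cmod (g0 z) \<le> L" "toeplitz g = toeplitz g0"
      using toeplitz_Linfty[OF g(1)] by blast
    show ?thesis
      unfolding toeplitz_closure_iff f g f0(3) g0(3) blinfun_apply_blinfun_compose o_def
      by (rule approx_form_toeplitz_compose[OF f0(1,2) g0(1,2)])
  qed
  moreover have "(\<lambda>n. (a n o\<^sub>L b n)) \<longlonglongrightarrow> (A o\<^sub>L B)"
    by (rule bounded_bilinear.tendsto[OF bounded_bilinear_blinfun_compose a(2) b(2)])
  ultimately show ?thesis by (rule closed_sequentially[OF closed_closure])
qed

section \<open>Separated sets\<close>

lemma bergman_beta_artanh: "bergman_beta u v = artanh (cmod (mobius u v))"
  by (simp add: bergman_beta_def artanh_def)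

lemma artanh_less:
  fixes x y :: real
  assumes "0 \<le> x" "x < y" "y < 1"
  shows "artanh x < artanh y"
proof -
  have "(1 + x) / (1 - x) < (1 + y) / (1 - y)"
    using assms by (intro frac_less) auto
  moreover have "0 < (1 + x) / (1 - x)" using assms by (intro divide_pos_pos) auto
  ultimately show ?thesis unfolding artanh_def by (intro divide_strict_right_mono ln_less_cancel_iff[THEN iffD2]) auto
qed

lemma artanh_le_iff:
  fixes x y :: real
  assumes "0 \<le> x" "x < 1" "0 \<le> y" "y < 1"
  shows "artanh x \<le> artanh y \<longleftrightarrow> x \<le> y"
  using artanh_less[of x y] artanh_less[of y x] assms by (cases x y rule: linorder_cases) auto

lemma bergman_beta_nonneg: "cmod u < 1 \<Longrightarrow> cmod v < 1 \<Longrightarrow> 0 \<le> bergman_beta u v"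
  using artanh_le_iff[of 0 "cmod (mobius u v)"] cmod_mobius_lt_1[of u v]
  by (simp add: bergman_beta_artanh)

text \<open>The metric is a sum of nonnegative terms artanh of the pseudohyperbolic distance, so it
  dominates each term. The converse comparison loses the factor \<open>CARD('n)\<close>.\<close>

lemma mob_pd_of_poly_dist:
  assumes z: "z \<in> polydisc" "w \<in> polydisc" and t: "0 \<le> t" "t < 1" and le: "poly_dist z w \<le> artanh t"
  shows "mob z w \<in> pd t"
proof -
  have "cmod (mobius (z $ i) (w $ i)) \<le> t" for i
  proof -
    have "bergman_beta (z $ i) (w $ i) \<le> poly_dist z w"
      unfolding poly_dist_def using z by (intro member_le_sum bergman_beta_nonneg polydiscD) auto
    then have "artanh (cmod (mobius (z $ i) (w $ i))) \<le> artanh t"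
      using le by (simp add: bergman_beta_artanh)
    then show ?thesis
      using artanh_le_iff[of "cmod (mobius (z $ i) (w $ i))" t] cmod_mobius_lt_1[OF polydiscD[OF z(1)] polydiscD[OF z(2)], of i i] z t by simp
  qed
  then show ?thesis by (simp add: pd_def)
qed

lemma poly_dist_le_of_mob_pd:
  fixes z w :: "complex ^ 'n::finite"
  assumes z: "z \<in> polydisc" "w \<in> polydisc" and t: "0 \<le> t" "t < 1" and le: "mob z w \<in> pd t"
  shows "poly_dist z w \<le> real CARD('n) * artanh t"
  unfolding poly_dist_def
proof (rule sum_bounded_above)
  fix i
  show "bergman_beta (z $ i) (w $ i) \<le> artanh t"
    using artanh_le_iff[of "cmod (mobius (z $ i) (w $ i))" t] cmod_mobius_lt_1[OF polydiscD[OF z(1)] polydiscD[OF z(2)], of i i] z t le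
    by (simp add: bergman_beta_artanh pd_def)
qed

text \<open>Restates separation with pseudohyperbolic balls, on which the measure estimates are
  available.\<close>

lemma separated_pd:
  fixes \<Gamma> :: "(complex ^ 'n::finite) set"
  assumes "separated_set \<Gamma>"
  obtains \<delta> where "0 < \<delta>" "\<delta> < 1"
    "\<And>u v w. u \<in> \<Gamma> \<Longrightarrow> v \<in> \<Gamma> \<Longrightarrow> w \<in> polydisc \<Longrightarrow> mob u w \<in> pd \<delta> \<Longrightarrow> mob v w \<in> pd \<delta> \<Longrightarrow> u = v"
proof -
  have G: "\<Gamma> \<subseteq> polydisc" using assms by (simp add: separated_set_def)
  obtain a where a: "0 < a" "\<And>u v. u \<in> \<Gamma> \<Longrightarrow> v \<in> \<Gamma> \<Longrightarrow> u \<noteq> v \<Longrightarrow> poly_ball u a \<inter> poly_ball v a = {}"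
    using assms unfolding separated_set_def by blast
  \<comment> \<open>Each coordinate then contributes at most a / (2 n) to the metric; the total a/2
    is strictly below a.\<close>
  define \<delta> where "\<delta> = tanh (a / (2 * real CARD('n)))"
  have \<delta>: "0 < \<delta>" "\<delta> < 1" using a by (simp_all add: \<delta>_def tanh_real_lt_1)
  have lt: "real CARD('n) * artanh \<delta> < a" using a by (simp add: \<delta>_def artanh_tanh_real)
  have ball: "w \<in> poly_ball u a" if "u \<in> \<Gamma>" "w \<in> polydisc" "mob u w \<in> pd \<delta>" for u w
    using poly_dist_le_of_mob_pd[of u w \<delta>] that \<delta> lt G by (auto simp: poly_ball_def)
  show ?thesis
  proof (rule that[OF \<delta>])
    fix u v w assume "u \<in> \<Gamma>" "v \<in> \<Gamma>" "w \<in> polydisc" "mob u w \<in> pd \<delta>" "mob v w \<in> pd \<delta>"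
    then show "u = v" using ball[of u w] ball[of v w] a(2)[of u v] by blast
  qed
qed

text \<open>By invariance the ball is moved to the origin, where the density is at least 1 because
  \<open>om\<close> is at most 1.\<close>

lemma nn_integral_lam_ball_ge:
  fixes z :: "complex ^ 'n::finite"
  assumes z: "z \<in> polydisc"
  shows "emeasure dvb (pd r :: (complex ^ 'n) set) \<le> (\<integral>\<^sup>+w. indicator polydisc w * indicator (pd r) (mob z w) \<partial>lam)"
proof -
  define F where "F w = ennreal (1 / (om w)\<^sup>2) * (indicator polydisc w * indicator (pd r) (mob z w))" for w
  have Fm [measurable]: "F \<in> borel_measurable borel" unfolding F_def[abs_def] by measurable
  have "emeasure dvb (pd r :: (complex ^ 'n) set) = (\<integral>\<^sup>+u. indicator (pd r) u \<partial>(dvb :: (complex ^ 'n) measure))" by simp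
  also have "\<dots> \<le> (\<integral>\<^sup>+u. F (mob z u) * ennreal ((cmod (kf z u))\<^sup>2) \<partial>dvb)"
  proof (rule nn_integral_mono_AE)
    show "AE u in dvb. indicator (pd r) u \<le> F (mob z u) * ennreal ((cmod (kf z u))\<^sup>2)"
      using AE_dvb_polydisc
    proof eventually_elim
      case (elim u)
      show ?case
      proof (cases "u \<in> pd r")
        case True
        have om: "om (mob z u) = om u * cmod (kf z u)" by (rule om_mob[OF z elim])
        have k: "cmod (kf z u) > 0" using kf_nz[OF z elim] by simp
        have "F (mob z u) * ennreal ((cmod (kf z u))\<^sup>2) = ennreal (1 / (om (mob z u))\<^sup>2 * (cmod (kf z u))\<^sup>2)"
          using True elim z by (simp add: F_def ennreal_mult[symmetric])
        also have "1 / (om (mob z u))\<^sup>2 * (cmod (kf z u))\<^sup>2 = 1 / (om u)\<^sup>2"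
          unfolding om using k by (simp add: power_mult_distrib)
        finally have e: "F (mob z u) * ennreal ((cmod (kf z u))\<^sup>2) = ennreal (1 / (om u)\<^sup>2)" .
        have "1 \<le> 1 / (om u)\<^sup>2"
          using om_pos[OF elim] om_le_1[OF elim] by (simp add: power_le_one)
        then have "ennreal 1 \<le> ennreal (1 / (om u)\<^sup>2)" by (rule ennreal_leI)
        then show ?thesis unfolding e using True by simp
      qed simp
    qed
  qed
  also have "\<dots> = (\<integral>\<^sup>+w. F w \<partial>dvb)" by (rule nn_integral_dvb_mob[OF z Fm])
  also have "\<dots> = (\<integral>\<^sup>+w. indicator polydisc w * indicator (pd r) (mob z w) \<partial>lam)"
    unfolding F_def by (subst nn_integral_lam) simp_all
  finally show ?thesis .
qed

text \<open>A packing argument: the balls of radius \<open>\<delta>\<close> around points of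
  \<open>\<Gamma>\<close> near \<open>x\<close> are disjoint, each has invariant mass at least
  \<open>c\<close>, and all lie in a ball around \<open>x\<close> of mass at most \<open>V\<close>.
  Arguing with finite subsets yields finiteness together with the bound.\<close>

lemma separated_card_bound:
  fixes \<Gamma> :: "(complex ^ 'n::finite) set"
  assumes sep: "separated_set \<Gamma>" and r: "0 \<le> r" "r < 1"
  obtains B :: nat where "\<And>x. x \<in> polydisc \<Longrightarrow> finite {z \<in> \<Gamma>. mob z x \<in> pd r} \<and> card {z \<in> \<Gamma>. mob z x \<in> pd r} \<le> B"
proof -
  have G: "\<Gamma> \<subseteq> polydisc" using sep by (simp add: separated_set_def)
  obtain \<delta> where \<delta>: "0 < \<delta>" "\<delta> < 1"
    and dis: "\<And>u v w. u \<in> \<Gamma> \<Longrightarrow> v \<in> \<Gamma> \<Longrightarrow> w \<in> polydisc \<Longrightarrow> mob u w \<in> pd \<delta> \<Longrightarrow> mob v w \<in> pd \<delta> \<Longrightarrow> u = v"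
    using separated_pd[OF sep] by blast
  obtain t where t: "0 \<le> t" "t < 1" and tri: "\<And>x y z :: complex ^ 'n. x \<in> polydisc \<Longrightarrow> y \<in> polydisc \<Longrightarrow> z \<in> polydisc \<Longrightarrow>
       mob x y \<in> pd r \<Longrightarrow> mob y z \<in> pd \<delta> \<Longrightarrow> mob x z \<in> pd t"
    using mob_pd_triangle[OF r less_imp_le[OF \<delta>(1)] \<delta>(2)] by blast
  obtain V where V: "0 \<le> V" "\<And>x :: complex ^ 'n. x \<in> polydisc \<Longrightarrow>
      (\<integral>\<^sup>+w. indicator polydisc w * indicator (pd t) (mob w x) \<partial>lam) \<le> ennreal V"
    using lam.loc_fin[OF t] by blast
  define c where "c = measure dvb (pd \<delta> :: (complex ^ 'n) set)"
  have c: "0 < c" unfolding c_def by (rule measure_pd_pos[OF \<delta>])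
  have low: "ennreal c \<le> (\<integral>\<^sup>+w. indicator polydisc w * indicator (pd \<delta>) (mob z w) \<partial>lam)" if "z \<in> polydisc" for z :: "complex ^ 'n"
    using nn_integral_lam_ball_ge[OF that, of \<delta>] unfolding c_def dvb.emeasure_eq_measure .
  show ?thesis
  proof (rule that)
    fix x :: "complex ^ 'n" assume x: "x \<in> polydisc"
    show "finite {z \<in> \<Gamma>. mob z x \<in> pd r} \<and> card {z \<in> \<Gamma>. mob z x \<in> pd r} \<le> nat \<lfloor>V / c\<rfloor>"
    proof (rule finite_if_finite_subsets_card_bdd)
      fix F assume F: "F \<subseteq> {z \<in> \<Gamma>. mob z x \<in> pd r}" "finite F"
      have FG: "z \<in> \<Gamma>" "z \<in> polydisc" "mob x z \<in> pd r" if "z \<in> F" for z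
        using that F(1) G mob_pd_commute[of x z r] by auto
      define \<phi> where "\<phi> z w = (indicator polydisc w * indicator (pd \<delta>) (mob z w) :: ennreal)" for z w :: "complex ^ 'n"
      have pt: "(\<Sum>z\<in>F. \<phi> z w) \<le> indicator polydisc w * indicator (pd t) (mob w x)" for w
      proof (cases "\<exists>z0\<in>F. w \<in> polydisc \<and> mob z0 w \<in> pd \<delta>")
        case True
        then obtain z0 where z0: "z0 \<in> F" "w \<in> polydisc" "mob z0 w \<in> pd \<delta>" by blast
        have "\<phi> z w = 0" if "z \<in> F - {z0}" for z
          using dis[OF FG(1) FG(1)[OF z0(1)] z0(2) _ z0(3), of z] that by (auto simp: \<phi>_def indicator_def)
        then have "(\<Sum>z\<in>F. \<phi> z w) = (\<Sum>z\<in>{z0}. \<phi> z w)"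
          using F(2) z0 by (intro sum.mono_neutral_right) auto
        also have "\<dots> = \<phi> z0 w" by simp
        also have "\<phi> z0 w \<le> 1" using z0 by (simp add: \<phi>_def)
        also have "mob x w \<in> pd t" by (rule tri[OF x FG(2)[OF z0(1)] z0(2) FG(3)[OF z0(1)] z0(3)])
        then have "1 = (indicator polydisc w * indicator (pd t) (mob w x) :: ennreal)"
          using z0(2) mob_pd_commute[of x w t] by simp
        finally show ?thesis .
      next
        case False
        then have "(\<Sum>z\<in>F. \<phi> z w) = 0" by (auto simp: \<phi>_def indicator_def)
        then show ?thesis by simp
      qed
      have "ennreal (real (card F) * c) = (\<Sum>z\<in>F. ennreal c)"
        using c by (simp add: ennreal_mult ennreal_of_nat_eq_real_of_nat)
      also have "\<dots> \<le> (\<Sum>z\<in>F. \<integral>\<^sup>+w. \<phi> z w \<partial>lam)"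
        unfolding \<phi>_def by (intro sum_mono low FG)
      also have "\<dots> = (\<integral>\<^sup>+w. (\<Sum>z\<in>F. \<phi> z w) \<partial>lam)"
      proof (rule nn_integral_sum[symmetric])
        show "\<phi> z \<in> borel_measurable lam" for z
          unfolding \<phi>_def[abs_def] measurable_cong_sets[OF sets_lam refl] by measurable
      qed
      also have "\<dots> \<le> (\<integral>\<^sup>+w. indicator polydisc w * indicator (pd t) (mob w x) \<partial>lam)"
        by (rule nn_integral_mono) (rule pt)
      also have "\<dots> \<le> ennreal V" by (rule V(2)[OF x])
      finally have "real (card F) * c \<le> V" using V(1) by (simp add: ennreal_le_iff)
      then have "real (card F) \<le> V / c" using c by (simp add: pos_le_divide_eq)
      then show "card F \<le> nat \<lfloor>V / c\<rfloor>" by (rule le_nat_floor)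
    qed
  qed
qed

text \<open>As \<open>mob z 0\<close> is \<open>z\<close>, the points of \<open>\<Gamma>\<close> in
  \<open>pd (R n)\<close> are finite in number, and these sets exhaust
  \<open>\<Gamma>\<close>.\<close>

lemma separated_countable:
  fixes \<Gamma> :: "(complex ^ 'n::finite) set"
  assumes sep: "separated_set \<Gamma>"
  shows "countable \<Gamma>"
proof -
  have G: "\<Gamma> \<subseteq> polydisc" using sep by (simp add: separated_set_def)
  define R where "R n = 1 - inverse (real (Suc n))" for n
  have R: "0 \<le> R n" "R n < 1" for n by (auto simp: R_def inverse_eq_divide)
  have "\<Gamma> \<subseteq> (\<Union>n. {z \<in> \<Gamma>. mob z 0 \<in> pd (R n)})"
  proof
    fix z assume z: "z \<in> \<Gamma>"
    then obtain r d where r: "0 \<le> r" "r < 1" "0 < d" "ball z d \<subseteq> pd r"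
      using polydisc_nbhd[of z] G by blast
    obtain n where "inverse (real (Suc n)) < 1 - r" using reals_Archimedean[of "1 - r"] r by auto
    then have "pd r \<subseteq> (pd (R n) :: (complex ^ 'n) set)" by (intro pd_mono) (simp add: R_def)
    moreover have "z \<in> pd r" using r by (meson centre_in_ball subsetD)
    ultimately show "z \<in> (\<Union>n. {z \<in> \<Gamma>. mob z 0 \<in> pd (R n)})" using z by auto
  qed
  moreover have "countable (\<Union>n. {z \<in> \<Gamma>. mob z 0 \<in> pd (R n)})"
  proof (rule countable_UN)
    fix n
    obtain B where "\<And>x. x \<in> polydisc \<Longrightarrow> finite {z \<in> \<Gamma>. mob z x \<in> pd (R n)} \<and> card {z \<in> \<Gamma>. mob z x \<in> pd (R n)} \<le> B"
      using separated_card_bound[OF sep R[of n]] by blast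
    from this[OF zero_in_polydisc] show "countable {z \<in> \<Gamma>. mob z 0 \<in> pd (R n)}" by (simp add: countable_finite)
  qed simp
  ultimately show ?thesis by (rule countable_subset)
qed

lemma lf_measure_separated:
  fixes \<Gamma> :: "(complex ^ 'n::finite) set"
  assumes sep: "separated_set \<Gamma>"
  shows "lf_measure (count_space \<Gamma>)"
proof (intro lf_measure.intro lf_measure_axioms.intro)
  show "sigma_finite_measure (count_space \<Gamma>)"
    by (rule sigma_finite_measure_count_space_countable[OF separated_countable[OF sep]])
  show "(\<lambda>z. z) \<in> count_space \<Gamma> \<rightarrow>\<^sub>M borel" by simp
  fix r :: real assume r: "0 \<le> r" "r < 1"
  obtain B where B: "\<And>x. x \<in> polydisc \<Longrightarrow> finite {z \<in> \<Gamma>. mob z x \<in> pd r} \<and> card {z \<in> \<Gamma>. mob z x \<in> pd r} \<le> B"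
    using separated_card_bound[OF sep r] by blast
  have "(\<integral>\<^sup>+z. indicator polydisc z * indicator (pd r) (mob z x) \<partial>count_space \<Gamma>) \<le> ennreal (real B)" if x: "x \<in> polydisc" for x :: "complex ^ 'n"
  proof -
    define S where "S = {z \<in> \<Gamma>. mob z x \<in> pd r}"
    have "(\<integral>\<^sup>+z. indicator polydisc z * indicator (pd r) (mob z x) \<partial>count_space \<Gamma>) \<le> (\<integral>\<^sup>+z. indicator S z \<partial>count_space \<Gamma>)"
      by (rule nn_integral_mono) (auto simp: S_def indicator_def)
    also have "\<dots> = emeasure (count_space \<Gamma>) S" by (rule nn_integral_indicator) (auto simp: S_def)
    also have "\<dots> = ennreal (real (card S))"
      using B[OF x] by (subst emeasure_count_space_finite) (auto simp: S_def ennreal_of_nat_eq_real_of_nat)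
    also have "\<dots> \<le> ennreal (real B)" using B[OF x] by (intro ennreal_leI) (simp add: S_def)
    finally show ?thesis .
  qed
  then show "\<exists>B\<ge>0. \<forall>x\<in>polydisc. (\<integral>\<^sup>+z. indicator polydisc z * indicator (pd r) (mob z x) \<partial>count_space \<Gamma>) \<le> ennreal B"
    by (intro exI[of _ "real B"]) simp
qed

section \<open>Localized sums as limits of Toeplitz operators\<close>

text \<open>Unconditional convergence of complex numbers is absolute convergence, so the sum is a
  Lebesgue integral for counting measure.\<close>

lemma has_sum_count_space:
  fixes f :: "'a \<Rightarrow> complex"
  assumes "(f has_sum s) \<Gamma>"
  shows "(\<integral>z. f z \<partial>count_space \<Gamma>) = s"
proof -
  have "f summable_on \<Gamma>" using assms summable_on_def by blast
  then have "(\<lambda>x. norm (f x)) summable_on \<Gamma>" using summable_on_iff_abs_summable_on_complex by blast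
  then have "Infinite_Set_Sum.abs_summable_on f \<Gamma>" using abs_summable_equivalent[of f \<Gamma>] by blast
  from infsetsum_infsum[OF this] show ?thesis
    using infsumI[OF assms] by (simp add: infsetsum_def)
qed

lemma kernel_cinner_mobU:
  assumes "z \<in> polydisc"
  shows "cinner h (normalized_kernel z) = eval (mobU z h) 0" "cinner (normalized_kernel z) h = cnj (eval (mobU z h) 0)"
  using cinner_normalized_kernel[OF assms, of h] cinner_cnj[of h "normalized_kernel z"]
  by (simp_all add: eval_mobU_0[OF assms])

lemma cinner_sot_sum:
  assumes "sot_has_sum (\<lambda>z. scale_op (c z) (rank_one (k z) (l z))) A \<Gamma>"
  shows "cinner (A h) g = (\<integral>z. c z * (cinner h (l z) * cinner (k z) g) \<partial>count_space \<Gamma>)"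
proof -
  have "bounded_linear (\<lambda>f. cinner f g)"
  proof (rule bounded_linear_intro[where K = "norm g"])
    show "cinner (r *\<^sub>R f) g = r *\<^sub>R cinner f g" for r f
      by (simp add: scale_vec_of_real[symmetric] cinner_scale_left scaleR_conv_of_real)
  qed (simp_all add: cinner_add_left cmod_cinner_le)
  moreover have "((\<lambda>z. scale_op (c z) (rank_one (k z) (l z)) h) has_sum A h) \<Gamma>"
    using assms by (simp add: sot_has_sum_def)
  ultimately have "((\<lambda>z. cinner (scale_op (c z) (rank_one (k z) (l z)) h) g) has_sum cinner (A h) g) \<Gamma>"
    by (rule has_sum_bounded_linear)
  then show ?thesis by (simp add: cinner_scale_left has_sum_count_space[symmetric])
qed

text \<open>With \<open>b z = mob z (\<gamma> z)\<close>, pairing with the kernel at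
  \<open>\<gamma> z\<close> is evaluation of \<open>mobU z h\<close> at \<open>b z\<close>, times
  \<open>\<rho> z\<close>. The bound on the distances keeps \<open>b z\<close> in a fixed compact
  set, so \<open>point_functional\<close> applies to counting measure.\<close>

lemma D0_subset_toeplitz_closure: "D0 \<subseteq> (toeplitz_closure :: 'n::finite op set)"
proof
  fix A :: "'n op" assume "A \<in> D0"
  then obtain \<Gamma> c \<gamma> C where sep: "separated_set \<Gamma>" and bc: "bounded (c ` \<Gamma>)" and \<gamma>: "\<gamma> ` \<Gamma> \<subseteq> polydisc"
    and C: "C \<ge> 0" "\<And>z. z \<in> \<Gamma> \<Longrightarrow> poly_dist z (\<gamma> z) \<le> C"
    and A: "sot_has_sum (\<lambda>z. scale_op (c z) (rank_one (normalized_kernel z) (normalized_kernel (\<gamma> z)))) A \<Gamma>"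
    unfolding D0_def by blast
  interpret lf_measure "count_space \<Gamma>" by (rule lf_measure_separated[OF sep])
  have G: "z \<in> polydisc" if "z \<in> \<Gamma>" for z using sep that by (auto simp: separated_set_def)
  have \<gamma>p: "\<gamma> z \<in> polydisc" if "z \<in> \<Gamma>" for z using \<gamma> that by auto
  define t where "t = tanh C"
  have t: "0 \<le> t" "t < 1" using C by (simp_all add: t_def tanh_real_lt_1)
  \<comment> \<open>\<open>point_functional\<close> asks for \<open>b z \<in> pd t\<close> for every
    z, hence the default off \<open>\<Gamma>\<close>.\<close>
  define b where "b z = (if z \<in> \<Gamma> then mob z (\<gamma> z) else 0)" for z
  have b: "b z \<in> pd t" for z
    using mob_pd_of_poly_dist[OF G \<gamma>p t, of z] C(2)[of z] t
    by (auto simp: b_def t_def artanh_tanh_real pd_def)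
  obtain K where K: "\<And>z. z \<in> \<Gamma> \<Longrightarrow> cmod (c z) \<le> K" "0 \<le> K"
    using bc unfolding bounded_pos by (metis imageI less_imp_le)
  \<comment> \<open>Its modulus is \<open>om (b z)\<close>, at most 1, by
    \<open>om_mob\<close>.\<close>
  define \<rho> where "\<rho> z = complex_of_real (om (\<gamma> z)) / kf z (b z)" for z
  have bp: "b z \<in> polydisc" for z using b[of z] pd_subset[OF t(2)] by blast
  have \<gamma>b: "\<gamma> z = mob z (b z)" if "z \<in> \<Gamma>" for z using that G \<gamma>p by (simp add: b_def)
  have \<rho>: "cmod (\<rho> z) \<le> 1" if z: "z \<in> \<Gamma>" for z
  proof -
    have "om (\<gamma> z) = om (b z) * cmod (kf z (b z))" unfolding \<gamma>b[OF z] by (rule om_mob[OF G[OF z] bp])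
    moreover have "cmod (\<rho> z) = \<bar>om (\<gamma> z)\<bar> / cmod (kf z (b z))" by (simp add: \<rho>_def norm_divide)
    ultimately have "cmod (\<rho> z) = \<bar>om (b z)\<bar>" using kf_nz[OF G[OF z] bp, of z] by (simp add: abs_mult)
    then show ?thesis using om_pos[OF bp[of z]] om_le_1[OF bp[of z]] by simp
  qed
  have ev: "cinner h (normalized_kernel (\<gamma> z)) = \<rho> z * eval (mobU z h) (b z)" if z: "z \<in> \<Gamma>" for z h
    unfolding cinner_normalized_kernel[OF \<gamma>p[OF z]]
    using kf_nz[OF G[OF z] bp] by (simp add: eval_mobU G[OF z] bp \<gamma>b[OF z, symmetric] \<rho>_def)
  define c' where "c' z = (if z \<in> \<Gamma> then c z * \<rho> z else 0)" for z
  have c': "cmod (c' z) \<le> K" for z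
  proof (cases "z \<in> \<Gamma>")
    case True
    have "cmod (c z) * cmod (\<rho> z) \<le> K * 1" by (intro mult_mono K \<rho> True) simp
    then show ?thesis using True by (simp add: c'_def norm_mult)
  qed (simp add: c'_def K)
  have "approx_form (\<lambda>h g. \<integral>z. c' z * eval (mobU z h) (b z) * cnj (eval (mobU z g) 0) \<partial>count_space \<Gamma>)"
    by (rule point_functional[OF _ c' _ b t]) auto
  moreover have "(\<integral>z. c' z * eval (mobU z h) (b z) * cnj (eval (mobU z g) 0) \<partial>count_space \<Gamma>) = cinner (A h) g" for h g
    unfolding cinner_sot_sum[OF A]
    by (rule Bochner_Integration.integral_cong[OF refl]) (simp add: c'_def ev kernel_cinner_mobU G)
  ultimately show "A \<in> toeplitz_closure"
    unfolding toeplitz_closure_iff by simp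
qed

section \<open>Toeplitz operators as limits of localized sums\<close>

text \<open>Cauchy's criterion for the net of finite partial sums: finite sums outside a large
  finite set are controlled by tails of the convergent series of the \<open>x z\<close>.\<close>

lemma summable_on_dominated:
  fixes v :: "'a \<Rightarrow> 'b::banach" and x :: "'a \<Rightarrow> real"
  assumes x: "x summable_on \<Gamma>" and x0: "\<And>z. z \<in> \<Gamma> \<Longrightarrow> 0 \<le> x z" and M: "0 \<le> M"
    and le: "\<And>F. finite F \<Longrightarrow> F \<subseteq> \<Gamma> \<Longrightarrow> norm (sum v F) \<le> M * sqrt (sum x F)"
  shows "v summable_on \<Gamma>"
proof -
  obtain S where S: "(sum x \<longlongrightarrow> S) (finite_subsets_at_top \<Gamma>)"
    using x unfolding summable_on_def has_sum_def by blast
  have "\<exists>P. eventually P (finite_subsets_at_top \<Gamma>) \<and> (\<forall>F1 F2. P F1 \<and> P F2 \<longrightarrow> dist (sum v F1) (sum v F2) < e)" if e: "0 < e" for e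
  proof -
    define d where "d = e / (2 * (M + 1))"
    have d: "0 < d" using e M by (simp add: d_def)
    have de: "2 * (M + 1) * d = e" unfolding d_def times_divide_eq_right using M by (intro nonzero_mult_div_cancel_left) simp
    have "\<forall>\<^sub>F F in finite_subsets_at_top \<Gamma>. dist (sum x F) S < d\<^sup>2 / 2"
      by (rule tendstoD[OF S]) (use d in simp)
    then have "\<exists>F0. finite F0 \<and> F0 \<subseteq> \<Gamma> \<and> (\<forall>Y. finite Y \<and> F0 \<subseteq> Y \<and> Y \<subseteq> \<Gamma> \<longrightarrow> dist (sum x Y) S < d\<^sup>2 / 2)"
      by (simp only: eventually_finite_subsets_at_top)
    then obtain F0 where F01: "finite F0" "F0 \<subseteq> \<Gamma>"
      and F02: "\<forall>Y. finite Y \<and> F0 \<subseteq> Y \<and> Y \<subseteq> \<Gamma> \<longrightarrow> dist (sum x Y) S < d\<^sup>2 / 2"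
      by (elim exE conjE) (rule that)
    have F0: "finite F0" "F0 \<subseteq> \<Gamma>" "\<And>F. finite F \<Longrightarrow> F0 \<subseteq> F \<Longrightarrow> F \<subseteq> \<Gamma> \<Longrightarrow> dist (sum x F) S < d\<^sup>2 / 2"
      using F01 F02[rule_format] by blast+
    \<comment> \<open>The sum of \<open>x\<close> over \<open>G\<close> is a difference of two
      partial sums, each within half of d^2 of the limit; the square root gives d.\<close>
    have tail: "norm (sum v G) \<le> M * d" if G: "finite G" "G \<subseteq> \<Gamma>" "G \<inter> F0 = {}" for G
    proof -
      have "sum x (F0 \<union> G) = sum x F0 + sum x G" using F0 G by (intro sum.union_disjoint) auto
      moreover have "\<bar>sum x F0 - S\<bar> < d\<^sup>2 / 2" using F0(3)[OF F0(1) order_refl F0(2)] by (simp only: dist_real_def)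
      moreover have "\<bar>sum x (F0 \<union> G) - S\<bar> < d\<^sup>2 / 2"
        using F0(3)[of "F0 \<union> G"] F0(1,2) G by (simp add: dist_real_def)
      ultimately have "sum x G \<le> d\<^sup>2" by linarith
      then have "sqrt (sum x G) \<le> d" using d by (intro real_le_lsqrt) auto
      then show ?thesis using le[OF G(1,2)] M by (meson mult_left_mono order_trans)
    qed
    define P where "P F \<longleftrightarrow> finite F \<and> F0 \<subseteq> F \<and> F \<subseteq> \<Gamma>" for F
    have "eventually P (finite_subsets_at_top \<Gamma>)"
      unfolding eventually_finite_subsets_at_top by (rule exI[of _ F0]) (simp add: P_def F01)
    moreover have "dist (sum v F1) (sum v F2) < e" if P: "P F1" "P F2" for F1 F2
    proof -
      have f: "finite F1" "finite F2" using P by (auto simp: P_def)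
      have "sum v F1 = sum v (F1 - F2) + sum v (F1 \<inter> F2)" "sum v F2 = sum v (F2 - F1) + sum v (F1 \<inter> F2)"
        using f sum.Int_Diff[of F1 v F2] sum.Int_Diff[of F2 v F1] by (simp_all add: Int_commute add.commute)
      then have "dist (sum v F1) (sum v F2) = norm (sum v (F1 - F2) - sum v (F2 - F1))"
        by (simp add: dist_norm)
      also have "\<dots> \<le> norm (sum v (F1 - F2)) + norm (sum v (F2 - F1))" by (rule norm_triangle_ineq4)
      also have "\<dots> \<le> M * d + M * d" using P by (intro add_mono tail) (auto simp: P_def)
      also have "\<dots> = e - 2 * d" using de by (simp add: algebra_simps)
      also have "\<dots> < e" using d by simp
      finally show ?thesis .
    qed
    ultimately show ?thesis by blast
  qed
  then have "cauchy_filter (filtermap (sum v) (finite_subsets_at_top \<Gamma>))"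
    by (simp add: cauchy_filter_metric_filtermap)
  moreover have "complete (UNIV :: 'b set)"
    by (meson Cauchy_convergent UNIV_I complete_def convergent_def)
  ultimately obtain L where "(sum v \<longlongrightarrow> L) (finite_subsets_at_top \<Gamma>)"
    using complete_uniform[where S = UNIV] by (force simp add: filterlim_def)
  then show ?thesis using summable_on_def has_sum_def by blast
qed

text \<open>The pairings with the kernels of \<open>\<Gamma>\<close> are values at 0, hence bounded
  by local norms, whose squares are summable by \<open>bessel\<close> for counting measure. The
  finite-sum form is what summability and duality use.\<close>

lemma separated_bessel:
  fixes \<Gamma> :: "(complex ^ 'n::finite) set"
  assumes sep: "separated_set \<Gamma>"
  obtains L where "0 \<le> L" "\<And>F h. finite F \<Longrightarrow> F \<subseteq> \<Gamma> \<Longrightarrow> (\<Sum>z\<in>F. (cmod (eval (mobU z h) 0))\<^sup>2) \<le> (L * norm h)\<^sup>2"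
proof -
  interpret lf_measure "count_space \<Gamma>" by (rule lf_measure_separated[OF sep])
  obtain C t where C: "0 \<le> C" "0 \<le> t" "t < 1" and le: "\<And>k :: 'n bergman. cmod (eval k 0) \<le> C * locnorm t k"
    using eval_0_le_locnorm by blast
  obtain B where B: "0 \<le> B" and bes: "\<And>h. (\<integral>\<^sup>+z. ennreal ((locnorm t (mobU z h))\<^sup>2) \<partial>count_space \<Gamma>) \<le> ennreal (B * (norm h)\<^sup>2)"
    using bessel[OF C(2,3)] by blast
  show ?thesis
  proof (rule that[of "C * sqrt B"])
    fix F h assume F: "finite F" "F \<subseteq> \<Gamma>"
    define y where "y z = (locnorm t (mobU z h))\<^sup>2" for z :: "complex ^ 'n"
    have "ennreal (sum y F) = (\<Sum>z\<in>F. ennreal (y z))" by (simp add: y_def)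
    also have "\<dots> = (\<integral>\<^sup>+z. indicator F z * ennreal (y z) \<partial>count_space \<Gamma>)"
      using F by (subst nn_integral_count_space'[of F]) auto
    also have "\<dots> \<le> (\<integral>\<^sup>+z. ennreal (y z) \<partial>count_space \<Gamma>)"
      by (rule nn_integral_mono) (simp split: split_indicator)
    also have "\<dots> \<le> ennreal (B * (norm h)\<^sup>2)" unfolding y_def by (rule bes)
    finally have yB: "sum y F \<le> B * (norm h)\<^sup>2" using B by (simp add: ennreal_le_iff)
    have "(\<Sum>z\<in>F. (cmod (eval (mobU z h) 0))\<^sup>2) \<le> (\<Sum>z\<in>F. C\<^sup>2 * y z)"
    proof (rule sum_mono)
      fix z
      have "(cmod (eval (mobU z h) 0))\<^sup>2 \<le> (C * locnorm t (mobU z h))\<^sup>2" by (intro power_mono le) simp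
      then show "(cmod (eval (mobU z h) 0))\<^sup>2 \<le> C\<^sup>2 * y z" by (simp add: y_def power_mult_distrib)
    qed
    also have "\<dots> = C\<^sup>2 * sum y F" by (simp add: sum_distrib_left)
    also have "\<dots> \<le> C\<^sup>2 * (B * (norm h)\<^sup>2)" by (intro mult_left_mono yB) simp
    finally show "(\<Sum>z\<in>F. (cmod (eval (mobU z h) 0))\<^sup>2) \<le> (C * sqrt B * norm h)\<^sup>2"
      using B by (simp add: power_mult_distrib)
  qed (use B C in simp)
qed

lemma cinner_sum_left: "cinner (sum v F) g = (\<Sum>z\<in>F. cinner (v z) g)"
proof (induction F rule: infinite_finite_induct)
  case (infinite F)
  then show ?case using cinner_add_left[of 0 0 g] by simp
next
  case empty
  then show ?case using cinner_add_left[of 0 0 g] by simp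
next
  case (insert z F)
  then show ?case by (simp add: cinner_add_left)
qed

text \<open>Membership in \<open>D0\<close> requires an operator to which the series converges. By
  duality, Cauchy-Schwarz and \<open>separated_bessel\<close>, a finite partial sum at
  \<open>h\<close> is bounded by the l2 norm of the pairings of \<open>h\<close> on that finite set,
  so the series converges unconditionally and defines a bounded operator.\<close>

lemma sot_sum_exists:
  fixes \<Gamma> :: "(complex ^ 'n::finite) set"
  assumes sep: "separated_set \<Gamma>" and c: "\<And>z. z \<in> \<Gamma> \<Longrightarrow> cmod (c z) \<le> K" and K: "0 \<le> K"
  obtains A where "sot_has_sum (\<lambda>z. scale_op (c z) (rank_one (normalized_kernel z) (normalized_kernel z))) A \<Gamma>"
proof -
  have G: "z \<in> polydisc" if "z \<in> \<Gamma>" for z using sep that by (auto simp: separated_set_def)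
  obtain L where L: "0 \<le> L" and bes: "\<And>F h. finite F \<Longrightarrow> F \<subseteq> \<Gamma> \<Longrightarrow> (\<Sum>z\<in>F. (cmod (eval (mobU z h) 0))\<^sup>2) \<le> (L * norm h)\<^sup>2"
    using separated_bessel[OF sep] by blast
  define v where "v h z = scale_op (c z) (rank_one (normalized_kernel z) (normalized_kernel z)) h" for h and z :: "complex ^ 'n"
  have le: "norm (sum (v h) F) \<le> K * L * sqrt (\<Sum>z\<in>F. (cmod (eval (mobU z h) 0))\<^sup>2)" if F: "finite F" "F \<subseteq> \<Gamma>" for F h
  proof (rule norm_le_cinnerI)
    fix g
    define a b where "a z = cmod (eval (mobU z h) 0)" and "b z = cmod (eval (mobU z g) 0)" for z
    have "cmod (cinner (sum (v h) F) g) \<le> (\<Sum>z\<in>F. cmod (cinner (v h z) g))"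
      unfolding cinner_sum_left by (rule norm_sum)
    also have "\<dots> \<le> (\<Sum>z\<in>F. K * (\<bar>a z\<bar> * \<bar>b z\<bar>))"
    proof (rule sum_mono)
      fix z assume z: "z \<in> F"
      then have zG: "z \<in> \<Gamma>" using F by blast
      have "cmod (cinner (v h z) g) = cmod (c z) * (\<bar>a z\<bar> * \<bar>b z\<bar>)"
        by (simp add: v_def cinner_scale_left kernel_cinner_mobU G[OF zG] norm_mult a_def b_def)
      also have "\<dots> \<le> K * (\<bar>a z\<bar> * \<bar>b z\<bar>)" by (intro mult_right_mono c zG) simp
      finally show "cmod (cinner (v h z) g) \<le> K * (\<bar>a z\<bar> * \<bar>b z\<bar>)" .
    qed
    also have "\<dots> = K * (\<Sum>z\<in>F. \<bar>a z\<bar> * \<bar>b z\<bar>)" by (simp add: sum_distrib_left)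
    also have "\<dots> \<le> K * (L2_set a F * L2_set b F)" by (intro mult_left_mono L2_set_mult_ineq K)
    also have "\<dots> \<le> K * (L2_set a F * (L * norm g))"
    proof -
      have "L2_set b F \<le> L * norm g"
        unfolding L2_set_def b_def using bes[OF F, of g] L by (intro real_le_lsqrt) auto
      then show ?thesis by (intro mult_left_mono K L2_set_nonneg)
    qed
    finally show "cmod (cinner (sum (v h) F) g) \<le> K * L * sqrt (\<Sum>z\<in>F. (cmod (eval (mobU z h) 0))\<^sup>2) * norm g"
      by (simp add: L2_set_def a_def mult_ac)
  qed
  have "v h summable_on \<Gamma>" for h
  proof (rule summable_on_dominated[where M = "K * L"])
    show "(\<lambda>z. (cmod (eval (mobU z h) 0))\<^sup>2) summable_on \<Gamma>"
      by (rule nonneg_bdd_above_summable_on) (auto intro!: bdd_aboveI2 bes)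
  qed (use K L le in auto)
  then have T: "(v h has_sum infsum (v h) \<Gamma>) \<Gamma>" for h by (rule has_sum_infsum)
  define T where "T h = infsum (v h) \<Gamma>" for h
  have vadd: "v (h + g) z = v h z + v g z" and vscale: "v (r *\<^sub>R h) z = r *\<^sub>R v h z" for h g z r
    by (simp_all add: v_def cinner_add_left scale_vec_add_left scale_vec_add_right
        scale_vec_of_real[symmetric] cinner_scale_left scale_vec_mult mult.left_commute)
  have "bounded_linear T"
  proof (rule bounded_linear_intro[where K = "K * L * L"])
    show "T (h + g) = T h + T g" for h g
      unfolding T_def by (rule infsumI) (use has_sum_add[OF T[of h] T[of g]] in \<open>simp add: vadd[abs_def]\<close>)
    show "T (r *\<^sub>R h) = r *\<^sub>R T h" for r h
      unfolding T_def by (rule infsumI) (use has_sum_scaleR[OF T[of h], of r] in \<open>simp add: vscale[abs_def]\<close>)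
    show "norm (T h) \<le> norm h * (K * L * L)" for h
    proof (rule Lim_norm_ubound[OF finite_subsets_at_top_neq_bot])
      show "(sum (v h) \<longlongrightarrow> T h) (finite_subsets_at_top \<Gamma>)" using T[of h] by (simp add: T_def has_sum_def)
      show "\<forall>\<^sub>F F in finite_subsets_at_top \<Gamma>. norm (sum (v h) F) \<le> norm h * (K * L * L)"
      proof (rule eventually_finite_subsets_at_top_weakI)
        fix F assume F: "finite F" "F \<subseteq> \<Gamma>"
        have "sqrt (\<Sum>z\<in>F. (cmod (eval (mobU z h) 0))\<^sup>2) \<le> L * norm h"
          using bes[OF F, of h] L by (intro real_le_lsqrt) auto
        then have "K * L * sqrt (\<Sum>z\<in>F. (cmod (eval (mobU z h) 0))\<^sup>2) \<le> K * L * (L * norm h)"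
          using K L by (intro mult_left_mono) auto
        then show "norm (sum (v h) F) \<le> norm h * (K * L * L)" using le[OF F, of h] by (simp add: mult_ac)
      qed
    qed
  qed
  then have "blinfun_apply (Blinfun T) h = T h" for h by (simp add: bounded_linear_Blinfun_apply)
  then have "sot_has_sum (\<lambda>z. scale_op (c z) (rank_one (normalized_kernel z) (normalized_kernel z))) (Blinfun T) \<Gamma>"
    unfolding sot_has_sum_def using T by (simp add: T_def v_def[abs_def])
  then show ?thesis by (rule that)
qed

text \<open>By Zorn there is a maximal set of points with pairwise disjoint balls of radius
  \<open>a\<close>. Maximality forces the ball around any point to meet one of these balls, and the
  triangle inequality through the common point gives the net property.\<close>

lemma separated_net:
  assumes \<delta>: "0 < \<delta>" "\<delta> < 1"
  obtains \<Gamma> :: "(complex ^ 'n::finite) set" where "separated_set \<Gamma>" "\<And>x. x \<in> polydisc \<Longrightarrow> \<exists>z\<in>\<Gamma>. mob x z \<in> pd \<delta>"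
proof -
  \<comment> \<open>Two steps of size \<delta>/4 compose to 2 s / (1 - s^2), which is at most
    \<delta>.\<close>
  define s where "s = \<delta> / 4"
  have s: "0 < s" "s < 1" using \<delta> by (auto simp: s_def)
  have s2: "(s + s) / (1 - s * s) \<le> \<delta>"
  proof -
    have "s * s \<le> 1 / 2" using \<delta> mult_mono[of \<delta> 1 \<delta> 1] by (simp add: s_def)
    then have "\<delta> * (1 / 2) \<le> \<delta> * (1 - s * s)" using \<delta> by (intro mult_left_mono) auto
    then have "s + s \<le> \<delta> * (1 - s * s)" by (simp add: s_def)
    then show ?thesis using \<open>s * s \<le> 1 / 2\<close> by (simp add: pos_divide_le_eq)
  qed
  define a where "a = artanh s"
  have a: "0 < a" using artanh_less[of 0 s] s by (simp add: a_def)
  have meet: "mob x z \<in> pd \<delta>" if x: "x \<in> polydisc" "z \<in> polydisc" and w: "w \<in> poly_ball x a" "w \<in> poly_ball z a" for x z w :: "complex ^ 'n"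
  proof -
    have wp: "w \<in> polydisc" using w by (simp add: poly_ball_def)
    have "mob x w \<in> pd s" "mob w z \<in> pd s"
      using mob_pd_of_poly_dist[of x w s] mob_pd_of_poly_dist[of z w s] x w s mob_pd_commute[of w z s]
      by (auto simp: poly_ball_def a_def)
    then have "cmod (mobius (x $ i) (z $ i)) \<le> (s + s) / (1 - s * s)" for i
      using mobius_triangle_le[OF polydiscD[OF x(1)] polydiscD[OF wp] polydiscD[OF x(2)], of i i s i s] s
      by (simp add: pd_def)
    then show ?thesis using s2 by (auto simp: pd_def intro: order_trans)
  qed
  have self: "x \<in> poly_ball x a" if "x \<in> polydisc" for x :: "complex ^ 'n"
    using that a by (simp add: poly_ball_def poly_dist_def bergman_beta_artanh)
  define \<A> where "\<A> = {\<Gamma> :: (complex ^ 'n) set. \<Gamma> \<subseteq> polydisc \<and> (\<forall>u\<in>\<Gamma>. \<forall>v\<in>\<Gamma>. u \<noteq> v \<longrightarrow> poly_ball u a \<inter> poly_ball v a = {})}"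
  have "\<exists>M\<in>\<A>. \<forall>X\<in>\<A>. M \<subseteq> X \<longrightarrow> X = M"
  proof (rule subset_Zorn')
    fix C assume C: "subset.chain \<A> C"
    have "poly_ball u a \<inter> poly_ball v a = {}" if uv: "u \<in> \<Union>C" "v \<in> \<Union>C" "u \<noteq> v" for u v
    proof -
      obtain X Y where X: "X \<in> C" "u \<in> X" and Y: "Y \<in> C" "v \<in> Y" using uv by blast
      have "X \<subseteq> Y \<or> Y \<subseteq> X" using C X Y unfolding subset_chain_def by blast
      then obtain Z where "Z \<in> C" "u \<in> Z" "v \<in> Z" using X Y by blast
      moreover have "C \<subseteq> \<A>" using C unfolding subset_chain_def by blast
      ultimately show ?thesis using uv(3) unfolding \<A>_def by blast
    qed
    moreover have "\<Union>C \<subseteq> polydisc" using C unfolding subset_chain_def \<A>_def by blast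
    ultimately show "\<Union>C \<in> \<A>" unfolding \<A>_def by blast
  qed
  then obtain \<Gamma> where \<Gamma>: "\<Gamma> \<in> \<A>" and max: "\<And>X. X \<in> \<A> \<Longrightarrow> \<Gamma> \<subseteq> X \<Longrightarrow> X = \<Gamma>" by blast
  have Gp: "\<Gamma> \<subseteq> polydisc" and dis: "\<And>u v. u \<in> \<Gamma> \<Longrightarrow> v \<in> \<Gamma> \<Longrightarrow> u \<noteq> v \<Longrightarrow> poly_ball u a \<inter> poly_ball v a = {}"
    using \<Gamma> by (auto simp: \<A>_def)
  show ?thesis
  proof (rule that[of \<Gamma>])
    show "separated_set \<Gamma>" unfolding separated_set_def using Gp dis a by blast
    fix x :: "complex ^ 'n" assume x: "x \<in> polydisc"
    show "\<exists>z\<in>\<Gamma>. mob x z \<in> pd \<delta>"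
    proof (cases "\<exists>z\<in>\<Gamma>. poly_ball x a \<inter> poly_ball z a \<noteq> {}")
      case True
      then obtain z w where "z \<in> \<Gamma>" "w \<in> poly_ball x a" "w \<in> poly_ball z a" by blast
      then show ?thesis using meet[OF x, of z w] Gp by blast
    next
      case False
      then have none: "poly_ball x a \<inter> poly_ball z a = {}" if "z \<in> \<Gamma>" for z using that by blast
      then have "insert x \<Gamma> \<in> \<A>"
        using x Gp dis unfolding \<A>_def by (simp add: Int_commute)
      then have "x \<in> \<Gamma>" using max[of "insert x \<Gamma>"] by blast
      then show ?thesis using none[of x] self[OF x] by blast
    qed
  qed
qed

text \<open>Continuity at the origin, where \<open>om\<close> is 1. The two summands are the
  relative errors made when the base point of a rank-one term is displaced.\<close>

lemma om_near_0:
  assumes "0 < \<eta>"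
  obtains \<delta> where "0 < \<delta>" "\<delta> \<le> 1/2" "\<And>v :: complex ^ 'n::finite. v \<in> pd \<delta> \<Longrightarrow> \<bar>(om v)\<^sup>2 - 1\<bar> + norm v \<le> \<eta>"
proof -
  have "continuous_on UNIV (\<lambda>v :: complex ^ 'n. \<bar>(om v)\<^sup>2 - 1\<bar> + norm v)"
    unfolding om_def by (intro continuous_intros)
  then have "isCont (\<lambda>v :: complex ^ 'n. \<bar>(om v)\<^sup>2 - 1\<bar> + norm v) 0"
    by (simp add: continuous_on_eq_continuous_at)
  then obtain d where d: "0 < d" "\<And>v :: complex ^ 'n. dist v 0 < d \<Longrightarrow> dist (\<bar>(om v)\<^sup>2 - 1\<bar> + norm v) (\<bar>(om (0 :: complex ^ 'n))\<^sup>2 - 1\<bar> + norm (0 :: complex ^ 'n)) < \<eta>"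
    using assms unfolding continuous_at_eps_delta dist_norm by blast
  define \<delta> where "\<delta> = min (1/2) (d / (2 * real CARD('n)))"
  have \<delta>: "0 < \<delta>" "\<delta> \<le> 1/2" using d by (auto simp: \<delta>_def)
  show ?thesis
  proof (rule that[OF \<delta>])
    fix v :: "complex ^ 'n" assume v: "v \<in> pd \<delta>"
    have "norm v \<le> (\<Sum>i\<in>UNIV. norm (v $ i))" unfolding norm_vec_def by (rule L2_set_le_sum) simp
    also have "\<dots> \<le> real CARD('n) * \<delta>" using v by (intro sum_bounded_above) (simp add: pd_def)
    also have "\<dots> \<le> real CARD('n) * (d / (2 * real CARD('n)))" by (intro mult_left_mono) (auto simp: \<delta>_def)
    also have "\<dots> < d" using d by simp
    finally have "dist v 0 < d" by simp
    from d(2)[OF this] have "\<bar>(om v)\<^sup>2 - 1\<bar> + norm v - (\<bar>(om (0 :: complex ^ 'n))\<^sup>2 - 1\<bar> + 0) < \<eta>"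
      by (simp add: dist_real_def)
    then show "\<bar>(om v)\<^sup>2 - 1\<bar> + norm v \<le> \<eta>" by (simp add: om_def)
  qed
qed

text \<open>The value of \<open>mobU (mob x v) h\<close> at 0 is \<open>om v\<close> times the value
  of \<open>mobU x h\<close> at \<open>v\<close>, up to a phase depending on x and v alone. The
  phase cancels in the sesquilinear product.\<close>

lemma eval_mobU_0_mob:
  assumes x: "x \<in> polydisc" and v: "v \<in> polydisc"
  shows "eval (mobU (mob x v) h) 0 * cnj (eval (mobU (mob x v) g) 0) =
    complex_of_real ((om v)\<^sup>2) * (eval (mobU x h) v * cnj (eval (mobU x g) v))"
proof -
  have z: "mob x v \<in> polydisc" using x v by simp
  have n: "complex_of_real ((cmod (kf x v))\<^sup>2) = kf x v * cnj (kf x v)" by (rule complex_norm_square)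
  show ?thesis
    unfolding eval_mobU_0[OF z] om_mob[OF x v]
    using n by (simp add: eval_mobU x v power2_eq_square mult_ac)
qed

text \<open>The polydisc is cut into cells, one for each point of a fine net, each inside a small
  ball around its point; the coefficient of the point is the integral of \<open>f\<close> over its
  cell with respect to \<open>lam\<close>. The operator \<open>A\<close> so obtained is diagonal,
  with \<open>\<gamma>\<close> the identity, and lies in \<open>D0\<close> itself.\<close>

lemma localized_approx:
  fixes f :: "complex ^ 'n::finite \<Rightarrow> complex"
  assumes f [measurable]: "f \<in> borel_measurable borel" and fK: "\<And>z. cmod (f z) \<le> K" and e: "0 < e"
  shows "\<exists>A\<in>D0. norm (toeplitz f - A) \<le> e"
proof -
  have K: "0 \<le> K" using order_trans[OF norm_ge_zero fK] .
  have half: "(0 :: real) \<le> 1/2" "(1/2 :: real) < 1" by simp_all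
  obtain C t where C: "0 \<le> C" "0 \<le> t" "t < 1"
    and le1: "\<And>(k :: 'n bergman) (l :: 'n bergman) u v. u \<in> pd (1/2) \<Longrightarrow> v \<in> pd (1/2) \<Longrightarrow>
       cmod (eval k u * cnj (eval l v)) \<le> C * locnorm t k * locnorm t l"
    and le2: "\<And>(k :: 'n bergman) (l :: 'n bergman) u v. u \<in> pd (1/2) \<Longrightarrow> v \<in> pd (1/2) \<Longrightarrow>
       cmod (eval k u * cnj (eval l u) - eval k v * cnj (eval l v)) \<le> C * locnorm t k * locnorm t l * norm (u - v)"
    using local_sesq_estimates[OF half] by metis
  obtain B where B: "0 \<le> B" and sesq: "\<And>F e h g. F \<in> borel_measurable lam \<Longrightarrow> 0 \<le> e \<Longrightarrow>
      (\<And>z. z \<in> space lam \<Longrightarrow> cmod (F z) \<le> e * locnorm t (mobU z h) * locnorm t (mobU z g)) \<Longrightarrow>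
      integrable lam F \<and> cmod (\<integral>z. F z \<partial>lam) \<le> e * B * norm h * norm (g :: 'n bergman)"
    using lam.sesq_bound[OF C(2,3)] by blast
  define \<eta> where "\<eta> = e / (K * C * B + 1)"
  have KCB: "0 < K * C * B + 1" using K C B by (simp add: add_nonneg_pos)
  have \<eta>: "0 < \<eta>" "K * C * \<eta> * B \<le> e" using e KCB K C B by (auto simp: \<eta>_def field_simps)
  obtain \<delta> where \<delta>: "0 < \<delta>" "\<delta> \<le> 1/2" and om1: "\<And>v :: complex ^ 'n. v \<in> pd \<delta> \<Longrightarrow> \<bar>(om v)\<^sup>2 - 1\<bar> + norm v \<le> \<eta>"
    using om_near_0[OF \<eta>(1)] by blast
  have \<delta>1: "0 \<le> \<delta>" "\<delta> < 1" using \<delta> by auto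
  obtain \<Gamma> :: "(complex ^ 'n) set" where sep: "separated_set \<Gamma>" and net: "\<And>x. x \<in> polydisc \<Longrightarrow> \<exists>z\<in>\<Gamma>. mob x z \<in> pd \<delta>"
    using separated_net[OF \<delta>(1) \<delta>1(2)] by blast
  have G: "z \<in> polydisc" if "z \<in> \<Gamma>" for z using sep that by (auto simp: separated_set_def)
  have cnt: "countable \<Gamma>" by (rule separated_countable[OF sep])
  have ne: "\<Gamma> \<noteq> {}" using net[OF zero_in_polydisc] by blast
  interpret G: lf_measure "count_space \<Gamma>" by (rule lf_measure_separated[OF sep])
  \<comment> \<open>A measurable way to assign points to cells: the first net point in an
    enumeration within distance \<delta>. Outside the polydisc the choice is arbitrary, but
    \<open>f1\<close> vanishes there.\<close>
  define N where "N x = (LEAST i. mob x (from_nat_into \<Gamma> i) \<in> pd \<delta>)" for x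
  define \<zeta> where "\<zeta> x = from_nat_into \<Gamma> (N x)" for x
  have \<zeta>G: "\<zeta> x \<in> \<Gamma>" for x using from_nat_into[OF ne] by (simp add: \<zeta>_def)
  have \<zeta>x: "mob x (\<zeta> x) \<in> pd \<delta>" if x: "x \<in> polydisc" for x
  proof -
    obtain z where z: "z \<in> \<Gamma>" "mob x z \<in> pd \<delta>" using net[OF x] by blast
    obtain i where "from_nat_into \<Gamma> i = z" using from_nat_into_surj[OF cnt z(1)] by blast
    then have "mob x (from_nat_into \<Gamma> i) \<in> pd \<delta>" using z(2) by simp
    then show ?thesis unfolding \<zeta>_def N_def by (rule LeastI)
  qed
  have Nm: "N \<in> borel \<rightarrow>\<^sub>M count_space UNIV"
    unfolding N_def[abs_def] by measurable
  have \<zeta>m: "\<zeta> \<in> borel \<rightarrow>\<^sub>M count_space UNIV"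
    unfolding \<zeta>_def[abs_def] by (rule measurable_compose[OF Nm]) simp
  have \<zeta>b: "\<zeta> \<in> borel_measurable borel"
    unfolding \<zeta>_def[abs_def] by (rule measurable_compose[OF Nm]) simp
  define Q where "Q z = {x. \<zeta> x = z}" for z
  have Qm: "Q z \<in> sets borel" for z
  proof -
    have "\<zeta> -` {z} \<inter> space borel \<in> sets borel" by (rule measurable_sets[OF \<zeta>m]) simp
    moreover have "\<zeta> -` {z} \<inter> space borel = Q z" by (auto simp: Q_def)
    ultimately show ?thesis by (simp only:)
  qed
  define f1 where "f1 x = indicator polydisc x * f x" for x
  have f1m [measurable]: "f1 \<in> borel_measurable borel" unfolding f1_def[abs_def] by measurable
  have f1K: "cmod (f1 x) \<le> K" for x using fK[of x] K by (simp add: f1_def norm_mult split: split_indicator)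
  obtain V where V: "0 \<le> V" and vol: "\<And>z :: complex ^ 'n. z \<in> polydisc \<Longrightarrow>
      (\<integral>\<^sup>+w. indicator polydisc w * indicator (pd \<delta>) (mob w z) \<partial>lam) \<le> ennreal V"
    using lam.loc_fin[OF \<delta>1] by blast
  define H where "H z x = indicator (Q z) x * f1 x" for z x
  have Hm [measurable]: "H z \<in> borel_measurable borel" for z
    unfolding H_def[abs_def] by (intro borel_measurable_times borel_measurable_indicator Qm f1m)
  have Hle: "(\<integral>\<^sup>+x. ennreal (norm (H z x)) \<partial>lam) \<le> ennreal (K * V)" if z: "z \<in> \<Gamma>" for z
  proof -
    have "(\<integral>\<^sup>+x. ennreal (norm (H z x)) \<partial>lam) \<le> (\<integral>\<^sup>+x. ennreal K * (indicator polydisc x * indicator (pd \<delta>) (mob x z)) \<partial>lam)"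
    proof (rule nn_integral_mono)
      fix x :: "complex ^ 'n"
      show "ennreal (norm (H z x)) \<le> ennreal K * (indicator polydisc x * indicator (pd \<delta>) (mob x z))"
      proof (cases "x \<in> polydisc \<and> \<zeta> x = z")
        case True
        then show ?thesis using \<zeta>x[of x] fK[of x] by (auto simp: H_def Q_def f1_def intro!: ennreal_leI)
      next
        case False
        then show ?thesis by (auto simp: H_def Q_def f1_def)
      qed
    qed
    also have "\<dots> = ennreal K * (\<integral>\<^sup>+x. indicator polydisc x * indicator (pd \<delta>) (mob x z) \<partial>lam)"
    proof (rule nn_integral_cmult)
      show "(\<lambda>x. indicator polydisc x * indicator (pd \<delta>) (mob x z) :: ennreal) \<in> borel_measurable lam"
        unfolding measurable_cong_sets[OF sets_lam refl] by measurable
    qed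
    also have "\<dots> \<le> ennreal K * ennreal V" by (intro mult_left_mono vol G z) simp
    finally show ?thesis using K V by (simp add: ennreal_mult)
  qed
  have Hint: "integrable lam (H z)" if "z \<in> \<Gamma>" for z
  proof (rule integrableI_bounded)
    show "(\<integral>\<^sup>+x. ennreal (norm (H z x)) \<partial>lam) < \<infinity>" by (rule le_less_trans[OF Hle[OF that]]) simp
  qed (simp add: measurable_cong_sets[OF sets_lam refl])
  define c where "c z = (\<integral>x. H z x \<partial>lam)" for z
  have c: "cmod (c z) \<le> K * V" if z: "z \<in> \<Gamma>" for z
  proof -
    have "ennreal (cmod (c z)) \<le> ennreal (K * V)"
      unfolding c_def by (rule order_trans[OF integral_norm_bound_ennreal[OF Hint[OF z]] Hle[OF z]])
    then show ?thesis using K V by (simp add: ennreal_le_iff)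
  qed
  obtain A where A: "sot_has_sum (\<lambda>z. scale_op (c z) (rank_one (normalized_kernel z) (normalized_kernel z))) A \<Gamma>"
    using sot_sum_exists[where c = c, OF sep c mult_nonneg_nonneg[OF K V]] by blast
  have "A \<in> D0"
    unfolding D0_def
  proof (intro CollectI exI conjI)
    show "separated_set \<Gamma>" by (rule sep)
    show "bounded (c ` \<Gamma>)" using c by (auto intro!: boundedI)
    show "(\<lambda>z. z) ` \<Gamma> \<subseteq> polydisc" using G by auto
    show "(0 :: real) \<le> 0" by simp
    show "\<forall>z\<in>\<Gamma>. poly_dist z z \<le> 0" by (simp add: poly_dist_def bergman_beta_artanh)
    show "sot_has_sum (\<lambda>z. scale_op (c z) (rank_one (normalized_kernel z) (normalized_kernel z))) A \<Gamma>" by (rule A)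
  qed
  moreover have "norm (toeplitz f - A) \<le> e"
  proof (rule op_norm_le_cinnerI)
    fix h g :: "'n bergman"
    define S where "S x = eval (mobU x h) 0 * cnj (eval (mobU x g) 0)" for x
    have Sm [measurable]: "S \<in> borel_measurable borel" unfolding S_def[abs_def] by measurable
    have T: "cinner (toeplitz f h) g = (\<integral>x. f1 x * S x \<partial>lam)"
    proof -
      have "(1 / (om x)\<^sup>2) *\<^sub>R (f1 x * S x) = f x * (eval h x * cnj (eval g x))" if x: "x \<in> polydisc" for x
        using om_pos[OF x] x by (simp add: f1_def S_def eval_mobU_0[OF x] scaleR_conv_of_real power2_eq_square)
      then have "AE x in dvb. f x * (eval h x * cnj (eval g x)) = (1 / (om x)\<^sup>2) *\<^sub>R (f1 x * S x)"
        using AE_dvb_polydisc by (auto elim!: eventually_mono)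
      then show ?thesis
        unfolding cinner_toeplitz[OF f fK] by (subst integral_lam(1)) (simp, rule integral_cong_AE, simp_all)
    qed
    have intS: "integrable lam (\<lambda>x. f1 x * S x)"
      unfolding S_def by (rule lam.integrable_point_sesq[OF _ f1K])
        (simp_all add: zero_in_polydisc measurable_cong_sets[OF sets_lam refl])
    define D where "D x = f1 x * (S x - S (\<zeta> x))" for x
    have Dm: "D \<in> borel_measurable borel"
      unfolding D_def[abs_def] by (intro borel_measurable_times borel_measurable_diff f1m Sm measurable_compose[OF \<zeta>b Sm])
    have Dle: "cmod (D x) \<le> (K * C * \<eta>) * locnorm t (mobU x h) * locnorm t (mobU x g)" for x
    proof (cases "x \<in> polydisc")
      case True
      define v where "v = mob x (\<zeta> x)"
      have v: "v \<in> pd \<delta>" using \<zeta>x[OF True] by (simp add: v_def)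
      have v2: "v \<in> pd (1/2)" using v pd_mono[OF \<delta>(2)] by blast
      have z2: "0 \<in> (pd (1/2) :: (complex ^ 'n) set)" by (simp add: pd_def)
      have vp: "v \<in> polydisc" using v pd_subset[OF \<delta>1(2)] by blast
      have \<zeta>v: "\<zeta> x = mob x v" using True G[OF \<zeta>G] by (simp add: v_def)
      define s where "s u = eval (mobU x h) u * cnj (eval (mobU x g) u)" for u
      define l where "l = C * locnorm t (mobU x h) * locnorm t (mobU x g)"
      have l: "0 \<le> l" using C by (simp add: l_def)
      \<comment> \<open>Two sources of error: the displacement from 0 to \<open>v\<close>, and the
        factor \<open>(om v)\<^sup>2\<close> from moving the base point. Both are bounded by local
        norms of the functions moved to x.\<close>
      have "S x - S (\<zeta> x) = (s 0 - s v) - complex_of_real ((om v)\<^sup>2 - 1) * s v"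
        unfolding S_def \<zeta>v eval_mobU_0_mob[OF True vp] s_def by (simp add: algebra_simps)
      then have "cmod (S x - S (\<zeta> x)) \<le> cmod (s 0 - s v) + \<bar>(om v)\<^sup>2 - 1\<bar> * cmod (s v)"
        by (metis norm_triangle_ineq4 norm_mult norm_of_real)
      also have "\<dots> \<le> l * norm v + \<bar>(om v)\<^sup>2 - 1\<bar> * l"
        using le2[OF z2 v2, of "mobU x h" "mobU x g"] le1[OF v2 v2, of "mobU x h" "mobU x g"]
        unfolding s_def l_def by (intro add_mono mult_left_mono) auto
      also have "\<dots> = l * (\<bar>(om v)\<^sup>2 - 1\<bar> + norm v)" by (simp add: algebra_simps)
      also have "\<dots> \<le> l * \<eta>" by (intro mult_left_mono om1 v l)
      finally have "cmod (f1 x) * cmod (S x - S (\<zeta> x)) \<le> K * (l * \<eta>)"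
        by (intro mult_mono f1K K) auto
      then show ?thesis by (simp add: D_def l_def norm_mult mult_ac)
    next
      case False
      then have "D x = 0" by (simp add: D_def f1_def)
      then show ?thesis using K C \<eta> by simp
    qed
    have D: "integrable lam D" "cmod (\<integral>x. D x \<partial>lam) \<le> K * C * \<eta> * B * norm h * norm g"
    proof -
      have "D \<in> borel_measurable lam" using Dm by (simp add: measurable_cong_sets[OF sets_lam refl])
      moreover have "0 \<le> K * C * \<eta>" using K C \<eta> by simp
      ultimately have "integrable lam D \<and> cmod (\<integral>x. D x \<partial>lam) \<le> K * C * \<eta> * B * norm h * norm g"
        using Dle by (rule sesq)
      then show "integrable lam D" "cmod (\<integral>x. D x \<partial>lam) \<le> K * C * \<eta> * B * norm h * norm g" by auto
    qed
    have A_eq: "cinner (A h) g = (\<integral>x. f1 x * S (\<zeta> x) \<partial>lam)"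
    proof -
      interpret P: pair_sigma_finite "count_space \<Gamma>" "lam :: (complex ^ 'n) measure"
        by (intro pair_sigma_finite.intro G.sigma_finite_measure_axioms lam.sigma_finite_measure_axioms)
      have iG: "integrable (count_space \<Gamma>) S"
        using G.integrable_point_sesq[of "\<lambda>_. 1" 1 0 0 h g] by (simp add: S_def[abs_def] zero_in_polydisc)
      have Pm: "(\<lambda>(z, x). H z x * S z) \<in> borel_measurable (count_space \<Gamma> \<Otimes>\<^sub>M lam)"
      proof (rule measurable_pair_measure_countable1[OF cnt])
        show "(\<lambda>x. case (z, x) of (z, x) \<Rightarrow> H z x * S z) \<in> borel_measurable lam" for z
          unfolding measurable_cong_sets[OF sets_lam refl] by simp
      qed
      have P: "integrable (count_space \<Gamma> \<Otimes>\<^sub>M lam) (\<lambda>(z, x). H z x * S z)"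
      proof (rule integrableI_bounded[OF Pm])
        have "(\<integral>\<^sup>+p. ennreal (norm (case p of (z, x) \<Rightarrow> H z x * S z)) \<partial>(count_space \<Gamma> \<Otimes>\<^sub>M lam)) =
            (\<integral>\<^sup>+z. \<integral>\<^sup>+x. ennreal (norm (H z x * S z)) \<partial>lam \<partial>count_space \<Gamma>)"
          using lam.nn_integral_fst[of "\<lambda>p. ennreal (norm (case p of (z, x) \<Rightarrow> H z x * S z))" "count_space \<Gamma>"] Pm by simp
        also have "\<dots> \<le> (\<integral>\<^sup>+z. ennreal (K * V) * ennreal (norm (S z)) \<partial>count_space \<Gamma>)"
        proof (rule nn_integral_mono)
          fix z assume "z \<in> space (count_space \<Gamma>)"
          then have z: "z \<in> \<Gamma>" by simp
          have "(\<integral>\<^sup>+x. ennreal (norm (H z x * S z)) \<partial>lam) = (\<integral>\<^sup>+x. ennreal (norm (H z x)) * ennreal (norm (S z)) \<partial>lam)"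
            by (simp add: norm_mult ennreal_mult)
          also have "\<dots> = (\<integral>\<^sup>+x. ennreal (norm (H z x)) \<partial>lam) * ennreal (norm (S z))"
          proof (rule nn_integral_multc)
            show "(\<lambda>x. ennreal (norm (H z x))) \<in> borel_measurable lam"
              unfolding measurable_cong_sets[OF sets_lam refl] by measurable
          qed
          also have "\<dots> \<le> ennreal (K * V) * ennreal (norm (S z))" by (intro mult_right_mono Hle z) simp
          finally show "(\<integral>\<^sup>+x. ennreal (norm (H z x * S z)) \<partial>lam) \<le> ennreal (K * V) * ennreal (norm (S z))" .
        qed
        also have "\<dots> = ennreal (K * V) * (\<integral>\<^sup>+z. ennreal (norm (S z)) \<partial>count_space \<Gamma>)"
          by (rule nn_integral_cmult) simp
        also have "\<dots> < \<infinity>"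
          using iG by (simp add: integrable_iff_bounded ennreal_mult_less_top)
        finally show "(\<integral>\<^sup>+p. ennreal (norm (case p of (z, x) \<Rightarrow> H z x * S z)) \<partial>(count_space \<Gamma> \<Otimes>\<^sub>M lam)) < \<infinity>" .
      qed
      have "cinner (A h) g = (\<integral>z. c z * (cinner h (normalized_kernel z) * cinner (normalized_kernel z) g) \<partial>count_space \<Gamma>)"
        by (rule cinner_sot_sum[OF A])
      also have "\<dots> = (\<integral>z. (\<integral>x. H z x * S z \<partial>lam) \<partial>count_space \<Gamma>)"
        by (rule Bochner_Integration.integral_cong[OF refl]) (simp add: kernel_cinner_mobU G c_def S_def)
      also have "\<dots> = (\<integral>x. (\<integral>z. H z x * S z \<partial>count_space \<Gamma>) \<partial>lam)"
        using P by (rule P.Fubini_integral[symmetric])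
      also have "\<dots> = (\<integral>x. f1 x * S (\<zeta> x) \<partial>lam)"
      proof (rule Bochner_Integration.integral_cong[OF refl])
        fix x
        \<comment> \<open>After the exchange of sum and integral, a given x lies in the cell of
          \<open>\<zeta> x\<close> only, so at most one term survives.\<close>
        have sub: "{z \<in> \<Gamma>. H z x * S z \<noteq> 0} \<subseteq> {\<zeta> x}" by (auto simp: H_def Q_def indicator_def split: if_splits)
        have "(\<integral>z. H z x * S z \<partial>count_space \<Gamma>) = (\<Sum>z | z \<in> \<Gamma> \<and> H z x * S z \<noteq> 0. H z x * S z)"
          by (rule lebesgue_integral_count_space_finite_support) (rule finite_subset[OF sub], simp)
        also have "\<dots> = (\<Sum>z\<in>{\<zeta> x}. H z x * S z)"
          by (rule sum.mono_neutral_left) (use sub \<zeta>G in auto)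
        finally show "(\<integral>z. H z x * S z \<partial>count_space \<Gamma>) = f1 x * S (\<zeta> x)" by (simp add: H_def Q_def)
      qed
      finally show ?thesis .
    qed
    have "(\<integral>x. f1 x * S (\<zeta> x) \<partial>lam) = (\<integral>x. f1 x * S x - D x \<partial>lam)"
      by (rule Bochner_Integration.integral_cong[OF refl]) (simp add: D_def algebra_simps)
    also have "\<dots> = (\<integral>x. f1 x * S x \<partial>lam) - (\<integral>x. D x \<partial>lam)"
      by (rule Bochner_Integration.integral_diff[OF intS D(1)])
    finally have "cinner ((toeplitz f - A) h) g = (\<integral>x. D x \<partial>lam)"
      by (simp add: blinfun.diff_left cinner_diff_left T A_eq)
    then have "cmod (cinner ((toeplitz f - A) h) g) \<le> K * C * \<eta> * B * norm h * norm g" using D(2) by simp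
    also have "\<dots> \<le> e * norm h * norm g" by (intro mult_right_mono \<eta>) auto
    finally show "cmod (cinner ((toeplitz f - A) h) g) \<le> e * norm h * norm g" .
  qed (use e in simp)
  ultimately show ?thesis by blast
qed

section \<open>The C*-algebra property and the two equalities\<close>

lemma clinear_op_toeplitz_closure:
  fixes A :: "'n::finite op"
  assumes "A \<in> toeplitz_closure"
  shows "clinear_op A"
proof -
  obtain a :: "nat \<Rightarrow> 'n op" where a: "\<And>n. a n \<in> {toeplitz f | f. f \<in> Linfty}" "a \<longlonglongrightarrow> A"
    using assms unfolding closure_sequential by blast
  have lin: "clinear_op (a n)" for n
  proof -
    obtain f where f: "f \<in> Linfty" "a n = toeplitz f" using a(1)[of n] by blast
    obtain f0 K where "f0 \<in> borel_measurable borel" "\<And>z. cmod (f0 z) \<le> K" "toeplitz f = toeplitz f0"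
      using toeplitz_Linfty[OF f(1)] by blast
    then show ?thesis using clinear_toeplitz f(2) by metis
  qed
  have lim: "(\<lambda>n. a n h) \<longlonglongrightarrow> A h" for h
    by (rule bounded_linear.tendsto[OF blinfun.bounded_linear_left a(2)])
  show ?thesis
    unfolding clinear_op_def
  proof (intro allI)
    fix k h
    have "(\<lambda>n. scale_vec k (a n h)) \<longlonglongrightarrow> scale_vec k (A h)"
      by (rule bounded_linear.tendsto[OF bounded_linear_scale_vec lim])
    moreover have "(\<lambda>n. scale_vec k (a n h)) = (\<lambda>n. a n (scale_vec k h))"
      using lin by (simp add: clinear_op_def)
    ultimately show "A (scale_vec k h) = scale_vec k (A h)"
      using lim[of "scale_vec k h"] LIMSEQ_unique by metis
  qed
qed

lemma cstar_subalgebra_toeplitz_closure: "cstar_subalgebra (toeplitz_closure :: 'n::finite op set)"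
  unfolding cstar_subalgebra_def
proof (intro conjI ballI allI)
  fix A B :: "'n op" and k :: complex
  assume A: "A \<in> toeplitz_closure"
  show "clinear_op A" by (rule clinear_op_toeplitz_closure[OF A])
  show "scale_op k A \<in> toeplitz_closure"
    using approx_form_cmult[of "\<lambda>h g. cinner (A h) g" k] A
    by (simp add: toeplitz_closure_iff cinner_scale_left)
  show "adjoint_op A \<in> toeplitz_closure"
  proof -
    have "cinner (adjoint_op A h) g = cnj (cinner (A g) h)" for h g
      unfolding adjoint_op[OF clinear_op_toeplitz_closure[OF A]] by (rule cinner_cnj[symmetric])
    then show ?thesis
      using approx_form_adjoint[of "\<lambda>h g. cinner (A h) g"] A by (simp add: toeplitz_closure_iff)
  qed
  assume B: "B \<in> toeplitz_closure"
  show "A + B \<in> toeplitz_closure"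
    using approx_form_add[of "\<lambda>h g. cinner (A h) g" "\<lambda>h g. cinner (B h) g"] A B
    by (simp add: toeplitz_closure_iff plus_blinfun.rep_eq cinner_add_left)
  show "A o\<^sub>L B \<in> toeplitz_closure" by (rule toeplitz_closure_compose[OF A B])
next
  show "(0 :: 'n op) \<in> toeplitz_closure"
    using approx_form_0 cinner_scale_left[of 0 "0 :: 'n bergman"]
    by (simp add: toeplitz_closure_iff cinner_def zero_bergman.rep_eq)
qed simp

text \<open>Any closed algebra containing the Toeplitz operators contains their closure; conversely
  that closure is itself one of the algebras being intersected.\<close>

lemma toeplitz_closure_eq_algebra: "toeplitz_closure = (toeplitz_algebra :: 'n::finite op set)"
proof
  show "toeplitz_closure \<subseteq> (toeplitz_algebra :: 'n op set)"
    unfolding toeplitz_algebra_def cstar_generated_def cstar_subalgebra_def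
    by (intro Inter_greatest closure_minimal) auto
  show "(toeplitz_algebra :: 'n op set) \<subseteq> toeplitz_closure"
    unfolding toeplitz_algebra_def cstar_generated_def
    by (intro Inter_lower CollectI conjI cstar_subalgebra_toeplitz_closure closure_subset)
qed

text \<open>A single element of \<open>D0\<close> already approximates a given Toeplitz operator. In
  the other direction the closure is a closed complex subspace containing \<open>D0\<close>, hence
  it contains the closed span.\<close>

lemma toeplitz_closure_eq_D_closure: "toeplitz_closure = (D_closure :: 'n::finite op set)"
proof
  interpret vs: vector_space "scale_op :: complex \<Rightarrow> 'n op \<Rightarrow> 'n op" by (rule vector_space_scale_op)
  have "toeplitz f \<in> D_closure" if f: "f \<in> Linfty" for f :: "complex ^ 'n \<Rightarrow> complex"
  proof -
    obtain f0 K where f0: "f0 \<in> borel_measurable borel" "\<And>z. cmod (f0 z) \<le> K" "toeplitz f = toeplitz f0"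
      using toeplitz_Linfty[OF f] by blast
    have "\<exists>A\<in>vs.span D0. dist A (toeplitz f) < e" if e: "0 < e" for e
    proof -
      obtain A where A: "A \<in> D0" "norm (toeplitz f0 - A) \<le> e / 2"
        using localized_approx[OF f0(1,2), of "e / 2"] e by auto
      then have "dist A (toeplitz f) < e" using e by (simp add: f0(3) dist_norm norm_minus_commute)
      then show ?thesis using A(1) vs.span_base by blast
    qed
    then show ?thesis unfolding D_closure_def closure_approachable by blast
  qed
  then show "toeplitz_closure \<subseteq> (D_closure :: 'n op set)"
    by (intro closure_minimal) (auto simp: D_closure_def)
  have "vs.subspace toeplitz_closure"
    using cstar_subalgebra_toeplitz_closure[where 'n = 'n]
    unfolding vs.subspace_def cstar_subalgebra_def by blast
  from vs.span_minimal[OF D0_subset_toeplitz_closure this]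
  show "(D_closure :: 'n op set) \<subseteq> toeplitz_closure"
    unfolding D_closure_def by (intro closure_minimal) auto
qed

theorem mainTheorem5:
  shows "closure {toeplitz f | f. f \<in> Linfty} = (toeplitz_algebra :: 'n::finite op set) \<and>
         (toeplitz_algebra :: 'n op set) = D_closure"
  by (intro conjI toeplitz_closure_eq_algebra trans[OF toeplitz_closure_eq_algebra[symmetric] toeplitz_closure_eq_D_closure])

end
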